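(* Let $n\ge 2$ and let $L=\operatorname{div}A(X)\nabla$ be a divergence form elliptic operator in $\mathbb{R}^n_+$ (real, not necessarily symmetric). There are constants $\delta_0>0$, $\gamma>0$ and $C_1>0$, depending only on the dimension and the ellipticity, such that for every cube $Q\subset\mathbb{R}^{n-1}$, with corresponding point $A_Q=(x_Q,\ell(Q))$, and every Borel set $E\subset Q$, there is a Borel set $H\subset Q$ such that if $\omega^{A_Q}(E)<\delta_0$ and $u$ is the solution of $Lu=0$ in $\mathbb{R}^n_+$ with boundary data $u|_{\partial\mathbb{R}^n_+}=\chi_H$, then $$C_1\,\overline{k}^{\,1/2}\le S_\gamma^{\gamma\ell(Q)}(u)(x,0)\quad\text{for all }(x,0)\in E,$$ where $$\overline{k}=\log\frac1{\omega^{A_Q}(E)},\qquad S_\gamma^{\gamma\ell(Q)}(u)(x,0)=\Big(\int_{\Gamma_\gamma^{\gamma\ell(Q)}(x,0)}|\nabla u(Y)|^2\,|Y-(x,0)|^{2-n}\,dY\Big)^{1/2}.$$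
   Context: $\mathbb{R}^n_+=\{(x,t):x\in\mathbb{R}^{n-1},\,t>0\}$, and $\partial\mathbb{R}^n_+$ is identified with $\mathbb{R}^{n-1}$. $A(X)=(a_{ij}(X))_{i,j=1}^n$ is a real $n\times n$ matrix, not necessarily symmetric, with $a_{ij}\in L^\infty(\mathbb{R}^n_+)$, and there is $\lambda>0$ with $\lambda|\xi|^2\le\langle A(X)\xi,\xi\rangle\le\lambda^{-1}|\xi|^2$ for all $\xi\in\mathbb{R}^n$ (and a.e. $X$). "Depending only on the ellipticity" means depending only on $\lambda$ and $\sup_{i,j}\|a_{ij}\|_{L^\infty}$. Solutions of $Lu=0$ are weak solutions. Elliptic measure $\omega^X$ of $L$ with pole at $X\in\mathbb{R}^n_+$ is the probability measure on $\mathbb{R}^{n-1}$ such that for continuous compactly supported $g$ the bounded weak solution of $Lu=0$ in $\mathbb{R}^n_+$, $u=g$ on $\mathbb{R}^{n-1}$, is $u(X)=\int g\,d\omega^X$. For a bounded Borel function $F$ on $\mathbb{R}^{n-1}$, "the solution with boundary data $F$" is $u(X)=\int_{\partial\mathbb{R}^n_+}F\,d\omega^X$. A cube $Q\subset\mathbb{R}^{n-1}$ with center $x_Q$ and side length $\ell(Q)$ is $\{x:\max_i|(x-x_Q)_i|<\ell(Q)/2\}$. For $\gamma,h>0$: $\Gamma_\gamma(x,0)=\{(y,s)\in\mathbb{R}^n_+:|y-x|\le\gamma s\}$ and $\Gamma_\gamma^h(x,0)=\{(y,s)\in\Gamma_\gamma(x,0):0<s\le h\}$. *)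

theory Defs
  imports "HOL-Analysis.Analysis" "HOL-Probability.Probability_Measure"
begin

(* Points (x, t) of R^n, with x in R^(n-1), t in R and n = CARD('m) + 1. Index types are
   nonempty, so n >= 2 holds automatically; the norm on the product is the Euclidean one. *)
type_synonym 'm pnt = "(real^'m) \<times> real"

definition half_space :: "'m::finite pnt set" where
  "half_space = {(x, t). t > 0}"

definition cube :: "real^'m::finite \<Rightarrow> real \<Rightarrow> (real^'m) set" where
  "cube c l = {x. infnorm (x - c) < l / 2}"

definition approach_cone :: "real \<Rightarrow> real \<Rightarrow> real^'m::finite \<Rightarrow> 'm pnt set" where
  "approach_cone \<gamma> h x = {(y, s). (y, s) \<in> half_space \<and> norm (y - x) \<le> \<gamma> * s \<and> s \<le> h}"

(* The matrix A(X) is represented by the linear map it defines; for standard basis vectors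
   i, j its (i, j) entry is the inner product of A X j with i. *)
definition elliptic_coefficients ::
  "real \<Rightarrow> real \<Rightarrow> ('m::finite pnt \<Rightarrow> 'm pnt \<Rightarrow>\<^sub>L 'm pnt) \<Rightarrow> bool" where
  "elliptic_coefficients lam \<Lambda> A \<longleftrightarrow>
     (\<forall>i\<in>Basis. \<forall>j\<in>Basis.
        (\<lambda>X. blinfun_apply (A X) j \<bullet> i) \<in> borel_measurable (lebesgue_on half_space) \<and>
        (AE X in lebesgue_on half_space. \<bar>blinfun_apply (A X) j \<bullet> i\<bar> \<le> \<Lambda>)) \<and>
     (AE X in lebesgue_on half_space. \<forall>\<xi>.
        lam * (norm \<xi>)\<^sup>2 \<le> blinfun_apply (A X) \<xi> \<bullet> \<xi> \<and>
        blinfun_apply (A X) \<xi> \<bullet> \<xi> \<le> inverse lam * (norm \<xi>)\<^sup>2)"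

(* Test functions are compactly supported C^1 functions, as in Gilbarg--Trudinger;
   D is the gradient of f. *)
definition test_function ::
  "'a::euclidean_space set \<Rightarrow> ('a \<Rightarrow> real) \<Rightarrow> ('a \<Rightarrow> 'a) \<Rightarrow> bool" where
  "test_function \<Omega> f D \<longleftrightarrow>
     (\<forall>X. GDERIV f X :> D X) \<and> continuous_on UNIV D \<and>
     compact (closure {X. f X \<noteq> 0}) \<and> closure {X. f X \<noteq> 0} \<subseteq> \<Omega>"

(* u lies in W^{1,2}_loc of the open set \<Omega>, with weak gradient G. *)
definition has_weak_gradient ::
  "'a::euclidean_space set \<Rightarrow> ('a \<Rightarrow> real) \<Rightarrow> ('a \<Rightarrow> 'a) \<Rightarrow> bool" where
  "has_weak_gradient \<Omega> u G \<longleftrightarrow>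
     u \<in> borel_measurable (lebesgue_on \<Omega>) \<and> G \<in> borel_measurable (lebesgue_on \<Omega>) \<and>
     (\<forall>K. compact K \<and> K \<subseteq> \<Omega> \<longrightarrow>
        integrable (lebesgue_on K) (\<lambda>X. (u X)\<^sup>2) \<and>
        integrable (lebesgue_on K) (\<lambda>X. (norm (G X))\<^sup>2)) \<and>
     (\<forall>f D. test_function \<Omega> f D \<longrightarrow>
        (LINT X|lebesgue_on \<Omega>. u X *\<^sub>R D X) = - (LINT X|lebesgue_on \<Omega>. f X *\<^sub>R G X))"

(* Unique up to null sets. *)
definition weak_gradient ::
  "'a::euclidean_space set \<Rightarrow> ('a \<Rightarrow> real) \<Rightarrow> 'a \<Rightarrow> 'a" where
  "weak_gradient \<Omega> u = (SOME G. has_weak_gradient \<Omega> u G)"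

definition weak_solution ::
  "('m::finite pnt \<Rightarrow> 'm pnt \<Rightarrow>\<^sub>L 'm pnt) \<Rightarrow> ('m pnt \<Rightarrow> real) \<Rightarrow> bool" where
  "weak_solution A u \<longleftrightarrow>
     (\<exists>G. has_weak_gradient half_space u G) \<and>
     (\<forall>f D. test_function half_space f D \<longrightarrow>
        (LINT X|lebesgue_on half_space.
           blinfun_apply (A X) (weak_gradient half_space u X) \<bullet> D X) = 0)"

(* Weak solutions are taken in their continuous (De Giorgi--Nash) representative, so that
   point values and boundary values make sense. *)
definition solves_dirichlet ::
  "('m::finite pnt \<Rightarrow> 'm pnt \<Rightarrow>\<^sub>L 'm pnt) \<Rightarrow> (real^'m \<Rightarrow> real) \<Rightarrow> ('m pnt \<Rightarrow> real) \<Rightarrow> bool" where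
  "solves_dirichlet A g u \<longleftrightarrow>
     weak_solution A u \<and> continuous_on half_space u \<and> bounded (u ` half_space) \<and>
     (\<forall>x. (u \<longlongrightarrow> g x) (at (x, 0) within half_space))"

(* The measure with pole X is \<omega> X. Bounded solutions of the Dirichlet problem are unique, so
   the condition determines \<omega> on half_space. *)
definition is_elliptic_measure ::
  "('m::finite pnt \<Rightarrow> 'm pnt \<Rightarrow>\<^sub>L 'm pnt) \<Rightarrow> ('m pnt \<Rightarrow> (real^'m) measure) \<Rightarrow> bool" where
  "is_elliptic_measure A \<omega> \<longleftrightarrow>
     (\<forall>X\<in>half_space. prob_space (\<omega> X) \<and> sets (\<omega> X) = sets borel) \<and>
     (\<forall>g. continuous_on UNIV g \<and> compact (closure {x. g x \<noteq> 0}) \<longrightarrow>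
        solves_dirichlet A g (\<lambda>X. LINT y|\<omega> X. g y))"

definition solution_with_data ::
  "('m::finite pnt \<Rightarrow> (real^'m) measure) \<Rightarrow> (real^'m \<Rightarrow> real) \<Rightarrow> 'm pnt \<Rightarrow> real" where
  "solution_with_data \<omega> F X = (LINT y|\<omega> X. F y)"

definition sqrt_ennreal :: "ennreal \<Rightarrow> ennreal" where
  "sqrt_ennreal a = (if a = \<infinity> then \<infinity> else ennreal (sqrt (enn2real a)))"

(* log (1/p) for a probability p, with log (1/0) infinite. *)
definition log_recip :: "real \<Rightarrow> ennreal" where
  "log_recip p = (if p = 0 then \<infinity> else ennreal (ln (1 / p)))"

(* The truncated square function of u at (x, 0), with values in [0, \<infinity>]. *)
definition square_function ::
  "real \<Rightarrow> real \<Rightarrow> ('m::finite pnt \<Rightarrow> real) \<Rightarrow> real^'m \<Rightarrow> ennreal" where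
  "square_function \<gamma> h u x = sqrt_ennreal
     (\<integral>\<^sup>+ Y \<in> approach_cone \<gamma> h x.
        ennreal ((norm (weak_gradient half_space u Y))\<^sup>2 *
          norm (Y - (x, 0)) powr (2 - real DIM('m pnt))) \<partial>lebesgue)"

end

theory Submission
 imports Defs "HOL-Real_Asymp.Real_Asymp"
begin

text \<open>
The set \<open>H\<close> comes from a stopping time. Let \<open>p\<close> be the elliptic measure of \<open>E\<close> seen from \<open>A\<^sub>Q = (c, l)\<close>, and take
\<open>\<Phi> \<ge> 0\<close> with integral at most 1 against that measure which is huge near \<open>E\<close>: the indicator of an open
neighbourhood of measure at most \<open>2 p\<close>, divided by \<open>2 p\<close> (for \<open>p = 0\<close> a series of such indicators). A dyadic cell
is heavy of generation \<open>i\<close> if the integral of \<open>\<Phi>\<close> over it, against elliptic measure with pole above that cell,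
is at least \<open>M ^ i\<close>; each point of \<open>E\<close> lies in heavy cells of about \<open>ln (1 / p)\<close> generations. \<open>H\<close> is the union
over \<open>i\<close> of the left halves of the maximal heavy cells of generation \<open>i\<close>, minus the cells of generation \<open>i + 1\<close>.

Seen from just above a maximal cell of generation \<open>i\<close>, generation \<open>i + 1\<close> inside it has small elliptic measure, because
\<open>\<omega>\<^sup>Z(S) \<omega>\<^sup>X(F) \<le> C \<omega>\<^sup>Z(F)\<close> for \<open>X\<close> above \<open>S\<close> (a boundary comparison). Hence \<open>u\<close> is at least 3/4 above the left half and at
most 1/4 above the right half, which forces a fixed amount of scaled energy in a slab above the cell. The slabs of
different generations are disjoint and lie in one cone, and summing gives \<open>S(u)\<^sup>2 \<ge> c ln (1 / p)\<close>.

All estimates for solutions follow from De Giorgi's method applied to continuous subsolutions: energy inequality,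
decay of a subsolution that vanishes on a fixed part of a ball, and from it Harnack, boundary decay and the comparison.
\<close>

text \<open>Each cell is weighed from the pole above that cell, never by a ratio of measures seen
  from \<open>A_Q\<close>. This keeps the argument one-sided: passing from a parent cell to a child
  costs an interior Harnack constant, returning to a common pole uses only the product inequality,
  and neither doubling of elliptic measure nor a Green function enters. \<Phi> is large on a
  neighbourhood of \<open>E\<close> and not only on \<open>E\<close>, because a whole small cell
  around each point must become heavy. The ratio \<open>M\<close> of consecutive thresholds exceeds
  the Harnack and comparison constants by so much that a maximal cell of one generation is too light
  for the next, and the next carries at most 1/8 of the measure from low poles.

  Where a solution is nonpositive on a flat boundary piece, its positive part extended by zero is
  admissible on balls reaching into the lower half space, so the interior decay lemma also yields
  boundary decay. The same device replaces the maximum principle on unbounded regions. Energy enters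
  through the L2 bound of an increment by the gradient, which gives Nash and Poincare inequalities
  in place of the Sobolev embedding.\<close>

abbreviation lims (infix "~~>" 55) where "f ~~> l == (f \<longlonglongrightarrow> l)"
abbreviation scl (infixr "*." 75) where "c *. x == c *\<^sub>R x"
abbreviation evs (binder "EV " 10) where "evs P == eventually P sequentially"
abbreviation ie :: "'a set => 'a => real => ennreal" where "ie S x r == indicator S x * ennreal r"
abbreviation bm :: "('a::topological_space => 'b::topological_space) set" where "bm == borel_measurable borel"
abbreviation nnint :: "('a::euclidean_space => ennreal) => ennreal" (binder "NI " 10) where "nnint f == nn_integral lborel f"
abbreviation lbint :: "('a::euclidean_space => 'b::{banach, second_countable_topology}) => 'b" (binder "BI " 10) where "lbint f == integral\<^sup>L lborel f"

text \<open>Most estimates below have the form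
  \<open>\<exists>c. ... \<forall>data. hypotheses --> conclusion\<close>, so that the constant is
  visibly chosen before the data. These rules turn such an object-level statement back into a usable
  rule.\<close>

lemma spec4: "\<forall>a b c d. P a b c d ==> P a b c d"
 and mp4: "A --> B --> C --> D --> E ==> A ==> B ==> C ==> D ==> E"
 by blast+

subsection \<open>Mollification and translations in L2\<close>

definition C1 :: "('a::euclidean_space => real) => ('a => 'a) => bool" where
 "C1 f D \<longleftrightarrow> (\<forall>x. GDERIV f x :> D x) & continuous_on UNIV D"

lemma C1_D: "C1 f D ==> GDERIV f x :> D x"
 and C1_cont_D: "C1 f D ==> continuous_on UNIV D"
 by (auto simp: C1_def)

lemma C1_cont: "C1 f D ==> continuous_on UNIV f"
 unfolding C1_def gderiv_def
 by (intro continuous_at_imp_continuous_on ballI) (blast intro: has_derivative_continuous)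

lemma C1_measurable:
 assumes "C1 f D"
 shows "f \<in> bm" "D \<in> bm"
 using borel_measurable_continuous_onI[OF C1_cont[OF assms]] borel_measurable_continuous_onI[OF C1_cont_D[OF assms]] by auto

lemma C1_const: "C1 (%x. c) (%x. 0)"
 by (simp add: C1_def GDERIV_const)

lemma C1_add: "C1 f D ==> C1 g E ==> C1 (%x. f x + g x) (%x. D x + E x)"
 by (auto simp: C1_def intro!: GDERIV_add continuous_intros)

lemma C1_mult: 
 assumes "C1 f D" "C1 g E"
 shows "C1 (%x. f x * g x) (%x. f x *. E x + g x *. D x)"
 using C1_cont[OF assms(1)] C1_cont[OF assms(2)] assms
 by (auto simp: C1_def intro!: GDERIV_mult continuous_intros)

lemma C1_compose:
 assumes "C1 f D" "!!t. DERIV p t :> p' t" "continuous_on UNIV p'"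
 shows "C1 (%x. p (f x)) (%x. p' (f x) *. D x)"
 using C1_cont[OF assms(1)] assms
 unfolding C1_def
 by (intro conjI allI GDERIV_DERIV_compose continuous_intros continuous_on_compose2[of UNIV p' UNIV f]) auto

lemma C1_scale: "C1 f D ==> C1 (%x. c * f x) (%x. c *. D x)"
 using C1_mult[OF C1_const[of c], of f D] by simp

lemma C1_inner_self: "C1 (%x. x \<bullet> x) (%x. 2 *. x)"
proof -
 have "GDERIV (%x. x \<bullet> x) x :> 2 *. x" for x :: 'a
 unfolding gderiv_def
 by (rule has_derivative_eq_rhs, (rule derivative_eq_intros refl)+) (auto simp: inner_commute)
 then show ?thesis by (auto simp: C1_def intro!: continuous_intros)
qed

lemma C1_shift: "C1 f D ==> C1 (%x. f (x - a)) (%x. D (x - a))"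
proof -
 assume *: "C1 f D"
 have "GDERIV (%x. f (x - a)) x :> D (x - a)" for x
 proof -
 have "((%x. x - a) has_derivative (%h. h)) (at x)"
 by (auto intro!: derivative_eq_intros)
 from has_derivative_compose[OF this] C1_D[OF *, of "x - a"] show ?thesis
 by (auto simp: gderiv_def)
 qed
 moreover have "continuous_on UNIV (%x. D (x - a))"
 by (intro continuous_on_compose2[OF C1_cont_D[OF *]] continuous_intros) auto
 ultimately show ?thesis by (simp add: C1_def)
qed

text \<open>The positive part itself is not differentiable at \<open>k\<close>, but its square
  already has a continuous derivative. Test functions are C1, so truncations inside them appear with
  power two or higher.\<close>

lemma DERIV_pos_part_power:
 assumes "1 <= m"
 shows "DERIV (%t::real. (max 0 (t - k)) ^ Suc m) t :> real (Suc m) * (max 0 (t - k)) ^ m"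
proof (cases "t = k")
 case False
 show ?thesis
 proof (cases "t < k")
 case True
 have z: "DERIV (%t::real. 0::real) t :> 0" by simp
 have "eventually (%s. (max 0 (s - k)) ^ Suc m = 0) (nhds t)"
 using eventually_nhds_in_open[of "{..<k}" t] True by (auto elim!: eventually_mono)
 then have "DERIV (%t. (max 0 (t - k)) ^ Suc m) t :> 0"
 using DERIV_cong_ev[OF refl, of "%s. (max 0 (s - k)) ^ Suc m" "%_. 0" t 0 0] z by blast
 then show ?thesis using True assms by (simp add: max_def power_0_left)
 next
 case 2: False
 have "DERIV (%t::real. (t - k) ^ Suc m) t :> real (Suc m) * (t - k) ^ m"
 by (auto intro!: derivative_eq_intros simp del: power_Suc)
 moreover have "eventually (%s. (max 0 (s - k)) ^ Suc m = (s - k) ^ Suc m) (nhds t)"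
 using eventually_nhds_in_open[of "{k<..}" t] 2 False by (auto elim!: eventually_mono)
 ultimately have "DERIV (%t. (max 0 (t - k)) ^ Suc m) t :> real (Suc m) * (t - k) ^ m"
 by (subst DERIV_cong_ev) auto
 then show ?thesis using 2 False by (simp add: max_def)
 qed
next
 case True
 have "((%h. (max 0 h) ^ Suc m / h) \<longlongrightarrow> 0) (at (0::real))"
 proof (rule Lim_null_comparison)
 show "\<forall>\<^sub>F h in at 0. norm ((max 0 h) ^ Suc m / h) <= \<bar>h\<bar> ^ m" 
 by (intro always_eventually allI) (auto simp: max_def abs_mult power_abs)
 show "((%h. \<bar>h\<bar> ^ m) \<longlongrightarrow> 0) (at (0::real))"
 using assms by (auto intro!: tendsto_eq_intros)
 qed
 then show ?thesis using True assms by (simp add: DERIV_def power_0_left)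
qed

text \<open>The fundamental theorem of calculus along the segment, then Cauchy-Schwarz on
  \<open>[0,1]\<close>. Stated in \<open>ennreal\<close> so that it can be integrated in
  \<open>x\<close> without integrability conditions.\<close>

lemma segment_sq_le:
 assumes "C1 f D"
 shows "ennreal ((f (x + h) - f x)^2) <=
 (NI t. indicator {0..1} t * ennreal ((norm h)^2 * (norm (D (x + t *. h)))^2))"
proof -
 let ?g = "%t. h \<bullet> D (x + t *. h)"
 have cD: "continuous_on UNIV (%t. D (x + t *. h))"
 by (intro continuous_on_compose2[OF C1_cont_D[OF assms]] continuous_intros) auto
 have cg: "continuous_on UNIV ?g" by (intro continuous_intros cD)
 have [measurable]: "?g \<in> bm" by (rule borel_measurable_continuous_onI[OF cg])
 have [measurable]: "(%t. D (x + t *. h)) \<in> bm" by (rule borel_measurable_continuous_onI[OF cD])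
 have der: "((%t. f (x + t *. h)) has_vector_derivative ?g t) (at t within {0..1})" for t
 proof -
 have "((%t. x + t *. h) has_derivative (%s. s *. h)) (at t)"
 by (auto intro!: derivative_eq_intros)
 from has_derivative_compose[OF this C1_D[OF assms, unfolded gderiv_def]]
 have "((%t. f (x + t *. h)) has_derivative (%s. s *. ?g t)) (at t)" by simp
 then show ?thesis
 unfolding has_vector_derivative_def by (rule has_derivative_at_withinI)
 qed
 have "has_bochner_integral lborel (%t. indicator {0..1} t *. ?g t) (f (x + 1 *. h) - f (x + 0 *. h))"
 by (rule has_bochner_integral_FTC_Icc) (use der continuous_on_subset[OF cg] in auto)
 then have hb: "has_bochner_integral lborel (%t. indicator {0..1} t * ?g t) (f (x + h) - f x)" by simp
 have "ennreal \<bar>f (x + h) - f x\<bar> <= (NI t. ennreal (norm (indicator {0..1} t * ?g t)))"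
 using integral_norm_bound_ennreal[OF hb[unfolded has_bochner_integral_iff, THEN conjunct1]]
 hb[unfolded has_bochner_integral_iff, THEN conjunct2] by simp
 also have "... = (NI t. ennreal (indicator {0..1} t * \<bar>?g t\<bar>) * indicator {0..1} t)"
 by (intro nn_integral_cong) (auto split: split_indicator simp: abs_mult)
 finally have "(ennreal \<bar>f (x + h) - f x\<bar>)^2 <= (NI t. ennreal (indicator {0..1} t * \<bar>?g t\<bar>) * indicator {0..1} t)^2"
 by (rule power_mono) simp
 also have "... <= (NI t. ennreal (indicator {0..1} t * \<bar>?g t\<bar>) ^ 2) * (NI t. (indicator {0..1::real} t) ^ 2)"
 by (rule Cauchy_Schwarz_nn_integral) auto
 also have "(NI t. (indicator {0..1::real} t) ^ 2) = (NI t. indicator {0..1::real} t)"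
 by (intro nn_integral_cong) (auto split: split_indicator)
 also have "... = 1" by simp
 also have "(NI t. ennreal (indicator {0..1} t * \<bar>?g t\<bar>) ^ 2)
 <= (NI t. indicator {0..1} t * ennreal ((norm h)^2 * (norm (D (x + t *. h)))^2))"
 proof (intro nn_integral_mono)
 fix t :: real
 have "\<bar>?g t\<bar>^2 <= (norm h * norm (D (x + t *. h)))^2"
 by (intro power_mono Cauchy_Schwarz_ineq2) auto
 then show "ennreal (indicator {0..1} t * \<bar>?g t\<bar>) ^ 2 <= indicator {0..1} t * ennreal ((norm h)^2 * (norm (D (x + t *. h)))^2)"
 by (auto split: split_indicator simp: ennreal_power power_mult_distrib intro!: ennreal_leI)
 qed
 finally show ?thesis by (simp add: ennreal_power)
qed

lemma nn_integral_shift: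
 fixes f :: "'a::euclidean_space => ennreal"
 assumes [measurable]: "f \<in> bm"
 shows "(NI x. f (x + c)) = (NI x. f x)"
proof -
 have "(NI x. f x) = (\<integral>\<^sup>+x. f x \<partial>distr lborel borel ((+) c))"
 by (simp add: lborel_distr_plus)
 also have "... = (NI x. f (c + x))"
 by (subst nn_integral_distr) auto
 finally show ?thesis by (simp add: add.commute)
qed

text \<open>Integrates the segment bound over \<open>x\<close>. Convexity keeps the segment from
  \<open>x\<close> to \<open>x + h\<close> in \<open>S\<close>, and after Fubini each slice in
  \<open>t\<close> is a translate with the same integral. The Nash and Poincare inequalities both
  rest on this estimate.\<close>

lemma translation_energy:
 assumes "C1 f D" "convex S" "S \<in> sets borel"
 shows "(NI x. indicator S x * indicator S (x + h) * ennreal ((f (x + h) - f x)^2))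
 <= ennreal ((norm h)^2) * (NI x. ie S x ((norm (D x))^2))"
proof -
 note [measurable] = C1_measurable[OF assms(1)] assms(3)
 let ?I = "\<integral>\<^sup>+x. ie S x ((norm (D x))^2) \<partial>lborel"
 have "(NI x. indicator S x * indicator S (x + h) * ennreal ((f (x + h) - f x)^2))
 <= (NI x. (NI t. indicator {0..1} t * (ennreal ((norm h)^2) * (indicator S (x + t *. h) * ennreal ((norm (D (x + t *. h)))^2)))))"
 proof (intro nn_integral_mono)
 fix x
 show "indicator S x * indicator S (x + h) * ennreal ((f (x + h) - f x)^2) <=
 (NI t. indicator {0..1} t * (ennreal ((norm h)^2) * (indicator S (x + t *. h) * ennreal ((norm (D (x + t *. h)))^2))))"
 proof (cases "x \<in> S & x + h \<in> S")
 case True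
 have "x + t *. h \<in> S" if "t \<in> {0..1}" for t
 using convexD[OF assms(2), of x "x + h" "1 - t" t] True that by (auto simp: algebra_simps)
 then have "(NI t. indicator {0..1} t * ennreal ((norm h)^2 * (norm (D (x + t *. h)))^2)) =
 (NI t. indicator {0..1} t * (ennreal ((norm h)^2) * (indicator S (x + t *. h) * ennreal ((norm (D (x + t *. h)))^2))))"
 by (intro nn_integral_cong) (auto split: split_indicator simp: ennreal_mult)
 with segment_sq_le[OF assms(1), of x h] True show ?thesis by simp
 qed auto
 qed
 also have "... = (NI t. (NI x. indicator {0..1} t * (ennreal ((norm h)^2) * (indicator S (x + t *. h) * ennreal ((norm (D (x + t *. h)))^2)))))"
 by (rule lborel_pair.Fubini'[symmetric]) measurable
 also have "... = (NI t. indicator {0..1::real} t * (ennreal ((norm h)^2) * ?I))"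
 proof (rule nn_integral_cong)
 fix t :: real
 have "(NI x. indicator S (x + t *. h) * ennreal ((norm (D (x + t *. h)))^2)) = ?I"
 by (rule nn_integral_shift[of "%x. ie S x ((norm (D x))^2)"]) measurable
 then show "(NI x. indicator {0..1} t * (ennreal ((norm h)^2) * (indicator S (x + t *. h) * ennreal ((norm (D (x + t *. h)))^2))))
 = indicator {0..1} t * (ennreal ((norm h)^2) * ?I)"
 by (simp add: nn_integral_cmult)
 qed
 also have "... = ennreal ((norm h)^2) * ?I"
 by (simp add: nn_integral_multc)
 finally show ?thesis .
qed

section \<open>Mollifiers and convolution with a C1 kernel\<close>

lemma integrable_compact_support:
 fixes f :: "'a::euclidean_space => 'b::euclidean_space"
 assumes "continuous_on UNIV f" "compact K" "!!x. x ~: K ==> f x = 0"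
 shows "integrable lborel f"
proof -
 have "integrable lborel (%x. indicator K x *. f x)"
 by (rule borel_integrable_compact[OF assms(2) continuous_on_subset[OF assms(1)]]) simp
 also have "(%x. indicator K x *. f x) = f"
 using assms(3) by (auto simp: indicator_def fun_eq_iff)
 finally show ?thesis .
qed

lemma C1_bump:
 "C1 (%x::'a::euclidean_space. (max 0 (r^2 - x \<bullet> x))^2) (%x. (- 4 * max 0 (r^2 - x \<bullet> x)) *. x)"
proof -
 have 1: "C1 (%x::'a. r^2 + (-1) * (x \<bullet> x)) (%x. 0 + (-1) *. (2 *. x))"
 by (intro C1_add C1_const C1_scale C1_inner_self)
 have d: "DERIV (%t::real. (max 0 t)^2) t :> 2 * max 0 t" for t
 using DERIV_pos_part_power[of 1 0 t] by (simp add: power2_eq_square)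
 have "C1 (%x::'a. (max 0 (r^2 + (-1) * (x \<bullet> x)))^2) (%x. (2 * max 0 (r^2 + (-1) * (x \<bullet> x))) *. (0 + (-1) *. (2 *. x)))"
 by (rule C1_compose[OF 1 d]) (intro continuous_intros)
 then show ?thesis by simp
qed

text \<open>A C1 kernel is smooth enough, since test functions are only C1. Evenness is included
  because the kernel is used both as a function of \<open>x - y\<close>, for differentiating, and of
  \<open>y - x\<close>, for testing.\<close>

definition mollifier :: "real => ('a::euclidean_space => real) => ('a => 'a) => bool" where
 "mollifier r k Dk \<longleftrightarrow> C1 k Dk & (\<forall>x. 0 <= k x) & (\<forall>x. r <= norm x --> k x = 0 & Dk x = 0) &
 (\<forall>x. k (- x) = k x & Dk (- x) = - Dk x) & integrable lborel k & (BI x. k x) = 1"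

lemma mollifierD:
 assumes "mollifier r k Dk"
 shows "C1 k Dk" "!!x. 0 <= k x" "!!x. r <= norm x ==> k x = 0" "!!x. r <= norm x ==> Dk x = 0"
 "!!x. k (- x) = k x" "!!x. Dk (- x) = - Dk x" "integrable lborel k" "(BI x. k x) = 1"
 using assms by (auto simp: mollifier_def)

lemma mollifier_exists:
 assumes "0 < r"
 shows "\<exists>k Dk. mollifier r (k :: 'a::euclidean_space => real) Dk"
proof -
 define b where "b = (%x::'a. (max 0 (r^2 - x \<bullet> x))^2)"
 define I where "I = (BI x. b x)"
 have C: "C1 b (%x. (- 4 * max 0 (r^2 - x \<bullet> x)) *. x)"
 unfolding b_def by (rule C1_bump)
 have z: "r^2 - x \<bullet> x <= 0" if "r <= norm x" for x :: 'a
 using that assms power_mono[of r "norm x" 2] by (simp add: power2_norm_eq_inner)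
 have int: "integrable lborel b"
 by (rule integrable_compact_support[OF C1_cont[OF C], of "cball 0 r"]) (use z in \<open>auto simp: b_def\<close>)
 have pos: "b x > 0" if "x \<in> ball 0 r" for x
 proof -
 have "(norm x)^2 < r^2" using that by (intro power_strict_mono) auto
 then show ?thesis by (simp add: b_def power2_norm_eq_inner)
 qed
 have "I ~= 0"
 proof
 assume "I = 0"
 then have "AE x in lborel. b x = 0"
 using integral_nonneg_eq_0_iff_AE[OF int] by (simp add: I_def b_def)
 then have "AE x in lborel. x ~: ball (0::'a) r"
 by eventually_elim (use pos in force)
 then have "emeasure lborel (ball (0::'a) r) = 0"
 by (subst (asm) AE_iff_measurable[OF _ refl]) (auto simp: ball_def dist_norm)
 then show False using assms emeasure_lborel_ball_finite[of "0::'a" r] content_ball_pos[of r "0::'a"]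
 by (simp add: measure_def)
 qed
 moreover have "I \<ge> 0" unfolding I_def by (intro Bochner_Integration.integral_nonneg) (auto simp: b_def)
 ultimately have I: "I > 0" by simp
 have "C1 (%x. (1 / I) * b x) (%x. (1 / I) *. (- 4 * max 0 (r^2 - x \<bullet> x)) *. x)"
 by (rule C1_scale[OF C])
 moreover have "integrable lborel (%x. (1 / I) * b x)" using int by simp
 moreover have "(BI x. (1 / I) * b x) = 1" using I by (simp add: I_def)
 ultimately have "mollifier r (%x. (1 / I) * b x) (%x. (1 / I) *. (- 4 * max 0 (r^2 - x \<bullet> x)) *. x)"
 using I z unfolding mollifier_def by (auto simp: b_def)
 then show ?thesis by blast
qed

lemma C1_mvt_bound:
 assumes "C1 k Dk" "!!t. 0 <= t ==> t <= 1 ==> norm (Dk (z + t *. h) - Dk z) <= e"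
 shows "\<bar>k (z + h) - k z - h \<bullet> Dk z\<bar> <= e * norm h"
proof -
 have der: "((%t. k (z + t *. h)) has_derivative (%s. s * (h \<bullet> Dk (z + t *. h)))) (at t)" for t :: real
 proof -
 have "((%t. z + t *. h) has_derivative (%s. s *. h)) (at t)"
 by (auto intro!: derivative_eq_intros)
 from has_derivative_compose[OF this C1_D[OF assms(1), unfolded gderiv_def]]
 show ?thesis by simp
 qed
 have "\<exists>t\<in>{0<..<1}. k (z + 1 *. h) - k (z + 0 *. h) = (1 - 0) * (h \<bullet> Dk (z + t *. h))"
 by (rule mvt_simple[of 0 1 "%t. k (z + t *. h)"]) (use der in \<open>auto intro: has_derivative_at_withinI\<close>)
 then obtain t where t: "0 < t" "t < 1" "k (z + h) - k z = h \<bullet> Dk (z + t *. h)" by auto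
 have "\<bar>h \<bullet> (Dk (z + t *. h) - Dk z)\<bar> <= norm h * norm (Dk (z + t *. h) - Dk z)"
 by (rule Cauchy_Schwarz_ineq2)
 also have "... <= norm h * e" using t by (intro mult_left_mono assms(2)) auto
 finally show ?thesis using t by (simp add: inner_diff_right mult.commute)
qed

text \<open>\<open>e / (N + 1)\<close> is the tolerance used where an error is multiplied by a
  nonnegative \<open>N\<close> that may vanish.\<close>

lemma div_Suc_bound:
 fixes e N :: real
 assumes "0 < e" "0 <= N"
 shows "0 < e / (N + 1)" "e / (N + 1) * N < e"
 using assms by (auto simp: field_simps add_pos_nonneg)

text \<open>The derivative falls on the kernel, so \<open>u\<close> only has to be integrable with
  bounded support. Uniform continuity of \<open>Dk\<close> on a ball containing all arguments
  \<open>x - y + h\<close> with \<open>norm h < 1\<close> makes the first-order error uniform in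
  \<open>y\<close>.\<close>

lemma C1_convolution:
 fixes u :: "'a::euclidean_space => real"
 assumes k: "C1 k Dk" and u: "integrable lborel u" and supp: "!!y. \<rho> < norm y ==> u y = 0" and "0 <= \<rho>"
 shows "C1 (%x. \<integral>y. u y * k (x - y) \<partial>lborel) (%x. \<integral>y. u y *. Dk (x - y) \<partial>lborel)"
proof -
 note [measurable] = C1_measurable[OF k] borel_measurable_integrable[OF u]
 have bnd: "\<exists>B. \<forall>z\<in>cball 0 R. norm (g z) <= B" if "continuous_on UNIV g" for R and g :: "'a => 'b::real_normed_vector"
 using compact_imp_bounded[OF compact_continuous_image[OF continuous_on_subset[OF that] compact_cball[of 0 R]]]
 by (auto simp: bounded_iff)
 have int: "integrable lborel (%y. u y *. g (x - y))" if g: "continuous_on UNIV g" for x and g :: "'a => 'b::euclidean_space"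
 proof -
 have [measurable]: "g \<in> bm" by (rule borel_measurable_continuous_onI[OF g])
 obtain B where B: "\<forall>z\<in>cball 0 (norm x + \<rho>). norm (g z) <= B" using bnd[OF g] by blast
 have "norm (u y *. g (x - y)) <= norm (B * u y)" for y
 proof (cases "\<rho> < norm y")
 case False
 then have "norm (g (x - y)) <= B" 
 using B norm_triangle_ineq4[of x y] by auto
 then have "\<bar>u y\<bar> * norm (g (x - y)) <= \<bar>u y\<bar> * \<bar>B\<bar>"
 by (intro mult_left_mono) auto
 then show ?thesis by (simp add: abs_mult mult.commute)
 qed (use supp in auto)
 then show ?thesis by (intro Bochner_Integration.integrable_bound[OF integrable_mult_right[OF u, of B]]) auto
 qed
 have intk: "integrable lborel (%y. u y * k (x - y))" for x using int[OF C1_cont[OF k], of x] by simp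
 have intD: "integrable lborel (%y. u y *. Dk (x - y))" for x by (rule int[OF C1_cont_D[OF k]])
 let ?N = "\<integral>y. \<bar>u y\<bar> \<partial>lborel"
 have N: "0 <= ?N" by simp
 have uc: "\<exists>d>0. d <= 1 & (\<forall>y h. norm y <= \<rho> --> norm h < d --> norm (Dk (x - y + h) - Dk (x - y)) <= e)" if "0 < e" for x e
 proof -
 have "uniformly_continuous_on (cball 0 (norm x + \<rho> + 1)) Dk"
 by (intro compact_uniformly_continuous continuous_on_subset[OF C1_cont_D[OF k]]) auto
 then obtain d where d: "d > 0" "!!z z'. z \<in> cball 0 (norm x + \<rho> + 1) ==> z' \<in> cball 0 (norm x + \<rho> + 1) ==> dist z' z < d ==> dist (Dk z') (Dk z) < e"
 using \<open>0 < e\<close> unfolding uniformly_continuous_on_def by metis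
 show ?thesis
 proof (intro exI[of _ "min d 1"] conjI allI impI)
 fix y h :: 'a assume y: "norm y <= \<rho>" and h: "norm h < min d 1"
 have "norm (x - y) <= norm x + \<rho>" using norm_triangle_ineq4[of x y] y by simp
 moreover have "norm (x - y + h) <= norm x + \<rho> + 1" using norm_triangle_ineq[of "x - y" h] h calculation by simp
 ultimately have "dist (Dk (x - y + h)) (Dk (x - y)) < e"
 using h by (intro d(2)) (simp_all only: mem_cball_0, auto simp: dist_norm)
 then show "norm (Dk (x - y + h) - Dk (x - y)) <= e" by (simp add: dist_norm)
 qed (use d in auto)
 qed
 have bound: "norm (BI y. u y *. g y) <= e * ?N"
 if "integrable lborel (%y. u y *. g y)" "!!y. norm y <= \<rho> ==> norm (g y) <= e" for g :: "'a => 'b::euclidean_space" and e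
 proof -
 have "norm (BI y. u y *. g y) <= (BI y. norm (u y *. g y))"
 by (rule integral_norm_bound)
 also have "... <= (BI y. e * \<bar>u y\<bar>)"
 proof (rule integral_mono)
 show "norm (u y *. g y) <= e * \<bar>u y\<bar>" for y
 proof (cases "norm y <= \<rho>")
 case True
 then show ?thesis using mult_right_mono[OF that(2)[OF True] abs_ge_zero[of "u y"]] by (simp add: mult.commute)
 qed (use supp in auto)
 qed (rule integrable_norm[OF that(1)], use u in auto)
 finally show ?thesis by simp
 qed
 have "GDERIV (%x. \<integral>y. u y * k (x - y) \<partial>lborel) x :> (BI y. u y *. Dk (x - y))" for x
 unfolding gderiv_def has_derivative_at_alt
 proof (intro conjI allI impI)
 show "bounded_linear (%h. h \<bullet> (BI y. u y *. Dk (x - y)))" by (rule bounded_linear_inner_left)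
 fix e :: real assume e: "0 < e"
 define e' where "e' = e / (?N + 1)"
 have e': "e' > 0" "e' * ?N <= e" using div_Suc_bound[OF e N] by (auto simp: e'_def)
 from uc[OF e'(1), of x] obtain d where d: "d > 0"
 "!!y h. norm y <= \<rho> ==> norm h < d ==> norm (Dk (x - y + h) - Dk (x - y)) <= e'" by blast
 show "\<exists>d>0. \<forall>x'. norm (x' - x) < d --> norm ((BI y. u y * k (x' - y)) - (BI y. u y * k (x - y)) -
 (x' - x) \<bullet> (BI y. u y *. Dk (x - y))) <= e * norm (x' - x)"
 proof (intro exI[of _ d] conjI allI impI)
 fix x' assume x': "norm (x' - x) < d"
 define h where "h = x' - x"
 have eq: "(BI y. u y * k (x' - y)) - (BI y. u y * k (x - y)) -
 h \<bullet> (BI y. u y *. Dk (x - y)) = (BI y. u y *. (k (x' - y) - k (x - y) - h \<bullet> Dk (x - y)))"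
 and ii: "integrable lborel (%y. u y *. (k (x' - y) - k (x - y) - h \<bullet> Dk (x - y)))"
 proof -
 have i3: "integrable lborel (%y. u y * (h \<bullet> Dk (x - y)))"
 using integrable_inner_right[of h lborel "%y. u y *. Dk (x - y)"] intD[of x] by (simp add: mult.commute)
 have "h \<bullet> (BI y. u y *. Dk (x - y)) = (BI y. u y * (h \<bullet> Dk (x - y)))"
 using integral_inner_right[of h lborel "%y. u y *. Dk (x - y)"] intD[of x] by simp
 then show "(BI y. u y * k (x' - y)) - (BI y. u y * k (x - y)) -
 h \<bullet> (BI y. u y *. Dk (x - y)) = (BI y. u y *. (k (x' - y) - k (x - y) - h \<bullet> Dk (x - y)))"
 "integrable lborel (%y. u y *. (k (x' - y) - k (x - y) - h \<bullet> Dk (x - y)))"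
 using intk i3 by (auto simp: right_diff_distrib)
 qed
 have "norm (BI y. u y *. (k (x' - y) - k (x - y) - h \<bullet> Dk (x - y))) <= (e' * norm h) * ?N"
 proof (rule bound[OF ii])
 fix y :: 'a assume y: "norm y <= \<rho>"
 have "\<bar>k ((x - y) + h) - k (x - y) - h \<bullet> Dk (x - y)\<bar> <= e' * norm h"
 proof (rule C1_mvt_bound[OF k])
 fix t :: real assume "0 <= t" "t <= 1"
 then have "norm (t *. h) <= norm h" by (simp add: mult_left_le_one_le)
 then show "norm (Dk (x - y + t *. h) - Dk (x - y)) <= e'"
 using x' y by (intro d) (auto simp: h_def)
 qed
 then show "norm (k (x' - y) - k (x - y) - h \<bullet> Dk (x - y)) <= e' * norm h"
 by (simp add: h_def)
 qed
 also have "... = (e' * ?N) * norm h" by simp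
 also have "... <= e * norm h" using e' by (intro mult_right_mono) auto
 finally show "norm ((BI y. u y * k (x' - y)) - (BI y. u y * k (x - y)) -
 (x' - x) \<bullet> (BI y. u y *. Dk (x - y))) <= e * norm (x' - x)"
 using eq by (simp add: h_def)
 qed (rule d)
 qed
 moreover have "continuous_on UNIV (%x. \<integral>y. u y *. Dk (x - y) \<partial>lborel)"
 unfolding continuous_on_iff
 proof (intro ballI allI impI)
 fix x :: 'a and e :: real assume e: "0 < e"
 define e' where "e' = e / (?N + 1)"
 have e': "e' > 0" "e' * ?N < e" using div_Suc_bound[OF e N] by (auto simp: e'_def)
 from uc[OF e'(1), of x] obtain d where d: "d > 0"
 "!!y h. norm y <= \<rho> ==> norm h < d ==> norm (Dk (x - y + h) - Dk (x - y)) <= e'" by blast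
 show "\<exists>d>0. \<forall>x'\<in>UNIV. dist x' x < d --> dist (BI y. u y *. Dk (x' - y)) (BI y. u y *. Dk (x - y)) < e"
 proof (intro exI[of _ d] conjI ballI impI)
 fix x' assume x': "dist x' x < d"
 have eq: "(BI y. u y *. Dk (x' - y)) - (BI y. u y *. Dk (x - y)) = (BI y. u y *. (Dk (x' - y) - Dk (x - y)))"
 and ii: "integrable lborel (%y. u y *. (Dk (x' - y) - Dk (x - y)))"
 using intD by (auto simp: scaleR_diff_right)
 have "norm (BI y. u y *. (Dk (x' - y) - Dk (x - y))) <= e' * ?N"
 proof (rule bound[OF ii])
 fix y :: 'a assume y: "norm y <= \<rho>"
 have "norm (Dk (x - y + (x' - x)) - Dk (x - y)) <= e'"
 using x' y by (intro d) (auto simp: dist_norm)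
 then show "norm (Dk (x' - y) - Dk (x - y)) <= e'" by (simp add: algebra_simps)
 qed
 then show "dist (BI y. u y *. Dk (x' - y)) (BI y. u y *. Dk (x - y)) < e"
 using eq e' by (simp add: dist_norm)
 qed (rule d)
 qed
 ultimately show ?thesis by (simp add: C1_def)
qed

section \<open>Square norms of vector fields and continuity of translations\<close>

definition L2sq :: "'a::euclidean_space set => ('a => 'b::euclidean_space) => ennreal" where
 "L2sq S V = (NI x. ie S x ((norm (V x))^2))"

lemma norm_add_sq_le: "(norm (a + b :: 'a::real_normed_vector))^2 <= 2 * (norm a)^2 + 2 * (norm b)^2"
proof -
 have "(norm (a + b))^2 <= (norm a + norm b)^2" by (intro power_mono norm_triangle_ineq) simp
 also have "... <= 2 * (norm a)^2 + 2 * (norm b)^2"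
 using zero_le_power2[of "norm a - norm b"] by (simp add: power2_eq_square algebra_simps)
 finally show ?thesis .
qed

lemma L2sq_add:
 assumes [measurable]: "V \<in> bm" "W \<in> bm" "S \<in> sets borel"
 shows "L2sq S (%x. V x + W x) <= 2 * L2sq S V + 2 * L2sq S W"
proof -
 have "L2sq S (%x. V x + W x) <= (NI x. 2 * (ie S x ((norm (V x))^2)) + 2 * (ie S x ((norm (W x))^2)))"
 unfolding L2sq_def
 proof (intro nn_integral_mono)
 fix x
 have "ennreal ((norm (V x + W x))^2) <= ennreal (2 * (norm (V x))^2 + 2 * (norm (W x))^2)"
 by (intro ennreal_leI norm_add_sq_le)
 also have "... = 2 * ennreal ((norm (V x))^2) + 2 * ennreal ((norm (W x))^2)"
 by (simp add: ennreal_plus ennreal_mult)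
 finally show "ie S x ((norm (V x + W x))^2) <= 2 * (ie S x ((norm (V x))^2)) + 2 * (ie S x ((norm (W x))^2))"
 by (auto split: split_indicator)
 qed
 also have "... = 2 * L2sq S V + 2 * L2sq S W"
 unfolding L2sq_def by (simp add: nn_integral_add nn_integral_cmult)
 finally show ?thesis .
qed

lemma L2sq_mono: "S \<subseteq> T ==> L2sq S V <= L2sq T V"
 unfolding L2sq_def by (intro nn_integral_mono) (auto split: split_indicator)

lemma L2sq_shift:
 assumes [measurable]: "V \<in> bm"
 shows "L2sq UNIV (%x. V (x + z)) = L2sq UNIV V"
 unfolding L2sq_def using nn_integral_shift[of "%x. ie UNIV x ((norm (V x))^2)" z] by simp

lemma integral_shift:
 fixes f :: "'a::euclidean_space => 'b::euclidean_space"
 assumes [measurable]: "f \<in> bm"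
 shows "(BI x. f (x + c)) = (BI x. f x)"
proof -
 have "(BI x. f x) = (\<integral>x. f x \<partial>distr lborel borel ((+) c))"
 by (simp add: lborel_distr_plus)
 also have "... = (BI x. f (c + x))"
 by (subst integral_distr) auto
 finally show ?thesis by (simp add: add.commute)
qed

lemma integrable_shift:
 fixes f :: "'a::euclidean_space => 'b::euclidean_space"
 assumes "integrable lborel f"
 shows "integrable lborel (%x. f (x + c))"
proof -
 have "integrable (distr lborel borel ((+) c)) f" using assms by (simp add: lborel_distr_plus)
 then have "integrable lborel (%x. f (c + x))" by (subst (asm) integrable_distr_eq) (use assms in auto)
 then show ?thesis by (simp add: add.commute)
qed

lemma emeasure_compact_finite: "compact K ==> emeasure lborel K < \<infinity>"
 by (rule emeasure_bounded_finite[OF compact_imp_bounded])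

lemma L2_truncate:
 fixes G :: "'a::euclidean_space => 'b::euclidean_space"
 assumes [measurable]: "G \<in> bm" and fin: "L2sq UNIV G < \<infinity>" and "0 < e"
 shows "\<exists>m::nat. L2sq UNIV (%x. G x - (if norm (G x) <= real m then G x else 0)) < e"
proof -
 let ?u = "%m x. ennreal ((norm (G x - (if norm (G x) <= real m then G x else 0)))^2)"
 have "(%m. \<integral>\<^sup>+x. ?u m x \<partial>lborel) ~~> (\<integral>\<^sup>+x. (0::ennreal) \<partial>(lborel::'a measure))"
 proof (rule nn_integral_dominated_convergence[where w = "%x. ennreal ((norm (G x))^2)"])
 show "(NI x. ennreal ((norm (G x))^2)) < \<infinity>" using fin by (simp add: L2sq_def)
 have "(%m. ?u m x) ~~> 0" for x
 proof (rule tendsto_eventually)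
 show "\<forall>\<^sub>F m in sequentially. ?u m x = 0"
 using eventually_ge_at_top[of "nat \<lceil>norm (G x)\<rceil>"] 
 proof eventually_elim
 case (elim m)
 then have "norm (G x) <= real m" using real_nat_ceiling_ge[of "norm (G x)"] by linarith
 then show ?case by simp
 qed
 qed
 then show "AE x in lborel. (%m. ?u m x) ~~> 0" by simp
 qed auto
 then have "(%m. L2sq UNIV (%x. G x - (if norm (G x) <= real m then G x else 0))) ~~> 0"
 by (simp add: L2sq_def)
 from order_tendstoD(2)[OF this \<open>0 < e\<close>] show ?thesis
 by (auto simp: eventually_sequentially)
qed

text \<open>Measurability supplies continuous approximants converging almost everywhere, but with no
  control on size or support. Capping them at norm \<open>m\<close> and multiplying by a function of
  the distance to \<open>K\<close> leaves the limit unchanged and gives a dominating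
  function.\<close>

lemma L2_approx_bounded:
 fixes G :: "'a::euclidean_space => 'b::euclidean_space"
 assumes [measurable]: "G \<in> bm" and "0 < (e::ennreal)" and "compact K" "K ~= {}"
 and supp: "!!x. x ~: K ==> G x = 0" and bd: "!!x. norm (G x) <= m" and "0 < m"
 shows "\<exists>g. continuous_on UNIV g & (\<forall>x. 1 <= infdist x K --> g x = 0) & L2sq UNIV (%x. G x - g x) < e"
proof -
 have "G \<in> borel_measurable lebesgue" by (simp add: measurable_completion)
 then have "G measurable_on UNIV" by (intro lebesgue_measurable_imp_measurable_on) auto
 then obtain N g where N: "negligible N" "!!n. continuous_on UNIV (g n)" "!!x. x ~: N ==> (%n. g n x) ~~> G x"
 unfolding measurable_on_def by auto
 define c where "c n x = (max 0 (1 - infdist x K) / max 1 (norm (g n x) / m)) *. g n x" for n :: nat and x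
 have cc: "continuous_on UNIV (c n)" for n
 unfolding c_def using \<open>0 < m\<close> by (intro continuous_intros N) (auto simp: max_def)
 then have [measurable]: "c n \<in> bm" for n by (rule borel_measurable_continuous_onI)
 have cb: "norm (c n x) <= m" for n x
 proof -
 have "norm (c n x) = max 0 (1 - infdist x K) * (norm (g n x) / max 1 (norm (g n x) / m))"
 by (simp add: c_def)
 also have "... <= 1 * (norm (g n x) / max 1 (norm (g n x) / m))"
 by (intro mult_right_mono) (auto simp: infdist_nonneg)
 also have "norm (g n x) / max 1 (norm (g n x) / m) <= m"
 using \<open>0 < m\<close> by (auto simp: max_def field_simps)
 finally show ?thesis by simp
 qed
 have cs: "c n x = 0" if "1 <= infdist x K" for n x using that by (simp add: c_def)
 let ?K = "{x. infdist x K <= 1}"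
 have K': "compact ?K" by (intro compact_infdist_le assms) simp
 then have [measurable]: "?K \<in> sets borel" by (simp add: borel_compact)
 have lim: "(%n. c n x) ~~> G x" if "x ~: N" for x
 proof (cases "x \<in> K")
 case True
 have "(%n. (1 / max 1 (norm (g n x) / m)) *. g n x) ~~> (1 / max 1 (norm (G x) / m)) *. G x"
 by (intro tendsto_intros N(3) that) (use \<open>0 < m\<close> in auto)
 moreover have "max 1 (norm (G x) / m) = 1" using bd[of x] \<open>0 < m\<close> by (simp add: max_def field_simps)
 ultimately show ?thesis using True by (simp add: c_def)
 next
 case False
 have "(%n. (max 0 (1 - infdist x K) / max 1 (norm (g n x) / m)) *. g n x) ~~> (max 0 (1 - infdist x K) / max 1 (norm (G x) / m)) *. G x"
 by (intro tendsto_intros N(3) that) (use \<open>0 < m\<close> in auto)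
 then show ?thesis using supp[OF False] by (simp add: c_def)
 qed
 have "(%n. \<integral>\<^sup>+x. ennreal ((norm (G x - c n x))^2) \<partial>lborel) ~~> (\<integral>\<^sup>+x. (0::ennreal) \<partial>(lborel::'a measure))"
 proof (rule nn_integral_dominated_convergence[where w = "%x. ennreal ((2 * m)^2) * indicator ?K x"])
 show "(NI x. ennreal ((2 * m)^2) * indicator ?K x) < \<infinity>"
 using emeasure_compact_finite[OF K'] by (simp add: nn_integral_cmult_indicator ennreal_mult_less_top)
 show "AE x in lborel. ennreal ((norm (G x - c n x))^2) <= ennreal ((2 * m)^2) * indicator ?K x" for n
 proof (intro AE_I2)
 fix x
 show "ennreal ((norm (G x - c n x))^2) <= ennreal ((2 * m)^2) * indicator ?K x"
 proof (cases "x \<in> ?K")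
 case True
 have "norm (G x - c n x) <= 2 * m" using norm_triangle_ineq4[of "G x" "c n x"] bd[of x] cb[of n x] by simp
 then have "(norm (G x - c n x))^2 <= (2 * m)^2" by (intro power_mono) auto
 then show ?thesis using True by (auto intro!: ennreal_leI simp del: power_mult_distrib)
 next
 case False
 then have "x ~: K" by auto
 then show ?thesis using False cs[of x n] supp by auto
 qed
 qed
 have "AE x in lebesgue. x ~: N" using N(1) by (intro AE_not_in) (simp add: negligible_iff_null_sets)
 then have "AE x in lborel. x ~: N" by (simp add: AE_completion_iff)
 then show "AE x in lborel. (%n. ennreal ((norm (G x - c n x))^2)) ~~> 0"
 proof eventually_elim
 case (elim x)
 have "(%n. ennreal ((norm (G x - c n x))^2)) ~~> ennreal ((norm (G x - G x))^2)"
 by (intro tendsto_intros tendsto_ennrealI lim elim)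
 then show ?case by simp
 qed
 qed auto
 then have "(%n. L2sq UNIV (%x. G x - c n x)) ~~> 0" by (simp add: L2sq_def)
 from order_tendstoD(2)[OF this \<open>0 < e\<close>] obtain n where "L2sq UNIV (%x. G x - c n x) < e"
 by (auto simp: eventually_sequentially)
 then show ?thesis using cc cs by blast
qed

text \<open>Truncate, approximate by a continuous function of compact support, and use its uniform
  continuity. The two outer errors are translates of each other and have equal norm.\<close>

lemma L2_translation_continuous:
 fixes G :: "'a::euclidean_space => 'b::euclidean_space"
 assumes G[measurable]: "G \<in> bm" and "0 < (e::real)" and K: "compact K" "K ~= {}"
 and supp: "!!x. x ~: K ==> G x = 0" and fin: "L2sq UNIV G < \<infinity>"
 shows "\<exists>d>0. \<forall>z. norm z < d --> L2sq UNIV (%x. G (x + z) - G x) <= ennreal e"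
proof -
 define e' where "e' = e / 64"
 have e': "0 < ennreal e'" using \<open>0 < e\<close> by (simp add: e'_def)
 obtain m :: nat where m: "L2sq UNIV (%x. G x - (if norm (G x) <= real m then G x else 0)) < ennreal e'"
 using L2_truncate[OF G fin e'] by blast
 define G1 where "G1 x = (if norm (G x) <= real m then G x else 0)" for x
 have [measurable]: "G1 \<in> bm" unfolding G1_def by measurable
 have G1s: "G1 x = 0" if "x ~: K" for x using supp[OF that] by (simp add: G1_def)
 have G1b: "norm (G1 x) <= real m + 1" for x by (simp add: G1_def)
 obtain g where g: "continuous_on UNIV g" "!!x. 1 <= infdist x K ==> g x = 0" "L2sq UNIV (%x. G1 x - g x) < ennreal e'"
 using L2_approx_bounded[of G1 "ennreal e'" K "real m + 1", OF _ e' K G1s G1b] by auto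
 have [measurable]: "g \<in> bm" by (rule borel_measurable_continuous_onI[OF g(1)])
 have "L2sq UNIV (%x. (G x - G1 x) + (G1 x - g x)) <= 2 * L2sq UNIV (%x. G x - G1 x) + 2 * L2sq UNIV (%x. G1 x - g x)"
 by (rule L2sq_add) auto
 also have "... <= 2 * ennreal e' + 2 * ennreal e'"
 using m g(3) by (intro add_mono mult_left_mono) (auto simp: G1_def)
 also have "... = ennreal (e / 16)" using \<open>0 < e\<close>
 by (simp add: e'_def flip: ennreal_plus ennreal_mult ennreal_numeral)
 finally have Gg: "L2sq UNIV (%x. G x - g x) <= ennreal (e / 16)" by simp
 let ?K = "{x. infdist x K <= 2}" and ?K3 = "{x. infdist x K <= 3}"
 have K': "compact ?K" "compact ?K3" by (auto intro!: compact_infdist_le K)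
 then have [measurable]: "?K \<in> sets borel" by (simp add: borel_compact)
 define \<mu> where "\<mu> = measure lborel ?K"
 have \<mu>: "emeasure lborel ?K = ennreal \<mu>" "0 <= \<mu>"
 using emeasure_compact_finite[OF K'(1)] by (auto simp: \<mu>_def emeasure_eq_ennreal_measure)
 define et where "et = sqrt (e / (8 * (\<mu> + 1)))"
 have et: "0 < et" "et^2 * \<mu> <= e / 8" using \<open>0 < e\<close> \<mu>(2) by (auto simp: et_def field_simps)
 have "uniformly_continuous_on ?K3 g"
 by (intro compact_uniformly_continuous continuous_on_subset[OF g(1)] K') auto
 then obtain d where d: "d > 0" "!!x x'. x \<in> ?K3 ==> x' \<in> ?K3 ==> dist x' x < d ==> dist (g x') (g x) < et"
 using et(1) unfolding uniformly_continuous_on_def by metis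
 show ?thesis
 proof (intro exI[of _ "min d 1"] conjI allI impI)
 fix z :: 'a assume z: "norm z < min d 1"
 have gz: "L2sq UNIV (%x. g (x + z) - g x) <= ennreal (e / 8)"
 proof -
 have "L2sq UNIV (%x. g (x + z) - g x) <= (NI x. ennreal (et^2) * indicator ?K x)"
 unfolding L2sq_def
 proof (intro nn_integral_mono)
 fix x
 have tri: "infdist x K <= infdist (x + z) K + norm z" "infdist (x + z) K <= infdist x K + norm z"
 using infdist_triangle[of x K "x + z"] infdist_triangle[of "x + z" K x] by (auto simp: dist_norm)
 show "ie UNIV x ((norm (g (x + z) - g x))^2) <= ennreal (et^2) * indicator ?K x"
 proof (cases "x \<in> ?K")
 case True
 then have "dist (g (x + z)) (g x) < et" using z tri by (intro d) (auto simp: dist_norm)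
 then show ?thesis using True by (auto simp: dist_norm intro!: ennreal_leI power_mono)
 next
 case False
 then show ?thesis using g(2)[of x] g(2)[of "x + z"] tri z by auto
 qed
 qed
 also have "... = ennreal (et^2 * \<mu>)" by (simp add: nn_integral_cmult_indicator \<mu> ennreal_mult)
 also have "... <= ennreal (e / 8)" by (intro ennreal_leI et)
 finally show ?thesis .
 qed
 have 1: "L2sq UNIV (%x. ((G (x + z) - g (x + z)) + (g x - G x)) + (g (x + z) - g x)) <=
 2 * L2sq UNIV (%x. ((G (x + z) - g (x + z)) + (g x - G x))) + 2 * L2sq UNIV (%x. g (x + z) - g x)"
 by (rule L2sq_add) auto
 have 2: "L2sq UNIV (%x. ((G (x + z) - g (x + z)) + (g x - G x))) <= 2 * L2sq UNIV (%x. G (x + z) - g (x + z)) + 2 * L2sq UNIV (%x. g x - G x)"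
 by (rule L2sq_add) auto
 have 3: "L2sq UNIV (%x. G (x + z) - g (x + z)) = L2sq UNIV (%x. G x - g x)"
 by (rule L2sq_shift[of "%x. G x - g x"]) auto
 have 4: "L2sq UNIV (%x. g x - G x) = L2sq UNIV (%x. G x - g x)"
 by (simp add: L2sq_def norm_minus_commute)
 have "L2sq UNIV (%x. G (x + z) - G x) <= 2 * (2 * L2sq UNIV (%x. G x - g x) + 2 * L2sq UNIV (%x. G x - g x)) + 2 * L2sq UNIV (%x. g (x + z) - g x)"
 using order_trans[OF 1 add_mono[OF mult_left_mono[OF 2] order_refl]] by (simp add: 3 4)
 also have "... <= 2 * (2 * ennreal (e / 16) + 2 * ennreal (e / 16)) + 2 * ennreal (e / 8)"
 using Gg gz by (intro add_mono mult_left_mono) auto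
 also have "... = ennreal (3 / 4 * e)"
 using \<open>0 < e\<close> by (simp flip: ennreal_plus ennreal_mult ennreal_numeral)
 also have "... <= ennreal e" using \<open>0 < e\<close> by (intro ennreal_leI) simp
 finally show "L2sq UNIV (%x. G (x + z) - G x) <= ennreal e" .
 qed (use d in auto)
qed

lemma ennreal_pos_dense:
 assumes "0 < (a::ennreal)"
 shows "\<exists>e>0. ennreal e < a"
proof -
 obtain b where b: "0 < b" "b < a" using dense[OF assms] by blast
 then have "b < top" using top_greatest[of a] by (rule_tac less_le_trans)
 with b show ?thesis
 by (intro exI[of _ "enn2real b"]) (simp add: enn2real_positive_iff)
qed

subsection \<open>Local Sobolev functions\<close>

text \<open>A form of W^{1,2}_loc for continuous functions: on each compact set, global C1 functions
  converge uniformly and their gradients converge in L2. Uniform convergence of the functions lets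
  compositions \<open>p (u x)\<close> pass to the limit. The approximants may depend on
  \<open>K\<close>.\<close>

definition sob :: "'a::euclidean_space set => ('a => real) => ('a => 'a) => bool" where
 "sob Om u G \<longleftrightarrow> continuous_on Om u & G \<in> bm &
 (\<forall>K. compact K & K \<subseteq> Om --> (\<exists>f D. (\<forall>n. C1 (f n) (D n)) & uniform_limit K f u sequentially &
 (%n::nat. L2sq K (%x. D n x - G x)) ~~> 0))"

text \<open>Jensen's inequality for the probability density \<open>k\<close>, by Cauchy-Schwarz with
  the factor \<open>sqrt (k z)\<close>. If the integrand is not integrable, the Bochner integral is
  0 by convention and the bound is trivial.\<close>

lemma sq_integral_le_weighted:
 fixes V :: "'a::euclidean_space => 'b::euclidean_space"
 assumes k: "integrable lborel k" "!!x. 0 <= k x" "(BI x. k x) = 1"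
 and V[measurable]: "V \<in> bm"
 shows "ennreal ((norm (BI z. k z *. V z))^2) <= (NI z. ennreal (k z) * ennreal ((norm (V z))^2))"
proof (cases "integrable lborel (%z. k z *. V z)")
 case True
 have [measurable]: "k \<in> bm" using k by auto
 have "ennreal (norm (BI z. k z *. V z)) <= (NI z. ennreal (norm (k z *. V z)))"
 by (rule integral_norm_bound_ennreal[OF True])
 also have "... = (NI z. ennreal (sqrt (k z)) * ennreal (sqrt (k z) * norm (V z)))"
 using k(2) by (intro nn_integral_cong) (simp flip: ennreal_mult mult.assoc)
 finally have "(ennreal (norm (BI z. k z *. V z)))^2 <= (NI z. ennreal (sqrt (k z)) * ennreal (sqrt (k z) * norm (V z)))^2"
 by (rule power_mono) simp
 also have "... <= (NI z. ennreal (sqrt (k z)) ^ 2) * (NI z. ennreal (sqrt (k z) * norm (V z)) ^ 2)"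
 by (rule Cauchy_Schwarz_nn_integral) auto
 also have "(NI z. ennreal (sqrt (k z)) ^ 2) = (NI z. ennreal (k z))"
 using k(2) by (intro nn_integral_cong) (simp add: ennreal_power)
 also have "... = 1" using nn_integral_eq_integral[OF k(1)] k by simp
 also have "(NI z. ennreal (sqrt (k z) * norm (V z)) ^ 2) = (NI z. ennreal (k z) * ennreal ((norm (V z))^2))"
 using k(2) by (intro nn_integral_cong) (simp add: ennreal_power power_mult_distrib flip: ennreal_mult)
 finally show ?thesis by (simp add: ennreal_power)
qed (simp add: not_integrable_integral_eq)

lemma L2_mollify:
 fixes G :: "'a::euclidean_space => 'b::euclidean_space"
 assumes k: "integrable lborel k" "!!x. 0 <= k x" "(BI x. k x) = 1" "!!x. r <= norm x ==> k x = 0"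
 and G[measurable]: "G \<in> bm"
 and tr: "!!z. norm z < r ==> L2sq UNIV (%x. G (x + z) - G x) <= ennreal e"
 shows "L2sq UNIV (%x. \<integral>z. k z *. (G (x + z) - G x) \<partial>lborel) <= ennreal e"
proof -
 have [measurable]: "k \<in> bm" using k by auto
 have "L2sq UNIV (%x. \<integral>z. k z *. (G (x + z) - G x) \<partial>lborel) <=
 (NI x. (NI z. ennreal (k z) * ennreal ((norm (G (x + z) - G x))^2)))"
 unfolding L2sq_def using k by (intro nn_integral_mono) (simp add: sq_integral_le_weighted)
 also have "... = (NI z. (NI x. ennreal (k z) * ennreal ((norm (G (x + z) - G x))^2)))"
 by (rule lborel_pair.Fubini'[symmetric]) measurable
 also have "... = (NI z. ennreal (k z) * L2sq UNIV (%x. G (x + z) - G x))"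
 by (intro nn_integral_cong) (simp add: L2sq_def nn_integral_cmult)
 also have "... <= (NI z. ennreal (k z) * ennreal e)"
 proof (intro nn_integral_mono)
 fix z
 show "ennreal (k z) * L2sq UNIV (%x. G (x + z) - G x) <= ennreal (k z) * ennreal e"
 using tr[of z] k(4)[of z] by (cases "norm z < r") (auto intro: mult_left_mono)
 qed
 also have "... = ennreal e"
 using nn_integral_eq_integral[OF k(1)] k by (simp add: nn_integral_multc)
 finally show ?thesis .
qed

lemma L2sq_finite_integrable:
 fixes G :: "'a::euclidean_space => 'b::euclidean_space"
 assumes G[measurable]: "G \<in> bm" and K: "compact K" "!!x. x ~: K ==> G x = 0"
 and fin: "L2sq UNIV G < \<infinity>"
 shows "integrable lborel G"
proof -
 have [measurable]: "K \<in> sets borel" using K by (simp add: borel_compact)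
 have "(NI x. ennreal (norm (G x))) <= (NI x. indicator K x + ie UNIV x ((norm (G x))^2))"
 proof (intro nn_integral_mono)
 fix x
 have "t <= 1 + t^2" for t :: real
 using zero_le_power2[of "t - 1 / 2"] by (simp add: power2_eq_square algebra_simps)
 then have "ennreal (norm (G x)) <= ennreal (1 + (norm (G x))^2)" by (intro ennreal_leI)
 then show "ennreal (norm (G x)) <= indicator K x + ie UNIV x ((norm (G x))^2)"
 using K(2)[of x] by (cases "x \<in> K") (auto simp: ennreal_plus)
 qed
 also have "... = emeasure lborel K + L2sq UNIV G" by (simp add: L2sq_def nn_integral_add)
 also have "... < \<infinity>" using fin emeasure_compact_finite[OF K(1)] by (simp add: less_top)
 finally show ?thesis by (intro integrableI_bounded) auto
qed

text \<open>Mollify \<open>u\<close> cut to a compact neighbourhood \<open>K'\<close> of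
  \<open>K\<close>. For \<open>x\<close> in \<open>K\<close> the function
  \<open>y \<mapsto> k (y - x)\<close> is a test function, and the weak identity for it says that
  the gradient of the mollified \<open>u\<close> is the mollified \<open>G\<close>. Continuity of
  translations then gives L2 convergence.\<close>

lemma sob_of_weak_gradient:
 fixes u :: "'a::euclidean_space => real"
 assumes "open Om" and u: "continuous_on Om u" and G[measurable]: "G \<in> bm"
 and fin: "!!K. compact K ==> K \<subseteq> Om ==> L2sq K G < \<infinity>"
 and weak: "!!f D. test_function Om f D ==> (BI x. (indicator Om x * u x) *. D x) = - (BI x. f x *. (indicator Om x *. G x))"
 shows "sob Om u G"
 unfolding sob_def
proof (intro conjI allI impI)
 fix K :: "'a set" assume K: "compact K & K \<subseteq> Om"
 show "\<exists>f D. (\<forall>n. C1 (f n) (D n)) & uniform_limit K f u sequentially & (%n. L2sq K (%x. D n x - G x)) ~~> 0"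
 proof (cases "K = {}")
 case True
 then show ?thesis
 by (intro exI[of _ "%n x. 0"] exI[of _ "%n x. 0"]) (auto simp: L2sq_def C1_const[of 0, simplified])
 next
 case False
 obtain e0 where e0: "0 < e0" "(\<Union>x\<in>K. cball x e0) \<subseteq> Om"
 using compact_subset_open_imp_cball_epsilon_subset[of K Om] K \<open>open Om\<close> by blast
 define K' where "K' = (\<Union>x\<in>K. cball x e0)"
 have K'c: "compact K'" unfolding K'_def by (intro compact_minkowski_sum_cball) (use K in auto)
 have K'Om: "K' \<subseteq> Om" using e0 by (simp add: K'_def)
 have KK': "K \<subseteq> K'" using e0(1) by (force simp: K'_def)
 have [measurable]: "K' \<in> sets borel" using K'c by (simp add: borel_compact)
 obtain \<rho>0 where \<rho>0: "!!y. y \<in> K' ==> norm y <= \<rho>0" using compact_imp_bounded[OF K'c] by (auto simp: bounded_iff)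
 define \<rho> where "\<rho> = max 0 \<rho>0"
 have \<rho>: "0 <= \<rho>" "!!y. y \<in> K' ==> norm y <= \<rho>" using \<rho>0 by (force simp: \<rho>_def)+
 define u' where "u' = (%x. indicator K' x *. u x)"
 define G' where "G' = (%x. indicator K' x *. G x)"
 have u'i: "integrable lborel u'" unfolding u'_def
 by (rule borel_integrable_compact[OF K'c continuous_on_subset[OF u K'Om]])
 have [measurable]: "u' \<in> bm" using borel_measurable_integrable[OF u'i] by simp
 have [measurable]: "G' \<in> bm" unfolding G'_def by measurable
 have G'fin: "L2sq UNIV G' < \<infinity>"
 proof -
 have "L2sq UNIV G' = L2sq K' G" unfolding L2sq_def G'_def by (intro nn_integral_cong) (auto split: split_indicator)
 then show ?thesis using fin[OF K'c K'Om] by simp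
 qed
 have G'z: "x ~: K' ==> G' x = 0" for x by (simp add: G'_def)
 have G'i: "integrable lborel G'" by (rule L2sq_finite_integrable[OF _ K'c G'z G'fin]) auto
 define r where "r n = e0 / (real n + 2)" for n :: nat
 have r: "0 < r n" "r n < e0" for n using e0 by (auto simp: r_def field_simps intro!: add_pos_nonneg)
 have r0: "r ~~> 0" unfolding r_def by real_asymp
 have "\<exists>k Dk. mollifier (r n) (k :: 'a => real) Dk" for n by (rule mollifier_exists[OF r(1)])
 then obtain k :: "nat => 'a => real" and Dk where "!!n. mollifier (r n) (k n) (Dk n)" by metis
 note k = mollifierD[OF this]
 note [measurable] = C1_measurable[OF k(1)]
 define f where "f n x = (BI y. u' y * k n (x - y))" for n x
 define D where "D n x = (BI y. u' y *. Dk n (x - y))" for n x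
 have C1: "C1 (f n) (D n)" for n
 proof -
 have "C1 (%x. \<integral>y. u' y * k n (x - y) \<partial>lborel) (%x. \<integral>y. u' y *. Dk n (x - y) \<partial>lborel)"
 proof (rule C1_convolution[OF k(1) u'i _ \<rho>(1)])
 show "u' y = 0" if "\<rho> < norm y" for y
 using \<rho>(2)[of y] that by (auto simp: u'_def indicator_def)
 qed
 then show ?thesis by (simp add: f_def[abs_def] D_def[abs_def])
 qed
 have inK': "y \<in> K'" if "x \<in> K" "norm (y - x) < r n" for x y n
 using that r(2)[of n] by (auto simp: K'_def dist_norm norm_minus_commute intro!: bexI[of _ x])
 have swap: "k n (x - y) = k n (y - x)" "Dk n (x - y) = - Dk n (y - x)" for n x y
 using k(5)[of n "y - x"] k(6)[of n "y - x"] by auto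
 have kbd: "\<exists>B. \<forall>z. \<bar>k n z\<bar> <= B" for n
 proof -
 have "compact (k n ` cball 0 (r n))"
 by (intro compact_continuous_image continuous_on_subset[OF C1_cont[OF k(1)]]) auto
 then obtain B where B: "!!z. norm z <= r n ==> \<bar>k n z\<bar> <= B" using compact_imp_bounded by (force simp: bounded_iff)
 have "\<bar>k n z\<bar> <= max 0 B" for z
 using k(3)[of n z] B[of z] by (cases "r n <= norm z") (auto simp: max_def)
 then show ?thesis by blast
 qed
 have kGi: "integrable lborel (%z. k n z *. G' (x + z))" for n x
 proof -
 obtain B where B: "!!z. \<bar>k n z\<bar> <= B" using kbd by blast
 have "integrable lborel (%z. B *. G' (z + x))" by (intro integrable_scaleR_right integrable_shift G'i)
 then show ?thesis
 by (rule Bochner_Integration.integrable_bound)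
 (use B in \<open>auto simp: add.commute intro!: mult_right_mono order_trans[OF _ abs_ge_self]\<close>)
 qed
 \<comment> \<open>Since \<open>k n\<close> has integral 1, the gradient error is an average of
   increments \<open>G' (x + z) - G' x\<close> over small \<open>z\<close>.\<close>
 have D_eq: "D n x - G x = (BI z. k n z *. (G' (x + z) - G' x))" if x: "x \<in> K" for n x
 proof -
 have sh: "C1 (%y. k n (y - x)) (%y. Dk n (y - x))" by (rule C1_shift[OF k(1)])
 have cl: "closure {y. k n (y - x) ~= 0} \<subseteq> cball x (r n)"
 by (rule closure_minimal) (use k(3)[of n] in \<open>force simp: dist_norm norm_minus_commute\<close>)+
 have "test_function Om (%y. k n (y - x)) (%y. Dk n (y - x))"
 unfolding test_function_def
 proof (intro conjI allI)
 show "closure {y. k n (y - x) ~= 0} \<subseteq> Om"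
 using cl e0(2) x r(2)[of n] by (force simp: subset_iff)
 show "compact (closure {y. k n (y - x) ~= 0})"
 using cl bounded_subset[OF bounded_cball] by (auto simp: compact_eq_bounded_closed)
 qed (use sh in \<open>auto simp: C1_def\<close>)
 from weak[OF this]
 have w: "(BI y. (indicator Om y * u y) *. Dk n (y - x)) = - (BI y. k n (y - x) *. (indicator Om y *. G y))" .
 have "D n x = - (BI y. u' y *. Dk n (y - x))"
 unfolding D_def swap(2)[of n x] by simp
 also have "(BI y. u' y *. Dk n (y - x)) = (BI y. (indicator Om y * u y) *. Dk n (y - x))"
 proof (intro Bochner_Integration.integral_cong refl)
 fix y
 show "u' y *. Dk n (y - x) = (indicator Om y * u y) *. Dk n (y - x)"
 using inK'[OF x, of y n] K'Om k(4)[of n "y - x"] by (cases "norm (y - x) < r n") (auto simp: u'_def)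
 qed
 also have "... = - (BI y. k n (y - x) *. (indicator Om y *. G y))" by (rule w)
 also have "(BI y. k n (y - x) *. (indicator Om y *. G y)) = (BI y. k n (y - x) *. G' y)"
 proof (intro Bochner_Integration.integral_cong refl)
 fix y
 show "k n (y - x) *. (indicator Om y *. G y) = k n (y - x) *. G' y"
 using inK'[OF x, of y n] K'Om k(3)[of n "y - x"] by (cases "norm (y - x) < r n") (auto simp: G'_def)
 qed
 also have "... = (BI z. k n z *. G' (x + z))"
 using integral_shift[of "%y. k n (y - x) *. G' y" x] by (simp add: add.commute)
 finally have "D n x = (BI z. k n z *. G' (x + z))" by simp
 moreover have "G x = (BI z. k n z *. G' x)"
 using k(8)[of n] k(7)[of n] KK' x by (auto simp: G'_def)
 moreover have "(BI z. k n z *. (G' (x + z) - G' x)) = (BI z. k n z *. G' (x + z)) - (BI z. k n z *. G' x)"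
 using kGi k(7) by (simp add: scaleR_diff_right)
 ultimately show ?thesis by simp
 qed
 have "(%n. L2sq K (%x. D n x - G x)) ~~> 0"
 proof (rule order_tendstoI)
 fix a :: ennreal assume "0 < a"
 then obtain e where e: "0 < e" "ennreal e < a"
 using ennreal_pos_dense by blast
 obtain d where d: "d > 0" "!!z. norm z < d ==> L2sq UNIV (%x. G' (x + z) - G' x) <= ennreal e"
 using L2_translation_continuous[of G' e K'] e(1) K'c KK' False G'z G'fin by auto
 have "EV n. r n < d" using order_tendstoD(2)[OF r0 d(1)] .
 then show "EV n. L2sq K (%x. D n x - G x) < a"
 proof eventually_elim
 case (elim n)
 have "L2sq K (%x. D n x - G x) = L2sq K (%x. \<integral>z. k n z *. (G' (x + z) - G' x) \<partial>lborel)"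
 unfolding L2sq_def using D_eq by (intro nn_integral_cong) (auto split: split_indicator)
 also have "... <= L2sq UNIV (%x. \<integral>z. k n z *. (G' (x + z) - G' x) \<partial>lborel)"
 by (rule L2sq_mono) simp
 also have "... <= ennreal e"
 by (rule L2_mollify[OF k(7) k(2) k(8) k(3)]) (use elim in \<open>auto intro!: d(2)\<close>)
 finally show ?case using e(2) by simp
 qed
 qed simp
 moreover have "uniform_limit K f u sequentially"
 proof (rule uniform_limitI)
 fix e :: real assume e: "0 < e"
 have "uniformly_continuous_on K' u"
 by (intro compact_uniformly_continuous continuous_on_subset[OF u K'Om] K'c)
 then obtain d where d: "d > 0" "!!x x'. x \<in> K' ==> x' \<in> K' ==> dist x' x < d ==> dist (u x') (u x) < e / 2"
 using half_gt_zero[OF e] unfolding uniformly_continuous_on_def by metis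
 have "EV n. r n < d" using order_tendstoD(2)[OF r0 d(1)] .
 then show "EV n. \<forall>x\<in>K. dist (f n x) (u x) < e"
 proof (eventually_elim, intro ballI)
 fix n x assume n: "r n < d" and x: "x \<in> K"
 have 1: "f n x = (BI z. k n z * u' (x + z))"
 unfolding f_def swap(1)[of n x] using integral_shift[of "%y. u' y * k n (y - x)" x] by (simp add: add.commute mult.commute)
 obtain B where B: "!!z. \<bar>k n z\<bar> <= B" using kbd by blast
 have i: "integrable lborel (%z. k n z * u' (x + z))"
 proof -
 have "integrable lborel (%z. B * u' (z + x))" by (intro integrable_mult_right integrable_shift u'i)
 then show ?thesis
 by (rule Bochner_Integration.integrable_bound)
 (auto simp: add.commute abs_mult intro!: AE_I2 mult_right_mono order_trans[OF B abs_ge_self])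
 qed
 have "f n x - u x = (BI z. k n z * u' (x + z) - k n z * u x)"
 using 1 i k(7)[of n] k(8)[of n] by simp
 also have "norm ... <= (BI z. norm (k n z * u' (x + z) - k n z * u x))"
 by (rule integral_norm_bound)
 also have "... <= (BI z. k n z * (e / 2))"
 proof (rule integral_mono)
 fix z
 show "norm (k n z * u' (x + z) - k n z * u x) <= k n z * (e / 2)"
 proof (cases "norm z < r n")
 case True
 then have "x + z \<in> K'" using inK'[OF x, of "x + z" n] by simp
 then have "dist (u (x + z)) (u x) < e / 2" using True n x KK' by (intro d) (auto simp: dist_norm)
 moreover have "norm (k n z * u' (x + z) - k n z * u x) = k n z * dist (u (x + z)) (u x)"
 using \<open>x + z \<in> K'\<close> k(2)[of n z] by (simp add: u'_def dist_real_def abs_mult flip: right_diff_distrib)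
 ultimately show ?thesis using mult_left_mono[of "dist (u (x + z)) (u x)" "e / 2" "k n z"] k(2)[of n z] by linarith
 qed (use k(3)[of n z] in simp)
 qed (use i k(7)[of n] in auto)
 also have "... = e / 2" using k(8)[of n] by simp
 finally show "dist (f n x) (u x) < e" using e by (simp add: dist_real_def)
 qed
 qed
 ultimately show ?thesis using C1 by blast
 qed
qed (use u G in auto)

lemma sob_L2_finite:
 assumes "sob Om u G" "compact K" "K \<subseteq> Om"
 shows "L2sq K G < \<infinity>"
proof -
 obtain f D where fD: "!!n. C1 (f n) (D n)" "(%n::nat. L2sq K (%x. D n x - G x)) ~~> 0"
 using assms unfolding sob_def by blast
 have [measurable]: "G \<in> bm" "K \<in> sets borel" using assms by (auto simp: sob_def borel_compact)
 have "EV n. L2sq K (%x. D n x - G x) < 1"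
 using order_tendstoD(2)[OF fD(2), of 1] by simp
 then obtain n where n: "L2sq K (%x. D n x - G x) < 1" by (auto simp: eventually_sequentially)
 note [measurable] = C1_measurable[OF fD(1)[of n]]
 have "L2sq K (D n) < \<infinity>"
 proof -
 have "bounded (D n ` K)"
 by (intro compact_imp_bounded compact_continuous_image continuous_on_subset[OF C1_cont_D[OF fD(1)]] assms) auto
 then obtain B where B: "!!x. x \<in> K ==> norm (D n x) <= B" by (auto simp: bounded_iff)
 have "L2sq K (D n) <= (NI x. ennreal (B^2) * indicator K x)"
 unfolding L2sq_def using B by (intro nn_integral_mono) (auto split: split_indicator intro!: ennreal_leI power_mono)
 also have "... < \<infinity>" using emeasure_compact_finite[OF assms(2)] by (simp add: nn_integral_cmult_indicator ennreal_mult_less_top)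
 finally show ?thesis .
 qed
 have "L2sq K G = L2sq K (%x. D n x + (-1) *. (D n x - G x))" by (simp add: L2sq_def)
 also have "... <= 2 * L2sq K (D n) + 2 * L2sq K (%x. (-1) *. (D n x - G x))" by (rule L2sq_add) auto
 also have "L2sq K (%x. (-1) *. (D n x - G x)) = L2sq K (%x. D n x - G x)" unfolding L2sq_def by (simp only: norm_scaleR) simp
 also have "2 * L2sq K (D n) + 2 * L2sq K (%x. D n x - G x) < \<infinity>"
 using n \<open>L2sq K (D n) < \<infinity>\<close> by (simp add: ennreal_mult_less_top less_trans[OF n])
 finally show ?thesis .
qed

lemma L2sq_tendsto_add:
 assumes [measurable]: "!!n. V n \<in> bm" "!!n. W n \<in> bm" "S \<in> sets borel"
 and "(%n. L2sq S (V n)) ~~> 0" "(%n. L2sq S (W n)) ~~> 0"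
 shows "(%n. L2sq S (%x. V n x + W n x)) ~~> 0"
proof -
 have "(%n. 2 * L2sq S (V n) + 2 * L2sq S (W n)) ~~> 2 * 0 + 2 * 0"
 by (intro tendsto_add ennreal_tendsto_cmult assms) auto
 then have l: "(%n. 2 * L2sq S (V n) + 2 * L2sq S (W n)) ~~> 0" by simp
 show ?thesis
 by (rule tendsto_sandwich[OF _ _ tendsto_const l]) (auto intro!: always_eventually L2sq_add)
qed

lemma L2sq_scale_le:
 assumes [measurable]: "V \<in> bm" "S \<in> sets borel" and "!!x. x \<in> S ==> \<bar>a x\<bar> <= M"
 shows "L2sq S (%x. a x *. V x) <= ennreal (M^2) * L2sq S V"
proof -
 have "L2sq S (%x. a x *. V x) <= (NI x. ennreal (M^2) * (ie S x ((norm (V x))^2)))"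
 unfolding L2sq_def
 proof (intro nn_integral_mono)
 fix x
 show "ie S x ((norm (a x *. V x))^2) <= ennreal (M^2) * (ie S x ((norm (V x))^2))"
 proof (cases "x \<in> S")
 case True
 have "(a x)^2 <= M^2" using assms(3)[OF True] by (metis abs_ge_zero power2_abs power_mono)
 then show ?thesis using True
 by (simp add: power_mult_distrib mult_right_mono ennreal_leI flip: ennreal_mult)
 qed simp
 qed
 also have "... = ennreal (M^2) * L2sq S V" by (simp add: L2sq_def nn_integral_cmult)
 finally show ?thesis .
qed

lemma L2sq_tendsto_bounded_scale:
 assumes [measurable]: "!!n. V n \<in> bm" "S \<in> sets borel" 
 and "EV n. \<forall>x\<in>S. \<bar>a n x\<bar> <= M" and "(%n. L2sq S (V n)) ~~> 0"
 shows "(%n. L2sq S (%x. a n x *. V n x)) ~~> 0"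
proof -
 have "(%n. ennreal (M^2) * L2sq S (V n)) ~~> ennreal (M^2) * 0"
 by (intro ennreal_tendsto_cmult assms) auto
 then have l: "(%n. ennreal (M^2) * L2sq S (V n)) ~~> 0" by simp
 show ?thesis
 proof (rule tendsto_sandwich[OF _ _ tendsto_const l])
 show "EV n. L2sq S (%x. a n x *. V n x) <= ennreal (M^2) * L2sq S (V n)"
 using assms(3) by eventually_elim (auto intro!: L2sq_scale_le)
 qed simp
qed

lemma L2sq_tendsto_uniform_scale:
 assumes [measurable]: "V \<in> bm" "S \<in> sets borel" 
 and "uniform_limit S a (%_. 0::real) sequentially" and fin: "L2sq S V < \<infinity>"
 shows "(%n. L2sq S (%x. a n x *. V x)) ~~> 0"
proof (rule order_tendstoI)
 fix e :: ennreal assume "0 < e"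
 define v where "v = enn2real (L2sq S V)"
 have v: "L2sq S V = ennreal v" "0 <= v" using fin by (auto simp: v_def)
 obtain e' where e': "0 < e'" "ennreal e' < e"
 using ennreal_pos_dense[OF \<open>0 < e\<close>] by blast
 define M where "M = sqrt (e' / (v + 1))"
 have M: "0 < M" "M^2 * v <= e'" using div_Suc_bound[OF e'(1) v(2)] by (auto simp: M_def)
 have "EV n. \<forall>x\<in>S. dist (a n x) 0 < M"
 using assms(3) M(1) by (rule uniform_limitD)
 then show "EV n. L2sq S (%x. a n x *. V x) < e"
 proof eventually_elim
 case (elim n)
 have "L2sq S (%x. a n x *. V x) <= ennreal (M^2) * L2sq S V"
 by (rule L2sq_scale_le) (use elim in force)+
 also have "... = ennreal (M^2 * v)" by (simp add: v ennreal_mult)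
 also have "... <= ennreal e'" using M by (intro ennreal_leI)
 finally show ?case using e' by simp
 qed
qed simp

lemma C1_locally_const:
 assumes "C1 f D" "open U" "x \<in> U" "!!y. y \<in> U ==> f y = c"
 shows "D x = 0"
proof -
 have "(f has_derivative (%h. h \<bullet> D x)) (at x)" using C1_D[OF assms(1)] by (simp add: gderiv_def)
 moreover have "(f has_derivative (%h. 0)) (at x)"
 by (rule has_derivative_transform_within_open[OF has_derivative_const[of c] assms(2,3)]) (simp add: assms(4))
 ultimately have "(%h. h \<bullet> D x) = (%h. 0)" by (rule has_derivative_unique)
 then have "D x \<bullet> D x = 0" by meson
 then show ?thesis by simp
qed

subsection \<open>Nash and Poincare inequalities\<close>

text \<open>Mollify the indicator of the \<open>2 d\<close>-neighbourhood of \<open>C\<close> at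
  scale \<open>d\<close>: the result is 1 on the \<open>d\<close>-neighbourhood and 0 off the
  \<open>3 d\<close>-neighbourhood. It is constant on an open set around \<open>C\<close>, so its
  gradient vanishes on \<open>C\<close>, and likewise off \<open>L\<close>.\<close>

lemma cutoff_exists:
 fixes C V :: "'a::euclidean_space set"
 assumes "compact C" "open V" "C \<subseteq> V"
 obtains ch E L where "C1 ch E" "!!x. 0 <= ch x" "!!x. ch x <= 1" "!!x. x \<in> C ==> ch x = 1" "!!x. x \<in> C ==> E x = 0"
 "compact L" "L \<subseteq> V" "!!x. x ~: L ==> ch x = 0" "!!x. x ~: L ==> E x = 0"
proof -
 obtain e where e: "0 < e" "(\<Union>x\<in>C. cball x e) \<subseteq> V"
 using compact_subset_open_imp_cball_epsilon_subset[of C V] assms by blast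
 define d where "d = e / 3"
 have d: "d > 0" using e by (simp add: d_def)
 define C2 where "C2 = (\<Union>x\<in>C. cball x (2 * d))"
 define L where "L = (\<Union>x\<in>C. cball x (3 * d))"
 have cp: "compact C2" "compact L" unfolding C2_def L_def by (auto intro!: compact_minkowski_sum_cball assms)
 have LV: "L \<subseteq> V" using e by (simp add: L_def d_def)
 obtain k :: "'a => real" and Dk where "mollifier d k Dk" using mollifier_exists[OF d] by blast
 note k = mollifierD[OF this]
 have [measurable]: "C2 \<in> sets borel" using cp by (simp add: borel_compact)
 note [measurable] = C1_measurable[OF k(1)]
 define u :: "'a => real" where "u = indicator C2"
 have ui: "integrable lborel u" unfolding u_def
 using emeasure_compact_finite[OF cp(1)] by (intro integrable_real_indicator) auto
 obtain \<rho> where \<rho>: "!!y. y \<in> C2 ==> norm y <= \<rho>" using compact_imp_bounded[OF cp(1)] by (auto simp: bounded_iff)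
 define ch where "ch x = (BI y. u y * k (x - y))" for x
 define E where "E x = (BI y. u y *. Dk (x - y))" for x
 have C: "C1 ch E"
 unfolding ch_def[abs_def] E_def[abs_def]
 proof (rule C1_convolution[OF k(1) ui, of "max 0 \<rho>"])
 show "u y = 0" if "max 0 \<rho> < norm y" for y
 using \<rho>[of y] that by (auto simp: u_def indicator_def)
 qed simp
 have ch: "ch x = (BI z. u (x + z) * k z)" for x
 proof -
 have "ch x = (BI y. u y * k (y - x))" unfolding ch_def using k(5)[of "x - y" for y] by simp
 also have "... = (BI z. u (x + z) * k z)"
 using integral_shift[of "%y. u y * k (y - x)" x] by (simp add: u_def add.commute)
 finally show ?thesis .
 qed
 have ik: "integrable lborel (%z. u (x + z) * k z)" for x
 by (rule Bochner_Integration.integrable_bound[OF k(7)]) (auto simp: u_def indicator_def)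
 have le1: "ch x <= 1" for x
 unfolding ch k(8)[symmetric] by (rule integral_mono[OF ik k(7)]) (auto simp: u_def indicator_def k(2))
 have ge0: "0 <= ch x" for x
 unfolding ch by (rule Bochner_Integration.integral_nonneg) (auto simp: u_def indicator_def k(2))
 have one: "ch x = 1" if "x \<in> (\<Union>c\<in>C. ball c d)" for x
 proof -
 obtain c where c: "c \<in> C" "dist c x < d" using \<open>x \<in> (\<Union>c\<in>C. ball c d)\<close> by auto
 have "u (x + z) * k z = k z" for z
 proof (cases "norm z < d")
 case True
 then have "dist c (x + z) <= 2 * d" using c dist_triangle[of c "x + z" x] by (simp add: dist_norm)
 then show ?thesis using c by (auto simp: u_def C2_def indicator_def)
 qed (use k(3)[of z] in auto)
 then have "(%z. u (x + z) * k z) = k" by auto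
 then show ?thesis unfolding ch by (simp add: k(8))
 qed
 have zero: "ch x = 0" if "x ~: L" for x
 proof -
 have "u (x + z) * k z = 0" for z
 proof (cases "norm z < d")
 case True
 have "x + z ~: C2"
 proof
 assume "x + z \<in> C2"
 then obtain c where c: "c \<in> C" "dist c (x + z) <= 2 * d" by (auto simp: C2_def)
 then have "dist c x <= 3 * d" using True dist_triangle[of c x "x + z"] by (simp add: dist_norm)
 then show False using \<open>x ~: L\<close> c by (auto simp: L_def)
 qed
 then show ?thesis by (simp add: u_def)
 qed (use k(3)[of z] in auto)
 then have "(%z. u (x + z) * k z) = (%z. 0)" by auto
 then show ?thesis unfolding ch by simp
 qed
 show ?thesis
 proof
 have inC: "x \<in> (\<Union>c\<in>C. ball c d)" if "x \<in> C" for x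
 by (rule UN_I[OF that]) (use d in simp)
 show "E x = 0" if "x \<in> C" for x
 by (rule C1_locally_const[OF C _ inC[OF that] one]) auto
 show "E x = 0" if "x ~: L" for x
 by (rule C1_locally_const[OF C, of "- L" _ 0]) (use that zero compact_imp_closed[OF cp(2)] in auto)
 show "ch x = 1" if "x \<in> C" for x by (rule one[OF inC[OF that]])
 qed (use C cp LV ge0 le1 zero in auto)
qed

text \<open>The compactly supported companion of \<open>sob\<close>: the approximants vanish off the
  same compact \<open>L\<close>, so they may be inserted in the weak equation when \<open>L\<close>
  lies in the domain.\<close>

definition sob0 :: "'a::euclidean_space set => ('a => real) => ('a => 'a) => bool" where
 "sob0 L Z H \<longleftrightarrow> compact L & Z \<in> bm & H \<in> bm &
 (\<forall>x. x ~: L --> Z x = 0 & H x = 0) &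
 (\<exists>g D. (\<forall>n::nat. C1 (g n) (D n)) & (\<forall>n x. x ~: L --> g n x = 0 & D n x = 0) &
 uniform_limit UNIV g Z sequentially & (%n. L2sq UNIV (%x. D n x - H x)) ~~> 0)"

lemma sob0_D:
 assumes "sob0 L Z H"
 shows "compact L" "Z \<in> bm" "H \<in> bm" "!!x. x ~: L ==> Z x = 0" "!!x. x ~: L ==> H x = 0"
 using assms by (auto simp: sob0_def)

lemma sob0_L2_finite:
 assumes "sob0 L Z H"
 shows "L2sq UNIV H < \<infinity>"
proof -
 obtain g D where g: "!!n::nat. C1 (g n) (D n)" "!!n x. x ~: L ==> D n x = 0" "(%n. L2sq UNIV (%x. D n x - H x)) ~~> 0"
 using assms unfolding sob0_def by blast
 have cL: "compact L" and [measurable]: "H \<in> bm" using sob0_D[OF assms] by auto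
 have "EV n. L2sq UNIV (%x. D n x - H x) < 1"
 using order_tendstoD(2)[OF g(3), of 1] by simp
 then obtain n where n: "L2sq UNIV (%x. D n x - H x) < 1" by (auto simp: eventually_sequentially)
 note [measurable] = C1_measurable[OF g(1)[of n]]
 have "bounded (D n ` L)"
 by (intro compact_imp_bounded compact_continuous_image continuous_on_subset[OF C1_cont_D[OF g(1)]] cL) auto
 then obtain B where B: "!!x. x \<in> L ==> norm (D n x) <= B" by (auto simp: bounded_iff)
 have [measurable]: "L \<in> sets borel" using cL by (simp add: borel_compact)
 have "L2sq UNIV (D n) <= (NI x. ennreal (B^2) * indicator L x)"
 unfolding L2sq_def using B g(2) by (intro nn_integral_mono) (auto split: split_indicator intro!: ennreal_leI power_mono)
 also have "... < \<infinity>" using emeasure_compact_finite[OF cL] by (simp add: nn_integral_cmult_indicator ennreal_mult_less_top)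
 finally have 1: "L2sq UNIV (D n) < \<infinity>" .
 have "L2sq UNIV H = L2sq UNIV (%x. D n x + (-1) *. (D n x - H x))" by (simp add: L2sq_def)
 also have "... <= 2 * L2sq UNIV (D n) + 2 * L2sq UNIV (%x. (-1) *. (D n x - H x))" by (rule L2sq_add) auto
 also have "L2sq UNIV (%x. (-1) *. (D n x - H x)) = L2sq UNIV (%x. D n x - H x)" unfolding L2sq_def by (simp only: norm_scaleR) simp
 also have "2 * L2sq UNIV (D n) + 2 * L2sq UNIV (%x. D n x - H x) < \<infinity>"
 using 1 by (simp add: ennreal_mult_less_top less_trans[OF n])
 finally show ?thesis .
qed

text \<open>A Nash inequality with a free radius. In
  \<open>f(x)^2 + f(x+h)^2 = (f(x+h) - f(x))^2 + 2 f(x) f(x+h)\<close>, integrate over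
  \<open>x\<close> and over \<open>h\<close> in a ball: the square is controlled by translation
  energy, the product by the square of the L1 norm. It takes the place of the Sobolev embedding and
  has the same form in every dimension.\<close>

lemma C1_nash:
 fixes f :: "'a::euclidean_space => real"
 assumes f: "C1 f D" and "0 < r"
 shows "2 * emeasure lborel (ball (0::'a) r) * (NI x. ennreal ((f x)^2))
 <= emeasure lborel (ball (0::'a) r) * ennreal (r^2) * L2sq UNIV D + 2 * (NI x. ennreal \<bar>f x\<bar>)^2"
proof -
 note [measurable] = C1_measurable[OF f]
 have [measurable]: "ball (0::'a) r \<in> sets borel" by simp
 let ?B = "ball (0::'a) r" and ?I = "\<integral>\<^sup>+x. ennreal ((f x)^2) \<partial>lborel" and ?J = "\<integral>\<^sup>+x. ennreal \<bar>f x\<bar> \<partial>lborel"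
 have "2 * emeasure lborel ?B * ?I = (NI h. (2 * ?I) * indicator ?B h)"
 by (subst nn_integral_cmult_indicator) (auto simp: mult_ac)
 also have "... <= (NI h. ennreal (r^2) * L2sq UNIV D * indicator ?B h + (NI x. ennreal (2 * \<bar>f x\<bar>) * ennreal \<bar>f (x + h)\<bar>))"
 proof (intro nn_integral_mono)
 fix h :: 'a
 show "(2 * ?I) * indicator ?B h <= ennreal (r^2) * L2sq UNIV D * indicator ?B h + (NI x. ennreal (2 * \<bar>f x\<bar>) * ennreal \<bar>f (x + h)\<bar>)"
 proof (cases "h \<in> ?B")
 case True
 have "2 * ?I = ?I + (NI x. ennreal ((f (x + h))^2))"
 using nn_integral_shift[of "%x. ennreal ((f x)^2)" h] by (simp add: mult_2)
 also have "... = (NI x. ennreal ((f x)^2) + ennreal ((f (x + h))^2))"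
 by (simp add: nn_integral_add)
 also have "... <= (NI x. indicator UNIV x * indicator UNIV (x + h) * ennreal ((f (x + h) - f x)^2) + ennreal (2 * \<bar>f x\<bar>) * ennreal \<bar>f (x + h)\<bar>)"
 proof (intro nn_integral_mono)
 fix x
 have "(f x)^2 + (f (x + h))^2 = (f (x + h) - f x)^2 + 2 * (f x * f (x + h))"
 by (simp add: power2_eq_square algebra_simps)
 also have "f x * f (x + h) <= \<bar>f x\<bar> * \<bar>f (x + h)\<bar>" by (metis abs_ge_self abs_mult)
 finally have "(f x)^2 + (f (x + h))^2 <= (f (x + h) - f x)^2 + 2 * \<bar>f x\<bar> * \<bar>f (x + h)\<bar>" by simp
 then have "ennreal ((f x)^2 + (f (x + h))^2) <= ennreal ((f (x + h) - f x)^2 + 2 * \<bar>f x\<bar> * \<bar>f (x + h)\<bar>)"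
 by (intro ennreal_leI)
 then show "ennreal ((f x)^2) + ennreal ((f (x + h))^2) <= indicator UNIV x * indicator UNIV (x + h) * ennreal ((f (x + h) - f x)^2) + ennreal (2 * \<bar>f x\<bar>) * ennreal \<bar>f (x + h)\<bar>"
 by (simp add: ennreal_plus flip: ennreal_mult)
 qed
 also have "... = (NI x. indicator UNIV x * indicator UNIV (x + h) * ennreal ((f (x + h) - f x)^2)) + (NI x. ennreal (2 * \<bar>f x\<bar>) * ennreal \<bar>f (x + h)\<bar>)"
 by (intro nn_integral_add) auto
 also have "(NI x. indicator UNIV x * indicator UNIV (x + h) * ennreal ((f (x + h) - f x)^2)) <= ennreal ((norm h)^2) * L2sq UNIV D"
 using translation_energy[OF f convex_UNIV, of h] by (simp add: L2sq_def)
 also have "... <= ennreal (r^2) * L2sq UNIV D"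
 using True by (intro mult_right_mono ennreal_leI power_mono) auto
 finally show ?thesis using True by (simp add: add_right_mono)
 qed simp
 qed
 also have "... = (NI h. ennreal (r^2) * L2sq UNIV D * indicator ?B h) + (NI h. \<integral>\<^sup>+x. ennreal (2 * \<bar>f x\<bar>) * ennreal \<bar>f (x + h)\<bar> \<partial>lborel)"
 by (rule nn_integral_add) measurable
 also have "(NI h. ennreal (r^2) * L2sq UNIV D * indicator ?B h) = emeasure lborel ?B * ennreal (r^2) * L2sq UNIV D"
 by (subst nn_integral_cmult_indicator) (auto simp: mult_ac)
 also have "(NI h. \<integral>\<^sup>+x. ennreal (2 * \<bar>f x\<bar>) * ennreal \<bar>f (x + h)\<bar> \<partial>lborel) = (NI x. \<integral>\<^sup>+h. ennreal (2 * \<bar>f x\<bar>) * ennreal \<bar>f (x + h)\<bar> \<partial>lborel)"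
 by (rule lborel_pair.Fubini') measurable
 also have "... = (NI x. (2 * ?J) * ennreal \<bar>f x\<bar>)"
 proof (rule nn_integral_cong)
 fix x
 have "(NI h. ennreal \<bar>f (x + h)\<bar>) = ?J"
 using nn_integral_shift[of "%x. ennreal \<bar>f x\<bar>" x] by (simp add: add.commute)
 then show "(NI h. ennreal (2 * \<bar>f x\<bar>) * ennreal \<bar>f (x + h)\<bar>) = (2 * ?J) * ennreal \<bar>f x\<bar>"
 by (simp add: nn_integral_cmult ennreal_mult mult.commute mult.left_commute)
 qed
 also have "... = 2 * ?J^2" by (simp add: nn_integral_cmult power2_eq_square mult.assoc)
 finally show ?thesis .
qed

lemma liminf_tendsto_bound:
 fixes a b :: "nat => ennreal"
 assumes "x <= liminf a" "!!n. a n <= b n" "b ~~> c"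
 shows "x <= c"
proof -
 have "liminf a <= liminf b" using assms(2) by (intro Liminf_mono always_eventually) auto
 also have "liminf b = c" using assms(3) lim_imp_Liminf by force
 finally show ?thesis using assms(1) by simp
qed

lemma uniform_limit_imp_tendsto:
 assumes "uniform_limit S f g F" "x \<in> S"
 shows "((%n. f n x) \<longlongrightarrow> g x) F"
 using tendsto_uniform_limitI[OF assms] .

text \<open>Fatou for the left side; the L1 norm of the approximants is controlled by uniform
  convergence on the bounded support, up to \<open>e * l\<close>. Passing from \<open>D n\<close> to
  \<open>H\<close> costs a factor 2, which is why the C1 version is kept with its better constant: a
  common factor 2 cancels at the end.\<close>

lemma sob0_nash:
 fixes Z :: "'a::euclidean_space => real"
 assumes Z: "sob0 L Z H" and r: "0 < r"
 shows "emeasure lborel (ball (0::'a) r) * (NI x. ennreal ((Z x)^2))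
 <= emeasure lborel (ball (0::'a) r) * ennreal (r^2) * L2sq UNIV H + (NI x. ennreal \<bar>Z x\<bar>)^2"
proof (cases "(NI x. ennreal \<bar>Z x\<bar>) = \<infinity>")
 case True
 then show ?thesis by (simp add: power2_eq_square ennreal_top_mult)
next
 case False
 obtain g D where g: "!!n::nat. C1 (g n) (D n)" "!!n x. x ~: L ==> g n x = 0" "!!n x. x ~: L ==> D n x = 0"
 "uniform_limit UNIV g Z sequentially" "(%n. L2sq UNIV (%x. D n x - H x)) ~~> 0"
 using Z unfolding sob0_def by blast
 have cL: "compact L" and [measurable]: "H \<in> bm" "Z \<in> bm" using sob0_D[OF Z] by auto
 have [measurable]: "L \<in> sets borel" using cL by (simp add: borel_compact)
 note [measurable] = C1_measurable[OF g(1)]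
 let ?B = "ball (0::'a) r"
 define m where "m = emeasure lborel ?B"
 have m: "m < \<infinity>" unfolding m_def by (rule emeasure_lborel_ball_finite)
 define j where "j = enn2real (NI x. ennreal \<bar>Z x\<bar>)"
 have j: "(NI x. ennreal \<bar>Z x\<bar>) = ennreal j" "0 <= j" using False by (auto simp: j_def less_top)
 define l where "l = measure lborel L"
 have l: "emeasure lborel L = ennreal l" "0 <= l"
 using emeasure_compact_finite[OF cL] by (auto simp: l_def emeasure_eq_ennreal_measure)
 have key: "2 * m * (NI x. ennreal ((Z x)^2)) <= m * ennreal (r^2) * (2 * L2sq UNIV H) + 2 * ennreal ((j + e * l)^2)"
 if e: "0 < e" for e
 proof -
 have "EV n. \<forall>x\<in>UNIV. dist (g n x) (Z x) < e" using g(4) e by (rule uniform_limitD)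
 then obtain N where N: "!!n x. N <= n ==> \<bar>g n x - Z x\<bar> < e" by (auto simp: eventually_sequentially dist_real_def)
 have 1: "(NI x. ennreal \<bar>g n x\<bar>) <= ennreal (j + e * l)" if n: "N <= n" for n
 proof -
 have "(NI x. ennreal \<bar>g n x\<bar>) <= (NI x. ennreal \<bar>Z x\<bar> + ennreal e * indicator L x)"
 proof (intro nn_integral_mono)
 fix x
 show "ennreal \<bar>g n x\<bar> <= ennreal \<bar>Z x\<bar> + ennreal e * indicator L x"
 proof (cases "x \<in> L")
 case True
 have "\<bar>g n x\<bar> <= \<bar>Z x\<bar> + e" using N[OF n, of x] by linarith
 then show ?thesis using True e by (simp flip: ennreal_plus)
 qed (use g(2) in auto)
 qed
 also have "... = ennreal j + ennreal e * ennreal l"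
 by (simp add: nn_integral_add nn_integral_cmult_indicator j l)
 also have "... = ennreal (j + e * l)" using e j l by (simp flip: ennreal_mult)
 finally show ?thesis .
 qed
 show ?thesis
 proof (rule liminf_tendsto_bound)
 show "2 * m * (NI x. ennreal ((Z x)^2)) <= liminf (%n. 2 * m * (NI x. ennreal ((g (n + N) x)^2)))"
 proof -
 have lim: "(%n. ennreal ((g (n + N) x)^2)) ~~> ennreal ((Z x)^2)" for x
 by (intro tendsto_ennrealI tendsto_intros LIMSEQ_ignore_initial_segment uniform_limit_imp_tendsto[OF g(4)]) simp
 have "2 * m * (NI x. ennreal ((Z x)^2)) = (NI x. liminf (%n. 2 * m * ennreal ((g (n + N) x)^2)))"
 proof -
 have "liminf (%n. 2 * m * ennreal ((g (n + N) x)^2)) = 2 * m * ennreal ((Z x)^2)" for x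
 by (intro lim_imp_Liminf ennreal_tendsto_cmult lim) (use m in \<open>auto simp: ennreal_mult_less_top\<close>)
 then show ?thesis by (simp add: nn_integral_cmult)
 qed
 also have "... <= liminf (%n. \<integral>\<^sup>+x. 2 * m * ennreal ((g (n + N) x)^2) \<partial>lborel)"
 by (rule nn_integral_liminf) auto
 finally show ?thesis by (simp add: nn_integral_cmult)
 qed
 show "2 * m * (NI x. ennreal ((g (n + N) x)^2)) <= m * ennreal (r^2) * (2 * L2sq UNIV H + 2 * L2sq UNIV (%x. D (n + N) x - H x)) + 2 * ennreal ((j + e * l)^2)" for n
 proof -
 have "L2sq UNIV (D (n + N)) = L2sq UNIV (%x. H x + (D (n + N) x - H x))" by (simp add: L2sq_def)
 also have "... <= 2 * L2sq UNIV H + 2 * L2sq UNIV (%x. D (n + N) x - H x)" by (rule L2sq_add) auto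
 finally have a: "L2sq UNIV (D (n + N)) <= 2 * L2sq UNIV H + 2 * L2sq UNIV (%x. D (n + N) x - H x)" .
 have b: "(NI x. ennreal \<bar>g (n + N) x\<bar>)^2 <= ennreal ((j + e * l)^2)"
 proof -
 have "(NI x. ennreal \<bar>g (n + N) x\<bar>)^2 <= (ennreal (j + e * l))^2"
 by (intro power_mono 1) auto
 also have "... = ennreal ((j + e * l)^2)" using j l e by (intro ennreal_power) auto
 finally show ?thesis .
 qed
 show ?thesis
 unfolding m_def by (rule order_trans[OF C1_nash[OF g(1) r] add_mono[OF mult_left_mono[OF a] mult_left_mono[OF b]]]) auto
 qed
 have "(%n. m * ennreal (r^2) * (2 * L2sq UNIV H + 2 * L2sq UNIV (%x. D (n + N) x - H x)) + 2 * ennreal ((j + e * l)^2)) ~~>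
 m * ennreal (r^2) * (2 * L2sq UNIV H + 2 * 0) + 2 * ennreal ((j + e * l)^2)"
 using m by (intro tendsto_add ennreal_tendsto_cmult tendsto_const LIMSEQ_ignore_initial_segment[OF g(5)]) (auto simp: ennreal_mult_less_top)
 then show "(%n. m * ennreal (r^2) * (2 * L2sq UNIV H + 2 * L2sq UNIV (%x. D (n + N) x - H x)) + 2 * ennreal ((j + e * l)^2)) ~~>
 m * ennreal (r^2) * (2 * L2sq UNIV H) + 2 * ennreal ((j + e * l)^2)" by simp
 qed
 qed
 have "2 * m * (NI x. ennreal ((Z x)^2)) <= m * ennreal (r^2) * (2 * L2sq UNIV H) + 2 * ennreal (j^2)"
 proof (rule LIMSEQ_le_const)
 have "(%n. ennreal ((j + inverse (real (Suc n)) * l)^2)) ~~> ennreal ((j + 0 * l)^2)"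
 by (intro tendsto_ennrealI tendsto_intros LIMSEQ_inverse_real_of_nat)
 then show "(%n. m * ennreal (r^2) * (2 * L2sq UNIV H) + 2 * ennreal ((j + inverse (real (Suc n)) * l)^2)) ~~> m * ennreal (r^2) * (2 * L2sq UNIV H) + 2 * ennreal (j^2)"
 by (intro tendsto_add tendsto_const ennreal_tendsto_cmult) auto
 qed (use key in auto)
 then have "2 * (m * (NI x. ennreal ((Z x)^2))) <= 2 * (m * ennreal (r^2) * L2sq UNIV H + ennreal (j^2))"
 by (simp add: distrib_left mult_ac)
 then have "m * (NI x. ennreal ((Z x)^2)) <= m * ennreal (r^2) * L2sq UNIV H + ennreal (j^2)"
 by (subst (asm) ennreal_mult_le_mult_iff) auto
 then show ?thesis by (simp add: m_def j ennreal_power)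
qed

text \<open>Where \<open>Z x = 0\<close>, the value \<open>Z y\<close> is the increment
  \<open>Z y - Z x\<close>. Integrating its square over \<open>x\<close> in the zero set and
  \<open>y = x + h\<close> in \<open>S\<close> leaves only \<open>h\<close> with
  \<open>norm h < d\<close>, each bounded by translation energy on the convex set. A large zero set
  thus replaces subtracting a mean.\<close>

lemma sob0_poincare:
 fixes Z :: "'a::euclidean_space => real"
 assumes Z: "sob0 L Z H" and S: "convex S" "S \<in> sets borel" and d: "!!x y. x \<in> S ==> y \<in> S ==> norm (x - y) < d" "0 < d"
 shows "emeasure lborel {x\<in>S. Z x = 0} * (NI x. ie S x ((Z x)^2))
 <= emeasure lborel (ball (0::'a) d) * ennreal (d^2) * (2 * L2sq S H)"
proof -
 obtain g D where g: "!!n::nat. C1 (g n) (D n)" 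
 "uniform_limit UNIV g Z sequentially" "(%n. L2sq UNIV (%x. D n x - H x)) ~~> 0"
 using Z unfolding sob0_def by blast
 have [measurable]: "H \<in> bm" "Z \<in> bm" "S \<in> sets borel" using sob0_D[OF Z] S by auto
 note [measurable] = C1_measurable[OF g(1)]
 have [measurable]: "ball (0::'a) d \<in> sets borel" by simp
 let ?B = "ball (0::'a) d"
 define m where "m = emeasure lborel ?B"
 have m: "m < \<infinity>" unfolding m_def by (rule emeasure_lborel_ball_finite)
 have [measurable]: "{x\<in>S. Z x = 0} \<in> sets borel" by measurable
 have glim: "(%n. g n x) ~~> Z x" for x by (rule uniform_limit_imp_tendsto[OF g(2)]) simp
 let ?q = "%f h x. indicator ?B h * (indicator S x * indicator S (x + h) * ennreal ((f (x + h) - f x)^2))"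
 have "emeasure lborel {x\<in>S. Z x = 0} * (NI x. ie S x ((Z x)^2)) =
 (NI x. indicator {x\<in>S. Z x = 0} x * (NI y. ie S y ((Z y)^2)))"
 by (simp add: nn_integral_multc)
 also have "... <= (NI x. \<integral>\<^sup>+h. ?q Z h x \<partial>lborel)"
 proof (intro nn_integral_mono)
 fix x
 show "indicator {x\<in>S. Z x = 0} x * (NI y. ie S y ((Z y)^2)) <= (NI h. ?q Z h x)"
 proof (cases "x \<in> S & Z x = 0")
 case True
 have "(NI y. ie S y ((Z y)^2)) = (NI h. indicator S (h + x) * ennreal ((Z (h + x))^2))"
 using nn_integral_shift[of "%y. ie S y ((Z y)^2)" x] by simp
 also have "... <= (NI h. ?q Z h x)"
 proof (intro nn_integral_mono)
 fix h
 show "indicator S (h + x) * ennreal ((Z (h + x))^2) <= ?q Z h x"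
 using True d(1)[of "h + x" x] by (auto simp: add.commute split: split_indicator)
 qed
 finally show ?thesis using True by simp
 qed auto
 qed
 also have "... = (NI h. \<integral>\<^sup>+x. ?q Z h x \<partial>lborel)"
 by (rule lborel_pair.Fubini'[symmetric]) measurable
 also have "... <= m * ennreal (d^2) * (2 * L2sq S H)"
 proof (rule liminf_tendsto_bound)
 have lim: "(%n. ?q (g n) h x) ~~> ?q Z h x" for h x
 by (intro ennreal_tendsto_cmult tendsto_ennrealI tendsto_intros glim) (auto split: split_indicator)
 have "(NI h. \<integral>\<^sup>+x. ?q Z h x \<partial>lborel) = (NI h. \<integral>\<^sup>+x. liminf (%n. ?q (g n) h x) \<partial>lborel)"
 using lim_imp_Liminf[OF _ lim] by simp
 also have "... <= (NI h. liminf (%n. \<integral>\<^sup>+x. ?q (g n) h x \<partial>lborel))"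
 by (intro nn_integral_mono nn_integral_liminf) auto
 also have "... <= liminf (%n. \<integral>\<^sup>+h. \<integral>\<^sup>+x. ?q (g n) h x \<partial>lborel \<partial>lborel)"
 by (intro nn_integral_liminf) measurable
 finally show "(NI h. \<integral>\<^sup>+x. ?q Z h x \<partial>lborel) <= liminf (%n. \<integral>\<^sup>+h. \<integral>\<^sup>+x. ?q (g n) h x \<partial>lborel \<partial>lborel)" .
 show "(NI h. \<integral>\<^sup>+x. ?q (g n) h x \<partial>lborel) <= m * ennreal (d^2) * (2 * L2sq S H + 2 * L2sq UNIV (%x. D n x - H x))" for n
 proof -
 have "L2sq S (D n) = L2sq S (%x. H x + (D n x - H x))" by (simp add: L2sq_def)
 also have "... <= 2 * L2sq S H + 2 * L2sq S (%x. D n x - H x)" by (rule L2sq_add) auto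
 also have "... <= 2 * L2sq S H + 2 * L2sq UNIV (%x. D n x - H x)" by (intro add_left_mono mult_left_mono L2sq_mono) auto
 finally have a: "L2sq S (D n) <= 2 * L2sq S H + 2 * L2sq UNIV (%x. D n x - H x)" .
 have "(NI h. \<integral>\<^sup>+x. ?q (g n) h x \<partial>lborel) <= (NI h. ennreal (d^2) * L2sq S (D n) * indicator ?B h)"
 proof (intro nn_integral_mono)
 fix h
 have "(NI x. ?q (g n) h x) = indicator ?B h * (NI x. indicator S x * indicator S (x + h) * ennreal ((g n (x + h) - g n x)^2))"
 by (rule nn_integral_cmult) measurable
 also have "... <= indicator ?B h * (ennreal ((norm h)^2) * L2sq S (D n))"
 using translation_energy[OF g(1)[of n] S, of h] by (intro mult_left_mono) (auto simp: L2sq_def)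
 also have "... <= ennreal (d^2) * L2sq S (D n) * indicator ?B h"
 by (auto split: split_indicator intro!: mult_right_mono ennreal_leI power_mono)
 finally show "(NI x. ?q (g n) h x) <= ennreal (d^2) * L2sq S (D n) * indicator ?B h" .
 qed
 also have "... = m * ennreal (d^2) * L2sq S (D n)"
 unfolding m_def by (subst nn_integral_cmult_indicator) (auto simp: mult_ac)
 also have "... <= m * ennreal (d^2) * (2 * L2sq S H + 2 * L2sq UNIV (%x. D n x - H x))"
 by (intro mult_left_mono a) simp
 finally show ?thesis .
 qed
 have "(%n. m * ennreal (d^2) * (2 * L2sq S H + 2 * L2sq UNIV (%x. D n x - H x))) ~~> m * ennreal (d^2) * (2 * L2sq S H + 2 * 0)"
 using m by (intro tendsto_add ennreal_tendsto_cmult tendsto_const g(3)) (auto simp: ennreal_mult_less_top)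
 then show "(%n. m * ennreal (d^2) * (2 * L2sq S H + 2 * L2sq UNIV (%x. D n x - H x))) ~~> m * ennreal (d^2) * (2 * L2sq S H)" by simp
 qed
 finally show ?thesis by (simp add: m_def)
qed

lemma uniform_limit_compose_continuous:
 fixes f :: "nat => 'a::topological_space => real"
 assumes lim: "uniform_limit L f w sequentially" and "compact L" "continuous_on L w" and p: "continuous_on UNIV (p::real => real)"
 shows "uniform_limit L (%n x. p (f n x)) (%x. p (w x)) sequentially"
proof (rule uniform_limitI)
 fix e :: real assume e: "0 < e"
 obtain b where b: "!!x. x \<in> L ==> \<bar>w x\<bar> <= b"
 using compact_imp_bounded[OF compact_continuous_image[OF assms(3,2)]] by (auto simp: bounded_iff)
 have "uniformly_continuous_on (cball 0 (b + 1)) p"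
 by (intro compact_uniformly_continuous continuous_on_subset[OF p]) auto
 then obtain d where d: "d > 0" "!!x x'. x \<in> cball 0 (b + 1) ==> x' \<in> cball 0 (b + 1) ==> dist x' x < d ==> dist (p x') (p x) < e"
 using e unfolding uniformly_continuous_on_def by metis
 have "EV n. \<forall>x\<in>L. dist (f n x) (w x) < min d 1"
 using d(1) by (intro uniform_limitD[OF lim]) auto
 then show "EV n. \<forall>x\<in>L. dist (p (f n x)) (p (w x)) < e"
 proof eventually_elim
 case (elim n)
 show ?case
 proof
 fix x assume x: "x \<in> L"
 show "dist (p (f n x)) (p (w x)) < e"
 using elim x b[OF x] by (intro d(2)) (force simp: dist_real_def)+
 qed
 qed
qed

text \<open>The set \<open>B\<close> may reach beyond \<open>Om\<close>, where \<open>w\<close> has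
  no meaning; \<open>W\<close> is continuous on \<open>B\<close> and agrees with \<open>w\<close>
  wherever it is positive. Because \<open>p\<close> vanishes up to level \<open>\<kappa>\<close>,
  the product of \<open>et\<close> and \<open>p (w x)\<close> lives on the compact set
  \<open>L\<close>, which does lie in \<open>Om\<close>. The half level in \<open>L\<close> leaves
  room for a second cutoff.\<close>

lemma sob0_compose:
 fixes w :: "'a::euclidean_space => real"
 assumes w: "sob Om w G" and "open B" and W: "continuous_on B W" and Ww: "!!x. x \<in> B ==> 0 < W x ==> x \<in> Om & W x = w x"
 and eta: "C1 et Det" and K: "compact K" "K \<subseteq> B" "!!x. x ~: K ==> et x = 0" "!!x. x ~: K ==> Det x = 0"
 and "0 < \<kappa>" and p: "!!t. DERIV p t :> p' t" "continuous_on UNIV p'" "!!t. t <= \<kappa> ==> p t = 0" "!!t. t <= \<kappa> ==> p' t = 0"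
 and L: "L = {x\<in>K. \<kappa> / 2 <= W x}"
 shows "sob0 L (%x. if x \<in> L then et x * p (w x) else 0)
 (%x. if x \<in> L then (et x * p' (w x)) *. G x + p (w x) *. Det x else 0)"
proof -
 have WK: "continuous_on K W" by (rule continuous_on_subset[OF W K(2)])
 have cl: "compact {x\<in>K. a <= W x}" for a
 proof -
 have "closed (K \<inter> W -` {a..})" by (rule continuous_closed_preimage[OF WK compact_imp_closed[OF K(1)]]) simp
 moreover have "K \<inter> W -` {a..} = {x\<in>K. a <= W x}" by auto
 ultimately have "closed {x\<in>K. a <= W x}" by simp
 then have "compact (K \<inter> {x\<in>K. a <= W x})" by (rule compact_Int_closed[OF K(1)])
 also have "K \<inter> {x\<in>K. a <= W x} = {x\<in>K. a <= W x}" by auto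
 finally show ?thesis .
 qed
 have cL: "compact L" unfolding L by (rule cl)
 have Lw: "x \<in> Om" "W x = w x" if "x \<in> L" for x
 using that Ww[of x] K(2) \<open>0 < \<kappa>\<close> by (auto simp: L)
 have LOm: "L \<subseteq> Om" using Lw by auto
 \<comment> \<open>The cutoff \<open>ch\<close> is 1 on \<open>K\<close> wherever \<open>p\<close>
   or \<open>p'\<close> can be nonzero, and vanishes before \<open>W\<close> drops to
   \<open>\<kappa> / 2\<close>. It forces the approximants built from \<open>p (f n x)\<close> to
   vanish off \<open>L\<close>, although \<open>f n\<close> approximates \<open>w\<close> only on
   \<open>L\<close>.\<close>
 define C where "C = {x\<in>K. \<kappa> <= W x}"
 define V where "V = B \<inter> W -` {\<kappa>/2 <..}"
 have "open V" unfolding V_def by (rule continuous_open_preimage[OF W \<open>open B\<close>]) simp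
 moreover have "C \<subseteq> V" using K(2) \<open>0 < \<kappa>\<close> by (auto simp: C_def V_def)
 moreover have "compact C" unfolding C_def by (rule cl)
 ultimately obtain ch E M where ch: "C1 ch E" "!!x. 0 <= ch x" "!!x. ch x <= 1" "!!x. x \<in> C ==> ch x = 1" "!!x. x \<in> C ==> E x = 0"
 "compact M" "M \<subseteq> V" "!!x. x ~: M ==> ch x = 0" "!!x. x ~: M ==> E x = 0"
 using cutoff_exists[of C V] by metis
 obtain f D where fD: "!!n::nat. C1 (f n) (D n)" "uniform_limit L f w sequentially" "(%n. L2sq L (%x. D n x - G x)) ~~> 0"
 using w cL LOm unfolding sob_def by blast
 have wc: "continuous_on L w" by (rule continuous_on_subset[OF _ LOm]) (use w in \<open>simp add: sob_def\<close>)
 have [measurable]: "G \<in> bm" using w by (simp add: sob_def)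
 have [measurable]: "L \<in> sets borel" using cL by (simp add: borel_compact)
 note [measurable] = C1_measurable[OF ch(1)] C1_measurable[OF fD(1)] C1_measurable[OF eta]
 have pc: "continuous_on UNIV p" by (intro continuous_at_imp_continuous_on ballI DERIV_isCont[OF p(1)])
 have [measurable]: "p \<in> bm" "p' \<in> bm"
 using pc p(2) by (auto intro: borel_measurable_continuous_onI)
 \<comment> \<open>\<open>w\<close> is merely continuous on \<open>Om\<close>; cutting it to
   \<open>L\<close> gives a Borel function on the whole space.\<close>
 define wl where "wl x = (if x \<in> L then w x else 0)" for x
 have [measurable]: "wl \<in> bm"
 proof -
 have "(%x. indicator L x *. w x) \<in> bm"
 by (rule borel_measurable_continuous_on_indicator[OF _ wc]) measurable
 also have "(%x. indicator L x *. w x) = wl" by (auto simp: wl_def fun_eq_iff)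
 finally show ?thesis .
 qed
 define Z where "Z x = (if x \<in> L then et x * p (wl x) else 0)" for x
 define H where "H x = (if x \<in> L then (et x * p' (wl x)) *. G x + p (wl x) *. Det x else 0)" for x
 have [measurable]: "Z \<in> bm" "H \<in> bm" unfolding Z_def H_def by measurable
 define g where "g n x = (et x * ch x) * p (f n x)" for n x
 define Dg where "Dg n x = (et x * ch x) *. (p' (f n x) *. D n x) + p (f n x) *. (et x *. E x + ch x *. Det x)" for n x
 have gC: "C1 (g n) (Dg n)" for n
 unfolding g_def[abs_def] Dg_def[abs_def]
 by (intro C1_mult eta ch C1_compose[OF fD(1) p(1,2)])
 have [measurable]: "Dg n \<in> bm" for n using C1_measurable[OF gC] by auto
 have off: "et x * ch x = 0" "et x *. E x + ch x *. Det x = 0" if "x ~: L" for x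
 proof -
 have "x ~: K \<or> x ~: M" using that ch(7) by (auto simp: L V_def)
 then show "et x * ch x = 0" "et x *. E x + ch x *. Det x = 0" using K(3,4)[of x] ch(8,9)[of x] by auto
 qed
 have goff: "g n x = 0" "Dg n x = 0" if "x ~: L" for n x using off[OF that] by (simp_all add: g_def Dg_def)
 have bdd: "\<exists>b. \<forall>x\<in>L. norm (q x) <= b" if "continuous_on UNIV q" for q :: "'a => 'b::real_normed_vector"
 using compact_imp_bounded[OF compact_continuous_image[OF continuous_on_subset[OF that] cL]] by (auto simp: bounded_iff)
 obtain b where b: "!!x. x \<in> L ==> \<bar>et x\<bar> <= b" using bdd[OF C1_cont[OF eta]] by auto
 have "L = {} \<or> 0 <= b" using b by (metis abs_ge_zero all_not_in_conv order_trans)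
 have b1: "\<bar>et x * ch x\<bar> <= \<bar>b\<bar>" if "x \<in> L" for x
 proof -
 have "\<bar>et x * ch x\<bar> = \<bar>et x\<bar> * ch x" using ch(2) by (simp add: abs_mult)
 also have "... <= \<bar>et x\<bar> * 1" using ch(3) by (intro mult_left_mono) auto
 finally show ?thesis using b[OF that] by simp
 qed
 have up: "uniform_limit L (%n x. p (f n x)) (%x. p (w x)) sequentially"
 by (rule uniform_limit_compose_continuous[OF fD(2) cL wc pc])
 have up': "uniform_limit L (%n x. p' (f n x)) (%x. p' (w x)) sequentially"
 by (rule uniform_limit_compose_continuous[OF fD(2) cL wc p(2)])
 have on: "ch x = 1 & E x = 0 \<or> p (w x) = 0 & p' (w x) = 0" if "x \<in> L" for x
 proof (cases "x \<in> C")
 case False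
 then have "w x <= \<kappa>" using that Lw[OF that] by (auto simp: C_def L)
 then show ?thesis using p by auto
 qed (use ch in auto)
 have gl: "uniform_limit UNIV g Z sequentially"
 proof (rule uniform_limitI)
 fix e :: real assume e: "0 < e"
 have "EV n. \<forall>x\<in>L. dist (p (f n x)) (p (w x)) < e / (\<bar>b\<bar> + 1)"
 using e by (intro uniform_limitD[OF up]) auto
 then show "EV n. \<forall>x\<in>UNIV. dist (g n x) (Z x) < e"
 proof eventually_elim
 case (elim n)
 show ?case
 proof
 fix x
 show "dist (g n x) (Z x) < e"
 proof (cases "x \<in> L")
 case True
 have "Z x = (et x * ch x) * p (w x)" using on[OF True] True by (auto simp: Z_def wl_def)
 then have "dist (g n x) (Z x) = \<bar>et x * ch x\<bar> * dist (p (f n x)) (p (w x))"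
 by (simp add: g_def dist_real_def flip: right_diff_distrib abs_mult)
 also have "... <= \<bar>b\<bar> * (e / (\<bar>b\<bar> + 1))"
 using elim True by (intro mult_mono b1) auto
 also have "... < e" using div_Suc_bound(2)[OF e abs_ge_zero[of b]] by (simp add: mult.commute)
 finally show ?thesis .
 qed (use e goff in \<open>simp add: Z_def\<close>)
 qed
 qed
 qed
 have hl: "(%n. L2sq UNIV (%x. Dg n x - H x)) ~~> 0"
 proof -
 have eq: "L2sq UNIV (%x. Dg n x - H x) = L2sq L (%x. ((et x * ch x * p' (f n x)) *. (D n x - G x) + (et x * ch x * (p' (f n x) - p' (wl x))) *. G x)
 + (p (f n x) - p (wl x)) *. (et x *. E x + ch x *. Det x))" for n
 unfolding L2sq_def
 proof (rule nn_integral_cong)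
 fix x
 show "ie UNIV x ((norm (Dg n x - H x))^2) = ie L x ((norm (((et x * ch x * p' (f n x)) *. (D n x - G x) + (et x * ch x * (p' (f n x) - p' (wl x))) *. G x)
 + (p (f n x) - p (wl x)) *. (et x *. E x + ch x *. Det x)))^2)"
 proof (cases "x \<in> L")
 case True
 have "Dg n x - H x = ((et x * ch x * p' (f n x)) *. (D n x - G x) + (et x * ch x * (p' (f n x) - p' (wl x))) *. G x)
 + (p (f n x) - p (wl x)) *. (et x *. E x + ch x *. Det x)"
 using on[OF True] True by (auto simp: Dg_def H_def wl_def algebra_simps)
 then show ?thesis using True by simp
 next
 case False
 then show ?thesis using goff by (simp add: H_def)
 qed
 qed
 obtain b' where b': "!!x. x \<in> L ==> \<bar>p' (w x)\<bar> <= b'"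
 proof -
 have "continuous_on L (%x. p' (w x))" by (rule continuous_on_compose2[OF p(2) wc]) auto
 from compact_imp_bounded[OF compact_continuous_image[OF this cL]] show ?thesis using that by (auto simp: bounded_iff)
 qed
 have 1: "(%n. L2sq L (%x. (et x * ch x * p' (f n x)) *. (D n x - G x))) ~~> 0"
 proof (rule L2sq_tendsto_bounded_scale[where M = "\<bar>b\<bar> * (b' + 1)"])
 have "EV n. \<forall>x\<in>L. dist (p' (f n x)) (p' (w x)) < 1"
 by (intro uniform_limitD[OF up']) auto
 then show "EV n. \<forall>x\<in>L. \<bar>et x * ch x * p' (f n x)\<bar> <= \<bar>b\<bar> * (b' + 1)"
 proof (eventually_elim, intro ballI)
 fix n x assume n: "\<forall>x\<in>L. dist (p' (f n x)) (p' (w x)) < 1" and x: "x \<in> L"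
 have "\<bar>p' (f n x)\<bar> <= b' + 1" using n x b'[OF x] by (force simp: dist_real_def)
 then show "\<bar>et x * ch x * p' (f n x)\<bar> <= \<bar>b\<bar> * (b' + 1)"
 using b1[OF x] by (simp only: abs_mult[of "et x * ch x"]) (intro mult_mono, auto)
 qed
 qed (use fD(3) in auto)
 have 2: "(%n. L2sq L (%x. (et x * ch x * (p' (f n x) - p' (wl x))) *. G x)) ~~> 0"
 proof (rule L2sq_tendsto_uniform_scale)
 show "L2sq L G < \<infinity>" by (rule sob_L2_finite[OF w cL LOm])
 show "uniform_limit L (%n x. et x * ch x * (p' (f n x) - p' (wl x))) (%_. 0) sequentially"
 proof (rule uniform_limitI)
 fix e :: real assume e: "0 < e"
 have "EV n. \<forall>x\<in>L. dist (p' (f n x)) (p' (w x)) < e / (\<bar>b\<bar> + 1)"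
 using e by (intro uniform_limitD[OF up']) auto
 then show "EV n. \<forall>x\<in>L. dist (et x * ch x * (p' (f n x) - p' (wl x))) 0 < e"
 proof (eventually_elim, intro ballI)
 fix n x assume n: "\<forall>x\<in>L. dist (p' (f n x)) (p' (w x)) < e / (\<bar>b\<bar> + 1)" and x: "x \<in> L"
 have "dist (et x * ch x * (p' (f n x) - p' (wl x))) 0 = \<bar>et x * ch x\<bar> * dist (p' (f n x)) (p' (w x))"
 using x by (simp add: dist_real_def abs_mult wl_def)
 also have "... <= \<bar>b\<bar> * (e / (\<bar>b\<bar> + 1))"
 using n x by (intro mult_mono b1) auto
 also have "... < e" using div_Suc_bound(2)[OF e abs_ge_zero[of b]] by (simp add: mult.commute)
 finally show "dist (et x * ch x * (p' (f n x) - p' (wl x))) 0 < e" .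
 qed
 qed
 qed auto
 have 3: "(%n. L2sq L (%x. (p (f n x) - p (wl x)) *. (et x *. E x + ch x *. Det x))) ~~> 0"
 proof (rule L2sq_tendsto_uniform_scale)
 have "continuous_on UNIV (%x. et x *. E x + ch x *. Det x)"
 by (intro continuous_intros C1_cont[OF eta] C1_cont[OF ch(1)] C1_cont_D[OF eta] C1_cont_D[OF ch(1)])
 from bdd[OF this] obtain b3 where b3: "!!x. x \<in> L ==> norm (et x *. E x + ch x *. Det x) <= b3" by auto
 have "L2sq L (%x. et x *. E x + ch x *. Det x) <= (NI x. ennreal (b3^2) * indicator L x)"
 unfolding L2sq_def using b3 by (intro nn_integral_mono) (auto split: split_indicator intro!: ennreal_leI power_mono)
 also have "... < \<infinity>" using emeasure_compact_finite[OF cL] by (simp add: nn_integral_cmult_indicator ennreal_mult_less_top)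
 finally show "L2sq L (%x. et x *. E x + ch x *. Det x) < \<infinity>" .
 have "uniform_limit L (%n x. p (f n x) - p (w x)) (%x. p (w x) - p (w x)) sequentially"
 by (intro uniform_limit_intros up)
 then show "uniform_limit L (%n x. p (f n x) - p (wl x)) (%_. 0) sequentially"
 by (rule uniform_limit_cong'[THEN iffD1, rotated 2]) (auto simp: wl_def)
 qed auto
 show ?thesis unfolding eq by (intro L2sq_tendsto_add 1 2 3) auto
 qed
 have "sob0 L Z H"
 unfolding sob0_def using cL gC goff gl hl by (auto simp: Z_def H_def intro!: exI[of _ g] exI[of _ Dg])
 moreover have "Z = (%x. if x \<in> L then et x * p (w x) else 0)"
 "H = (%x. if x \<in> L then (et x * p' (w x)) *. G x + p (w x) *. Det x else 0)"
 by (auto simp: Z_def H_def wl_def fun_eq_iff)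
 ultimately show ?thesis by simp
qed

subsection \<open>The energy inequality and De Giorgi iteration\<close>

text \<open>\<open>F\<close> stands for \<open>A \<nabla>w\<close>. The estimates only see the ellipticity of the flux, so the coefficients
themselves (and their symmetry) never enter.\<close>

definition ellflux :: "real => real => 'a::euclidean_space set => ('a => real) => ('a => 'a) => ('a => 'a) => bool" where
 "ellflux lam Lam Om w G F \<longleftrightarrow> open Om & sob Om w G & F \<in> bm &
 (AE x in lborel. x \<in> Om --> lam * (norm (G x))^2 <= F x \<bullet> G x & norm (F x) <= Lam * norm (G x)) &
 (\<forall>f D. test_function Om f D --> (BI x. F x \<bullet> D x) = 0)"

lemma ellflux_L2_finite:
 assumes "ellflux lam Lam Om w G F" "compact L" "L \<subseteq> Om"
 shows "L2sq L F < \<infinity>"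
proof -
 have [measurable]: "G \<in> bm" "F \<in> bm" "L \<in> sets borel"
 using assms by (auto simp: ellflux_def sob_def borel_compact)
 have "L2sq L F <= (NI x. ennreal (Lam^2) * (ie L x ((norm (G x))^2)))"
 unfolding L2sq_def
 proof (rule nn_integral_mono_AE)
 have "AE x in lborel. x \<in> Om --> norm (F x) <= Lam * norm (G x)"
 using assms(1) by (auto simp: ellflux_def elim!: eventually_mono)
 then show "AE x in lborel. ie L x ((norm (F x))^2) <= ennreal (Lam^2) * (ie L x ((norm (G x))^2))"
 proof eventually_elim
 case (elim x)
 show ?case
 proof (cases "x \<in> L")
 case True
 then have "(norm (F x))^2 <= (Lam * norm (G x))^2" using elim assms(3) by (intro power_mono) auto
 then show ?thesis using True by (auto simp: power_mult_distrib ennreal_leI simp flip: ennreal_mult)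
 qed simp
 qed
 qed
 also have "... = ennreal (Lam^2) * L2sq L G" by (simp add: L2sq_def nn_integral_cmult)
 also have "... < \<infinity>" using sob_L2_finite[of Om w G L] assms by (simp add: ellflux_def ennreal_mult_less_top)
 finally show ?thesis .
qed

lemma nn_integral_inner_le:
 fixes F V :: "'a::euclidean_space => 'b::euclidean_space"
 assumes [measurable]: "F \<in> bm" "V \<in> bm" "L \<in> sets borel" and "!!x. x ~: L ==> V x = 0"
 shows "(NI x. ennreal \<bar>F x \<bullet> V x\<bar>)^2 <= L2sq L F * L2sq UNIV V"
proof -
 have "(NI x. ennreal \<bar>F x \<bullet> V x\<bar>) <= (NI x. (ie L x (norm (F x))) * ennreal (norm (V x)))"
 using assms(4) by (intro nn_integral_mono) (auto split: split_indicator simp: Cauchy_Schwarz_ineq2 ennreal_leI simp flip: ennreal_mult)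
 then have "(NI x. ennreal \<bar>F x \<bullet> V x\<bar>)^2 <= (NI x. (ie L x (norm (F x))) * ennreal (norm (V x)))^2"
 by (rule power_mono) simp
 also have "... <= (NI x. (ie L x (norm (F x)))^2) * (NI x. (ennreal (norm (V x)))^2)"
 by (rule Cauchy_Schwarz_nn_integral) auto
 also have "... = L2sq L F * L2sq UNIV V"
 unfolding L2sq_def by (intro arg_cong2[where f = "(*)"] nn_integral_cong) (auto split: split_indicator simp: ennreal_power)
 finally show ?thesis .
qed

text \<open>Extends the weak equation from C1 test functions to \<open>sob0\<close> functions: each
  approximant gives 0, and the remainder is bounded by Cauchy-Schwarz with the finite L2 norm of
  \<open>F\<close> on \<open>L\<close>.\<close>

lemma ellflux_test:
 assumes e: "ellflux lam Lam Om w G F" and Z: "sob0 L Z H" and L: "L \<subseteq> Om"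
 shows "integrable lborel (%x. F x \<bullet> H x)" "(BI x. F x \<bullet> H x) = 0"
proof -
 obtain g D where g: "!!n::nat. C1 (g n) (D n)" "!!n x. x ~: L ==> g n x = 0" "!!n x. x ~: L ==> D n x = 0" "(%n. L2sq UNIV (%x. D n x - H x)) ~~> 0"
 using Z unfolding sob0_def by blast
 have cL: "compact L" and [measurable]: "H \<in> bm" and H0: "!!x. x ~: L ==> H x = 0" using sob0_D[OF Z] by auto
 have [measurable]: "L \<in> sets borel" "F \<in> bm" using cL e by (auto simp: borel_compact ellflux_def)
 note [measurable] = C1_measurable[OF g(1)]
 have Ff: "L2sq L F < \<infinity>" by (rule ellflux_L2_finite[OF e cL L])
 have int: "integrable lborel (%x. F x \<bullet> V x)" if [measurable]: "V \<in> bm" and "!!x. x ~: L ==> V x = 0" "L2sq UNIV V < \<infinity>" for V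
 proof (rule integrableI_bounded)
 have "(NI x. ennreal \<bar>F x \<bullet> V x\<bar>)^2 < \<infinity>"
 using nn_integral_inner_le[of F V L] Ff that by (auto simp: ennreal_mult_less_top intro: le_less_trans)
 then show "(NI x. ennreal (norm (F x \<bullet> V x))) < \<infinity>"
 by (auto simp: power2_eq_square ennreal_mult_less_top)
 qed measurable
 show iH: "integrable lborel (%x. F x \<bullet> H x)" by (rule int[OF _ H0 sob0_L2_finite[OF Z]]) auto
 have z: "(BI x. F x \<bullet> D n x) = 0" for n
 proof -
 have cl: "closure {x. g n x ~= 0} \<subseteq> L" by (rule closure_minimal[OF _ compact_imp_closed[OF cL]]) (use g(2) in auto)
 then have "test_function Om (g n) (D n)"
 using g(1)[of n] L compact_closure[of "{x. g n x ~= 0}"] bounded_subset[OF compact_imp_bounded[OF cL]] closure_subset[of "{x. g n x ~= 0}"]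
 unfolding test_function_def C1_def by (auto simp: compact_closure)
 then show ?thesis using e by (auto simp: ellflux_def)
 qed
 have lim: "(%n. L2sq L F * L2sq UNIV (%x. D n x - H x)) ~~> L2sq L F * 0"
 using Ff by (intro ennreal_tendsto_cmult g(4)) simp
 have "ennreal ((BI x. F x \<bullet> H x)^2) <= L2sq L F * 0"
 proof (rule LIMSEQ_le_const[OF lim])
 have "EV n. L2sq UNIV (%x. D n x - H x) < 1" using order_tendstoD(2)[OF g(4), of 1] by simp
 then have "EV n. ennreal ((BI x. F x \<bullet> H x)^2) <= L2sq L F * L2sq UNIV (%x. D n x - H x)"
 proof eventually_elim
 case (elim n)
 have i2: "integrable lborel (%x. F x \<bullet> (D n x - H x))"
 by (rule int) (use g(3) H0 elim less_top in \<open>auto intro: less_trans[OF elim]\<close>)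
 have i1: "integrable lborel (%x. F x \<bullet> D n x)"
 using Bochner_Integration.integrable_add[OF i2 iH] by (simp add: inner_diff_right)
 have "(BI x. F x \<bullet> (D n x - H x)) = - (BI x. F x \<bullet> H x)"
 using z[of n] i1 iH by (simp add: inner_diff_right)
 then have "ennreal \<bar>\<integral>x. F x \<bullet> H x \<partial>lborel\<bar> <= (NI x. ennreal (norm (F x \<bullet> (D n x - H x))))"
 using integral_norm_bound_ennreal[OF i2] by simp
 then have "(ennreal \<bar>\<integral>x. F x \<bullet> H x \<partial>lborel\<bar>)^2 <= (NI x. ennreal \<bar>F x \<bullet> (D n x - H x)\<bar>)^2"
 by (intro power_mono) auto
 also have "... <= L2sq L F * L2sq UNIV (%x. D n x - H x)"
 by (rule nn_integral_inner_le) (use g(3) H0 in auto)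
 finally show ?case by (simp add: ennreal_power)
 qed
 then show "\<exists>N. \<forall>n\<ge>N. ennreal ((BI x. F x \<bullet> H x)^2) <= L2sq L F * L2sq UNIV (%x. D n x - H x)"
 by (simp add: eventually_sequentially)
 qed
 then show "(BI x. F x \<bullet> H x) = 0" by simp
qed

text \<open>Models the positive part of a solution, extended by zero, on a set \<open>B\<close> that
  may leave the domain \<open>Om\<close> of the solution. Only agreement with a solution where
  \<open>W\<close> is positive is demanded: test functions built from truncations above a positive
  level never see the zero set.\<close>

definition subsol :: "real => real => 'a::euclidean_space set => ('a => real) => bool" where
 "subsol lam Lam B W \<longleftrightarrow> open B & continuous_on B W & W \<in> bm & (\<forall>x\<in>B. 0 <= W x) &
 (\<exists>Om w G F. ellflux lam Lam Om w G F & (\<forall>x\<in>B. 0 < W x --> x \<in> Om & W x = w x))"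

text \<open>Tests the equation with \<open>et^2 * p(w)\<close>. The condition
  \<open>p^2 \<le> b p' m^2\<close> is what Young's inequality needs to absorb the cross term into
  \<open>p' |G|^2\<close>, leaving \<open>|Det|^2 m^2\<close>. It is used with cubes of
  \<open>(t - k)_+\<close> and \<open>m = (t - k)_+^2\<close>, and with a logarithmic choice and
  \<open>m = 1\<close>. Restricting to values in \<open>T\<close> allows an upper bound of
  \<open>W\<close> to be exploited.\<close>

lemma energy_inequality:
 fixes w :: "'a::euclidean_space => real"
 assumes e: "ellflux lam Lam Om w G F" and "0 < lam" "0 < Lam"
 and B: "open B" and W: "continuous_on B W" and Ww: "!!x. x \<in> B ==> 0 < W x ==> x \<in> Om & W x = w x"
 and eta: "C1 et Det" and K: "compact K" "K \<subseteq> B" "!!x. x ~: K ==> et x = 0" "!!x. x ~: K ==> Det x = 0"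
 and "0 < \<kappa>" and p: "!!t. DERIV p t :> p' t" "continuous_on UNIV p'" "!!t. t <= \<kappa> ==> p t = 0" "!!t. t <= \<kappa> ==> p' t = 0"
 and L: "L = {x\<in>K. \<kappa> / 2 <= W x}"
 and b: "0 <= b" and m: "continuous_on UNIV m" and T: "!!x. x \<in> B ==> W x \<in> T"
 and p'0: "!!t. t \<in> T ==> 0 <= p' t" and pm: "!!t. t \<in> T ==> (p t)^2 <= b * p' t * (m t)^2"
 shows "(NI x. ie L x ((et x)^2 * p' (w x) * (norm (G x))^2))
 <= ennreal (4 * Lam^2 * b / lam^2) * (NI x. ie L x ((norm (Det x))^2 * (m (w x))^2))"
proof -
 have w: "sob Om w G" using e by (simp add: ellflux_def)
 have eta2: "C1 (%x. et x * et x) (%x. et x *. Det x + et x *. Det x)" by (rule C1_mult[OF eta eta])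
 define H where "H x = (if x \<in> L then (et x * et x * p' (w x)) *. G x + p (w x) *. (et x *. Det x + et x *. Det x) else 0)" for x
 have s0: "sob0 L (%x. if x \<in> L then et x * et x * p (w x) else 0) H"
 unfolding H_def[abs_def]
 by (rule sob0_compose[OF w B W Ww eta2 K(1,2) _ _ \<open>0 < \<kappa>\<close> p L]) (use K in auto)
 have Lw: "x \<in> Om" "W x = w x" "w x \<in> T" if "x \<in> L" for x
 using that Ww[of x] K(2) \<open>0 < \<kappa>\<close> T[of x] by (auto simp: L)
 then have LOm: "L \<subseteq> Om" by auto
 have cL: "compact L" and [measurable]: "H \<in> bm" using sob0_D[OF s0] by auto
 have [measurable]: "L \<in> sets borel" "F \<in> bm" "G \<in> bm"
 using cL e by (auto simp: borel_compact ellflux_def sob_def)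
 note [measurable] = C1_measurable[OF eta]
 note int = ellflux_test[OF e s0 LOm]
 have wc: "continuous_on L w" by (rule continuous_on_subset[OF _ LOm]) (use w in \<open>simp add: sob_def\<close>)
 define c where "c = 2 * Lam^2 * b / lam"
 have c0: "0 <= c" using b \<open>0 < lam\<close> by (simp add: c_def)
 define Y where "Y x = indicator L x *. (c * ((norm (Det x))^2 * (m (w x))^2))" for x
 have Yi: "integrable lborel Y"
 unfolding Y_def[abs_def]
 by (intro borel_integrable_compact[OF cL] continuous_intros continuous_on_subset[OF C1_cont_D[OF eta]]
 continuous_on_compose2[OF m wc]) auto
 have Y0: "0 <= Y x" for x using c0 by (simp add: Y_def)
 have "AE x in lborel. x \<in> Om --> lam * (norm (G x))^2 <= F x \<bullet> G x & norm (F x) <= Lam * norm (G x)"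
 using e by (simp add: ellflux_def)
 \<comment> \<open>Ellipticity and Young's inequality bound the wanted energy density pointwise by
   the tested integrand plus \<open>Y\<close>. The tested integrand has integral 0, so only
   \<open>Y\<close> survives integration.\<close>
 then have ae: "AE x in lborel. indicator L x * ((lam / 2) * ((et x)^2 * p' (w x) * (norm (G x))^2)) <= F x \<bullet> H x + Y x"
 proof eventually_elim
 case (elim x)
 show ?case
 proof (cases "x \<in> L")
 case True
 note lw = Lw[OF True]
 let ?p' = "p' (w x)"
 have p'n: "0 <= ?p'" by (rule p'0[OF lw(3)])
 have 1: "lam * (norm (G x))^2 <= F x \<bullet> G x" and 2: "norm (F x) <= Lam * norm (G x)" using elim lw by auto
 have "(et x)^2 * ?p' * (lam * (norm (G x))^2) <= (et x)^2 * ?p' * (F x \<bullet> G x)"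
 by (intro mult_left_mono 1 mult_nonneg_nonneg p'n) auto
 then have "lam * ((et x)^2 * ?p' * (norm (G x))^2) <= (et x)^2 * ?p' * (F x \<bullet> G x)"
 by (simp add: mult_ac)
 moreover have "\<bar>p (w x) * (2 * et x) * (F x \<bullet> Det x)\<bar> <= (lam / 2) * ((et x)^2 * ?p' * (norm (G x))^2) + c * ((norm (Det x))^2 * (m (w x))^2)"
 proof -
 define a where "a = \<bar>et x\<bar> * norm (G x) * sqrt ?p'"
 define d where "d = norm (Det x) * \<bar>m (w x)\<bar> * sqrt b"
 have "\<bar>p (w x)\<bar> = sqrt ((p (w x))^2)" by simp
 also have "... <= sqrt (b * ?p' * (m (w x))^2)" by (intro real_sqrt_le_mono pm lw)
 also have "... = sqrt b * sqrt ?p' * \<bar>m (w x)\<bar>" by (simp add: real_sqrt_mult)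
 finally have 3: "\<bar>p (w x)\<bar> <= sqrt b * sqrt ?p' * \<bar>m (w x)\<bar>" .
 have 4: "\<bar>F x \<bullet> Det x\<bar> <= (Lam * norm (G x)) * norm (Det x)"
 by (rule order_trans[OF Cauchy_Schwarz_ineq2 mult_right_mono[OF 2]]) simp
 have "\<bar>p (w x) * (2 * et x) * (F x \<bullet> Det x)\<bar> = \<bar>p (w x)\<bar> * (2 * \<bar>et x\<bar>) * \<bar>F x \<bullet> Det x\<bar>" by (simp add: abs_mult)
 also have "... <= (sqrt b * sqrt ?p' * \<bar>m (w x)\<bar>) * (2 * \<bar>et x\<bar>) * ((Lam * norm (G x)) * norm (Det x))"
 using b p'n by (intro mult_mono 3 4) auto
 also have "... = 2 * Lam * (a * d)" by (simp add: a_def d_def algebra_simps)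
 also have "... <= (lam / 2) * a^2 + (2 * Lam^2 / lam) * d^2"
 proof -
 have "0 <= (lam * a - 2 * Lam * d)^2 / (2 * lam)" using \<open>0 < lam\<close> by simp
 also have "... = (lam / 2) * a^2 + (2 * Lam^2 / lam) * d^2 - 2 * Lam * (a * d)"
 using \<open>0 < lam\<close> by (simp add: power2_eq_square field_simps)
 finally show ?thesis by simp
 qed
 also have "a^2 = (et x)^2 * ?p' * (norm (G x))^2" using p'n by (simp add: a_def power_mult_distrib)
 also have "d^2 = (norm (Det x))^2 * (m (w x))^2 * b" using b by (simp add: d_def power_mult_distrib)
 also have "(2 * Lam^2 / lam) * ((norm (Det x))^2 * (m (w x))^2 * b) = c * ((norm (Det x))^2 * (m (w x))^2)"
 by (simp add: c_def)
 finally show ?thesis .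
 qed
 moreover have "F x \<bullet> H x = (et x)^2 * ?p' * (F x \<bullet> G x) + p (w x) * (2 * et x) * (F x \<bullet> Det x)"
 using True by (simp add: H_def inner_add_right power2_eq_square algebra_simps)
 ultimately have "(lam / 2) * ((et x)^2 * ?p' * (norm (G x))^2) <= F x \<bullet> H x + c * ((norm (Det x))^2 * (m (w x))^2)"
 by linarith
 then show ?thesis using True by (simp add: Y_def) 
 qed (simp add: H_def Y_def)
 qed
 let ?X = "%x. (et x)^2 * p' (w x) * (norm (G x))^2"
 have "(NI x. ie L x ((lam / 2) * ?X x)) <= (NI x. ennreal (F x \<bullet> H x + Y x))"
 using ae by (intro nn_integral_mono_AE) (auto elim!: eventually_mono split: split_indicator intro!: ennreal_leI)
 also have "... = ennreal (BI x. F x \<bullet> H x + Y x)"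
 proof (rule nn_integral_eq_integral)
 show "AE x in lborel. 0 <= F x \<bullet> H x + Y x"
 using ae
 proof eventually_elim
 case (elim x)
 have "0 <= indicator L x * ((lam / 2) * ?X x)"
 using \<open>0 < lam\<close> p'0[OF Lw(3)] by (auto split: split_indicator)
 then show ?case using elim by simp
 qed
 qed (use int Yi in auto)
 also have "(BI x. F x \<bullet> H x + Y x) = (BI x. Y x)" using int Yi by simp
 also have "ennreal ... = (NI x. ennreal (Y x))" using nn_integral_eq_integral[OF Yi] Y0 by simp
 also have "... = (NI x. ennreal c * (ie L x ((norm (Det x))^2 * (m (w x))^2)))"
 using c0 by (intro nn_integral_cong) (auto simp: Y_def ennreal_mult split: split_indicator)
 finally have *: "(NI x. ie L x ((lam / 2) * ?X x)) <= (NI x. ennreal c * (ie L x ((norm (Det x))^2 * (m (w x))^2)))" .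
 have mw: "(%x. ie L x ((norm (Det x))^2 * (m (w x))^2)) \<in> bm"
 and mX: "(%x. ie L x (?X x)) \<in> bm"
 proof -
 have [measurable]: "(%x. indicator L x *. w x) \<in> bm"
 by (rule borel_measurable_continuous_on_indicator[OF _ wc]) measurable
 have [measurable]: "m \<in> bm" "p' \<in> bm"
 using m p(2) by (auto intro: borel_measurable_continuous_onI)
 have "(%x. ie L x ((norm (Det x))^2 * (m (indicator L x *. w x))^2)) \<in> bm"
 by measurable
 also have "(%x. ie L x ((norm (Det x))^2 * (m (indicator L x *. w x))^2)) = (%x. ie L x ((norm (Det x))^2 * (m (w x))^2))"
 by (auto simp: fun_eq_iff split: split_indicator)
 finally show "(%x. ie L x ((norm (Det x))^2 * (m (w x))^2)) \<in> bm" .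
 have "(%x. ie L x ((et x)^2 * p' (indicator L x *. w x) * (norm (G x))^2)) \<in> bm"
 by measurable
 also have "(%x. ie L x ((et x)^2 * p' (indicator L x *. w x) * (norm (G x))^2)) = (%x. ie L x (?X x))"
 by (auto simp: fun_eq_iff split: split_indicator)
 finally show "(%x. ie L x (?X x)) \<in> bm" .
 qed
 have "(NI x. ie L x (?X x)) = (NI x. ennreal (2 / lam) * (ie L x ((lam / 2) * ?X x)))"
 proof (intro nn_integral_cong)
 fix x
 show "ie L x (?X x) = ennreal (2 / lam) * (ie L x ((lam / 2) * ?X x))"
 proof (cases "x \<in> L")
 case True
 have "0 <= p' (w x)" by (rule p'0[OF Lw(3)[OF True]])
 then have "ennreal (2 / lam) * ennreal ((lam / 2) * ?X x) = ennreal ((2 / lam) * ((lam / 2) * ?X x))"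
 using \<open>0 < lam\<close> by (intro ennreal_mult[symmetric]) auto
 then show ?thesis using True \<open>0 < lam\<close> by (simp add: mult.assoc)
 qed simp
 qed
 also have "... = ennreal (2 / lam) * (NI x. ie L x ((lam / 2) * ?X x))"
 proof (rule nn_integral_cmult)
 have "(%x. ennreal (lam / 2) * (ie L x (?X x))) \<in> borel_measurable lborel" using mX by simp
 also have "(%x. ennreal (lam / 2) * (ie L x (?X x))) = (%x. ie L x ((lam / 2) * ?X x))"
 proof
 fix x
 show "ennreal (lam / 2) * (ie L x (?X x)) = ie L x ((lam / 2) * ?X x)"
 using \<open>0 < lam\<close> p'0[OF Lw(3)[of x]] by (cases "x \<in> L") (simp_all flip: ennreal_mult)
 qed
 finally show "(%x. ie L x ((lam / 2) * ?X x)) \<in> borel_measurable lborel" .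
 qed
 also have "... <= ennreal (2 / lam) * (NI x. ennreal c * (ie L x ((norm (Det x))^2 * (m (w x))^2)))"
 by (intro mult_left_mono *) simp
 also have "... = ennreal (2 / lam) * (ennreal c * (NI x. ie L x ((norm (Det x))^2 * (m (w x))^2)))"
 using mw by (subst nn_integral_cmult) auto
 also have "... = ennreal (4 * Lam^2 * b / lam^2) * (NI x. ie L x ((norm (Det x))^2 * (m (w x))^2))"
 using \<open>0 < lam\<close> c0 by (simp add: c_def power2_eq_square mult.assoc[symmetric] flip: ennreal_mult)
 finally show ?thesis .
qed

section \<open>Cutoffs, affine changes and truncations\<close>

lemma DERIV_If_glue:
 fixes f g :: "real => real"
 assumes "DERIV f a :> d" "DERIV g a :> d" "f a = g a"
 shows "DERIV (%t. if t <= a then f t else g t) a :> d"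
 unfolding has_field_derivative_def has_derivative_at_alt
proof (intro conjI allI impI)
 fix e :: real assume e: "0 < e"
 obtain d1 where d1: "0 < d1" "!!y. norm (y - a) < d1 ==> norm (f y - f a - d * (y - a)) <= e * norm (y - a)"
 using assms(1) e unfolding has_field_derivative_def has_derivative_at_alt by blast
 obtain d2 where d2: "0 < d2" "!!y. norm (y - a) < d2 ==> norm (g y - g a - d * (y - a)) <= e * norm (y - a)"
 using assms(2) e unfolding has_field_derivative_def has_derivative_at_alt by blast
 show "\<exists>d'>0. \<forall>y. norm (y - a) < d' --> norm ((if y <= a then f y else g y) - (if a <= a then f a else g a) - d * (y - a)) <= e * norm (y - a)"
 proof (intro exI[of _ "min d1 d2"] conjI allI impI)
 fix y assume "norm (y - a) < min d1 d2"
 then show "norm ((if y <= a then f y else g y) - (if a <= a then f a else g a) - d * (y - a)) <= e * norm (y - a)"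
 using d1(2)[of y] d2(2)[of y] assms(3) by (cases "y <= a") auto
 qed (use d1 d2 in auto)
qed (rule bounded_linear_mult_right)

lemma DERIV_If:
 fixes f g :: "real => real"
 assumes f: "!!t. t <= a ==> DERIV f t :> f' t" and g: "!!t. a <= t ==> DERIV g t :> g' t" and "f a = g a" "f' a = g' a"
 shows "DERIV (%t. if t <= a then f t else g t) t :> (if t <= a then f' t else g' t)"
proof (cases "t = a")
 case True
 then show ?thesis using DERIV_If_glue[where f = f and g = g and a = a and d = "f' a"] f[of a] g[of a] assms(3,4) by simp
next
 case False
 show ?thesis
 proof (cases "t < a")
 case True
 then have ev: "\<forall>\<^sub>F s in nhds t. (if s <= a then f s else g s) = f s"
 using eventually_nhds_in_open[of "{..<a}" t] by (auto elim!: eventually_mono)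
 then show ?thesis using DERIV_cong_ev[OF refl ev refl] f[of t] True by simp
 next
 case 2: False
 then have ev: "\<forall>\<^sub>F s in nhds t. (if s <= a then f s else g s) = g s"
 using False eventually_nhds_in_open[of "{a<..}" t] by (auto elim!: eventually_mono)
 then show ?thesis using DERIV_cong_ev[OF refl ev refl] g[of t] False 2 by simp
 qed
qed

text \<open>Compose a rational C1 step of slope at most 2 with the quadratic
  \<open>(s^2 - |x - x0|^2) / (s^2 - r^2)\<close>, which is smooth at the centre. Inside radius
  \<open>s\<close> the gradient is at most \<open>4 s / (s^2 - r^2)\<close>, hence at most
  \<open>4 / (s - r)\<close>.\<close>

lemma radial_cutoff:
 fixes x0 :: "'a::euclidean_space"
 assumes "0 < r" "r < s"
 obtains et D where "C1 et D" "!!x. 0 <= et x" "!!x. et x <= 1" "!!x. x \<in> cball x0 r ==> et x = 1" "!!x. x \<in> cball x0 r ==> D x = 0"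
 "!!x. x ~: cball x0 s ==> et x = 0" "!!x. x ~: cball x0 s ==> D x = 0" "!!x. norm (D x) <= 4 / (s - r)"
proof -
 define A where "A t = (max 0 t)^2" for t :: real
 define B where "B t = (max 0 (1 - t))^2" for t :: real
 have pos: "0 < A t + B t" for t by (cases "0 < t") (auto simp: A_def B_def max_def intro: add_nonneg_pos add_pos_nonneg)
 have dA: "DERIV A t :> 2 * max 0 t" for t
 using DERIV_pos_part_power[of 1 0 t] by (simp add: A_def[abs_def] power2_eq_square)
 have dB: "DERIV B t :> - 2 * max 0 (1 - t)" for t
 proof -
 have "DERIV (%t. A (1 - t)) t :> (2 * max 0 (1 - t)) * (- 1)"
 by (rule DERIV_chain2[OF dA]) (auto intro!: derivative_eq_intros)
 then show ?thesis by (simp add: A_def B_def[abs_def])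
 qed
 define h where "h t = A t / (A t + B t)" for t
 define h' where "h' t = (2 * max 0 t * B t + A t * (2 * max 0 (1 - t))) / (A t + B t)^2" for t
 have dh: "DERIV h t :> h' t" for t
 proof -
 have "DERIV (%t. A t / (A t + B t)) t :> ((2 * max 0 t) * (A t + B t) - A t * (2 * max 0 t + - 2 * max 0 (1 - t))) / ((A t + B t) * (A t + B t))"
 using pos[of t] by (intro DERIV_divide DERIV_add dA dB) auto
 then show ?thesis by (simp add: h_def[abs_def] h'_def power2_eq_square algebra_simps)
 qed
 have ch: "continuous_on UNIV h'"
 unfolding h'_def A_def B_def using pos by (intro continuous_intros) (auto simp: A_def B_def order_less_imp_not_eq2)
 have h01: "0 <= h t" "h t <= 1" for t using pos[of t] by (auto simp: h_def A_def B_def divide_le_eq)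
 have h1: "h t = 1" "h' t = 0" if "1 <= t" for t using that by (auto simp: h_def h'_def A_def B_def max_def)
 have h0: "h t = 0" "h' t = 0" if "t <= 0" for t using that by (auto simp: h_def h'_def A_def B_def max_def)
 have hb: "\<bar>h' t\<bar> <= 2" for t
 proof (cases "0 < t & t < 1")
 case True
 then have "A t = t^2" "B t = (1 - t)^2" "max 0 t = t" "max 0 (1 - t) = 1 - t" by (auto simp: A_def B_def)
 then have e: "h' t = 2 * t * (1 - t) / (t^2 + (1 - t)^2)^2"
 proof -
 have "2 * t * (1 - t)^2 + t^2 * (2 * (1 - t)) = 2 * t * (1 - t)" by (simp add: power2_eq_square algebra_simps)
 then show ?thesis unfolding h'_def \<open>A t = t^2\<close> \<open>B t = (1 - t)^2\<close> \<open>max 0 t = t\<close> \<open>max 0 (1 - t) = 1 - t\<close> by simp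
 qed
 have q: "1 / 2 <= t^2 + (1 - t)^2" using zero_le_power2[of "2 * t - 1"] by (simp add: power2_eq_square algebra_simps)
 have n: "2 * t * (1 - t) <= 1 / 2" using zero_le_power2[of "2 * t - 1"] by (simp add: power2_eq_square algebra_simps)
 have "(1 / 2)^2 <= (t^2 + (1 - t)^2)^2" by (intro power_mono q) simp
 then have "2 * t * (1 - t) <= 2 * (t^2 + (1 - t)^2)^2" using n by (simp add: power2_eq_square)
 moreover have "0 < (t^2 + (1 - t)^2)^2" using q by (intro zero_less_power) linarith
 ultimately have "h' t <= 2" unfolding e by (simp add: pos_divide_le_eq)
 moreover have "0 <= h' t" unfolding e using True by auto
 ultimately show ?thesis by simp
 qed (use h0 h1 in \<open>auto simp: not_less\<close>)
 have den: "0 < s^2 - r^2" using assms by (simp add: power_strict_mono)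
 define \<tau> where "\<tau> x = s^2 / (s^2 - r^2) + (- 1 / (s^2 - r^2)) * ((x - x0) \<bullet> (x - x0))" for x
 have \<tau>: "\<tau> x = (s^2 - (dist x0 x)^2) / (s^2 - r^2)" for x
 by (simp add: \<tau>_def dist_norm norm_minus_commute[of x0] power2_norm_eq_inner diff_divide_distrib)
 have C\<tau>: "C1 \<tau> (%x. 0 + (- 1 / (s^2 - r^2)) *. (2 *. (x - x0)))"
 unfolding \<tau>_def[abs_def] by (intro C1_add C1_const C1_scale C1_shift[OF C1_inner_self])
 have C: "C1 (%x. h (\<tau> x)) (%x. h' (\<tau> x) *. (0 + (- 1 / (s^2 - r^2)) *. (2 *. (x - x0))))"
 by (rule C1_compose[OF C\<tau> dh ch])
 have in1: "1 <= \<tau> x" if "x \<in> cball x0 r" for x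
 proof -
 have "(dist x0 x)^2 <= r^2" using that by (intro power_mono) auto
 then show ?thesis using den by (simp add: \<tau> le_divide_eq)
 qed
 have out0: "\<tau> x <= 0" if "x ~: cball x0 s" for x
 proof -
 have "s^2 <= (dist x0 x)^2" using that assms by (intro power_mono) auto
 then show ?thesis using den by (simp add: \<tau> divide_le_0_iff)
 qed
 have bd: "norm (h' (\<tau> x) *. (0 + (- 1 / (s^2 - r^2)) *. (2 *. (x - x0)))) <= 4 / (s - r)" for x
 proof (cases "x \<in> cball x0 s")
 case False
 then show ?thesis using h0(2)[OF out0] assms by simp
 next
 case True
 have "norm (h' (\<tau> x) *. (0 + (- 1 / (s^2 - r^2)) *. (2 *. (x - x0)))) = \<bar>h' (\<tau> x)\<bar> * (2 * dist x0 x / (s^2 - r^2))"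
 using den by (simp add: dist_norm norm_minus_commute abs_mult)
 also have "... <= 2 * (2 * s / (s^2 - r^2))"
 using True den assms by (intro mult_mono hb divide_right_mono) auto
 also have "... = 4 * (s / (s + r)) / (s - r)"
 using assms by (simp add: power2_eq_square field_simps)
 also have "... <= 4 * 1 / (s - r)" using assms by (intro divide_right_mono mult_left_mono) auto
 finally show ?thesis by simp
 qed
 show ?thesis
 by (rule that[OF C]) (use h01 h1 h0 in1 out0 bd in auto)
qed

lemma sob_affine:
 assumes "sob Om w G"
 shows "sob Om (%x. a * w x + b) (%x. a *. G x)"
 unfolding sob_def
proof (intro conjI allI impI)
 have [measurable]: "G \<in> bm" using assms by (simp add: sob_def)
 show "continuous_on Om (%x. a * w x + b)" using assms by (intro continuous_intros) (simp add: sob_def)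
 show "(%x. a *. G x) \<in> bm" by measurable
 fix K assume K: "compact K & K \<subseteq> Om"
 then have [measurable]: "K \<in> sets borel" by (simp add: borel_compact)
 obtain f D where fD: "!!n::nat. C1 (f n) (D n)" "uniform_limit K f w sequentially" "(%n. L2sq K (%x. D n x - G x)) ~~> 0"
 using assms K unfolding sob_def by blast
 note [measurable] = C1_measurable[OF fD(1)]
 have "C1 (%x. a * f n x + b) (%x. a *. D n x + 0)" for n by (intro C1_add C1_scale fD C1_const)
 moreover have "uniform_limit K (%n x. a * f n x + b) (%x. a * w x + b) sequentially"
 by (intro uniform_limit_intros bounded_linear.uniform_limit[OF bounded_linear_mult_right] fD(2))
 moreover have "(%n. L2sq K (%x. a *. (D n x - G x))) ~~> 0"
 by (rule L2sq_tendsto_bounded_scale[where M = "\<bar>a\<bar>"]) (use fD(3) in auto)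
 ultimately show "\<exists>f D. (\<forall>n. C1 (f n) (D n)) & uniform_limit K f (%x. a * w x + b) sequentially &
 (%n. L2sq K (%x. D n x - a *. G x)) ~~> 0"
 by (intro exI[of _ "%n x. a * f n x + b"] exI[of _ "%n x. a *. D n x"]) (simp add: scaleR_diff_right)
qed

text \<open>Multiples of either sign are allowed, so the class contains \<open>1 - v / a\<close>
  along with \<open>v\<close>. Lower bounds for solutions are obtained from upper bounds in this
  way.\<close>

lemma ellflux_affine:
 assumes "ellflux lam Lam Om w G F"
 shows "ellflux lam Lam Om (%x. a * w x + b) (%x. a *. G x) (%x. a *. F x)"
 unfolding ellflux_def
proof (intro conjI allI impI)
 show "AE x in lborel. x \<in> Om --> lam * (norm (a *. G x))^2 <= a *. F x \<bullet> a *. G x & norm (a *. F x) <= Lam * norm (a *. G x)"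
 proof -
 have "AE x in lborel. x \<in> Om --> lam * (norm (G x))^2 <= F x \<bullet> G x & norm (F x) <= Lam * norm (G x)"
 using assms by (simp add: ellflux_def)
 then show ?thesis
 proof (eventually_elim, intro impI)
 fix x assume x: "x \<in> Om --> lam * (norm (G x))^2 <= F x \<bullet> G x & norm (F x) <= Lam * norm (G x)" "x \<in> Om"
 then have "a^2 * (lam * (norm (G x))^2) <= a^2 * (F x \<bullet> G x)" "\<bar>a\<bar> * norm (F x) <= \<bar>a\<bar> * (Lam * norm (G x))"
 by (auto intro!: mult_left_mono)
 moreover have "lam * (norm (a *. G x))^2 = a^2 * (lam * (norm (G x))^2)" by (simp add: power_mult_distrib)
 moreover have "a *. F x \<bullet> a *. G x = a^2 * (F x \<bullet> G x)" by (simp add: power2_eq_square)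
 moreover have "norm (a *. F x) = \<bar>a\<bar> * norm (F x)" "Lam * norm (a *. G x) = \<bar>a\<bar> * (Lam * norm (G x))" by simp_all
 ultimately show "lam * (norm (a *. G x))^2 <= a *. F x \<bullet> a *. G x & norm (a *. F x) <= Lam * norm (a *. G x)"
 by metis
 qed
 qed
 show "(BI x. a *. F x \<bullet> D x) = 0" if "test_function Om f D" for f D
 using assms that by (auto simp: ellflux_def)
qed (use assms in \<open>auto simp: ellflux_def sob_affine\<close>)

lemma subsol_subset: "subsol lam Lam B W ==> open B' ==> B' \<subseteq> B ==> subsol lam Lam B' W"
 unfolding subsol_def by (blast intro: continuous_on_subset)

lemma subsol_truncate:
 assumes "subsol lam Lam B W" "0 <= k" "0 < a"
 shows "subsol lam Lam B (%x. a * max 0 (W x - k))"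
proof -
 have [measurable]: "W \<in> bm" using assms by (simp add: subsol_def)
 obtain Om w G F where e: "ellflux lam Lam Om w G F" "\<forall>x\<in>B. 0 < W x --> x \<in> Om & W x = w x"
 using assms by (auto simp: subsol_def)
 have "ellflux lam Lam Om (%x. a * w x + (- a * k)) (%x. a *. G x) (%x. a *. F x)"
 by (rule ellflux_affine[OF e(1)])
 moreover have "x \<in> Om & a * max 0 (W x - k) = a * w x + (- a * k)" if "x \<in> B" "0 < a * max 0 (W x - k)" for x
 using that e(2) assms(2,3) by (auto simp: zero_less_mult_iff max_def right_diff_distrib split: if_splits)
 ultimately show ?thesis
 using assms unfolding subsol_def by (intro conjI exI continuous_intros ballI) auto
qed

lemma ennreal_const_mult: "0 <= a ==> 0 <= b ==> 2 * (ennreal a * (ennreal b * X)) = ennreal (2 * a * b) * X"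
 by (simp add: ennreal_mult mult.assoc)

text \<open>Apart from the cutoff, the energy of \<open>(W - k)_+^2\<close> is
  \<open>4 (W - k)_+^2 |G|^2\<close>, a multiple of \<open>p' |G|^2\<close> for
  \<open>p(t) = (t - k)_+^3\<close>. The square replaces the usual first power because only C1
  compositions are available, so fourth powers become the quantity to iterate.\<close>

lemma truncation_energy:
 fixes W :: "'a::euclidean_space => real"
 assumes s: "subsol lam Lam B W" and "0 < lam" "0 < Lam"
 and eta: "C1 et Det" and K: "compact K" "K \<subseteq> B" "!!x. x ~: K ==> et x = 0" "!!x. x ~: K ==> Det x = 0"
 and k: "0 < k"
 shows "\<exists>L H. L \<subseteq> K & sob0 L (%x. indicator K x * (et x * (max 0 (W x - k))^2)) H &
 L2sq UNIV H <= ennreal (4 * Lam^2 / lam^2 + 2) * (NI x. ie K x ((norm (Det x))^2 * (max 0 (W x - k))^4))"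
proof -
 have B: "open B" and W: "continuous_on B W" and [measurable]: "W \<in> bm"
 using s by (auto simp: subsol_def)
 obtain Om w G F where e: "ellflux lam Lam Om w G F" and Ww: "!!x. x \<in> B ==> 0 < W x ==> x \<in> Om & W x = w x"
 using s by (auto simp: subsol_def)
 have w: "sob Om w G" using e by (simp add: ellflux_def)
 define L where "L = {x\<in>K. k / 2 <= W x}"
 have Lw: "x \<in> Om" "W x = w x" if "x \<in> L" for x
 using that Ww[of x] K(2) k by (auto simp: L_def)
 let ?q = "%t. (max 0 (t - k))^2" and ?q' = "%t. 2 * max 0 (t - k)"
 have dq: "DERIV ?q t :> ?q' t" for t
 using DERIV_pos_part_power[of 1 k t] by (simp add: power2_eq_square)
 define H where "H x = (if x \<in> L then (et x * ?q' (w x)) *. G x + ?q (w x) *. Det x else 0)" for x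
 have s0: "sob0 L (%x. if x \<in> L then et x * ?q (w x) else 0) H"
 unfolding H_def[abs_def]
 by (rule sob0_compose[OF w B W Ww eta K(1,2) K(3,4) k dq _ _ _ L_def]) (auto intro!: continuous_intros)
 have cL: "compact L" and [measurable]: "H \<in> bm" using sob0_D[OF s0] by auto
 have [measurable]: "L \<in> sets borel" "K \<in> sets borel" "G \<in> bm"
 using cL w K(1) by (auto simp: borel_compact sob_def)
 note [measurable] = C1_measurable[OF eta]
 let ?I = "\<integral>\<^sup>+x. ie K x ((norm (Det x))^2 * (max 0 (W x - k))^4) \<partial>lborel"
 have d3: "DERIV (%t. (max 0 (t - k))^3) t :> 3 * (max 0 (t - k))^2" for t
 using DERIV_pos_part_power[of 2 k t] by (simp add: power3_eq_cube power2_eq_square mult_ac)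
 have EI: "(NI x. ie L x ((et x)^2 * (3 * (max 0 (w x - k))^2) * (norm (G x))^2))
 <= ennreal (4 * Lam^2 * (1 / 3) / lam^2) * (NI x. ie L x ((norm (Det x))^2 * (?q (w x))^2))"
 proof (rule energy_inequality[OF e assms(2,3) B W Ww eta K(1,2) K(3,4) k d3 _ _ _ L_def, where T = UNIV])
 show "((max 0 (t - k)) ^ 3)^2 <= 1 / 3 * (3 * (max 0 (t - k))^2) * ((max 0 (t - k))^2)^2" for t
 by (simp add: power_mult[symmetric] power_add[symmetric])
 qed (auto intro!: continuous_intros)
 have L4: "(NI x. ie L x ((norm (Det x))^2 * (?q (w x))^2)) <= ?I"
 using Lw(2) by (intro nn_integral_mono) (auto split: split_indicator simp: L_def power_mult[symmetric])
 define H1 where "H1 x = (if x \<in> L then (et x * ?q' (W x)) *. G x else 0)" for x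
 define H2 where "H2 x = (if x \<in> L then ?q (W x) *. Det x else 0)" for x
 have [measurable]: "H1 \<in> bm" "H2 \<in> bm" unfolding H1_def H2_def by measurable
 have "L2sq UNIV H = L2sq UNIV (%x. H1 x + H2 x)"
 using Lw(2) unfolding L2sq_def by (intro nn_integral_cong) (auto simp: H_def H1_def H2_def)
 also have "... <= 2 * L2sq UNIV H1 + 2 * L2sq UNIV H2" by (rule L2sq_add) auto
 also have "L2sq UNIV H1 = (NI x. ennreal (4 / 3) * (ie L x ((et x)^2 * (3 * (max 0 (W x - k))^2) * (norm (G x))^2)))"
 unfolding L2sq_def by (intro nn_integral_cong) (auto split: split_indicator simp: H1_def power_mult_distrib simp flip: ennreal_mult)
 also have "... = ennreal (4 / 3) * (NI x. ie L x ((et x)^2 * (3 * (max 0 (W x - k))^2) * (norm (G x))^2))"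
 by (rule nn_integral_cmult) measurable
 also have "(NI x. ie L x ((et x)^2 * (3 * (max 0 (W x - k))^2) * (norm (G x))^2))
 = (NI x. ie L x ((et x)^2 * (3 * (max 0 (w x - k))^2) * (norm (G x))^2))"
 using Lw(2) by (intro nn_integral_cong) (auto split: split_indicator)
 finally have 1: "L2sq UNIV H <= 2 * (ennreal (4 / 3) * (NI x. ie L x ((et x)^2 * (3 * (max 0 (w x - k))^2) * (norm (G x))^2))) + 2 * L2sq UNIV H2" .
 have 2: "L2sq UNIV H2 <= ?I"
 unfolding L2sq_def
 by (intro nn_integral_mono) (auto split: split_indicator simp: H2_def L_def power_mult_distrib power_mult[symmetric] mult.commute)
 have "L2sq UNIV H <= 2 * (ennreal (4 / 3) * (ennreal (4 * Lam^2 * (1 / 3) / lam^2) * ?I)) + 2 * ?I"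
 by (rule order_trans[OF 1 add_mono[OF mult_left_mono[OF mult_left_mono[OF order_trans[OF EI mult_left_mono[OF L4]]]] mult_left_mono[OF 2]]]) auto
 also have "2 * (ennreal (4 / 3) * (ennreal (4 * Lam^2 * (1 / 3) / lam^2) * ?I)) + 2 * ?I = (ennreal (2 * (4 / 3) * (4 * Lam^2 * (1 / 3) / lam^2)) + ennreal 2) * ?I"
 by (subst ennreal_const_mult) (auto simp: distrib_right)
 also have "ennreal (2 * (4 / 3) * (4 * Lam^2 * (1 / 3) / lam^2)) + ennreal 2 = ennreal (2 * (4 / 3) * (4 * Lam^2 * (1 / 3) / lam^2) + 2)"
 by (rule ennreal_plus[symmetric]) auto
 also have "... * ?I <= ennreal (4 * Lam^2 / lam^2 + 2) * ?I"
 using \<open>0 < lam\<close> by (intro mult_right_mono ennreal_leI add_mono) (auto simp: field_simps)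
 finally have fin: "L2sq UNIV H <= ennreal (4 * Lam^2 / lam^2 + 2) * ?I" .
 have "(%x. if x \<in> L then et x * ?q (w x) else 0) = (%x. indicator K x * (et x * (max 0 (W x - k))^2))"
 proof
 fix x
 show "(if x \<in> L then et x * ?q (w x) else 0) = indicator K x * (et x * (max 0 (W x - k))^2)"
 using Lw(2)[of x] k by (cases "x \<in> L") (auto simp: L_def split: split_indicator)
 qed
 with s0 fin show ?thesis by (intro exI[of _ L] exI[of _ H]) (auto simp: L_def)
qed

section \<open>De Giorgi iteration\<close>

lemma emeasure_ball_scale:
 fixes x0 :: "'a::euclidean_space"
 assumes "0 <= r"
 shows "emeasure lborel (ball x0 r) = ennreal (r ^ DIM('a) * measure lborel (ball (0::'a) 1))"
 using content_ball_conv_unit_ball[OF assms, of x0] emeasure_lborel_ball_finite[of x0 r]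
 by (simp add: emeasure_eq_ennreal_measure less_top)

lemma content_unit_ball_pos: "0 < measure lborel (ball (0::'a::euclidean_space) 1)"
 by (rule content_ball_pos) simp

text \<open>Chebyshev bounds the measure of the set where \<open>W\<close> exceeds \<open>k2\<close>
  by \<open>Y / (k2 - k1)^4\<close>. In the Nash inequality the squared L1 norm is at most that
  measure times the squared L2 norm, and the hypothesis on \<open>r\<close> lets it be absorbed,
  leaving \<open>2 r^2\<close> times the energy. A small \<open>Y\<close> permits a small
  \<open>r\<close>, which is the gain.\<close>

lemma de_giorgi_step:
 fixes W :: "'a::euclidean_space => real"
 assumes s: "subsol lam Lam (ball x0 R) W" and lam: "0 < lam" "0 < Lam"
 and R: "0 < R2" "R2 < R1" "R1 <= R" and W1: "!!x. x \<in> ball x0 R ==> W x <= 1"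
 and k: "0 < k1" "k1 < k2" 
 and Y: "(NI x. ie (ball x0 R1) x ((max 0 (W x - k1))^4)) <= ennreal Y"
 and r: "0 < r" "2 * (Y / (k2 - k1)^4) <= r ^ DIM('a) * measure lborel (ball (0::'a) 1)" and "0 <= Y"
 shows "(NI x. ie (ball x0 R2) x ((max 0 (W x - k2))^4))
 <= ennreal (2 * r^2 * ((4 * Lam^2 / lam^2 + 2) * (8 / (R1 - R2))^2 * Y))"
proof -
 have [measurable]: "W \<in> bm" using s by (auto simp: subsol_def)
 have [measurable]: "ball x0 R1 \<in> sets borel" "ball x0 R2 \<in> sets borel" by simp_all
 define s' where "s' = (R1 + R2) / 2"
 have s': "R2 < s'" "s' < R1" "s' - R2 = (R1 - R2) / 2" using R by (auto simp: s'_def field_simps)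
 obtain et Det where eta: "C1 et Det" "!!x. 0 <= et x" "!!x. et x <= 1" "!!x. x \<in> cball x0 R2 ==> et x = 1" 
 "!!x. x ~: cball x0 s' ==> et x = 0" "!!x. x ~: cball x0 s' ==> Det x = 0" "!!x. norm (Det x) <= 4 / (s' - R2)"
 using radial_cutoff[OF R(1) s'(1), of x0] by metis
 have etab: "norm (Det x) <= 8 / (R1 - R2)" for x using eta(7)[of x] s'(3) by simp
 let ?K = "cball x0 s'"
 have KB: "?K \<subseteq> ball x0 R" "?K \<subseteq> ball x0 R1" using s' R by auto
 define P where "P x = indicator ?K x * (et x * (max 0 (W x - k2))^2)" for x
 obtain L H where LH: "sob0 L P H" "L2sq UNIV H <= ennreal (4 * Lam^2 / lam^2 + 2) * (NI x. indicator ?K x * ennreal ((norm (Det x))^2 * (max 0 (W x - k2))^4))"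
 using truncation_energy[OF s lam eta(1) compact_cball KB(1) eta(5,6), of k2] k unfolding P_def[abs_def] by auto
 have [measurable]: "P \<in> bm" using sob0_D[OF LH(1)] by simp
 define c where "c = 4 * Lam^2 / lam^2 + 2"
 have c: "0 <= c" using lam by (simp add: c_def)
 define E where "E = c * (8 / (R1 - R2))^2 * Y"
 have E0: "0 <= E" using c \<open>0 <= Y\<close> by (simp add: E_def)
 have E: "L2sq UNIV H <= ennreal E"
 proof -
 have "(NI x. indicator ?K x * ennreal ((norm (Det x))^2 * (max 0 (W x - k2))^4))
 <= (NI x. ennreal ((8 / (R1 - R2))^2) * (ie (ball x0 R1) x ((max 0 (W x - k1))^4)))"
 proof (intro nn_integral_mono)
 fix x
 have "(norm (Det x))^2 <= (8 / (R1 - R2))^2" by (intro power_mono etab) simp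
 moreover have "(max 0 (W x - k2))^4 <= (max 0 (W x - k1))^4" using k by (intro power_mono) auto
 ultimately have "(norm (Det x))^2 * (max 0 (W x - k2))^4 <= (8 / (R1 - R2))^2 * (max 0 (W x - k1))^4"
 by (intro mult_mono) auto
 then show "indicator ?K x * ennreal ((norm (Det x))^2 * (max 0 (W x - k2))^4) <= ennreal ((8 / (R1 - R2))^2) * (ie (ball x0 R1) x ((max 0 (W x - k1))^4))"
 using KB(2) by (auto split: split_indicator intro!: ennreal_leI simp flip: ennreal_mult)
 qed
 also have "... = ennreal ((8 / (R1 - R2))^2) * (NI x. ie (ball x0 R1) x ((max 0 (W x - k1))^4))"
 by (rule nn_integral_cmult) measurable
 also have "... <= ennreal ((8 / (R1 - R2))^2) * ennreal Y" by (intro mult_left_mono Y) simp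
 finally have "L2sq UNIV H <= ennreal c * (ennreal ((8 / (R1 - R2))^2) * ennreal Y)"
 using LH(2) unfolding c_def by (meson mult_left_mono order_trans zero_le)
 also have "... = ennreal E" using c \<open>0 <= Y\<close> by (simp add: E_def mult.assoc flip: ennreal_mult)
 finally show ?thesis .
 qed
 define S where "S = {x \<in> ball x0 R1. k2 < W x}"
 have [measurable]: "S \<in> sets borel" unfolding S_def by measurable
 have PS: "P x = 0" if "x ~: S" for x using that KB(2) by (auto simp: P_def S_def split: split_indicator)
 define \<sigma> where "\<sigma> = Y / (k2 - k1)^4"
 have \<sigma>0: "0 <= \<sigma>" using \<open>0 <= Y\<close> by (simp add: \<sigma>_def)
 have \<sigma>: "emeasure lborel S <= ennreal \<sigma>"
 proof -
 have "ennreal ((k2 - k1)^4) * emeasure lborel S = (NI x. ennreal ((k2 - k1)^4) * indicator S x)"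
 by (simp add: nn_integral_cmult_indicator)
 also have "... <= (NI x. ie (ball x0 R1) x ((max 0 (W x - k1))^4))"
 using k by (intro nn_integral_mono) (auto simp: S_def split: split_indicator intro!: ennreal_leI power_mono)
 also have "... <= ennreal Y" by (rule Y)
 also have "... = ennreal ((k2 - k1)^4) * ennreal \<sigma>" using k \<sigma>0 by (simp add: \<sigma>_def flip: ennreal_mult)
 finally show ?thesis using k by (subst (asm) ennreal_mult_le_mult_iff) auto
 qed
 define I where "I = (NI x. ennreal ((P x)^2))"
 have P1: "\<bar>P x\<bar> <= 1" for x
 proof (cases "x \<in> ?K")
 case True
 have "max 0 (W x - k2) <= 1" using W1[of x] True KB(1) k by auto
 then have "(max 0 (W x - k2))^2 <= 1" by (simp add: power_le_one)
 then show ?thesis using True eta(2,3)[of x] by (simp add: P_def abs_mult mult_le_one)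
 qed (simp add: P_def)
 have Ifin: "I < \<infinity>"
 proof -
 have "I <= (NI x. indicator S x)"
 unfolding I_def
 proof (intro nn_integral_mono)
 fix x
 have "(P x)^2 <= 1" using P1[of x] by (simp add: abs_square_le_1)
 then show "ennreal ((P x)^2) <= indicator S x" using PS[of x] by (cases "x \<in> S") auto
 qed
 also have "... < \<infinity>" using \<sigma> by (auto simp: le_less_trans)
 finally show ?thesis .
 qed
 define i where "i = enn2real I"
 have i: "I = ennreal i" "0 <= i" using Ifin by (auto simp: i_def less_top)
 define mr where "mr = r ^ DIM('a) * measure lborel (ball (0::'a) 1)"
 have mr: "emeasure lborel (ball (0::'a) r) = ennreal mr" "0 < mr"
 using r content_unit_ball_pos[where 'a='a] by (auto simp: mr_def emeasure_ball_scale)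
 have J: "(NI x. ennreal \<bar>P x\<bar>)^2 <= ennreal (\<sigma> * i)"
 proof -
 have "(NI x. ennreal \<bar>P x\<bar>) = (NI x. indicator S x * ennreal \<bar>P x\<bar>)"
 using PS by (intro nn_integral_cong) (auto split: split_indicator)
 then have "(NI x. ennreal \<bar>P x\<bar>)^2 <= (NI x. (indicator S x)^2) * (NI x. (ennreal \<bar>P x\<bar>)^2)"
 by (simp add: Cauchy_Schwarz_nn_integral)
 also have "(NI x. (indicator S x)^2) = (NI x. indicator S x)"
 by (intro nn_integral_cong) (auto split: split_indicator)
 also have "... = emeasure lborel S" by simp
 also have "(NI x. (ennreal \<bar>P x\<bar>)^2) = I"
 unfolding I_def by (intro nn_integral_cong) (simp add: ennreal_power)
 also have "emeasure lborel S * I <= ennreal \<sigma> * ennreal i" unfolding i(1) by (intro mult_right_mono \<sigma>) simp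
 also have "... = ennreal (\<sigma> * i)" using \<sigma>0 i by (simp add: ennreal_mult)
 finally show ?thesis .
 qed
 have "ennreal (mr * i) = emeasure lborel (ball (0::'a) r) * I" using mr i by (simp add: ennreal_mult)
 also have "... <= emeasure lborel (ball (0::'a) r) * ennreal (r^2) * L2sq UNIV H + (NI x. ennreal \<bar>P x\<bar>)^2"
 unfolding I_def by (rule sob0_nash[OF LH(1) r(1)])
 also have "... <= ennreal mr * ennreal (r^2) * ennreal E + ennreal (\<sigma> * i)"
 unfolding mr(1) by (intro add_mono mult_left_mono E J) auto
 also have "... = ennreal (mr * r^2 * E + \<sigma> * i)"
 using mr E0 \<sigma>0 i by (simp add: ennreal_mult ennreal_plus)
 finally have "mr * i <= mr * r^2 * E + \<sigma> * i"
 using mr E0 \<sigma>0 i by (subst (asm) ennreal_le_iff) auto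
 moreover have "2 * \<sigma> <= mr" using r(2) by (simp add: \<sigma>_def mr_def)
 then have "2 * \<sigma> * i <= mr * i" using i by (intro mult_right_mono) auto
 ultimately have "mr * i <= mr * (2 * r^2 * E)" by (simp add: algebra_simps)
 then have iE: "i <= 2 * r^2 * E" using mr by simp
 have "(NI x. ie (ball x0 R2) x ((max 0 (W x - k2))^4)) <= I"
 unfolding I_def
 proof (intro nn_integral_mono)
 fix x
 show "ie (ball x0 R2) x ((max 0 (W x - k2))^4) <= ennreal ((P x)^2)"
 proof (cases "x \<in> ball x0 R2")
 case True
 then have "x \<in> ?K" "et x = 1" using s' eta(4)[of x] by auto
 then show ?thesis using True by (simp add: P_def power_mult[symmetric])
 qed simp
 qed
 also have "... <= ennreal (2 * r^2 * E)" unfolding i(1) by (intro ennreal_leI iE)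
 finally show ?thesis by (simp add: E_def c_def)
qed

text \<open>The integrals over shrinking balls at rising levels are shown to decay like
  \<open>q^j\<close> by a plain induction. In the limit nothing is left above level 1/2 in the half
  ball, and continuity of \<open>W\<close> turns this into a statement about every point.\<close>

lemma de_giorgi_small_measure:
 assumes lam: "0 < lam" "0 < Lam"
 shows "\<exists>\<nu>>0. \<forall>(x0 :: 'a::euclidean_space) R W. 0 < R --> subsol lam Lam (ball x0 R) W --> (\<forall>x\<in>ball x0 R. W x <= 1) -->
 emeasure lborel {x\<in>ball x0 R. 0 < W x} <= ennreal (\<nu> * (R ^ DIM('a) * measure lborel (ball (0::'a) 1))) -->
 (\<forall>x\<in>ball x0 (R / 2). W x <= 1 / 2)"
proof -
 define n where "n = DIM('a)"
 define c where "c = 4 * Lam^2 / lam^2 + 2"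
 have c: "0 < c" using lam by (simp add: c_def add_nonneg_pos)
 \<comment> \<open>The factor 1/16 offsets the fourth power of the level gap, which halves at each
   stage; \<open>(1/2)^n\<close> matches the volume of the Nash ball, whose radius also halves. Then
   \<open>r0\<close> makes one step multiply the bound by exactly \<open>q\<close>, and
   \<open>\<nu>\<close> makes the radius condition of the step hold with equality.\<close>
 define q where "q = (1 / 2) ^ n / (16::real)"
 have q: "0 < q" "q < 1" by (auto simp: q_def intro: le_less_trans[of _ 1] simp: power_le_one)
 define r0 where "r0 = sqrt (q / (2 * c * 2 ^ 10))"
 have r0: "0 < r0" "2 * c * 2 ^ 10 * r0^2 = q" using q c by (auto simp: r0_def)
 define \<nu> where "\<nu> = r0 ^ n / 2 ^ 13"
 have \<nu>: "0 < \<nu>" using r0 by (simp add: \<nu>_def)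
 show ?thesis
 proof (intro exI[of _ \<nu>] conjI allI impI ballI \<nu>)
 fix x0 :: 'a and R :: real and W x
 assume R: "0 < R" and s: "subsol lam Lam (ball x0 R) W" and W1: "\<forall>x\<in>ball x0 R. W x <= 1"
 and small: "emeasure lborel {x\<in>ball x0 R. 0 < W x} <= ennreal (\<nu> * (R ^ DIM('a) * measure lborel (ball (0::'a) 1)))"
 and x: "x \<in> ball x0 (R / 2)"
 have [measurable]: "W \<in> bm" using s by (auto simp: subsol_def)
 define om where "om = measure lborel (ball (0::'a) 1)"
 have om: "0 < om" unfolding om_def by (rule content_unit_ball_pos)
 define Rj where "Rj j = R * (1 / 2 + (1 / 2) ^ Suc j)" for j :: nat
 define k where "k j = 1 / 2 - (1 / 2 :: real) ^ (j + 2)" for j :: nat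
 define Y where "Y j = \<nu> * q ^ j * (R ^ n * om)" for j :: nat
 have Y0: "0 <= Y j" for j using \<nu> q R om by (simp add: Y_def)
 have kpos: "0 < k j" for j
 proof -
 have "(1 / 2 :: real) ^ j <= 1" by (simp add: power_le_one)
 then show ?thesis by (simp add: k_def power_add)
 qed
 have main: "(NI x. indicator (ball x0 (Rj j)) x * ennreal ((max 0 (W x - k j))^4)) <= ennreal (Y j)" for j
 proof (induction j)
 case 0
 have "(NI x. indicator (ball x0 (Rj 0)) x * ennreal ((max 0 (W x - k 0))^4)) <= (NI x. indicator {x\<in>ball x0 R. 0 < W x} x)"
 proof (intro nn_integral_mono)
 fix x
 show "indicator (ball x0 (Rj 0)) x * ennreal ((max 0 (W x - k 0))^4) <= indicator {x\<in>ball x0 R. 0 < W x} x"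
 proof (cases "x \<in> ball x0 R & 0 < W x")
 case True
 then have "max 0 (W x - k 0) <= 1" using W1 kpos[of 0] by (auto simp: max_def dest!: bspec[of _ _ x])
 then have "(max 0 (W x - k 0))^4 <= 1" by (intro power_le_one) auto
 then show ?thesis using True by (auto split: split_indicator)
 next
 case False
 then show ?thesis using kpos[of 0] by (auto simp: Rj_def max_def split: split_indicator)
 qed
 qed
 also have "... = emeasure lborel {x\<in>ball x0 R. 0 < W x}" by (subst nn_integral_indicator) auto
 also have "... <= ennreal (Y 0)" using small by (simp add: Y_def n_def om_def)
 finally show ?case .
 next
 case (Suc j)
 define r where "r = R * r0 * (1 / 2) ^ j"
 have dR: "Rj j - Rj (Suc j) = R * (1 / 2) ^ (j + 2)" by (simp add: Rj_def field_simps)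
 have dk: "k (Suc j) - k j = (1 / 2) ^ (j + 3)" by (simp add: k_def power_add field_simps)
 have "(NI x. indicator (ball x0 (Rj (Suc j))) x * ennreal ((max 0 (W x - k (Suc j)))^4))
 <= ennreal (2 * r^2 * ((4 * Lam^2 / lam^2 + 2) * (8 / (Rj j - Rj (Suc j)))^2 * Y j))"
 proof (rule de_giorgi_step[OF s lam _ _ _ _ kpos _ Suc.IH])
 show "0 < Rj (Suc j)" using R by (simp add: Rj_def add_pos_pos)
 have "0 < R * (1 / 2) ^ (j + 2)" using R by simp
 then show "Rj (Suc j) < Rj j" using dR by linarith
 have "(1 / 2 :: real) ^ Suc j <= 1 / 2" by (simp add: power_le_one)
 then have "1 / 2 + (1 / 2 :: real) ^ Suc j <= 1" by linarith
 then show "Rj j <= R" using R mult_left_mono[of "1 / 2 + (1 / 2 :: real) ^ Suc j" 1 R] by (simp add: Rj_def)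
 show "k j < k (Suc j)" using dk by (metis diff_gt_0_iff_gt zero_less_divide_1_iff zero_less_numeral zero_less_power)
 show "0 < r" using R r0 by (simp add: r_def)
 have "2 * (Y j / (k (Suc j) - k j)^4) = 2 * (\<nu> * q ^ j * (R ^ n * om)) * (2 ^ (j + 3)) ^ 4"
 unfolding dk Y_def by (simp add: power_one_over power_add field_simps)
 also have "(2 ^ (j + 3)) ^ 4 = (16 ^ j * 2 ^ 12 :: real)"
 by (simp add: power_mult[symmetric] power_add power_mult_distrib mult.commute[of _ 4] power_mult)
 also have "2 * (\<nu> * q ^ j * (R ^ n * om)) * (16 ^ j * 2 ^ 12) = (2 ^ 13 * \<nu>) * (16 * q) ^ j * (R ^ n * om)"
 by (simp add: power_mult_distrib)
 also have "16 * q = (1 / 2) ^ n" by (simp add: q_def)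
 also have "2 ^ 13 * \<nu> = r0 ^ n" by (simp add: \<nu>_def)
 also have "r0 ^ n * ((1 / 2) ^ n) ^ j * (R ^ n * om) = r ^ DIM('a) * measure lborel (ball (0::'a) 1)"
 by (simp add: r_def n_def om_def power_mult_distrib power_mult[symmetric] mult_ac)
 finally show "2 * (Y j / (k (Suc j) - k j) ^ 4) <= r ^ DIM('a) * measure lborel (ball (0::'a) 1)" by simp
 qed (use W1 Y0 in auto)
 also have "2 * r^2 * ((4 * Lam^2 / lam^2 + 2) * (8 / (Rj j - Rj (Suc j)))^2 * Y j) = Y (Suc j)"
 proof -
 have "8 / (Rj j - Rj (Suc j)) = 2 ^ (j + 5) / R"
 unfolding dR using R by (simp add: power_add power_one_over field_simps)
 then have "r * (8 / (Rj j - Rj (Suc j))) = (R * r0 * (1 / 2) ^ j) * (2 ^ (j + 5) / R)" by (simp only: r_def)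
 also have "... = r0 * 2 ^ 5" using R by (simp add: power_add power_one_over field_simps)
 finally have "r * (8 / (Rj j - Rj (Suc j))) = r0 * 2 ^ 5" .
 then have "(r * (8 / (Rj j - Rj (Suc j))))^2 = (r0 * 2 ^ 5)^2" by (rule arg_cong)
 then have e: "r^2 * (8 / (Rj j - Rj (Suc j)))^2 = r0^2 * 2 ^ 10"
 unfolding power_mult_distrib[symmetric, of r] by (simp add: power_mult_distrib)
 have "2 * r^2 * (c * (8 / (Rj j - Rj (Suc j)))^2 * Y j) = 2 * c * (r^2 * (8 / (Rj j - Rj (Suc j)))^2) * Y j"
 by (simp only: mult_ac)
 also have "... = 2 * c * 2 ^ 10 * r0^2 * Y j" unfolding e by (simp only: mult_ac)
 also have "... = Y (Suc j)" unfolding r0(2) by (simp add: Y_def)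
 finally show ?thesis by (simp add: c_def)
 qed
 finally show ?case .
 qed
 show "W x <= 1 / 2"
 proof (rule ccontr)
 assume "\<not> W x <= 1 / 2"
 define a where "a = (W x - 1 / 2) / 2"
 have a: "0 < a" "1 / 2 + a < W x" using \<open>\<not> W x <= 1 / 2\<close> by (auto simp: a_def field_simps)
 have "continuous_on (ball x0 (R / 2)) W"
 using s R by (auto simp: subsol_def intro: continuous_on_subset)
 then have op: "open (ball x0 (R / 2) \<inter> W -` {1 / 2 + a <..})"
 by (intro continuous_open_preimage) auto
 have "x \<in> ball x0 (R / 2) \<inter> W -` {1 / 2 + a <..}" using x a by simp
 with op obtain d where d: "0 < d" "ball x d \<subseteq> ball x0 (R / 2) \<inter> W -` {1 / 2 + a <..}"
 by (rule openE)
 have le: "ennreal (a ^ 4 * (d ^ n * om)) <= ennreal (Y j)" for j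
 proof -
 have "ennreal (a ^ 4 * (d ^ n * om)) = (NI y. ennreal (a ^ 4) * indicator (ball x d) y)"
 using d a om by (simp add: nn_integral_cmult_indicator emeasure_ball_scale n_def om_def ennreal_mult)
 also have "... <= (NI y. indicator (ball x0 (Rj j)) y * ennreal ((max 0 (W y - k j))^4))"
 proof (intro nn_integral_mono)
 fix y
 show "ennreal (a ^ 4) * indicator (ball x d) y <= indicator (ball x0 (Rj j)) y * ennreal ((max 0 (W y - k j))^4)"
 proof (cases "y \<in> ball x d")
 case True
 then have y: "y \<in> ball x0 (R / 2)" "1 / 2 + a < W y" using d(2) by auto
 have "R / 2 <= Rj j" using R by (simp add: Rj_def algebra_simps)
 then have "y \<in> ball x0 (Rj j)" using y(1) by auto
 moreover have "a <= max 0 (W y - k j)"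
 proof -
 have "k j <= 1 / 2" by (simp add: k_def)
 then show ?thesis using y(2) by linarith
 qed
 ultimately show ?thesis using True a by (auto intro!: ennreal_leI power_mono)
 qed simp
 qed
 also have "... <= ennreal (Y j)" by (rule main)
 finally show ?thesis .
 qed
 have "Y ~~> \<nu> * 0 * (R ^ n * om)" unfolding Y_def using q by (intro tendsto_intros LIMSEQ_power_zero) auto
 moreover have "a ^ 4 * (d ^ n * om) <= Y j" for j using le[of j] Y0[of j] by (simp add: ennreal_le_iff)
 ultimately have "a ^ 4 * (d ^ n * om) <= \<nu> * 0 * (R ^ n * om)"
 by (intro LIMSEQ_le_const[of Y]) auto
 moreover have "0 < a ^ 4 * (d ^ n * om)" using a d om by simp
 ultimately show False by simp
 qed
 qed
qed

text \<open>\<open>l\<close> is a C1 variant of \<open>ln (1 / (1 + d - t))\<close> started at 1/4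
  and continued linearly beyond 1. Its companion \<beta>, which behaves like
  \<open>1 / (1 + d - t)\<close>, is the function to test with: \<open>l'^2 \<le> \<beta>'\<close>
  turns the energy estimate with \<open>m = 1\<close> into a gradient bound for \<open>l(w)\<close>
  independent of \<open>d\<close>, while \<open>l\<close> grows like \<open>ln (1 / d)\<close> near
  1.\<close>

lemma log_truncation:
 fixes d :: real
 assumes d: "0 < d" "d <= 1 / 4"
 obtains \<beta> \<beta>' l l' :: "real => real" where
 "!!t. DERIV \<beta> t :> \<beta>' t" "continuous_on UNIV \<beta>'" "!!t. t <= 1 / 4 ==> \<beta> t = 0" "!!t. t <= 1 / 4 ==> \<beta>' t = 0"
 "!!t. DERIV l t :> l' t" "continuous_on UNIV l'" "!!t. t <= 1 / 4 ==> l t = 0" "!!t. t <= 1 / 4 ==> l' t = 0"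
 "!!t. t <= 1 ==> 0 <= \<beta>' t" "!!t. t <= 1 ==> (\<beta> t)^2 <= \<beta>' t" "!!t. t <= 1 ==> (l' t)^2 <= \<beta>' t"
 "!!t. 1 - d < t ==> t <= 1 ==> 3 / 4 * ln (3 / (8 * d)) - 3 / 4 <= l t"
proof -
 define s where "s t = max 0 (t - 1 / 4)" for t :: real
 define \<beta>0 where "\<beta>0 t = (s t)^2 / (1 + d - t)" for t
 define \<beta>0' where "\<beta>0' t = (2 * s t * (1 + d - t) + (s t)^2) / (1 + d - t)^2" for t
 define \<beta> where "\<beta> t = (if t <= 1 then \<beta>0 t else \<beta>0 1 + \<beta>0' 1 * (t - 1))" for t
 define \<beta>' where "\<beta>' t = \<beta>0' (min t 1)" for t
 define g where "g t = (3 / 4 + d) * (ln (3 / 4 + d) - ln (1 + d - t)) - (t - 1 / 4)" for t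
 define g' where "g' t = (t - 1 / 4) / (1 + d - t)" for t
 define l1 where "l1 t = (if t <= 1 then g t else g 1 + g' 1 * (t - 1))" for t
 define l where "l t = (if t <= 1 / 4 then 0 else l1 t)" for t
 define l' where "l' t = s (min t 1) / (1 + d - min t 1)" for t
 have ds: "DERIV (%t. (s t)^2) t :> 2 * s t" for t
 using DERIV_pos_part_power[of 1 "1 / 4" t] by (simp add: s_def[abs_def] power2_eq_square)
 have d\<beta>0: "DERIV \<beta>0 t :> \<beta>0' t" if "t <= 1" for t
 proof -
 have "DERIV (%t. (s t)^2 / (1 + d - t)) t :> ((2 * s t) * (1 + d - t) - (s t)^2 * (- 1)) / ((1 + d - t) * (1 + d - t))"
 by (intro DERIV_divide ds) (use that d in \<open>auto intro!: derivative_eq_intros\<close>)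
 then show ?thesis by (simp add: \<beta>0_def[abs_def] \<beta>0'_def power2_eq_square)
 qed
 have 1: "DERIV \<beta> t :> \<beta>' t" for t
 proof -
 have "DERIV (%t. if t <= 1 then \<beta>0 t else \<beta>0 1 + \<beta>0' 1 * (t - 1)) t :> (if t <= 1 then \<beta>0' t else \<beta>0' 1)"
 by (rule DERIV_If[where g' = "%_. \<beta>0' 1", OF d\<beta>0]) (auto intro!: derivative_eq_intros)
 moreover have "(if t <= 1 then \<beta>0' t else \<beta>0' 1) = \<beta>' t" by (simp add: \<beta>'_def min_def)
 ultimately show ?thesis by (simp only: \<beta>_def[abs_def])
 qed
 have dg: "DERIV g t :> g' t" if "t <= 1" for t
 proof -
 have "DERIV g t :> (3 / 4 + d) * (0 - (- 1) / (1 + d - t)) - 1"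
 unfolding g_def[abs_def] using that d by (auto intro!: derivative_eq_intros)
 also have "(3 / 4 + d) * (0 - (- 1) / (1 + d - t)) - 1 = g' t" using that d by (simp add: g'_def field_simps)
 finally show ?thesis .
 qed
 have dl1: "DERIV l1 t :> (if t <= 1 then g' t else g' 1)" for t
 unfolding l1_def[abs_def]
 by (rule DERIV_If[where g' = "%_. g' 1", OF dg]) (auto intro!: derivative_eq_intros)
 have g0: "g (1 / 4) = 0" "g' (1 / 4) = 0" by (simp_all add: g_def g'_def)
 have 5: "DERIV l t :> l' t" for t
 proof -
 have "DERIV (%t. if t <= 1 / 4 then 0 else l1 t) t :> (if t <= 1 / 4 then 0 else (if t <= 1 then g' t else g' 1))"
 by (rule DERIV_If[where f' = "%_. 0", OF _ dl1]) (auto simp: l1_def g0)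
 moreover have "(if t <= 1 / 4 then 0 else (if t <= 1 then g' t else g' 1)) = l' t"
 by (auto simp: l'_def s_def g'_def min_def max_def)
 ultimately show ?thesis by (simp only: l_def[abs_def])
 qed
 have 2: "continuous_on UNIV \<beta>'" unfolding \<beta>'_def \<beta>0'_def s_def using d by (intro continuous_intros) (auto simp: min_def)
 have 6: "continuous_on UNIV l'" unfolding l'_def s_def using d by (intro continuous_intros) (auto simp: min_def)
 have v: "0 < 1 + d - t" if "t <= 1" for t using that d by simp
 have ldb: "(l' t)^2 <= \<beta>' t" if t: "t <= 1" for t
 proof -
 have "(s t)^2 <= 2 * s t * (1 + d - t) + (s t)^2" using v[OF t] by (simp add: s_def)
 then have "(s t)^2 / (1 + d - t)^2 <= (2 * s t * (1 + d - t) + (s t)^2) / (1 + d - t)^2" by (rule divide_right_mono) simp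
 then show ?thesis using t by (simp add: l'_def \<beta>'_def \<beta>0'_def power_divide)
 qed
 have bdb: "(\<beta> t)^2 <= \<beta>' t" if t: "t <= 1" for t
 proof -
 have s1: "0 <= s t" "s t <= 1" using t by (auto simp: s_def)
 have "(\<beta> t)^2 = (s t)^2 * (l' t)^2" using t by (simp add: \<beta>_def \<beta>0_def l'_def power2_eq_square)
 also have "... <= 1 * (l' t)^2" using s1 by (intro mult_right_mono) (auto simp: power_le_one)
 finally show ?thesis using ldb[OF t] by simp
 qed
 have big: "3 / 4 * ln (3 / (8 * d)) - 3 / 4 <= l t" if t: "1 - d < t" "t <= 1" for t
 proof -
 have "3 / (8 * d) <= (3 / 4 + d) / (1 + d - t)" using t d by (simp add: field_simps add_increasing2)
 then have "ln (3 / (8 * d)) <= ln ((3 / 4 + d) / (1 + d - t))" using d by (intro ln_mono) auto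
 also have "... = ln (3 / 4 + d) - ln (1 + d - t)" using d t by (subst ln_div) auto
 finally have a: "ln (3 / (8 * d)) <= ln (3 / 4 + d) - ln (1 + d - t)" .
 have b: "0 <= ln (3 / (8 * d))" using d by (intro ln_ge_zero) (simp add: field_simps)
 have "3 / 4 * ln (3 / (8 * d)) <= (3 / 4 + d) * ln (3 / (8 * d))" using b d by (intro mult_right_mono) auto
 also have "... <= (3 / 4 + d) * (ln (3 / 4 + d) - ln (1 + d - t))" using a d by (intro mult_left_mono) auto
 finally show ?thesis using t d by (simp add: l_def l1_def g_def)
 qed
 show ?thesis
 by (rule that[OF 1 2 _ _ 5 6 _ _ order_trans[OF zero_le_power2 ldb] bdb ldb big])
 (auto simp: \<beta>_def \<beta>0_def \<beta>'_def \<beta>0'_def s_def l_def l'_def)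
qed

lemma ennreal_mult3: "0 <= a ==> 0 <= b ==> 0 <= x ==> ennreal a * ennreal b * (2 * ennreal x) = ennreal (a * b * (2 * x))"
 by (simp add: ennreal_mult)

text \<open>The logarithmic energy and the Poincare inequality for the zero set bound the square
  integral of \<open>l(W)\<close> by \<open>Q\<close> times the volume, uniformly in
  \<open>d\<close>. Since \<open>l\<close> is at least \<open>\<Lambda>\<close> where
  \<open>W > 1 - d\<close>, that set has proportion at most \<open>Q / \<Lambda>^2 = \<nu>\<close>.
  The small measure lemma then applies to \<open>(W - (1 - d))_+ / d\<close> and gives
  \<open>W \<le> 1 - d / 2\<close>.\<close>

lemma density_lemma:
 assumes lam: "0 < lam" "0 < Lam" and "0 < \<theta>"
 shows "\<exists>c>0. c < 1 & (\<forall>(x0 :: 'a::euclidean_space) R W. 0 < R --> subsol lam Lam (ball x0 (2 * R)) W --> (\<forall>x\<in>ball x0 (2 * R). W x <= 1) -->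
 ennreal (\<theta> * (R ^ DIM('a) * measure lborel (ball (0::'a) 1))) <= emeasure lborel {x\<in>ball x0 R. W x = 0} -->
 (\<forall>x\<in>ball x0 (R / 2). W x <= 1 - c))"
proof -
 define n where "n = DIM('a)"
 define om where "om = measure lborel (ball (0::'a) 1)"
 have om: "0 < om" unfolding om_def by (rule content_unit_ball_pos)
 define c where "c = 4 * Lam^2 * 1 / lam^2"
 have c: "0 < c" using lam by (simp add: c_def)
 obtain \<nu> where \<nu>: "0 < \<nu>" "!!(x0 :: 'a) R W. 0 < R ==> subsol lam Lam (ball x0 R) W ==> (\<forall>x\<in>ball x0 R. W x <= 1) ==>
 emeasure lborel {x\<in>ball x0 R. 0 < W x} <= ennreal (\<nu> * (R ^ n * om)) ==> (\<forall>x\<in>ball x0 (R / 2). W x <= 1 / 2)"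
 using de_giorgi_small_measure[OF lam, where 'a = 'a] unfolding n_def om_def by blast
 \<comment> \<open>Collects the constants of the Poincare inequality:
   \<open>512 = 2 * 2^2 * 8^2\<close> from its factor 2, the diameter \<open>2 R\<close> and the
   cutoff gradient \<open>8 / R\<close>; \<open>4^n\<close> from two balls of radius
   \<open>2 R\<close>; \<theta> from the zero set.\<close>
 define Q where "Q = 512 * 4 ^ n * c / \<theta>"
 have Q: "0 < Q" using c \<open>0 < \<theta>\<close> by (simp add: Q_def)
 define \<Lambda> where "\<Lambda> = sqrt (Q / \<nu>)"
 have \<Lambda>: "0 < \<Lambda>" "Q / \<Lambda>^2 = \<nu>" using Q \<nu>(1) by (auto simp: \<Lambda>_def)
 \<comment> \<open>Chosen so that the lower bound of \<open>l\<close> above level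
   \<open>1 - d\<close> is exactly \<open>\<Lambda>\<close>.\<close>
 define d where "d = 3 / 8 * exp (- (4 / 3 * \<Lambda> + 1))"
 have d0: "0 < d" by (simp add: d_def)
 have d4: "d <= 1 / 4"
 proof -
 have "exp (- (4 / 3 * \<Lambda> + 1)) <= exp (- 1)" using \<Lambda> by simp
 also have "exp (- 1 :: real) <= 2 / 3"
 proof -
 have "3 / 2 <= exp (1::real)" using exp_ge_add_one_self[of "1::real"] by simp
 then show ?thesis by (simp add: exp_minus field_simps)
 qed
 finally show ?thesis by (simp add: d_def)
 qed
 have lnd: "3 / 4 * ln (3 / (8 * d)) - 3 / 4 = \<Lambda>"
 proof -
 define y where "y = 4 / 3 * \<Lambda> + 1"
 have 1: "exp (- y) * exp y = 1" by (simp flip: exp_add)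
 have 2: "d = 3 / 8 * exp (- y)" unfolding d_def y_def ..
 have "exp y * (8 * d) = 3 * (exp (- y) * exp y)" unfolding 2 by simp
 then have "exp y * (8 * d) = 3" unfolding 1 by simp
 then have "3 / (8 * d) = exp y" using d0 by (simp add: eq_divide_eq divide_eq_eq)
 then have "3 / (8 * d) = exp (4 / 3 * \<Lambda> + 1)" by (simp only: y_def)
 then have "ln (3 / (8 * d)) = 4 / 3 * \<Lambda> + 1" by (simp only: ln_exp)
 then show ?thesis by linarith
 qed
 show ?thesis
 proof (intro exI[of _ "d / 2"] conjI allI impI ballI)
 show "0 < d / 2" "d / 2 < 1" using d0 d4 by auto
 fix x0 :: 'a and R :: real and W x
 assume R: "0 < R" and s: "subsol lam Lam (ball x0 (2 * R)) W" and W1: "\<forall>x\<in>ball x0 (2 * R). W x <= 1"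
 and dens: "ennreal (\<theta> * (R ^ DIM('a) * measure lborel (ball (0::'a) 1))) <= emeasure lborel {x\<in>ball x0 R. W x = 0}"
 and x: "x \<in> ball x0 (R / 2)"
 obtain \<beta> \<beta>' l l' where fn:
 "!!t. DERIV \<beta> t :> \<beta>' t" "continuous_on UNIV \<beta>'" "!!t. t <= 1 / 4 ==> \<beta> t = 0" "!!t. t <= 1 / 4 ==> \<beta>' t = 0"
 "!!t. DERIV l t :> l' t" "continuous_on UNIV l'" "!!t. t <= 1 / 4 ==> l t = 0" "!!t. t <= 1 / 4 ==> l' t = 0"
 "!!t. t <= 1 ==> 0 <= \<beta>' t" "!!t. t <= 1 ==> (\<beta> t)^2 <= \<beta>' t" "!!t. t <= 1 ==> (l' t)^2 <= \<beta>' t"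
 "!!t. 1 - d < t ==> t <= 1 ==> 3 / 4 * ln (3 / (8 * d)) - 3 / 4 <= l t"
 using log_truncation[OF d0 d4] by blast
 let ?B = "ball x0 (2 * R)" and ?S = "ball x0 R" and ?K = "cball x0 (3 / 2 * R)"
 have B: "open ?B" and W: "continuous_on ?B W" and [measurable]: "W \<in> bm"
 using s by (auto simp: subsol_def)
 have [measurable]: "?B \<in> sets borel" "?S \<in> sets borel" by simp_all
 obtain Om w G F where e: "ellflux lam Lam Om w G F" and Ww: "!!x. x \<in> ?B ==> 0 < W x ==> x \<in> Om & W x = w x"
 using s by (auto simp: subsol_def)
 have w: "sob Om w G" using e by (simp add: ellflux_def)
 have Rr: "R < 3 / 2 * R" using R by simp
 obtain et Det where eta: "C1 et Det" "!!x. x \<in> cball x0 R ==> et x = 1" "!!x. x \<in> cball x0 R ==> Det x = 0"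
 "!!x. x ~: ?K ==> et x = 0" "!!x. x ~: ?K ==> Det x = 0" "!!x. norm (Det x) <= 4 / (3 / 2 * R - R)"
 using radial_cutoff[OF R Rr, of x0] by metis
 have etab: "norm (Det x) <= 8 / R" for x using eta(6)[of x] by simp
 have KB: "?K \<subseteq> ?B" using R by (auto simp: subset_iff)
 define L where "L = {x\<in>?K. (1 / 4) / 2 <= W x}"
 have Lw: "x \<in> Om" "W x = w x" "w x <= 1" if "x \<in> L" for x
 using that Ww[of x] KB W1 by (force simp: L_def)+
 have V2: "emeasure lborel ?B = ennreal (2 ^ n * (R ^ n * om))"
 using R by (simp add: emeasure_ball_scale n_def om_def power_mult_distrib mult.assoc)
 have EI: "(NI x. ie L x ((et x)^2 * \<beta>' (w x) * (norm (G x))^2))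
 <= ennreal (4 * Lam^2 * 1 / lam^2) * (NI x. ie L x ((norm (Det x))^2 * 1^2))"
 by (rule energy_inequality[OF e lam B W Ww eta(1) compact_cball KB eta(4,5) _ fn(1-4) L_def, where T = "{..1}"])
 (use W1 fn in \<open>auto intro: continuous_on_const\<close>)
 have "(NI x. ie L x ((norm (Det x))^2 * 1^2)) <= (NI x. ennreal ((8 / R)^2) * indicator ?B x)"
 using KB etab by (intro nn_integral_mono) (auto simp: L_def split: split_indicator intro!: ennreal_leI power_mono)
 also have "... = ennreal ((8 / R)^2 * (2 ^ n * (R ^ n * om)))"
 using R om by (simp add: nn_integral_cmult_indicator V2 ennreal_mult)
 finally have "(NI x. ie L x ((et x)^2 * \<beta>' (w x) * (norm (G x))^2)) <= ennreal c * ennreal ((8 / R)^2 * (2 ^ n * (R ^ n * om)))"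
 using EI unfolding c_def by (meson mult_left_mono order_trans zero_le)
 also have "... = ennreal (c * ((8 / R)^2 * (2 ^ n * (R ^ n * om))))"
 using c R om by (intro ennreal_mult[symmetric]) auto
 finally have EI2: "(NI x. ie L x ((et x)^2 * \<beta>' (w x) * (norm (G x))^2)) <= ennreal (c * ((8 / R)^2 * (2 ^ n * (R ^ n * om))))" .
 define Z where "Z x = (if x \<in> L then et x * l (w x) else 0)" for x
 define H where "H x = (if x \<in> L then (et x * l' (w x)) *. G x + l (w x) *. Det x else 0)" for x
 have s0: "sob0 L Z H" unfolding Z_def[abs_def] H_def[abs_def]
 by (rule sob0_compose[OF w B W Ww eta(1) compact_cball KB eta(4,5) _ fn(5-8) L_def]) auto
 have [measurable]: "Z \<in> bm" "H \<in> bm" "L \<in> sets borel"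
 using sob0_D[OF s0] by (auto simp: borel_compact)
 have HS: "L2sq ?S H <= ennreal (c * ((8 / R)^2 * (2 ^ n * (R ^ n * om))))"
 proof -
 have "L2sq ?S H <= (NI x. ie L x ((et x)^2 * \<beta>' (w x) * (norm (G x))^2))"
 unfolding L2sq_def
 proof (intro nn_integral_mono)
 fix x
 show "indicator ?S x * ennreal ((norm (H x))^2) <= ie L x ((et x)^2 * \<beta>' (w x) * (norm (G x))^2)"
 proof (cases "x \<in> ?S & x \<in> L")
 case True
 then have "et x = 1" "Det x = 0" using eta(2,3)[of x] by auto
 moreover have "(l' (w x))^2 * (norm (G x))^2 <= \<beta>' (w x) * (norm (G x))^2"
 using True Lw(3) by (intro mult_right_mono fn) auto
 ultimately show ?thesis using True by (simp add: H_def power_mult_distrib ennreal_leI)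
 qed (auto simp: H_def split: split_indicator)
 qed
 then show ?thesis using EI2 by simp
 qed
 let ?V = "R ^ n * om"
 have V0: "0 < ?V" using R om by simp
 define J where "J = (NI x. indicator ?S x * ennreal ((Z x)^2))"
 have "ennreal (\<theta> * ?V) * J <= emeasure lborel {x\<in>?S. Z x = 0} * J"
 proof (intro mult_right_mono order_trans[OF dens[folded n_def om_def]] emeasure_mono)
 show "{x \<in> ?S. W x = 0} \<subseteq> {x\<in>?S. Z x = 0}" by (auto simp: Z_def L_def)
 qed auto
 also have "... <= emeasure lborel (ball (0::'a) (2 * R)) * ennreal ((2 * R)^2) * (2 * L2sq ?S H)"
 unfolding J_def
 proof (rule sob0_poincare[OF s0])
 fix y z assume "y \<in> ?S" "z \<in> ?S"
 then show "norm (y - z) < 2 * R" using dist_triangle2[of y z x0] by (simp add: dist_norm dist_commute norm_minus_commute)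
 qed (use R in auto)
 also have "emeasure lborel (ball (0::'a) (2 * R)) = ennreal (2 ^ n * ?V)"
 using R by (simp add: emeasure_ball_scale n_def om_def power_mult_distrib mult.assoc)
 also have "ennreal (2 ^ n * ?V) * ennreal ((2 * R)^2) * (2 * L2sq ?S H) <= ennreal (2 ^ n * ?V) * ennreal ((2 * R)^2) * (2 * ennreal (c * ((8 / R)^2 * (2 ^ n * ?V))))"
 by (intro mult_left_mono HS) auto
 also have "... = ennreal ((2 ^ n * ?V) * (2 * R)^2 * (2 * (c * ((8 / R)^2 * (2 ^ n * ?V)))))"
 using V0 c by (intro ennreal_mult3) auto
 also have "(2 ^ n * ?V) * (2 * R)^2 * (2 * (c * ((8 / R)^2 * (2 ^ n * ?V)))) = (\<theta> * ?V) * (Q * ?V)"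
 proof -
 have "(2 * R)^2 * (8 / R)^2 = 256" using R by (simp add: power2_eq_square field_simps)
 moreover have "(4::real) ^ n = 2 ^ n * 2 ^ n" by (simp flip: power_mult_distrib)
 ultimately have "(2 ^ n * ?V) * (2 * R)^2 * (2 * (c * ((8 / R)^2 * (2 ^ n * ?V)))) = 512 * 4 ^ n * c * ?V * ?V"
 by (simp only: mult_ac)
 also have "... = (\<theta> * ?V) * (Q * ?V)" using \<open>0 < \<theta>\<close> by (simp add: Q_def)
 finally show ?thesis .
 qed
 also have "ennreal ((\<theta> * ?V) * (Q * ?V)) = ennreal (\<theta> * ?V) * ennreal (Q * ?V)"
 using mult_pos_pos[OF \<open>0 < \<theta>\<close> V0] mult_pos_pos[OF Q V0] by (intro ennreal_mult less_imp_le)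
 finally have J': "ennreal (\<theta> * ?V) * J <= ennreal (\<theta> * ?V) * ennreal (Q * ?V)" .
 have "ennreal (\<theta> * ?V) ~= 0" using mult_pos_pos[OF \<open>0 < \<theta>\<close> V0] by (simp only: ennreal_eq_0_iff not_le)
 with J' have J: "J <= ennreal (Q * ?V)" using ennreal_mult_le_mult_iff[OF _ ennreal_neq_top] by blast
 define N where "N = {x\<in>?S. 1 - d < W x}"
 have [measurable]: "N \<in> sets borel" unfolding N_def by measurable
 have "ennreal (\<Lambda>^2) * emeasure lborel N = (NI x. ennreal (\<Lambda>^2) * indicator N x)"
 by (simp add: nn_integral_cmult_indicator)
 also have "... <= J" unfolding J_def
 proof (intro nn_integral_mono)
 fix x
 show "ennreal (\<Lambda>^2) * indicator N x <= indicator ?S x * ennreal ((Z x)^2)"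
 proof (cases "x \<in> N")
 case True
 then have xs: "x \<in> ?S" "1 - d < W x" by (auto simp: N_def)
 then have xl: "x \<in> L" using R d4 by (auto simp: L_def)
 have "\<Lambda> <= l (w x)" using fn(12)[of "w x"] xs(2) Lw[OF xl] lnd by simp
 then have "\<Lambda>^2 <= (Z x)^2" using \<Lambda>(1) xl xs(1) eta(2)[of x] by (auto simp: Z_def intro!: power_mono)
 then show ?thesis using True xs(1) by (simp add: ennreal_leI)
 qed simp
 qed
 also note J
 also have "ennreal (Q * ?V) = ennreal (\<Lambda>^2) * ennreal (\<nu> * ?V)"
 using \<Lambda> V0 \<nu>(1) by (simp add: field_simps flip: ennreal_mult)
 finally have Nm: "emeasure lborel N <= ennreal (\<nu> * ?V)"
 using \<Lambda>(1) by (subst (asm) ennreal_mult_le_mult_iff) auto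
 define W' where "W' x = (1 / d) * max 0 (W x - (1 - d))" for x
 have "subsol lam Lam ?B W'" unfolding W'_def[abs_def] by (rule subsol_truncate[OF s]) (use d0 d4 in auto)
 then have s': "subsol lam Lam ?S W'" by (rule subsol_subset) (use R in auto)
 have "\<forall>x\<in>ball x0 (R / 2). W' x <= 1 / 2"
 proof (rule \<nu>(2)[OF R s'])
 show "\<forall>x\<in>?S. W' x <= 1"
 proof
 fix x assume "x \<in> ?S"
 then have "W x <= 1" using W1 R by auto
 then show "W' x <= 1" using d0 by (auto simp: W'_def field_simps max_def)
 qed
 have "{x \<in> ?S. 0 < W' x} = N" using d0 by (auto simp: W'_def N_def zero_less_divide_iff max_def)
 then show "emeasure lborel {x \<in> ?S. 0 < W' x} <= ennreal (\<nu> * (R ^ n * om))" using Nm by simp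
 qed
 then have "W' x <= 1 / 2" using x by blast
 then show "W x <= 1 - d / 2" using d0 by (auto simp: W'_def field_simps max_def split: if_splits)
 qed
qed

subsection \<open>Decay and the Harnack inequality\<close>

text \<open>The last hypothesis is the one-sided boundary condition: near points of \<open>B\<close>
  outside \<open>D\<close>, the values of \<open>w\<close> on \<open>D\<close> are eventually below
  every positive number. It makes the zero extension of the positive part continuous, so that
  behaviour at the boundary of \<open>D\<close> becomes interior behaviour in
  \<open>B\<close>.\<close>

lemma zero_ext_subsol:
 fixes w :: "'a::euclidean_space => real"
 assumes e: "ellflux lam Lam Om w G F" and D: "open D" "D \<subseteq> Om" and B: "open B"
 and bd: "!!x e. x \<in> B ==> x ~: D ==> 0 < e ==> \<exists>d>0. \<forall>y\<in>D. dist y x < d --> w y < e"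
 shows "subsol lam Lam B (%x. if x \<in> D then max 0 (w x) else 0)"
proof -
 let ?W = "%x. if x \<in> D then max 0 (w x) else 0"
 have wc: "continuous_on D w" using e D(2) by (auto simp: ellflux_def sob_def intro: continuous_on_subset)
 then have wc': "continuous_on D (%x. max 0 (w x))" by (intro continuous_intros)
 have "(%x. indicator D x *. max 0 (w x)) \<in> bm"
 by (rule borel_measurable_continuous_on_indicator[OF _ wc']) (use D in simp)
 also have "(%x. indicator D x *. max 0 (w x)) = ?W" by (auto simp: fun_eq_iff)
 finally have m: "?W \<in> bm" .
 have "continuous_on B ?W"
 unfolding continuous_on_iff
 proof (intro ballI allI impI)
 fix x e :: real and x' :: 'a assume "0 < e" and x: "x' \<in> B"
 show "\<exists>d>0. \<forall>y\<in>B. dist y x' < d --> dist (?W y) (?W x') < e"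
 proof (cases "x' \<in> D")
 case True
 obtain d1 where d1: "0 < d1" "ball x' d1 \<subseteq> D" using D(1) True by (rule openE)
 obtain d2 where d2: "0 < d2" "!!y. y \<in> D ==> dist y x' < d2 ==> dist (max 0 (w y)) (max 0 (w x')) < e"
 using wc' True \<open>0 < e\<close> unfolding continuous_on_iff by blast
 have "dist (?W y) (?W x') < e" if "dist y x' < min d1 d2" for y
 proof -
 have "y \<in> D" using that d1(2) by (auto simp: subset_iff dist_commute)
 then show ?thesis using True d2(2)[of y] that by simp
 qed
 then show ?thesis using d1(1) d2(1) by (intro exI[of _ "min d1 d2"]) auto
 next
 case False
 obtain d where d: "0 < d" "!!y. y \<in> D ==> dist y x' < d ==> w y < e"
 using bd[OF x False \<open>0 < e\<close>] by blast
 have "dist (?W y) (?W x') < e" if "dist y x' < d" for y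
 using False d(2)[of y] that \<open>0 < e\<close> by (auto simp: dist_real_def)
 then show ?thesis using d(1) by blast
 qed
 qed
 moreover have "\<forall>x\<in>B. 0 < ?W x --> x \<in> Om & ?W x = w x" using D(2) by (auto simp: max_def split: if_splits)
 ultimately show ?thesis using e m B unfolding subsol_def by fastforce
qed

lemma density_scaled:
 assumes lam: "0 < lam" "0 < Lam" and "0 < \<theta>"
 shows "\<exists>c>0. c < 1 & (\<forall>(x0 :: 'a::euclidean_space) R W M. 0 < R --> subsol lam Lam (ball x0 (2 * R)) W --> 0 <= M --> (\<forall>x\<in>ball x0 (2 * R). W x <= M) -->
 ennreal (\<theta> * (R ^ DIM('a) * measure lborel (ball (0::'a) 1))) <= emeasure lborel {x\<in>ball x0 R. W x = 0} -->
 (\<forall>x\<in>ball x0 (R / 2). W x <= (1 - c) * M))"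
proof -
 show ?thesis
 proof (rule exE[OF density_lemma[OF assms, where 'a = 'a]], elim conjE, goal_cases)
 case (1 c)
 note c = 1(1-2) and dl0 = 1(3)
 note dl = dl0[THEN spec, THEN spec, THEN spec, THEN mp4]
 show ?thesis
 proof (intro exI[of _ c] conjI c allI impI)
 fix x0 :: 'a and R W and M :: real
 assume R: "0 < R" and s: "subsol lam Lam (ball x0 (2 * R)) W" and M: "0 <= M" and WM: "\<forall>x\<in>ball x0 (2 * R). W x <= M"
 and dens: "ennreal (\<theta> * (R ^ DIM('a) * measure lborel (ball (0::'a) 1))) <= emeasure lborel {x\<in>ball x0 R. W x = 0}"
 have W0: "0 <= W x" if "x \<in> ball x0 (2 * R)" for x using s that by (auto simp: subsol_def)
 have sub: "x \<in> ball x0 (2 * R)" if "x \<in> ball x0 R" for x using that R by auto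
 show "\<forall>x\<in>ball x0 (R / 2). W x <= (1 - c) * M"
 proof (cases "M = 0")
 case True
 then show ?thesis using WM R by auto
 next
 case False
 then have M: "0 < M" using M by simp
 define W' where "W' x = (1 / M) * max 0 (W x - 0)" for x
 have W': "W' x = W x / M" if "x \<in> ball x0 (2 * R)" for x using W0[OF that] M by (simp add: W'_def)
 have "subsol lam Lam (ball x0 (2 * R)) W'" unfolding W'_def[abs_def] by (rule subsol_truncate[OF s]) (use M in auto)
 moreover have "\<forall>x\<in>ball x0 (2 * R). W' x <= 1" using WM W' M by (auto simp: divide_le_eq)
 moreover have "{x\<in>ball x0 R. W' x = 0} = {x\<in>ball x0 R. W x = 0}" using W'[OF sub] M by auto
 ultimately have "\<forall>x\<in>ball x0 (R / 2). W' x <= 1 - c" using dl[OF R] dens by simp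
 show ?thesis
 proof
 fix x assume x: "x \<in> ball x0 (R / 2)"
 then have "W' x <= 1 - c" using \<open>\<forall>x\<in>ball x0 (R / 2). W' x <= 1 - c\<close> by blast
 moreover have "W' x = W x / M" using x R by (intro W') auto
 ultimately show "W x <= (1 - c) * M" using M by (simp add: divide_le_eq)
 qed
 qed
 qed
 qed
qed

text \<open>The form used at the flat boundary: a zero extension vanishes in the lower half space,
  and a ball of radius \<open>R / 4\<close> found there supplies the density
  \<open>(1/4)^n\<close>.\<close>

lemma decay_ball:
 assumes lam: "0 < lam" "0 < Lam"
 shows "\<exists>c>0. c < 1 & (\<forall>(x0 :: 'a::euclidean_space) R W M z. 0 < R --> subsol lam Lam (ball x0 (2 * R)) W --> 0 <= M --> (\<forall>x\<in>ball x0 (2 * R). W x <= M) -->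
 ball z (R / 4) \<subseteq> ball x0 R --> (\<forall>x\<in>ball z (R / 4). W x = 0) --> (\<forall>x\<in>ball x0 (R / 2). W x <= (1 - c) * M))"
proof -
 have t: "0 < (1 / 4 :: real) ^ DIM('a)" by simp
 show ?thesis
 proof (rule exE[OF density_scaled[OF lam t, where 'a = 'a]], elim conjE, goal_cases)
 case (1 c)
 note c = 1(1-2) and dl0 = 1(3)
 note dl = dl0[THEN spec4, THEN mp4, THEN mp]
 show ?thesis
 proof (intro exI[of _ c] conjI c allI impI)
 fix x0 :: 'a and R W and M :: real and z
 assume R: "0 < R" and s: "subsol lam Lam (ball x0 (2 * R)) W" and M: "0 <= M" and WM: "\<forall>x\<in>ball x0 (2 * R). W x <= M"
 and z: "ball z (R / 4) \<subseteq> ball x0 R" "\<forall>x\<in>ball z (R / 4). W x = 0"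
 have [measurable]: "W \<in> bm" "ball x0 R \<in> sets borel" using s by (auto simp: subsol_def)
 have "ennreal ((1 / 4) ^ DIM('a) * (R ^ DIM('a) * measure lborel (ball (0::'a) 1))) = emeasure lborel (ball z (R / 4))"
 using R by (simp add: emeasure_ball_scale power_divide)
 also have "... <= emeasure lborel {x\<in>ball x0 R. W x = 0}"
 using z by (intro emeasure_mono) auto
 finally show "\<forall>x\<in>ball x0 (R / 2). W x <= (1 - c) * M" by (intro dl[OF R s M WM])
 qed
 qed
qed

text \<open>Apply the density lemma at radius \<open>4 R\<close> to the positive part of
  \<open>1 - v / a\<close>, which vanishes where \<open>v \<ge> a\<close>. Half of the small ball is
  still a fixed proportion of the larger one. The conclusion holds on twice the original radius, so
  the lemma can be iterated.\<close>

lemma expansion_of_positivity: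
 assumes lam: "0 < lam" "0 < Lam"
 shows "\<exists>c>0. c < 1 & (\<forall>Om v G F (x :: 'a::euclidean_space) R a. ellflux lam Lam Om v G F --> (\<forall>y\<in>Om. 0 <= v y) --> 0 < R --> 0 < a -->
 ball x (8 * R) \<subseteq> Om --> ennreal (1 / 2 * (R ^ DIM('a) * measure lborel (ball (0::'a) 1))) <= emeasure lborel {y\<in>ball x R. a <= v y} -->
 (\<forall>y\<in>ball x (2 * R). c * a <= v y))"
proof -
 have t: "0 < 1 / 2 * (1 / 4 :: real) ^ DIM('a)" by simp
 show ?thesis
 proof (rule exE[OF density_scaled[OF lam t, where 'a = 'a]], elim conjE, goal_cases)
 case (1 c)
 note c = 1(1-2) and dl0 = 1(3)
 note dl = dl0[THEN spec4, THEN mp4, THEN mp]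
 show ?thesis
 proof (intro exI[of _ c] conjI c allI impI)
 fix Om v G F and x :: 'a and R a :: real
 assume e: "ellflux lam Lam Om v G F" and v0: "\<forall>y\<in>Om. 0 <= v y" and R: "0 < R" and a: "0 < a" and sub: "ball x (8 * R) \<subseteq> Om"
 and dens: "ennreal (1 / 2 * (R ^ DIM('a) * measure lborel (ball (0::'a) 1))) <= emeasure lborel {y\<in>ball x R. a <= v y}"
 define W where "W y = (if y \<in> ball x (8 * R) then max 0 ((- 1 / a) * v y + 1) else 0)" for y
 have e8: "2 * (4 * R) = 8 * R" by simp
 have s: "subsol lam Lam (ball x (2 * (4 * R))) W"
 unfolding W_def[abs_def] e8
 by (rule zero_ext_subsol[OF ellflux_affine[OF e] open_ball sub open_ball]) auto
 have [measurable]: "W \<in> bm" using s by (auto simp: subsol_def)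
 have [measurable]: "ball x (4 * R) \<in> sets borel" by simp
 have "\<forall>y\<in>ball x (4 * R / 2). W y <= (1 - c) * 1"
 proof (rule dl[OF _ s])
 show "\<forall>y\<in>ball x (2 * (4 * R)). W y <= 1" using v0 sub a by (auto simp: W_def subset_iff)
 have eq: "1 / 2 * (1 / 4) ^ DIM('a) * ((4 * R) ^ DIM('a) * measure lborel (ball (0::'a) 1)) = 1 / 2 * (R ^ DIM('a) * measure lborel (ball (0::'a) 1))"
 by (simp add: power_mult_distrib power_one_over)
 have "emeasure lborel {y\<in>ball x R. a <= v y} <= emeasure lborel {y\<in>ball x (4 * R). W y = 0}"
 proof (rule emeasure_mono)
 have "W y = 0" if "a <= v y" for y
 proof -
 have "1 <= v y / a" using that a by (simp add: le_divide_eq)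
 then show ?thesis by (simp add: W_def)
 qed
 then show "{y\<in>ball x R. a <= v y} \<subseteq> {y\<in>ball x (4 * R). W y = 0}" using R by auto
 qed measurable
 then show "ennreal (1 / 2 * (1 / 4) ^ DIM('a) * ((4 * R) ^ DIM('a) * measure lborel (ball (0::'a) 1))) <= emeasure lborel {y\<in>ball x (4 * R). W y = 0}"
 using dens by (simp only: eq)
 show "0 < 4 * R" "0 <= (1::real)" using R by simp_all
 qed
 then show "\<forall>y\<in>ball x (2 * R). c * a <= v y"
 proof (intro ballI)
 fix y assume *: "\<forall>y\<in>ball x (4 * R / 2). W y <= (1 - c) * 1" and y: "y \<in> ball x (2 * R)"
 have "y \<in> ball x (4 * R / 2)" using y by simp
 then have "W y <= 1 - c" using bspec[OF *] by simp
 then have "1 - v y / a <= 1 - c" using y R by (auto simp: W_def)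
 then show "c * a <= v y" using a by (simp add: field_simps)
 qed
 qed
 qed
qed

text \<open>If \<open>v\<close> stayed below \<open>(1 + c/2) M\<close>, the positive part of
  \<open>v - M/2\<close> would be at most \<open>(1 + c) M/2\<close> and vanish on half of the ball.
  Its value at the centre would then be at most \<open>(1 - c)(1 + c) M/2\<close>, strictly below
  \<open>M/2\<close>.\<close>

lemma growth_lemma:
 assumes lam: "0 < lam" "0 < Lam"
 shows "\<exists>k>0. (\<forall>Om v G F (x :: 'a::euclidean_space) R M. ellflux lam Lam Om v G F --> 0 < R --> 0 < M -->
 ball x (2 * R) \<subseteq> Om --> M <= v x --> ennreal (1 / 2 * (R ^ DIM('a) * measure lborel (ball (0::'a) 1))) <= emeasure lborel {y\<in>ball x R. v y <= M / 2} -->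
 (\<exists>y\<in>ball x (2 * R). (1 + k) * M < v y))"
proof -
 have t: "0 < (1 / 2 :: real)" by simp
 show ?thesis
 proof (rule exE[OF density_scaled[OF lam t, where 'a = 'a]], elim conjE, goal_cases)
 case (1 c)
 note c = 1(1-2) and dl0 = 1(3)
 note dl = dl0[THEN spec4, THEN mp4, THEN mp]
 show ?thesis
 proof (intro exI[of _ "c / 2"] conjI allI impI)
 fix Om v G F and x :: 'a and R M :: real
 assume e: "ellflux lam Lam Om v G F" and R: "0 < R" and M: "0 < M" and sub: "ball x (2 * R) \<subseteq> Om" and vx: "M <= v x"
 and dens: "ennreal (1 / 2 * (R ^ DIM('a) * measure lborel (ball (0::'a) 1))) <= emeasure lborel {y\<in>ball x R. v y <= M / 2}"
 show "\<exists>y\<in>ball x (2 * R). (1 + c / 2) * M < v y"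
 proof (rule ccontr)
 assume "\<not> ?thesis"
 then have le: "v y <= (1 + c / 2) * M" if "y \<in> ball x (2 * R)" for y using that by (auto simp: not_less)
 define W where "W y = (if y \<in> ball x (2 * R) then max 0 (1 * v y + (- M / 2)) else 0)" for y
 have s: "subsol lam Lam (ball x (2 * R)) W"
 unfolding W_def[abs_def]
 by (rule zero_ext_subsol[OF ellflux_affine[OF e] open_ball sub open_ball]) auto
 have [measurable]: "W \<in> bm" using s by (auto simp: subsol_def)
 have [measurable]: "ball x R \<in> sets borel" by simp
 have "\<forall>y\<in>ball x (R / 2). W y <= (1 - c) * ((1 / 2 + c / 2) * M)"
 proof (rule dl[OF R s])
 show "\<forall>y\<in>ball x (2 * R). W y <= (1 / 2 + c / 2) * M"
 proof
 fix y assume y: "y \<in> ball x (2 * R)"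
 have "0 <= c * M" using c M by simp
 then show "W y <= (1 / 2 + c / 2) * M" using le[OF y] y M by (simp add: W_def algebra_simps)
 qed
 have "emeasure lborel {y\<in>ball x R. v y <= M / 2} <= emeasure lborel {y\<in>ball x R. W y = 0}"
 proof (rule emeasure_mono)
 have "W y = 0" if "v y <= M / 2" for y using that by (simp add: W_def)
 then show "{y\<in>ball x R. v y <= M / 2} \<subseteq> {y\<in>ball x R. W y = 0}" by auto
 qed measurable
 with dens show "ennreal (1 / 2 * (R ^ DIM('a) * measure lborel (ball (0::'a) 1))) <= emeasure lborel {y\<in>ball x R. W y = 0}"
 by (rule order_trans)
 show "0 <= (1 / 2 + c / 2) * M" using c M by simp
 qed
 moreover have "x \<in> ball x (R / 2)" using R by simp
 ultimately have "W x <= (1 - c) * ((1 / 2 + c / 2) * M)" by (rule bspec)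
 moreover have "M / 2 <= W x" using vx R by (simp add: W_def le_max_iff_disj)
 ultimately have "M / 2 <= (1 - c) * ((1 / 2 + c / 2) * M)" by simp
 also have "... = M / 2 - c * c / 2 * M" by (simp add: field_simps)
 finally have "c * c * M <= 0" by simp
 moreover have "0 < c * c * M" using c M by simp
 ultimately show False by linarith
 qed
 qed (use c in simp)
 qed
qed

text \<open>The length of a chain whose steps halve once every \<open>L\<close> steps; the closed
  form is used through its bound \<open>2 L\<close>.\<close>

lemma sum_half_power_div:
 assumes "0 < L"
 shows "(\<Sum>k<i. (1 / 2 :: real) ^ (k div L)) = 2 * real L - (1 / 2) ^ (i div L) * (2 * real L - real (i mod L))"
proof (induction i)
 case (Suc i)
 have "i mod L < L" using assms by simp
 show ?case
 proof (cases "Suc (i mod L) = L")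
 case True
 then have "Suc i div L = Suc (i div L)" "Suc i mod L = 0" by (simp_all add: div_Suc mod_Suc)
 moreover have "real (Suc (i mod L)) = real L" using True by (rule arg_cong)
 then have m: "real (i mod L) = real L - 1" by simp
 ultimately show ?thesis unfolding sum.lessThan_Suc Suc m by (simp add: algebra_simps)
 next
 case False
 then have "Suc i div L = i div L" "Suc i mod L = Suc (i mod L)" by (simp_all add: div_Suc mod_Suc)
 then show ?thesis using Suc by (simp add: algebra_simps)
 qed
qed simp

text \<open>If \<open>v\<close> exceeded \<open>M0\<close> near \<open>x0\<close>, a chain of points
  in a fixed compact ball would exist along which \<open>v\<close> grows like
  \<open>(1 + k)^i\<close>, against continuity. At each point of the chain, the set where
  \<open>v \<ge> M / 2\<close> cannot fill half of a suitable ball, since positivity would expand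
  until it contradicts \<open>v x0 \<le> 1\<close>. Hence the growth lemma applies and provides the
  next point.\<close>

lemma harnack_aux:
 assumes lam: "0 < lam" "0 < Lam"
 shows "\<exists>C\<ge>1. (\<forall>Om v G F (x0 :: 'a::euclidean_space) r. ellflux lam Lam Om v G F --> (\<forall>y\<in>Om. 0 <= v y) --> 0 < r -->
 ball x0 (18 * r) \<subseteq> Om --> v x0 <= 1 --> (\<forall>x\<in>ball x0 r. v x <= C))"
proof -
 show ?thesis
 proof (rule exE[OF expansion_of_positivity[OF lam, where 'a = 'a]], elim conjE, goal_cases)
 case (1 c)
 note c = 1(1-2) and ep0 = 1(3)
 note ep = ep0[THEN spec4, THEN spec, THEN spec, THEN spec, THEN mp4, THEN mp, THEN mp]
 show ?thesis
 proof (rule exE[OF growth_lemma[OF lam, where 'a = 'a]], elim conjE, goal_cases)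
 case (1 k)
 note k = 1(1) and gr0 = 1(2)
 note gr = gr0[THEN spec4, THEN spec, THEN spec, THEN spec, THEN mp4, THEN mp, THEN mp]
 \<comment> \<open>\<open>L\<close> steps of growth pay for one factor \<open>c\<close>, the price
   of one more doubling in the expansion of positivity, so the radii halve once every
   \<open>L\<close> steps. \<open>j0\<close> keeps the total length of the chain below
   \<open>r\<close>, and \<open>M0 = 3 / c^j0\<close> keeps the expanded lower bound at 3/2, above
   \<open>v x0\<close>.\<close>
 obtain L0 where L0: "1 / c < (1 + k) ^ L0" using real_arch_pow[of "1 + k" "1 / c"] k by auto
 define L where "L = Suc L0"
 have L: "0 < L" "1 <= c * (1 + k) ^ L"
 proof -
 have "1 <= c * (1 + k) ^ L0" using L0 c by (simp add: field_simps)
 also have "... <= c * (1 + k) ^ L" unfolding L_def using c k by (intro mult_left_mono power_increasing) auto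
 finally show "1 <= c * (1 + k) ^ L" .
 qed (simp add: L_def)
 obtain j0 where j0: "16 * real L < 2 ^ j0" using real_arch_pow[of 2 "16 * real L"] by auto
 define M0 where "M0 = 3 / c ^ j0"
 have M0: "0 < M0" "1 <= M0"
 proof -
 have "c ^ j0 <= 1" using c by (intro power_le_one) auto
 then show "1 <= M0" using c by (simp add: M0_def le_divide_eq)
 qed (use c in \<open>simp add: M0_def\<close>)
 show ?thesis
 proof (intro exI[of _ M0] conjI M0 allI impI ballI)
 fix Om v G F and x0 :: 'a and r and x
 assume e: "ellflux lam Lam Om v G F" and v0: "\<forall>y\<in>Om. 0 <= v y" and r: "0 < r" and sub: "ball x0 (18 * r) \<subseteq> Om"
 and vx0: "v x0 <= 1" and x: "x \<in> ball x0 r"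
 define om where "om = measure lborel (ball (0::'a) 1)"
 have om: "0 < om" unfolding om_def by (rule content_unit_ball_pos)
 have vc: "continuous_on Om v" using e by (auto simp: ellflux_def sob_def)
 have meas: "{y\<in>ball z R. a <= v y} \<in> sets borel" "{y\<in>ball z R. v y <= a} \<in> sets borel" "{y\<in>ball z R. v y < a} \<in> sets borel" if "ball z R \<subseteq> Om" for z R a
 proof -
 have [measurable]: "(%x. indicator (ball z R) x *. v x) \<in> bm"
 by (rule borel_measurable_continuous_on_indicator[OF _ continuous_on_subset[OF vc that]]) simp
 have [measurable]: "ball z R \<in> sets borel" by simp
 have m0: "{y\<in>ball z R. a <= indicator (ball z R) y *. v y} \<in> sets borel" by measurable
 have e0: "{y\<in>ball z R. a <= indicator (ball z R) y *. v y} = {y\<in>ball z R. a <= v y}" by auto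
 show "{y\<in>ball z R. a <= v y} \<in> sets borel" by (rule back_subst[of "%A. A \<in> sets borel", OF m0 e0])
 have m1: "{y\<in>ball z R. indicator (ball z R) y *. v y <= a} \<in> sets borel" by measurable
 have e1: "{y\<in>ball z R. indicator (ball z R) y *. v y <= a} = {y\<in>ball z R. v y <= a}" by auto
 show "{y\<in>ball z R. v y <= a} \<in> sets borel" by (rule back_subst[of "%A. A \<in> sets borel", OF m1 e1])
 have m2: "{y\<in>ball z R. indicator (ball z R) y *. v y < a} \<in> sets borel" by measurable
 have e2: "{y\<in>ball z R. indicator (ball z R) y *. v y < a} = {y\<in>ball z R. v y < a}" by auto
 show "{y\<in>ball z R. v y < a} \<in> sets borel" by (rule back_subst[of "%A. A \<in> sets borel", OF m2 e2])
 qed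
 have iter: "\<forall>y\<in>ball z (2 ^ Suc j * R). c ^ Suc j * a <= v y"
 if R: "0 < R" and a: "0 < a" and z: "ball z (4 * (2 ^ Suc j * R)) \<subseteq> Om"
 and dens: "ennreal (1 / 2 * (R ^ DIM('a) * om)) <= emeasure lborel {y\<in>ball z R. a <= v y}" for z R a j
 using z
 proof (induction j)
 case 0
 then show ?case using ep[OF e v0 R a _ dens[unfolded om_def]] by simp
 next
 case (Suc j)
 let ?R = "2 ^ Suc j * R" and ?a = "c ^ Suc j * a"
 have R': "0 < ?R" using R by simp
 have le: "4 * ?R <= 4 * (2 ^ Suc (Suc j) * R)" using R by simp
 have "ball z (4 * ?R) \<subseteq> Om" by (rule order_trans[OF _ Suc.prems]) (use le in \<open>simp add: subset_ball\<close>)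
 then have ih: "\<forall>y\<in>ball z ?R. ?a <= v y" by (rule Suc.IH)
 then have "{y\<in>ball z ?R. ?a <= v y} = ball z ?R" by auto
 then have "emeasure lborel {y\<in>ball z ?R. ?a <= v y} = ennreal (?R ^ DIM('a) * om)"
 using R' by (simp add: emeasure_ball_scale om_def)
 moreover have "1 / 2 * (?R ^ DIM('a) * om) <= ?R ^ DIM('a) * om" using R' om by simp
 ultimately have d: "ennreal (1 / 2 * (?R ^ DIM('a) * om)) <= emeasure lborel {y\<in>ball z ?R. ?a <= v y}"
 by (metis ennreal_leI)
 have "8 * ?R = 4 * (2 ^ Suc (Suc j) * R)" by simp
 then have "ball z (8 * ?R) \<subseteq> Om" using Suc.prems by metis
 then have "\<forall>y\<in>ball z (2 * ?R). c * ?a <= v y"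
 using ep[OF e v0 R' _ _ d[unfolded om_def]] a c by simp
 then show ?case by (simp add: mult.assoc mult.left_commute)
 qed
 define S where "S i = (\<Sum>k<i. (1 / 2 :: real) ^ (k div L))" for i
 have S: "S i <= 2 * real L" for i
 proof -
 have "real (i mod L) <= real L" using L by simp
 then have "0 <= (1 / 2) ^ (i div L) * (2 * real L - real (i mod L))" by (intro mult_nonneg_nonneg) auto
 then show ?thesis unfolding S_def sum_half_power_div[OF L(1)] by linarith
 qed
 define R where "R i = 4 * r * (1 / 2) ^ (j0 + i div L)" for i
 have Rp: "0 < R i" for i using r by (simp add: R_def)
 have Sr: "8 * r * (1 / 2) ^ j0 * S i <= r" for i
 proof -
 have "8 * r * (1 / 2) ^ j0 * S i <= 8 * r * (1 / 2) ^ j0 * (2 * real L)" using r by (intro mult_left_mono S) auto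
 also have "... = r * (16 * real L / 2 ^ j0)" by (simp add: power_one_over)
 also have "... <= r * 1" using j0 r by (intro mult_left_mono) (auto simp: divide_le_eq)
 finally show ?thesis by simp
 qed
 show "v x <= M0"
 proof (rule ccontr)
 assume "\<not> v x <= M0"
 have grow: "\<exists>z. dist x0 z < r + 8 * r * (1 / 2) ^ j0 * S i & (1 + k) ^ i * M0 < v z" for i
 proof (induction i)
 case 0
 then show ?case using x \<open>\<not> v x <= M0\<close> by (intro exI[of _ x]) (simp add: S_def)
 next
 case (Suc i)
 then obtain z where z: "dist x0 z < r + 8 * r * (1 / 2) ^ j0 * S i" "(1 + k) ^ i * M0 < v z" by blast
 define M where "M = (1 + k) ^ i * M0"
 have M: "0 < M" using k M0 by (simp add: M_def)
 have z2: "dist x0 z < 2 * r" using z(1) Sr[of i] by simp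
 define j where "j = j0 + i div L"
 have jR: "2 ^ j * R i = 4 * r" by (simp add: R_def j_def power_one_over)
 have "0 < j0" using j0 L by (cases j0) auto
 then obtain j' where j': "j = Suc j'" by (cases j) (auto simp: j_def)
 have b16: "ball z (16 * r) \<subseteq> Om"
 proof -
 have "ball z (16 * r) \<subseteq> ball x0 (18 * r)"
 proof
 fix y assume "y \<in> ball z (16 * r)"
 then show "y \<in> ball x0 (18 * r)" using z2 dist_triangle[of x0 y z] by simp
 qed
 then show ?thesis using sub by blast
 qed
 have R4: "4 * R i <= 16 * r"
 proof -
 have "(1 / 2 :: real) ^ (j0 + i div L) <= 1" by (simp add: power_le_one)
 then show ?thesis using r by (simp add: R_def mult_left_le)
 qed
 have bR: "ball z (R i) \<subseteq> Om" "ball z (2 * R i) \<subseteq> Om"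
 using R4 Rp[of i] by (auto intro!: order_trans[OF _ b16] subset_ball)
 have nd: "\<not> ennreal (1 / 2 * (R i ^ DIM('a) * om)) <= emeasure lborel {y\<in>ball z (R i). M / 2 <= v y}"
 proof
 assume d: "ennreal (1 / 2 * (R i ^ DIM('a) * om)) <= emeasure lborel {y\<in>ball z (R i). M / 2 <= v y}"
 have jR': "2 ^ Suc j' * R i = 4 * r" using jR j' by simp
 have "4 * (2 ^ Suc j' * R i) = 16 * r" using jR' by linarith
 then have zz: "ball z (4 * (2 ^ Suc j' * R i)) \<subseteq> Om" using b16 by (simp only:)
 have "\<forall>y\<in>ball z (2 ^ Suc j' * R i). c ^ Suc j' * (M / 2) <= v y"
 by (rule iter[OF Rp[of i] half_gt_zero[OF M] zz d])
 then have "\<forall>y\<in>ball z (4 * r). c ^ j * (M / 2) <= v y" unfolding jR' j' .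
 moreover have "x0 \<in> ball z (4 * r)" using z2 r by (simp add: dist_commute)
 ultimately have "c ^ j * (M / 2) <= v x0" by (rule bspec)
 then have "c ^ j * M <= 2" using vx0 by simp
 moreover have "3 <= c ^ j * M"
 proof -
 have "1 <= (c * (1 + k) ^ L) ^ (i div L)" using L(2) by (rule one_le_power)
 also have "... = c ^ (i div L) * (1 + k) ^ (L * (i div L))" by (simp add: power_mult_distrib power_mult)
 also have "... <= c ^ (i div L) * (1 + k) ^ i" using c k by (intro mult_left_mono power_increasing) auto
 finally have "3 * 1 <= 3 * (c ^ (i div L) * (1 + k) ^ i)" by simp
 also have "... = c ^ j * M" using c by (simp add: j_def M_def M0_def power_add)
 finally show ?thesis by simp
 qed
 ultimately show False by simp
 qed
 have half: "ennreal (1 / 2 * (R i ^ DIM('a) * om)) <= emeasure lborel {y\<in>ball z (R i). v y < M / 2}"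
 proof (rule ccontr)
 let ?V = "R i ^ DIM('a) * om"
 assume "\<not> ennreal (1 / 2 * ?V) <= emeasure lborel {y\<in>ball z (R i). v y < M / 2}"
 then have "emeasure lborel {y\<in>ball z (R i). v y < M / 2} + emeasure lborel {y\<in>ball z (R i). M / 2 <= v y} < ennreal (1 / 2 * ?V) + ennreal (1 / 2 * ?V)"
 using nd by (intro add_strict_mono) (auto simp: not_le)
 also have "... = ennreal ?V" using Rp[of i] om by (simp flip: ennreal_plus)
 also have "... = emeasure lborel (ball z (R i))" using Rp[of i] by (simp add: emeasure_ball_scale om_def)
 also have "emeasure lborel (ball z (R i)) <= emeasure lborel {y\<in>ball z (R i). v y < M / 2} + emeasure lborel {y\<in>ball z (R i). M / 2 <= v y}"
 proof -
 have eq: "{y\<in>ball z (R i). v y < M / 2} \<union> {y\<in>ball z (R i). M / 2 <= v y} = ball z (R i)" by auto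
 have "emeasure lborel ({y\<in>ball z (R i). v y < M / 2} \<union> {y\<in>ball z (R i). M / 2 <= v y}) <= emeasure lborel {y\<in>ball z (R i). v y < M / 2} + emeasure lborel {y\<in>ball z (R i). M / 2 <= v y}"
 by (rule emeasure_subadditive) (use meas(1)[OF bR(1), of "M / 2"] meas(3)[OF bR(1), of "M / 2"] in simp_all)
 then show ?thesis unfolding eq .
 qed
 finally show False by simp
 qed
 also have "... <= emeasure lborel {y\<in>ball z (R i). v y <= M / 2}"
 by (rule emeasure_mono) (use meas(2)[OF bR(1), of "M / 2"] in auto)
 finally obtain y where y: "y \<in> ball z (2 * R i)" "(1 + k) * M < v y"
 using gr[OF e Rp[of i] M bR(2)] z(2) by (auto simp: M_def om_def)
 have "dist x0 y < r + 8 * r * (1 / 2) ^ j0 * S i + 2 * R i" using y(1) z(1) dist_triangle[of x0 y z] by auto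
 also have "r + 8 * r * (1 / 2) ^ j0 * S i + 2 * R i = r + 8 * r * (1 / 2) ^ j0 * S (Suc i)"
 by (simp add: S_def R_def power_add algebra_simps)
 finally show ?case using y(2) by (intro exI[of _ y]) (simp add: M_def mult.assoc)
 qed
 have "cball x0 (2 * r) \<subseteq> Om" using sub r by (auto simp: subset_iff)
 then have "bounded (v ` cball x0 (2 * r))"
 by (intro compact_imp_bounded compact_continuous_image continuous_on_subset[OF vc]) auto
 then have "\<exists>b. \<forall>z\<in>cball x0 (2 * r). \<bar>v z\<bar> <= b" unfolding bounded_iff by simp
 then obtain b where b: "\<forall>z\<in>cball x0 (2 * r). \<bar>v z\<bar> <= b" ..
 obtain i where i: "b < (1 + k) ^ i" using real_arch_pow[of "1 + k" b] k by auto
 obtain z where z: "dist x0 z < r + 8 * r * (1 / 2) ^ j0 * S i" "(1 + k) ^ i * M0 < v z" using grow by blast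
 have "\<bar>v z\<bar> <= b" using z(1) Sr[of i] by (intro bspec[OF b]) simp
 moreover have "(1 + k) ^ i * 1 <= (1 + k) ^ i * M0" using k M0 by (intro mult_left_mono) auto
 ultimately show False using i z(2) by simp
 qed
 qed
 qed
 qed
qed

text \<open>Normalising by \<open>v x0 + t\<close> and letting \<open>t\<close> tend to 0 covers the
  case \<open>v x0 = 0\<close>.\<close>

lemma harnack:
 assumes lam: "0 < lam" "0 < Lam"
 shows "\<exists>C\<ge>1. (\<forall>Om v G F (x0 :: 'a::euclidean_space) r. ellflux lam Lam Om v G F --> (\<forall>y\<in>Om. 0 <= v y) --> 0 < r -->
 ball x0 (18 * r) \<subseteq> Om --> (\<forall>x\<in>ball x0 r. v x <= C * v x0))"
proof -
 show ?thesis
 proof (rule exE[OF harnack_aux[OF lam, where 'a = 'a]], elim conjE, goal_cases)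
 case (1 C)
 note C = 1(1) and ha0 = 1(2)
 note ha = ha0[THEN spec4, THEN spec, THEN spec, THEN mp4, THEN mp, THEN bspec]
 show ?thesis
 proof (intro exI[of _ C] conjI C allI impI ballI)
 fix Om v G F and x0 :: 'a and r and x
 assume e: "ellflux lam Lam Om v G F" and v0: "\<forall>y\<in>Om. 0 <= v y" and r: "0 < r" and sub: "ball x0 (18 * r) \<subseteq> Om" and x: "x \<in> ball x0 r"
 have "x0 \<in> Om" by (rule subsetD[OF sub]) (use r in simp)
 then have x0: "0 <= v x0" using v0 by blast
 have "v x <= C * (v x0 + t)" if t: "0 < t" for t
 proof -
 have p: "0 < v x0 + t" using x0 t by simp
 have "1 / (v x0 + t) * v x + 0 <= C"
 proof (rule ha[OF ellflux_affine[OF e] _ r sub _ x])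
 show "\<forall>y\<in>Om. 0 <= 1 / (v x0 + t) * v y + 0" using v0 p by simp
 show "1 / (v x0 + t) * v x0 + 0 <= 1" using p t by (simp add: divide_le_eq)
 qed
 then show ?thesis using p by (simp add: divide_le_eq)
 qed
 then have "!!t. 0 < t ==> v x <= C * v x0 + C * t" by (simp add: distrib_left)
 then have "v x <= C * v x0 + t" if "0 < t" for t
 using that C by (metis divide_pos_pos less_le_trans nonzero_mult_div_cancel_left times_divide_eq_right zero_less_one not_one_le_zero)
 then show "v x <= C * v x0" by (rule field_le_epsilon)
 qed
 qed
qed

text \<open>Weak gradients and coefficients are Lebesgue measurable, while the estimates above run
  in the Borel setting; fields are replaced by Borel representatives component by component.\<close>

lemma lebesgue_ex_borel:
 fixes V :: "'a::euclidean_space => 'b::euclidean_space"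
 assumes V: "V \<in> borel_measurable lebesgue"
 shows "\<exists>V'\<in>borel_measurable borel. AE x in lborel. V x = V' x"
proof -
 have "\<exists>g\<in>borel_measurable lborel. AE x in lborel. V x \<bullet> i = g x" for i
 by (rule completion_ex_borel_measurable_real) (use V in measurable)
 then obtain g where g: "!!i. g i \<in> borel_measurable lborel" "!!i. AE x in lborel. V x \<bullet> i = g i x" by metis
 have "AE x in lborel. \<forall>i\<in>Basis. V x \<bullet> i = g i x"
 by (rule AE_finite_allI) (use g in auto)
 then have ae: "AE x in lborel. V x = (\<Sum>i\<in>Basis. g i x *. i)"
 proof eventually_elim
 case (elim x)
 have "V x = (\<Sum>i\<in>Basis. (V x \<bullet> i) *. i)" by (simp add: euclidean_representation)
 also have "... = (\<Sum>i\<in>Basis. g i x *. i)" using elim by (intro sum.cong) auto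
 finally show ?case .
 qed
 show ?thesis
 proof (rule bexI)
 show "AE x in lborel. V x = (\<Sum>i\<in>Basis. g i x *. i)" by (rule ae)
 qed (use g(1) in \<open>auto intro!: borel_measurable_sum borel_measurable_scaleR\<close>)
qed

subsection \<open>Solutions given by elliptic measure\<close>

definition hext :: "('m::finite pnt => (real^'m) measure) => (real^'m => real) => 'm pnt => real" where
 "hext om g X = (LINT y|om X. g y)"

definition Cc :: "('a::topological_space => real) => bool" where
 "Cc g \<longleftrightarrow> continuous_on UNIV g & compact (closure {x. g x ~= 0})"

text \<open>All that the later argument knows about the operator: solutions with continuous
  compactly supported data are elliptic fluxes with the right boundary values. The matrix has
  disappeared, so every later constant depends only on \<open>lam\<close>, \<open>Lam\<close> and
  the dimension.\<close>

definition emeas :: "real => real => ('m::finite pnt => (real^'m) measure) => bool" where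
 "emeas lam Lam om \<longleftrightarrow> (\<forall>X\<in>half_space. prob_space (om X) & sets (om X) = sets borel) &
 (\<forall>g. Cc g --> (\<exists>G F. ellflux lam Lam half_space (hext om g) G F & has_weak_gradient half_space (hext om g) G) &
 (\<forall>x. (hext om g \<longlongrightarrow> g x) (at (x, 0) within half_space)))"

lemma half_space_snd: "X \<in> half_space \<longleftrightarrow> 0 < snd X"
 by (cases X) (simp add: half_space_def)

lemma open_half_space: "open (half_space :: 'm::finite pnt set)"
proof -
 have eq: "half_space = (snd -` {0<..} :: 'm pnt set)" by (auto simp: half_space_snd)
 show ?thesis unfolding eq by (rule open_vimage_snd) (rule open_greaterThan)
qed

lemma half_space_borel [measurable]: "half_space \<in> sets borel"
 using open_half_space by (rule borel_open)

section \<open>From Lebesgue weak solutions to Borel elliptic fluxes\<close>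

lemma set_lebesgue_on_lborel:
 fixes f g :: "'a::euclidean_space => 'b::euclidean_space"
 assumes S: "S \<in> sets borel" and g: "g \<in> bm" and eq: "AE x in lborel. indicator S x *. f x = g x"
 and f: "f \<in> borel_measurable (lebesgue_on S)"
 shows "(LINT x|lebesgue_on S. f x) = (LINT x|lborel. g x)"
proof -
 have S': "S \<in> sets lebesgue" using S by (simp add: sets_completionI_sets)
 have "(LINT x|lebesgue_on S. f x) = (LINT x|lebesgue. indicator S x *. f x)"
 using S' by (subst integral_restrict_space) (auto simp: set_lebesgue_integral_def)
 also have "... = (LINT x|lebesgue. g x)"
 proof (rule integral_cong_AE)
 show "(%x. indicator S x *. f x) \<in> borel_measurable lebesgue"
 using f S' by (subst (asm) borel_measurable_restrict_space_iff) auto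
 show "g \<in> borel_measurable lebesgue" using g by (simp add: measurable_completion)
 show "AE x in lebesgue. indicator S x *. f x = g x" using eq by (rule AE_completion)
 qed
 also have "... = (LINT x|lborel. g x)" using g by (intro integral_completion) simp
 finally show ?thesis .
qed

lemma C1_zero_outside_support:
 assumes "test_function Om f D" "x ~: closure {x. f x ~= 0}"
 shows "D x = 0"
proof (rule C1_locally_const[of f D "- closure {x. f x ~= 0}" x 0])
 show "C1 f D" using assms by (auto simp: test_function_def C1_def)
 show "f y = 0" if "y \<in> - closure {x. f x ~= 0}" for y using that closure_subset[of "{x. f x ~= 0}"] by auto
qed (use assms in auto)

text \<open>The entry bounds give an operator norm of at most \<open>n^2 |\<Lambda>|\<close> in
  dimension \<open>n\<close>; adding 1 makes the constant positive whatever \<open>\<Lambda>\<close>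
  is.\<close>

lemma elliptic_bound:
 fixes A :: "'m::finite pnt => 'm pnt \<Rightarrow>\<^sub>L 'm pnt"
 assumes "elliptic_coefficients lam \<Lambda> A"
 shows "AE X in lborel. X \<in> half_space --> (\<forall>\<xi>. lam * (norm \<xi>)^2 <= blinfun_apply (A X) \<xi> \<bullet> \<xi> &
 norm (blinfun_apply (A X) \<xi>) <= (real DIM('m pnt) ^ 2 * \<bar>\<Lambda>\<bar> + 1) * norm \<xi>)"
proof -
 have S: "half_space \<in> sets lebesgue" by (simp add: sets_completionI_sets)
 have tr: "(AE X in lebesgue_on half_space. P X) ==> AE X in lborel. X \<in> half_space --> P X" for P :: "'m pnt => bool"
 using S by (simp add: AE_restrict_space_iff AE_completion_iff)
 have 1: "AE X in lborel. X \<in> half_space --> (\<forall>\<xi>. lam * (norm \<xi>)^2 <= blinfun_apply (A X) \<xi> \<bullet> \<xi> &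
 blinfun_apply (A X) \<xi> \<bullet> \<xi> <= inverse lam * (norm \<xi>)^2)"
 by (rule tr) (use assms in \<open>simp add: elliptic_coefficients_def\<close>)
 have "AE X in lborel. \<forall>i\<in>Basis. \<forall>j\<in>Basis. X \<in> half_space --> \<bar>blinfun_apply (A X) j \<bullet> i\<bar> <= \<Lambda>"
 using assms by (intro AE_finite_allI tr) (auto simp: elliptic_coefficients_def)
 then have 2: "AE X in lborel. \<forall>i\<in>Basis. \<forall>j\<in>Basis. X \<in> half_space --> \<bar>blinfun_apply (A X) j \<bullet> i\<bar> <= \<Lambda>" .
 from 1 2 show ?thesis
 proof (eventually_elim, intro impI allI conjI)
 fix X \<xi> assume X: "X \<in> half_space" and a: "X \<in> half_space --> (\<forall>\<xi>. lam * (norm \<xi>)^2 <= blinfun_apply (A X) \<xi> \<bullet> \<xi> &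
 blinfun_apply (A X) \<xi> \<bullet> \<xi> <= inverse lam * (norm \<xi>)^2)"
 and b: "\<forall>i\<in>Basis. \<forall>j\<in>Basis. X \<in> half_space --> \<bar>blinfun_apply (A X) j \<bullet> i\<bar> <= \<Lambda>"
 show "lam * (norm \<xi>)^2 <= blinfun_apply (A X) \<xi> \<bullet> \<xi>" using a X by blast
 have c: "\<bar>blinfun_apply (A X) \<xi> \<bullet> i\<bar> <= real DIM('m pnt) * (norm \<xi> * \<bar>\<Lambda>\<bar>)" if i: "i \<in> Basis" for i
 proof -
 have "blinfun_apply (A X) \<xi> = blinfun_apply (A X) (\<Sum>j\<in>Basis. (\<xi> \<bullet> j) *. j)" by (simp add: euclidean_representation)
 also have "... = (\<Sum>j\<in>Basis. (\<xi> \<bullet> j) *. blinfun_apply (A X) j)" by (simp add: blinfun.sum_right blinfun.scaleR_right)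
 finally have "\<bar>blinfun_apply (A X) \<xi> \<bullet> i\<bar> = \<bar>\<Sum>j\<in>Basis. (\<xi> \<bullet> j) * (blinfun_apply (A X) j \<bullet> i)\<bar>" by (simp add: inner_sum_left)
 also have "... <= (\<Sum>j\<in>Basis. \<bar>(\<xi> \<bullet> j) * (blinfun_apply (A X) j \<bullet> i)\<bar>)" by (rule sum_abs)
 also have "... <= (\<Sum>j\<in>(Basis :: 'm pnt set). norm \<xi> * \<bar>\<Lambda>\<bar>)"
 proof (rule sum_mono)
 fix j :: "'m pnt" assume j: "j \<in> Basis"
 have "\<bar>blinfun_apply (A X) j \<bullet> i\<bar> <= \<bar>\<Lambda>\<bar>" using b i j X by fastforce
 then show "\<bar>(\<xi> \<bullet> j) * (blinfun_apply (A X) j \<bullet> i)\<bar> <= norm \<xi> * \<bar>\<Lambda>\<bar>"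
 unfolding abs_mult using j by (intro mult_mono Basis_le_norm) auto
 qed
 finally show ?thesis by simp
 qed
 have "norm (blinfun_apply (A X) \<xi>) <= (\<Sum>i\<in>Basis. \<bar>blinfun_apply (A X) \<xi> \<bullet> i\<bar>)" by (rule norm_le_l1)
 also have "... <= (\<Sum>i\<in>(Basis :: 'm pnt set). real DIM('m pnt) * (norm \<xi> * \<bar>\<Lambda>\<bar>))" by (intro sum_mono c)
 also have "... = (real DIM('m pnt) ^ 2 * \<bar>\<Lambda>\<bar>) * norm \<xi>" by (simp add: power2_eq_square mult_ac)
 also have "... <= (real DIM('m pnt) ^ 2 * \<bar>\<Lambda>\<bar> + 1) * norm \<xi>" by (intro mult_right_mono) auto
 finally show "norm (blinfun_apply (A X) \<xi>) <= (real DIM('m pnt) ^ 2 * \<bar>\<Lambda>\<bar> + 1) * norm \<xi>" .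
 qed
qed

lemma has_weak_gradient_borel:
 fixes u :: "'a::euclidean_space => real"
 assumes hw: "has_weak_gradient Om u G0" and Om: "open Om"
 shows "\<exists>G. G \<in> bm & (AE x in lborel. indicator Om x *. G0 x = G x) & has_weak_gradient Om u G"
proof -
 have bOm[measurable]: "Om \<in> sets borel" using Om by simp
 have lOm: "Om \<in> sets lebesgue" by (simp add: sets_completionI_sets)
 have G0: "G0 \<in> borel_measurable (lebesgue_on Om)" using hw by (simp add: has_weak_gradient_def)
 then have "(%x. indicator Om x *. G0 x) \<in> borel_measurable lebesgue"
 using lOm by (subst (asm) borel_measurable_restrict_space_iff) auto
 from lebesgue_ex_borel[OF this] obtain G where G[measurable]: "G \<in> bm" and ae: "AE x in lborel. indicator Om x *. G0 x = G x"
 by blast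
 have aeL: "AE x in lebesgue. x \<in> Om --> G0 x = G x"
 using AE_completion[OF ae] by eventually_elim (auto split: split_indicator_asm)
 have Gm: "G \<in> borel_measurable (lebesgue_on S)" for S by (simp add: measurable_completion measurable_restrict_space1)
 have aeS: "AE x in lebesgue_on S. G0 x = G x" if "S \<in> sets lebesgue" "S \<subseteq> Om" for S
 using aeL that by (simp add: AE_restrict_space_iff) (auto elim!: eventually_mono)
 have "has_weak_gradient Om u G"
 unfolding has_weak_gradient_def
 proof (intro conjI allI impI)
 show "u \<in> borel_measurable (lebesgue_on Om)" using hw by (simp add: has_weak_gradient_def)
 show "G \<in> borel_measurable (lebesgue_on Om)" by (rule Gm)
 fix K assume K: "compact K & K \<subseteq> Om"
 then have KL: "K \<in> sets lebesgue" by (simp add: sets_completionI_sets borel_compact)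
 show "integrable (lebesgue_on K) (%X. (u X)^2)" using hw K by (simp add: has_weak_gradient_def)
 have i0: "integrable (lebesgue_on K) (%X. (norm (G0 X))^2)" using hw K by (simp add: has_weak_gradient_def)
 have "AE x in lebesgue_on K. (norm (G0 x))^2 = (norm (G x))^2"
 using aeS[OF KL] K by (auto elim!: eventually_mono)
 then show "integrable (lebesgue_on K) (%X. (norm (G X))^2)"
 using i0 by (rule_tac integrable_cong_AE_imp[OF i0]) (use Gm[of K] in \<open>auto simp: eq_commute\<close>)
 next
 fix f D assume t: "test_function Om f D"
 have [measurable]: "f \<in> bm" using t C1_measurable(1)[of f D] by (auto simp: test_function_def C1_def)
 have fm: "f \<in> borel_measurable (lebesgue_on Om)" by (simp add: measurable_completion measurable_restrict_space1)
 have "(LINT X|lebesgue_on Om. u X *. D X) = - (LINT X|lebesgue_on Om. f X *. G0 X)"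
 using hw t by (simp add: has_weak_gradient_def)
 also have "(LINT X|lebesgue_on Om. f X *. G0 X) = (LINT X|lebesgue_on Om. f X *. G X)"
 using aeS[OF lOm] G0 fm Gm[of Om] by (intro integral_cong_AE) (auto elim!: eventually_mono)
 finally show "(LINT X|lebesgue_on Om. u X *. D X) = - (LINT X|lebesgue_on Om. f X *. G X)" .
 qed
 with G ae show ?thesis by (intro exI[of _ G] conjI)
qed

lemma has_weak_gradient_sob:
 fixes u :: "'a::euclidean_space => real"
 assumes hw: "has_weak_gradient Om u G" and Om: "open Om" and G[measurable]: "G \<in> bm" and u: "continuous_on Om u"
 shows "sob Om u G"
proof (rule sob_of_weak_gradient[OF Om u G])
 have bOm[measurable]: "Om \<in> sets borel" using Om by simp
 fix K assume K: "compact K" "K \<subseteq> Om"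
 then have [measurable]: "K \<in> sets borel" and KL: "K \<in> sets lebesgue" by (auto simp: sets_completionI_sets borel_compact)
 have "integrable (lebesgue_on K) (%X. (norm (G X))^2)" using hw K by (simp add: has_weak_gradient_def)
 then have "(\<integral>\<^sup>+x. ennreal ((norm (G x))^2) \<partial>lebesgue_on K) < \<infinity>" by (simp add: integrable_iff_bounded)
 also have "(\<integral>\<^sup>+x. ennreal ((norm (G x))^2) \<partial>lebesgue_on K) = L2sq K G"
 unfolding L2sq_def using KL by (simp add: nn_integral_restrict_space nn_integral_completion mult.commute)
 finally show "L2sq K G < \<infinity>" .
next
 have bOm[measurable]: "Om \<in> sets borel" using Om by simp
 have um: "u \<in> borel_measurable (lebesgue_on Om)" using hw by (simp add: has_weak_gradient_def)
 have [measurable]: "(%x. indicator Om x *. u x) \<in> bm"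
 by (rule borel_measurable_continuous_on_indicator[OF _ u]) simp
 fix f D assume t: "test_function Om f D"
 have [measurable]: "f \<in> bm" "D \<in> bm" using t C1_measurable[of f D] by (auto simp: test_function_def C1_def)
 have m: "V \<in> borel_measurable (lebesgue_on Om)" if "V \<in> bm" for V :: "'a => 'c::euclidean_space"
 using that by (simp add: measurable_completion measurable_restrict_space1)
 have "(LINT X|lebesgue_on Om. u X *. D X) = (BI x. (indicator Om x *. u x) *. D x)"
 proof (rule set_lebesgue_on_lborel)
 show "(%x. (indicator Om x *. u x) *. D x) \<in> bm" by measurable
 show "(%X. u X *. D X) \<in> borel_measurable (lebesgue_on Om)" by (intro borel_measurable_scaleR um m) measurable
 qed auto
 moreover have "(LINT X|lebesgue_on Om. f X *. G X) = (BI x. f x *. (indicator Om x *. G x))"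
 proof (rule set_lebesgue_on_lborel)
 show "(%x. f x *. (indicator Om x *. G x)) \<in> bm" by measurable
 show "(%X. f X *. G X) \<in> borel_measurable (lebesgue_on Om)" by (intro borel_measurable_scaleR m) measurable
 qed auto
 ultimately show "(BI x. (indicator Om x * u x) *. D x) = - (BI x. f x *. (indicator Om x *. G x))"
 using hw t by (simp add: has_weak_gradient_def)
qed

text \<open>Measurability is assumed for the entries of the matrix; this expansion transfers it to
  the field obtained by applying the matrix to a gradient.\<close>

lemma blinfun_components:
 fixes B :: "'a::euclidean_space \<Rightarrow>\<^sub>L 'b::euclidean_space"
 shows "blinfun_apply B \<xi> = (\<Sum>i\<in>Basis. (\<Sum>j\<in>Basis. (\<xi> \<bullet> j) * (blinfun_apply B j \<bullet> i)) *. i)"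
proof -
 have "blinfun_apply B \<xi> = blinfun_apply B (\<Sum>j\<in>Basis. (\<xi> \<bullet> j) *. j)" by (simp add: euclidean_representation)
 also have "... = (\<Sum>j\<in>Basis. (\<xi> \<bullet> j) *. blinfun_apply B j)" by (simp add: blinfun.sum_right blinfun.scaleR_right)
 finally have "blinfun_apply B \<xi> \<bullet> i = (\<Sum>j\<in>Basis. (\<xi> \<bullet> j) * (blinfun_apply B j \<bullet> i))" for i by (simp add: inner_sum_left)
 then show ?thesis by (metis (no_types, lifting) euclidean_representation sum.cong)
qed

lemma weak_solution_ellflux:
 fixes A :: "'m::finite pnt => 'm pnt \<Rightarrow>\<^sub>L 'm pnt"
 assumes el: "elliptic_coefficients lam \<Lambda> A" and ws: "weak_solution A u" and u: "continuous_on half_space u"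
 shows "\<exists>G F. ellflux lam (real DIM('m pnt) ^ 2 * \<bar>\<Lambda>\<bar> + 1) half_space u G F & has_weak_gradient half_space u G"
proof -
 let ?G0 = "weak_gradient half_space u"
 have hw: "has_weak_gradient half_space u ?G0"
 unfolding weak_gradient_def by (rule someI_ex[of "has_weak_gradient half_space u"]) (use ws in \<open>simp add: weak_solution_def\<close>)
 obtain G where G[measurable]: "G \<in> bm" and ae: "AE x in lborel. indicator half_space x *. ?G0 x = G x"
 and hwG: "has_weak_gradient half_space u G"
 by (rule exE[OF has_weak_gradient_borel[OF hw open_half_space]]) (elim conjE, rule that)
 have S: "half_space \<in> sets lebesgue" by (simp add: sets_completionI_sets)
 have G0m: "?G0 \<in> borel_measurable (lebesgue_on half_space)" using hw by (simp add: has_weak_gradient_def)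
 have ent: "(%X. blinfun_apply (A X) j \<bullet> i) \<in> borel_measurable (lebesgue_on half_space)" if "i \<in> Basis" "j \<in> Basis" for i j
 using el that by (simp add: elliptic_coefficients_def)
 have gj: "(%X. ?G0 X \<bullet> j) \<in> borel_measurable (lebesgue_on half_space)" for j
 by (rule borel_measurable_inner[OF G0m]) simp
 have AGm: "(%x. blinfun_apply (A x) (?G0 x)) \<in> borel_measurable (lebesgue_on half_space)"
 unfolding blinfun_components[of "A _" "?G0 _"]
 by (intro borel_measurable_sum borel_measurable_scaleR borel_measurable_times borel_measurable_const ent gj)
 then have "(%x. indicator half_space x *. blinfun_apply (A x) (?G0 x)) \<in> borel_measurable lebesgue"
 using S by (subst (asm) borel_measurable_restrict_space_iff) auto
 from lebesgue_ex_borel[OF this] obtain F where F[measurable]: "F \<in> bm"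
 and aeF: "AE x in lborel. indicator half_space x *. blinfun_apply (A x) (?G0 x) = F x"
 by blast
 have "AE x in lborel. x \<in> half_space --> lam * (norm (G x))^2 <= F x \<bullet> G x & norm (F x) <= (real DIM('m pnt) ^ 2 * \<bar>\<Lambda>\<bar> + 1) * norm (G x)"
 using ae aeF elliptic_bound[OF el]
 proof (eventually_elim, intro impI)
 fix x assume x: "indicator half_space x *. ?G0 x = G x" "indicator half_space x *. blinfun_apply (A x) (?G0 x) = F x" "x \<in> half_space"
 "x \<in> half_space --> (\<forall>\<xi>. lam * (norm \<xi>)^2 <= blinfun_apply (A x) \<xi> \<bullet> \<xi> &
 norm (blinfun_apply (A x) \<xi>) <= (real DIM('m pnt) ^ 2 * \<bar>\<Lambda>\<bar> + 1) * norm \<xi>)"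
 then have "?G0 x = G x" "F x = blinfun_apply (A x) (G x)" by auto
 then show "lam * (norm (G x))^2 <= F x \<bullet> G x & norm (F x) <= (real DIM('m pnt) ^ 2 * \<bar>\<Lambda>\<bar> + 1) * norm (G x)"
 using x(3,4) by metis
 qed
 moreover have "(BI x. F x \<bullet> D x) = 0" if t: "test_function half_space f D" for f D
 proof -
 have [measurable]: "D \<in> bm" using t C1_measurable[of f D] by (auto simp: test_function_def C1_def)
 have Dm: "D \<in> borel_measurable (lebesgue_on half_space)" by (simp add: measurable_completion measurable_restrict_space1)
 have "(LINT X|lebesgue_on half_space. blinfun_apply (A X) (?G0 X) \<bullet> D X) = (BI x. F x \<bullet> D x)"
 proof (rule set_lebesgue_on_lborel)
 show "AE x in lborel. indicator half_space x *. (blinfun_apply (A x) (?G0 x) \<bullet> D x) = F x \<bullet> D x"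
 using aeF by eventually_elim (metis inner_scaleR_left real_scaleR_def)
 qed (use AGm Dm in auto)
 then show ?thesis using ws t by (simp add: weak_solution_def)
 qed
 ultimately have "ellflux lam (real DIM('m pnt) ^ 2 * \<bar>\<Lambda>\<bar> + 1) half_space u G F"
 unfolding ellflux_def using has_weak_gradient_sob[OF hwG open_half_space G u] open_half_space F by blast
 then show ?thesis using hwG by blast
qed

lemma emeas_of_elliptic:
 fixes A :: "'m::finite pnt => 'm pnt \<Rightarrow>\<^sub>L 'm pnt"
 assumes "elliptic_coefficients lam \<Lambda> A" "is_elliptic_measure A om"
 shows "emeas lam (real DIM('m pnt) ^ 2 * \<bar>\<Lambda>\<bar> + 1) om"
proof -
 have sd: "solves_dirichlet A g (hext om g)" if "Cc g" for g
 using assms(2) that unfolding is_elliptic_measure_def Cc_def hext_def[abs_def] by blast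
 show ?thesis
 unfolding emeas_def
 proof (intro conjI allI impI)
 show "\<forall>X\<in>half_space. prob_space (om X) & sets (om X) = sets borel" using assms(2) by (simp add: is_elliptic_measure_def)
 fix g :: "real^'m => real" assume "Cc g"
 note * = sd[OF this]
 show "\<exists>G F. ellflux lam (real DIM('m pnt) ^ 2 * \<bar>\<Lambda>\<bar> + 1) half_space (hext om g) G F & has_weak_gradient half_space (hext om g) G"
 by (rule weak_solution_ellflux[OF assms(1)]) (use * in \<open>auto simp: solves_dirichlet_def\<close>)
 show "(hext om g \<longlongrightarrow> g x) (at (x, 0) within half_space)" for x using * by (simp add: solves_dirichlet_def)
 qed
qed

section \<open>Compactly supported data and comparison of measures\<close>

lemma emeas_D:
 assumes "emeas lam Lam om" "X \<in> half_space"
 shows "prob_space (om X)" "sets (om X) = sets borel" "space (om X) = UNIV"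
 using assms sets_eq_imp_space_eq[of "om X" borel] by (auto simp: emeas_def)

lemma Cc_measurable: "Cc g ==> g \<in> bm"
 unfolding Cc_def by (elim conjE) (rule borel_measurable_continuous_onI)

lemma Cc_bounded:
 fixes g :: "'a::euclidean_space => real"
 assumes "Cc g"
 shows "\<exists>B. \<forall>x. \<bar>g x\<bar> <= B"
proof -
 let ?K = "closure {x. g x ~= 0}"
 have c: "continuous_on UNIV g" "compact ?K" using assms by (auto simp: Cc_def)
 have "compact (g ` ?K)" by (rule compact_continuous_image[OF continuous_on_subset[OF c(1) subset_UNIV] c(2)])
 then have "\<exists>B. \<forall>x\<in>?K. \<bar>g x\<bar> <= B" using compact_imp_bounded[of "g ` ?K"] by (simp add: bounded_iff)
 then obtain B where B: "\<forall>x\<in>?K. \<bar>g x\<bar> <= B" ..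
 have "\<bar>g x\<bar> <= max B 0" for x
 proof (cases "g x = 0")
 case False
 then have "x \<in> ?K" using closure_subset[of "{x. g x ~= 0}"] by auto
 then have "\<bar>g x\<bar> <= B" using B by blast
 then show ?thesis by simp
 qed simp
 then show ?thesis by blast
qed

lemma Cc_integrable:
 fixes g :: "'a::euclidean_space => real"
 assumes "Cc g" "prob_space M" "sets M = sets borel"
 shows "integrable M g"
proof -
 interpret prob_space M by (rule assms)
 obtain B where "\<forall>x. \<bar>g x\<bar> <= B" using Cc_bounded[OF assms(1)] ..
 then show ?thesis
 using Cc_measurable[OF assms(1)] assms(3) by (intro integrable_const_bound[of _ B]) (auto cong: measurable_cong_sets)
qed

lemma Cc_lincomb:
 fixes g h :: "'a::euclidean_space => real"
 assumes "Cc g" "Cc h"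
 shows "Cc (%x. a * g x + b * h x)"
proof -
 have "closure {x. a * g x + b * h x ~= 0} \<subseteq> closure ({x. g x ~= 0} \<union> {x. h x ~= 0})"
 by (intro closure_mono) auto
 also have "... = closure {x. g x ~= 0} \<union> closure {x. h x ~= 0}" by (rule closure_Un)
 finally have "bounded (closure {x. a * g x + b * h x ~= 0})"
 using assms by (intro bounded_subset[OF bounded_Un[THEN iffD2]]) (auto simp: Cc_def compact_imp_bounded)
 then show ?thesis using assms by (auto simp: Cc_def compact_eq_bounded_closed intro!: continuous_intros)
qed

definition tent :: "'a::euclidean_space => real => 'a => real" where
 "tent y r x = max 0 (min 1 (2 - dist x y / r))"

lemma tent:
 assumes "0 < r"
 shows "Cc (tent y r)" "0 <= tent y r x" "tent y r x <= 1" "dist x y <= r ==> tent y r x = 1" "2 * r <= dist x y ==> tent y r x = 0"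
proof -
 have "closure {x. tent y r x ~= 0} \<subseteq> cball y (2 * r)"
 by (rule closure_minimal) (use assms in \<open>auto simp: tent_def max_def dist_commute field_simps split: if_splits\<close>)
 then have "bounded (closure {x. tent y r x ~= 0})" by (rule bounded_subset[OF bounded_cball])
 moreover have "continuous_on UNIV (tent y r)" unfolding tent_def[abs_def] using assms by (intro continuous_intros) auto
 ultimately show "Cc (tent y r)" by (simp add: Cc_def compact_eq_bounded_closed)
 show "0 <= tent y r x" "tent y r x <= 1" by (auto simp: tent_def)
 show "tent y r x = 1" if "dist x y <= r" using that assms by (simp add: tent_def min_def max_def field_simps)
 show "tent y r x = 0" if "2 * r <= dist x y"
 proof -
 have "2 <= dist x y / r" using that assms by (simp add: le_divide_eq)
 then show ?thesis by (simp add: tent_def)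
 qed
qed

lemma hext_lincomb:
 assumes "emeas lam Lam om" "X \<in> half_space" "Cc g" "Cc h"
 shows "hext om (%x. a * g x + b * h x) X = a * hext om g X + b * hext om h X"
 unfolding hext_def using Cc_integrable[OF assms(3)] Cc_integrable[OF assms(4)] emeas_D[OF assms(1,2)] by simp

lemma hext_nonneg: "(!!x. 0 <= g x) ==> 0 <= hext om g X"
 unfolding hext_def by (rule Bochner_Integration.integral_nonneg) simp

lemma hext_le_1:
 assumes "emeas lam Lam om" "X \<in> half_space" "Cc g" "!!x. g x <= 1"
 shows "hext om g X <= 1"
proof -
 interpret prob_space "om X" by (rule emeas_D[OF assms(1,2)])
 have "hext om g X <= (LINT y|om X. 1)"
 unfolding hext_def using Cc_integrable[OF assms(3) emeas_D(1,2)[OF assms(1,2)]] assms(4) by (intro integral_mono) auto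
 then show ?thesis by (simp add: prob_space)
qed

lemma hext_le_measure:
 assumes "emeas lam Lam om" "X \<in> half_space" "Cc g" "S \<in> sets borel" "!!x. g x <= 1" "!!x. x ~: S ==> g x <= 0"
 shows "hext om g X <= measure (om X) S"
proof -
 interpret prob_space "om X" by (rule emeas_D[OF assms(1,2)])
 have S: "S \<in> sets (om X)" using assms emeas_D(2)[OF assms(1,2)] by simp
 have "hext om g X <= (LINT y|om X. indicator S y)"
 unfolding hext_def using Cc_integrable[OF assms(3) emeas_D(1,2)[OF assms(1,2)]] assms(5,6) S
 by (intro integral_mono) (auto split: split_indicator simp: emeasure_eq_measure)
 then show ?thesis using S by simp
qed

lemma measure_le_hext:
 assumes "emeas lam Lam om" "X \<in> half_space" "Cc g" "S \<in> sets borel" "!!x. 0 <= g x" "!!x. x \<in> S ==> 1 <= g x"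
 shows "measure (om X) S <= hext om g X"
proof -
 interpret prob_space "om X" by (rule emeas_D[OF assms(1,2)])
 have S: "S \<in> sets (om X)" using assms emeas_D(2)[OF assms(1,2)] by simp
 have "(LINT y|om X. indicator S y) <= hext om g X"
 unfolding hext_def using Cc_integrable[OF assms(3) emeas_D(1,2)[OF assms(1,2)]] assms(5,6) S
 by (intro integral_mono) (auto split: split_indicator simp: emeasure_eq_measure)
 then show ?thesis using S by simp
qed

text \<open>One sequence serves all probability measures at once, so an inequality between two
  measures that is tested on \<open>Cc\<close> functions can be passed to the limit on both
  sides.\<close>

lemma compact_Cc_approx:
 fixes K :: "'a::euclidean_space set"
 assumes K: "compact K"
 shows "\<exists>g. (\<forall>n::nat. Cc (g n) & (\<forall>x. 0 <= g n x & g n x <= 1) & (\<forall>x\<in>K. g n x = 1)) &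
 (\<forall>P. prob_space P --> sets P = sets borel --> (%n. LINT x|P. g n x) ~~> measure P K)"
proof (cases "K = {}")
 case True
 then show ?thesis by (intro exI[of _ "%n x. 0"]) (auto simp: Cc_def)
next
 case False
 have Kb: "K \<in> sets borel" using K by (simp add: borel_compact)
 define g where "g n x = max 0 (1 - real (Suc n) * infdist x K)" for n x
 have gz: "g n x = 0" if "1 <= infdist x K" for n x
 proof -
 have "1 * 1 <= real (Suc n) * infdist x K" using that by (intro mult_mono) auto
 then show ?thesis by (simp add: g_def)
 qed
 have Cg: "Cc (g n)" for n
 proof -
 have "x \<in> {x. infdist x K <= 1}" if "x \<in> {x. g n x ~= 0}" for x using gz[of x n] that by (cases "1 <= infdist x K") auto
 then have "{x. g n x ~= 0} \<subseteq> {x. infdist x K <= 1}" by (rule subsetI)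
 moreover have cp: "compact {x. infdist x K <= 1}" by (intro compact_infdist_le False K) simp
 ultimately have "closure {x. g n x ~= 0} \<subseteq> {x. infdist x K <= 1}" by (intro closure_minimal compact_imp_closed)
 then have "bounded (closure {x. g n x ~= 0})" using cp by (meson bounded_subset compact_imp_bounded)
 moreover have "continuous_on UNIV (g n)" unfolding g_def by (intro continuous_intros)
 ultimately show ?thesis by (simp add: Cc_def compact_eq_bounded_closed)
 qed
 have g01: "0 <= g n x" "g n x <= 1" for n x by (auto simp: g_def infdist_nonneg)
 have lim: "(%n. g n x) ~~> indicator K x" for x
 proof (cases "x \<in> K")
 case True
 then show ?thesis by (simp add: g_def)
 next
 case nK: False
 then have pos: "0 < infdist x K" using K False by (metis compact_imp_closed in_closed_iff_infdist_zero infdist_nonneg less_le)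
 have "EV n. g n x = 0"
 proof -
 obtain n0 :: nat where n0: "1 / infdist x K < real n0" using reals_Archimedean2 by blast
 show ?thesis
 using eventually_ge_at_top[of n0]
 proof eventually_elim
 case (elim n)
 have "1 < real n0 * infdist x K" using n0 pos by (simp add: divide_less_eq)
 also have "... <= real (Suc n) * infdist x K" using elim pos by (intro mult_right_mono) auto
 finally show ?case by (simp add: g_def)
 qed
 qed
 then show ?thesis using nK by (simp add: tendsto_eventually)
 qed
 have conv: "(%n. LINT x|P. g n x) ~~> measure P K" if "prob_space P" "sets P = sets borel" for P
 proof -
 interpret P: prob_space P by (rule that)
 have "(%n. LINT x|P. g n x) ~~> (LINT x|P. indicator K x)"
 proof (rule integral_dominated_convergence[where w = "%x. 1"])
 show "indicator K \<in> borel_measurable P" using Kb that(2) by simp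
 show "g n \<in> borel_measurable P" for n using Cc_measurable[OF Cg[of n]] that(2) by (simp cong: measurable_cong_sets)
 show "AE x in P. norm (g n x) <= 1" for n using g01 by simp
 show "AE x in P. (%n. g n x) ~~> indicator K x" using lim by simp
 qed simp
 then show ?thesis using Kb that(2) by simp
 qed
 show ?thesis
 by (intro exI[of _ g] conjI allI impI conv Cg ballI g01) (simp_all add: g_def)
qed

text \<open>Compact sets by approximation from above, then Borel sets by inner regularity. Here
  inequalities for solutions with continuous data become inequalities for elliptic measures.\<close>

lemma measure_le_of_Cc:
 fixes M N :: "'a::euclidean_space measure"
 assumes M: "prob_space M" "sets M = sets borel" and N: "prob_space N" "sets N = sets borel" and C: "0 <= a" "0 <= C"
 and le: "!!g. Cc g ==> (!!x. 0 <= g x) ==> a * (LINT x|M. g x) <= C * (LINT x|N. g x)" and F: "F \<in> sets borel"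
 shows "a * measure M F <= C * measure N F"
proof -
 interpret M: prob_space M by (rule M)
 interpret N: prob_space N by (rule N)
 have Kc: "a * measure M K <= C * measure N K" if K: "compact K" for K
 proof -
 obtain g where g: "\<forall>n::nat. Cc (g n) & (\<forall>x. 0 <= g n x & g n x <= 1) & (\<forall>x\<in>K. g n x = 1)"
 and conv: "\<forall>P. prob_space P --> sets P = sets borel --> (%n. LINT x|P. g n x) ~~> measure P K"
 using compact_Cc_approx[OF K] by (elim exE conjE) (rule that)
 have "(%n. a * (LINT x|M. g n x)) ~~> a * measure M K" "(%n. C * (LINT x|N. g n x)) ~~> C * measure N K"
 using conv M N by (auto intro!: tendsto_intros)
 then show ?thesis by (rule LIMSEQ_le) (use le g in auto)
 qed
 have "emeasure M F = (SUP K\<in>{K. K \<subseteq> F & compact K}. emeasure M K)"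
 by (rule inner_regular[OF M(2) _ F]) (simp add: M.emeasure_space_1)
 have "ennreal a * emeasure M F <= ennreal (C * measure N F)"
 proof -
 have "ennreal a * emeasure M F = (SUP K\<in>{K. K \<subseteq> F & compact K}. ennreal a * emeasure M K)"
 unfolding \<open>emeasure M F = _\<close> by (rule SUP_mult_left_ennreal)
 also have "... <= ennreal (C * measure N F)"
 proof (rule SUP_least)
 fix K assume K: "K \<in> {K. K \<subseteq> F & compact K}"
 have "ennreal a * emeasure M K = ennreal (a * measure M K)" using C by (simp add: M.emeasure_eq_measure ennreal_mult)
 also have "a * measure M K <= C * measure N F"
 proof -
 have "measure N K <= measure N F" using K F N(2) by (intro N.finite_measure_mono) auto
 then show ?thesis using Kc[of K] K mult_left_mono[OF _ C(2), of "measure N K" "measure N F"] by auto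
 qed
 then have "ennreal (a * measure M K) <= ennreal (C * measure N F)" by (rule ennreal_leI)
 finally show "ennreal a * emeasure M K <= ennreal (C * measure N F)" .
 qed
 finally show ?thesis .
 qed
 then show ?thesis using C by (simp add: M.emeasure_eq_measure ennreal_mult[symmetric] ennreal_le_iff)
qed

section \<open>Harnack chains and boundary behaviour of elliptic measure\<close>

lemma ball_subset_half_space: "h <= snd X ==> ball X h \<subseteq> (half_space :: 'm::finite pnt set)"
proof
 fix Y assume h: "h <= snd X" and Y: "Y \<in> ball X h"
 have "dist (snd X) (snd Y) <= dist X Y" by (rule dist_snd_le)
 then show "Y \<in> half_space" using h Y by (simp add: half_space_snd dist_real_def)
qed

text \<open>A straight chain of \<open>k\<close> steps. The segment stays above height
  \<open>h\<close>, each step has length at most \<open>h / 36\<close>, and the Harnack lemma at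
  radius \<open>h / 18\<close> needs a ball of radius \<open>18 * (h / 18) = h\<close> in the half
  space.\<close>

lemma harnack_hext:
 assumes lam: "0 < lam" "0 < Lam"
 shows "\<exists>C\<ge>1. \<forall>om g (X :: 'm::finite pnt) Y h (k::nat). emeas lam Lam om --> Cc g --> (\<forall>x. 0 <= g x) --> 0 < h --> h <= snd X --> h <= snd Y -->
 dist X Y <= real k * h / 36 --> hext om g X <= C ^ k * hext om g Y"
proof -
 show ?thesis
 proof (rule exE[OF harnack[OF lam, where 'a = "'m pnt"]], elim conjE, goal_cases)
 case (1 C)
 note C = 1(1) and ha0 = 1(2)
 note ha = ha0[THEN spec4, THEN spec, THEN spec, THEN mp4, THEN bspec]
 show ?thesis
 proof (intro exI[of _ C] conjI C allI impI)
 fix om :: "'m pnt => (real^'m) measure" and g :: "real^'m => real" and X Y :: "'m pnt" and h :: real and k :: nat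
 assume e: "emeas lam Lam om" and g: "Cc g" "\<forall>x. 0 <= g x" and h: "0 < h"
 obtain G F where ef: "ellflux lam Lam half_space (hext om g) G F" using e g(1) unfolding emeas_def by blast
 have nn: "\<forall>y\<in>half_space. 0 <= hext om g y" using g(2) by (simp add: hext_nonneg)
 show "h <= snd X ==> h <= snd Y ==> dist X Y <= real k * h / 36 ==> hext om g X <= C ^ k * hext om g Y"
 proof (induction k arbitrary: X)
 case (Suc k)
 define X' where "X' = X + (1 / real (Suc k)) *. (Y - X)"
 have "X - X' = (- 1 / real (Suc k)) *. (Y - X)" by (simp add: X'_def)
 then have "dist X X' = (1 / real (Suc k)) * dist X Y" by (simp add: dist_norm norm_minus_commute)
 also have "... <= (1 / real (Suc k)) * (real (Suc k) * h / 36)" using Suc.prems by (intro mult_left_mono) auto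
 also have "... < h / 18" using h by simp
 finally have d1: "dist X X' < h / 18" .
 have t: "0 <= 1 - 1 / real (Suc k)" by simp
 have "Y - X' = (1 - 1 / real (Suc k)) *. (Y - X)" by (simp add: X'_def algebra_simps)
 then have "dist X' Y = \<bar>1 - 1 / real (Suc k)\<bar> * dist X Y" by (simp only: dist_norm norm_minus_commute[of X' Y] norm_minus_commute[of X Y] norm_scaleR)
 also have "... = (1 - 1 / real (Suc k)) * dist X Y" using t by simp
 also have "... <= (1 - 1 / real (Suc k)) * (real (Suc k) * h / 36)" by (rule mult_left_mono[OF Suc.prems(3) t])
 also have "... = real k * h / 36" by (simp add: field_simps)
 finally have d2: "dist X' Y <= real k * h / 36" .
 have sX': "h <= snd X'"
 proof -
 have "snd X' = (1 - 1 / real (Suc k)) * snd X + (1 / real (Suc k)) * snd Y" by (simp add: X'_def algebra_simps)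
 moreover have "(1 - 1 / real (Suc k)) * h + (1 / real (Suc k)) * h <= (1 - 1 / real (Suc k)) * snd X + (1 / real (Suc k)) * snd Y"
 using Suc.prems t by (intro add_mono mult_left_mono) auto
 ultimately show ?thesis by (simp add: algebra_simps)
 qed
 have "hext om g X <= C * hext om g X'"
 proof (rule ha[OF ef nn])
 show "0 < h / 18" using h by simp
 show "ball X' (18 * (h / 18)) \<subseteq> half_space" using ball_subset_half_space[OF sX'] by simp
 show "X \<in> ball X' (h / 18)" using d1 by (simp add: dist_commute)
 qed
 also have "... <= C * (C ^ k * hext om g Y)" using C by (intro mult_left_mono Suc.IH sX' Suc.prems d2) auto
 finally show ?case by simp
 qed simp
 qed
 qed
qed

lemma hext_boundary:
 assumes e: "emeas lam Lam om" "Cc g" and x: "x ~: half_space" and "0 < e"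
 shows "\<exists>d>0. \<forall>Y\<in>half_space. dist Y x < d --> snd x = 0 & \<bar>hext om g Y - g (fst x)\<bar> < e"
proof (cases "snd x = 0")
 case True
 then have x': "x = (fst x, 0)" by (metis prod.collapse)
 have "(hext om g \<longlongrightarrow> g (fst x)) (at x within half_space)" using e x' by (metis emeas_def)
 then obtain d where d: "0 < d" "!!Y. Y \<in> half_space ==> 0 < dist Y x ==> dist Y x < d ==> dist (hext om g Y) (g (fst x)) < e"
 using \<open>0 < e\<close> unfolding Lim_within by blast
 have "\<bar>hext om g Y - g (fst x)\<bar> < e" if "Y \<in> half_space" "dist Y x < d" for Y
 using d(2)[OF that(1) _ that(2)] that(1) x by (cases "Y = x") (auto simp: dist_real_def)
 then show ?thesis using d(1) True by blast
next
 case False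
 then have neg: "snd x < 0" using x by (simp add: half_space_snd)
 have "\<not> dist Y x < - snd x" if "Y \<in> half_space" for Y
 using that neg dist_snd_le[of Y x] by (auto simp: half_space_snd dist_real_def)
 then show ?thesis using neg by (intro exI[of _ "- snd x"]) auto
qed

text \<open>The boundary of \<open>D\<close> inside \<open>B\<close> has a part in the half space,
  handled by continuity and the first condition, and a flat part, handled by the boundary values and
  the second; points below the boundary keep a distance from the half space. The constant
  \<open>a\<close> admits data such as \<open>1 - g\<close>, which have no compact support.\<close>

lemma hext_subsol:
 fixes om :: "'m::finite pnt => (real^'m) measure"
 assumes e: "emeas lam Lam om" "Cc k" and D: "open D" "D \<subseteq> half_space" and B: "open B"
 and 1: "!!x. x \<in> B ==> x \<in> half_space ==> x \<in> closure D ==> x ~: D ==> a + hext om k x <= 0"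
 and 2: "!!x. x \<in> B ==> snd x = 0 ==> x \<in> closure D ==> a + k (fst x) <= 0"
 shows "subsol lam Lam B (%x. if x \<in> D then max 0 (a + hext om k x) else 0)"
proof -
 obtain G F where ef: "ellflux lam Lam half_space (hext om k) G F" using e unfolding emeas_def by blast
 have ef': "ellflux lam Lam half_space (%x. a + hext om k x) G F" using ellflux_affine[OF ef, of 1 a] by (simp add: add.commute)
 have hc: "continuous_on half_space (hext om k)" using ef by (simp add: ellflux_def sob_def)
 show ?thesis
 proof (rule zero_ext_subsol[OF ef' D B])
 fix x and e0 :: real assume x: "x \<in> B" "x ~: D" and e0: "0 < e0"
 consider "x ~: closure D" | "x \<in> closure D" "x \<in> half_space" | "x \<in> closure D" "x ~: half_space" by blast
 then show "\<exists>d>0. \<forall>y\<in>D. dist y x < d --> a + hext om k y < e0"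
 proof cases
 case 1
 then obtain d where d: "0 < d" "ball x d \<subseteq> - closure D" by (metis ComplI open_Compl closed_closure open_contains_ball)
 have "\<not> dist y x < d" if "y \<in> D" for y using that d(2) closure_subset[of D] by (auto simp: mem_ball dist_commute)
 then show ?thesis using d(1) by blast
 next
 case 2
 then obtain d where d: "0 < d" "!!y. y \<in> half_space ==> dist y x < d ==> dist (hext om k y) (hext om k x) < e0"
 using hc e0 unfolding continuous_on_iff by metis
 have "a + hext om k y < e0" if "y \<in> D" "dist y x < d" for y
 using d(2)[of y] that D(2) 1[OF x(1) 2(2,1) x(2)] by (auto simp: dist_real_def)
 then show ?thesis using d(1) by blast
 next
 case 3
 obtain d where d: "0 < d" "\<forall>Y\<in>half_space. dist Y x < d --> snd x = 0 & \<bar>hext om k Y - k (fst x)\<bar> < e0"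
 using hext_boundary[OF e 3(2) e0] by (elim exE conjE) (rule that)
 have "a + hext om k y < e0" if "y \<in> D" "dist y x < d" for y
 proof -
 have "snd x = 0 & \<bar>hext om k y - k (fst x)\<bar> < e0" using d(2) that D(2) by blast
 then show ?thesis using 2[OF x(1) _ 3(1)] by linarith
 qed
 then show ?thesis using d(1) by blast
 qed
 qed
qed

lemma measure_harnack:
 assumes lam: "0 < lam" "0 < Lam"
 shows "\<exists>C\<ge>1. \<forall>om (X :: 'm::finite pnt) Y h (k::nat) F. emeas lam Lam om --> F \<in> sets borel --> 0 < h --> h <= snd X --> h <= snd Y -->
 dist X Y <= real k * h / 36 --> measure (om X) F <= C ^ k * measure (om Y) F"
proof -
 show ?thesis
 proof (rule exE[OF harnack_hext[OF lam, where 'm = 'm]], elim conjE, goal_cases)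
 case (1 C)
 note C = 1(1) and ha0 = 1(2)
 note ha = ha0[THEN spec4, THEN spec, THEN spec, THEN mp4, THEN mp, THEN mp, THEN mp]
 show ?thesis
 proof (intro exI[of _ C] conjI C allI impI, goal_cases)
 case (1 om X Y h k F)
 note e = 1(1) and F = 1(2) and h = 1(3-6)
 have XY: "X \<in> half_space" "Y \<in> half_space" using h by (auto simp: half_space_snd)
 have "1 * measure (om X) F <= C ^ k * measure (om Y) F"
 proof (rule measure_le_of_Cc[OF emeas_D(1,2)[OF e XY(1)] emeas_D(1,2)[OF e XY(2)] _ _ _ F])
 show "0 <= C ^ k" using C by simp
 show "1 * (LINT x|om X. g x) <= C ^ k * (LINT x|om Y. g x)" if "Cc g" "!!x. 0 <= g x" for g
 using ha[OF e that(1) _ h] that(2) by (simp add: hext_def)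
 qed simp
 then show "measure (om X) F <= C ^ k * measure (om Y) F" by simp
 qed
 qed
qed

text \<open>\<open>1 - u\<close>, with \<open>u\<close> the solution for a tent over a large ball,
  vanishes on that ball of the boundary. Extended by zero it loses a factor \<open>1 - c\<close>
  each time the radius is divided by 4, so sufficiently many scales between \<open>R\<close> and
  \<open>s\<close> bring it below \<open>e\<close> at \<open>(y, s)\<close>.\<close>

lemma boundary_mass:
 assumes lam: "0 < lam" "0 < Lam" and e0: "0 < e"
 shows "\<exists>K>0. \<forall>om (y :: real^'m::finite) s. emeas lam Lam om --> 0 < s --> 1 - e <= measure (om (y, s)) (ball y (K * s))"
proof -
 show ?thesis
 proof (rule exE[OF decay_ball[OF lam, where 'a = "'m pnt"]], elim conjE, goal_cases)
 case (1 c)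
 note c = 1(1-2) and dl0 = 1(3)
 note dl = dl0[THEN spec4, THEN spec, THEN mp4, THEN mp, THEN mp]
 obtain j where j: "(1 - c) ^ j < e" using real_arch_pow_inv[OF e0, of "1 - c"] c by auto
 show ?thesis
 proof (intro exI[of _ "4 ^ (j + 1)"] conjI allI impI)
 fix om :: "'m pnt => (real^'m) measure" and y :: "real^'m" and s :: real
 assume e: "emeas lam Lam om" and s: "0 < s"
 define R where "R = 2 * 4 ^ j * s"
 have R: "0 < R" using s by (simp add: R_def)
 define g where "g = tent y R"
 have g: "Cc g" "!!x. 0 <= g x" "!!x. g x <= 1" "!!x. dist x y <= R ==> g x = 1" "!!x. 2 * R <= dist x y ==> g x = 0"
 unfolding g_def using tent[OF R] by blast+
 define W where "W x = (if x \<in> half_space then max 0 (1 + hext om (%z. - 1 * g z + 0 * g z) x) else 0)" for x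
 have We: "W x = 1 - hext om g x" if "x \<in> half_space" for x
 using hext_le_1[OF e that g(1,3)] hext_lincomb[OF e that g(1,1), of "-1" 0] that by (simp add: W_def)
 have W0: "W x = 0" if "snd x <= 0" for x using that by (simp add: W_def half_space_snd)
 have W1: "W x <= 1" for x
 by (cases "x \<in> half_space") (use hext_nonneg[of g om x] g(2) in \<open>auto simp: We W0 half_space_snd\<close>)
 have sub: "subsol lam Lam (ball (y, 0) R) W"
 unfolding W_def
 proof (rule hext_subsol[OF e Cc_lincomb[OF g(1,1)] open_half_space order_refl open_ball])
 fix x :: "'m pnt" assume x: "x \<in> ball (y, 0) R" "snd x = 0"
 have "dist (fst x) y <= R" using dist_fst_le[of x "(y, 0)"] x(1) by (simp add: dist_commute)
 then show "1 + (- 1 * g (fst x) + 0 * g (fst x)) <= 0" using g(4) by simp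
 qed auto
 have dec: "\<forall>x\<in>ball (y, 0) (R / 4 ^ i). W x <= (1 - c) ^ i" for i
 proof (induction i)
 case (Suc i)
 define r where "r = R / 4 ^ i / 2"
 have r: "0 < r" "2 * r = R / 4 ^ i" "r / 2 = R / 4 ^ Suc i" using R by (auto simp: r_def)
 have "R / 4 ^ i <= R" using R by (simp add: divide_le_eq mult_ge1_I)
 then have s1: "subsol lam Lam (ball (y, 0) (2 * r)) W"
 unfolding r(2) by (intro subsol_subset[OF sub] open_ball subset_ball)
 have zz: "x \<in> ball (y, 0) r & snd x <= 0" if x: "x \<in> ball (y, - r / 2) (r / 4)" for x :: "'m pnt"
 proof
 have "dist (y, 0 :: real) (y, - r / 2) = r / 2" using r by (simp add: dist_Pair_Pair dist_real_def)
 then show "x \<in> ball (y, 0) r" using dist_triangle[of "(y, 0)" x "(y, - r / 2)"] x r(1) by auto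
 show "snd x <= 0" using dist_snd_le[of "(y, - r / 2)" x] x r(1) by (simp add: dist_real_def)
 qed
 have "\<forall>x\<in>ball (y, 0) (r / 2). W x <= (1 - c) * (1 - c) ^ i"
 proof (rule dl[OF r(1) s1])
 show "ball (y, - r / 2) (r / 4) \<subseteq> ball (y, 0) r" "\<forall>x\<in>ball (y, - r / 2) (r / 4). W x = 0" using zz W0 by blast+
 qed (use Suc.IH c in \<open>auto simp: r(2)\<close>)
 then show ?case by (simp add: r(3))
 qed (simp add: W1)
 have H: "(y, s) \<in> half_space" using s by (simp add: half_space_snd)
 have "(y, s) \<in> ball (y, 0) (R / 4 ^ j)" using s by (simp add: R_def dist_Pair_Pair dist_real_def)
 then have "W (y, s) <= (1 - c) ^ j" using dec by blast
 then have "1 - e <= hext om g (y, s)" using We[OF H] j by linarith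
 also have "... <= measure (om (y, s)) (ball y (4 ^ (j + 1) * s))"
 proof (rule hext_le_measure[OF e H g(1) _ g(3)])
 fix x assume "x ~: ball y (4 ^ (j + 1) * s)"
 then show "g x <= 0" using g(5)[of x] by (simp add: R_def dist_commute)
 qed simp
 finally show "1 - e <= measure (om (y, s)) (ball y (4 ^ (j + 1) * s))" .
 qed simp
 qed
qed

subsection \<open>Boundary comparison and change of pole\<close>

text \<open>A Harnack chain downwards: travelling \<open>7 r\<close> at height \<open>r\<close>
  costs \<open>C^252 = q^7\<close>, and each halving of the height costs one further
  \<open>q = C^36\<close>. This exponential loss is what the strip decay has to beat.\<close>

lemma hext_lower:
 assumes lam: "0 < lam" "0 < Lam"
 shows "\<exists>q\<ge>1. \<forall>om h (x0 :: real^'m::finite) r y s i. emeas lam Lam om --> Cc h --> (\<forall>x. 0 <= h x) --> 0 < r --> dist y x0 <= 4 * r -->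
 r <= 2 ^ i * s --> 2 ^ i * s <= 4 * r --> hext om h (x0, r) <= q ^ (i + 7) * hext om h (y, s)"
proof -
 show ?thesis
 proof (rule exE[OF harnack_hext[OF lam, where 'm = 'm]], elim conjE, goal_cases)
 case (1 C)
 note C = 1(1) and ha0 = 1(2)
 note ha = ha0[THEN spec4, THEN spec, THEN spec, THEN mp4, THEN mp, THEN mp, THEN mp]
 define q where "q = C ^ 36"
 have q: "1 <= q" using C by (simp add: q_def)
 show ?thesis
 proof (intro exI[of _ q] conjI q allI)
 fix om :: "'m pnt => (real^'m) measure" and h :: "real^'m => real" and x0 y :: "real^'m" and r s :: real and i :: nat
 show "emeas lam Lam om --> Cc h --> (\<forall>x. 0 <= h x) --> 0 < r --> dist y x0 <= 4 * r -->
 r <= 2 ^ i * s --> 2 ^ i * s <= 4 * r --> hext om h (x0, r) <= q ^ (i + 7) * hext om h (y, s)"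
 proof (induction i arbitrary: s)
 case 0
 show ?case
 proof (intro impI)
 assume a: "emeas lam Lam om" "Cc h" "\<forall>x. 0 <= h x" "0 < r" "dist y x0 <= 4 * r" "r <= 2 ^ 0 * s" "2 ^ 0 * s <= 4 * r"
 have "dist (x0, r) (y, s) <= dist x0 y + dist r s" unfolding dist_Pair_Pair by (rule sqrt_sum_squares_le_sum) auto
 also have "... <= 4 * r + 3 * r" using a by (intro add_mono) (auto simp: dist_commute dist_real_def)
 finally have "dist (x0, r) (y, s) <= real 252 * r / 36" by simp
 then have "hext om h (x0, r) <= C ^ 252 * hext om h (y, s)" by (intro ha[OF a(1,2,3,4)]) (use a in auto)
 also have "C ^ 252 = q ^ (0 + 7)" by (simp add: q_def power_mult[symmetric])
 finally show "hext om h (x0, r) <= q ^ (0 + 7) * hext om h (y, s)" .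
 qed
 next
 case (Suc i)
 show ?case
 proof (intro impI)
 assume a: "emeas lam Lam om" "Cc h" "\<forall>x. 0 <= h x" "0 < r" "dist y x0 <= 4 * r" "r <= 2 ^ Suc i * s" "2 ^ Suc i * s <= 4 * r"
 have s: "0 < s" using a(4,6) by (smt (verit) zero_less_mult_pos zero_less_power)
 have "hext om h (x0, r) <= q ^ (i + 7) * hext om h (y, 2 * s)"
 by (rule Suc.IH[THEN mp4, THEN mp, THEN mp, THEN mp]) (use a in \<open>auto simp: algebra_simps\<close>)
 also have "hext om h (y, 2 * s) <= C ^ 36 * hext om h (y, s)"
 by (rule ha[OF a(1,2,3) s]) (use s in \<open>auto simp: dist_Pair_Pair dist_real_def\<close>)
 then have "q ^ (i + 7) * hext om h (y, 2 * s) <= q ^ (i + 7) * (q * hext om h (y, s))" using q by (intro mult_left_mono) (auto simp: q_def)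
 finally show "hext om h (x0, r) <= q ^ (Suc i + 7) * hext om h (y, s)" by (simp only: add_Suc power_Suc mult_ac)
 qed
 qed
 qed
 qed
qed

text \<open>For a point of a thin strip, the ball of radius \<open>2 h\<close> about it contains a
  ball of radius \<open>h / 2\<close> below the boundary, where \<open>W = 0\<close>. Each move of
  \<open>4 h\<close> away from the lateral boundary therefore gains a factor
  \<open>1 - c\<close>.\<close>

lemma strip_decay:
 assumes lam: "0 < lam" "0 < Lam"
 shows "\<exists>c>0. c < 1 & (\<forall>(y0 :: real^'m::finite) \<rho> h M W N y s. 0 < h --> subsol lam Lam (ball y0 \<rho> \<times> UNIV) W --> 0 <= M --> (\<forall>x. W x <= M) -->
 (\<forall>x. snd x <= 0 \<or> h <= snd x --> W x = 0) --> dist y y0 + 4 * h * real N <= \<rho> --> W (y, s) <= (1 - c) ^ N * M)"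
proof -
 show ?thesis
 proof (rule exE[OF decay_ball[OF lam, where 'a = "'m pnt"]], elim conjE, goal_cases)
 case (1 c)
 note c = 1(1-2) and dl0 = 1(3)
 note dl = dl0[THEN spec4, THEN spec, THEN mp4, THEN mp, THEN mp, THEN bspec]
 show ?thesis
 proof (intro exI[of _ c] conjI c allI impI)
 fix y0 y :: "real^'m" and \<rho> h M s :: real and W :: "'m pnt => real" and N :: nat
 assume h: "0 < h" and sub: "subsol lam Lam (ball y0 \<rho> \<times> UNIV) W" and M: "0 <= M" "\<forall>x. W x <= M"
 and W0: "\<forall>x. snd x <= 0 \<or> h <= snd x --> W x = 0"
 show "dist y y0 + 4 * h * real N <= \<rho> ==> W (y, s) <= (1 - c) ^ N * M"
 proof (induction N arbitrary: y s)
 case (Suc N)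
 show ?case
 proof (cases "s < h")
 case False
 then show ?thesis using W0[rule_format, of "(y, s)"] M c by simp
 next
 case s: True
 have inc: "dist y' y0 + 4 * h * real N < \<rho>" if "(y', s') \<in> ball (y, s) (2 * (2 * h))" for y' s'
 using Suc.prems that dist_fst_le[of "(y, s)" "(y', s')"] dist_triangle[of y' y0 y] by (simp add: algebra_simps dist_commute)
 have b: "ball (y, s) (2 * (2 * h)) \<subseteq> ball y0 \<rho> \<times> UNIV"
 proof
 fix x assume "x \<in> ball (y, s) (2 * (2 * h))"
 then have "dist (fst x) y0 + 4 * h * real N < \<rho>" using inc[of "fst x" "snd x"] by simp
 moreover have "0 <= 4 * h * real N" using h by simp
 ultimately show "x \<in> ball y0 \<rho> \<times> UNIV" by (simp add: mem_Times_iff dist_commute)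
 qed
 have d: "dist (y, s) (y, s - 3 * h / 2) = 3 * h / 2" using h by (simp add: dist_Pair_Pair dist_real_def)
 have "W (y, s) <= (1 - c) * ((1 - c) ^ N * M)"
 proof (rule dl)
 show "0 < 2 * h" using h by simp
 show "subsol lam Lam (ball (y, s) (2 * (2 * h))) W" by (rule subsol_subset[OF sub open_ball b])
 show "0 <= (1 - c) ^ N * M" using c M by simp
 show "\<forall>x\<in>ball (y, s) (2 * (2 * h)). W x <= (1 - c) ^ N * M"
 proof
 fix x assume "x \<in> ball (y, s) (2 * (2 * h))"
 then show "W x <= (1 - c) ^ N * M" using inc[of "fst x" "snd x"] Suc.IH[of "fst x" "snd x"] by simp
 qed
 show "ball (y, s - 3 * h / 2) (2 * h / 4) \<subseteq> ball (y, s) (2 * h)"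
 proof
 fix x assume "x \<in> ball (y, s - 3 * h / 2) (2 * h / 4)"
 then show "x \<in> ball (y, s) (2 * h)" using dist_triangle[of "(y, s)" x "(y, s - 3 * h / 2)"] d by simp
 qed
 show "\<forall>x\<in>ball (y, s - 3 * h / 2) (2 * h / 4). W x = 0"
 proof
 fix x assume "x \<in> ball (y, s - 3 * h / 2) (2 * h / 4)"
 then have "snd x <= 0" using dist_snd_le[of "(y, s - 3 * h / 2)" x] s by (simp add: dist_real_def)
 then show "W x = 0" using W0 by blast
 qed
 show "(y, s) \<in> ball (y, s) (2 * h / 2)" using h by simp
 qed
 then show ?thesis by simp
 qed
 qed (use M in simp)
 qed
 qed
qed

text \<open>With \<open>f\<close> the solution whose data is a tent over the ball, the induction shows \<open>t f <= Q (2 - 1/2^j) v\<close> at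
height \<open>2^-j\<close>: each step loses width \<open>(j + 1) 2^-j\<close>, which pays for the strip decay to beat the
Harnack growth \<open>q^j\<close>.\<close>

lemma box_estimate:
 assumes lam: "0 < lam" "0 < Lam"
 shows "\<exists>C\<ge>1. \<forall>om h (x0 :: real^'m::finite) r y s. emeas lam Lam om --> Cc h --> (\<forall>x. 0 <= h x) --> 0 < r --> 0 < s -->
 dist (y, s) (x0, 0) = 3 * r --> hext om h (x0, r) * hext om (tent x0 r) (y, s) <= C * hext om h (y, s)"
proof -
 show ?thesis
 proof (rule exE[OF hext_lower[OF lam, where 'm = 'm]], elim conjE, goal_cases)
 case (1 q)
 note q = 1(1) and hl0 = 1(2)
 note hl = hl0[THEN spec4, THEN spec, THEN spec, THEN spec, THEN mp4, THEN mp, THEN mp, THEN mp]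
 show ?thesis
 proof (rule exE[OF strip_decay[OF lam, where 'm = 'm]], elim conjE, goal_cases)
 case (1 c)
 note c = 1(1-2) and sd0 = 1(3)
 note sd = sd0[THEN spec4, THEN spec4, THEN mp4, THEN mp, THEN mp]
 \<comment> \<open>\<open>m\<close> rounds of strip decay outweigh one factor \<open>q\<close> by 2.
   The offset \<open>p\<close> starts the induction at a height so small that
   \<open>m * (j + 1)\<close> rounds fit into the width given up at stage \<open>j\<close>.\<close>
 obtain m where "(1 - c) ^ m < 1 / (2 * q)" using real_arch_pow_inv[of "1 / (2 * q)" "1 - c"] c q by auto
 then have m: "(1 - c) ^ m * q <= 1 / 2" using q by (simp add: field_simps)
 obtain p where "32 * real m < 2 ^ p" using real_arch_pow[of 2 "32 * real m"] by auto
 then have p: "4 * real m / 2 ^ p <= 1 / 8" by (simp add: field_simps)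
 define Q where "Q = q ^ (p + 8)"
 have Q: "1 <= Q" using q by (simp add: Q_def)
 show ?thesis
 proof (intro exI[of _ "2 * Q"] conjI allI impI, goal_cases)
 case 1
 show ?case using Q by simp
 next
 case (2 om h x0 r y0 s0)
 note e = 2(1) and h = 2(2,3) and r = 2(4) and s0 = 2(5) and dZ = 2(6)
 define t where "t = hext om h (x0, r)"
 define f where "f = tent x0 r"
 have f: "Cc f" "!!x. 0 <= f x" "!!x. f x <= 1" "!!x. 2 * r <= dist x x0 ==> f x = 0"
 unfolding f_def using tent[OF r] by blast+
 have t: "0 <= t" using h(2) by (simp add: t_def hext_nonneg)
 have v0: "0 <= hext om h X" for X using h(2) by (simp add: hext_nonneg)
 have f1: "hext om f X <= 1" if "X \<in> half_space" for X by (rule hext_le_1[OF e that f(1,3)])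
 have tf: "t * hext om f X <= t" if "X \<in> half_space" for X using mult_left_mono[OF f1[OF that] t] by simp
 define k where "k j x = t * f x + (- Q * (2 - 1 / 2 ^ j)) * h x" for j :: nat and x
 have k: "Cc (k j)" for j unfolding k_def by (rule Cc_lincomb[OF f(1) h(1)])
 have hk: "hext om (k j) X = t * hext om f X - Q * (2 - 1 / 2 ^ j) * hext om h X" if "X \<in> half_space" for j X
 unfolding k_def hext_lincomb[OF e that f(1) h(1)] by simp
 have cj: "0 <= Q * (2 - 1 / 2 ^ j)" for j :: nat
 proof -
 have "1 / 2 ^ j <= (1 :: real)" by simp
 then show ?thesis using Q by (intro mult_nonneg_nonneg) linarith+
 qed
 \<comment> \<open>Widths with differences \<open>r (j + 1) / 2^(j + 3)\<close>: they start at
   \<open>r / 2\<close> and stay nonnegative, so the total loss is affordable while stage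
   \<open>j\<close> still gives up \<open>j + 1\<close> units of its own scale.\<close>
 define \<rho> where "\<rho> j = r * (real j + 2) / (2 ^ j * 4)" for j :: nat
 have \<rho>1: "\<rho> j - \<rho> (Suc j) = r * (real j + 1) / 2 ^ j / 8" for j by (simp add: \<rho>_def field_simps)
 have \<rho>2: "\<rho> j <= r / 2" for j
 proof (induction j)
 case (Suc j)
 have "0 <= r * (real j + 1) / 2 ^ j / 8" using r by simp
 then show ?case using Suc \<rho>1[of j] by linarith
 qed (simp add: \<rho>_def)
 have \<rho>0: "0 <= \<rho> j" for j using r by (simp add: \<rho>_def)
 \<comment> \<open>A centre at distance at least \<open>5/2 r\<close> from \<open>x0\<close>, with
   widths at most \<open>r / 2\<close>, keeps the boxes over the part of the boundary where the tent
   vanishes.\<close>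
 have main: "t * hext om f (y, s) <= Q * (2 - 1 / 2 ^ j) * hext om h (y, s)"
 if y0: "5 / 2 * r <= dist y0 x0" "dist y0 x0 <= 3 * r" and "dist y y0 <= \<rho> j" "r <= 2 ^ (p + 1 + j) * s" "2 ^ (p + 1 + j) * s <= 2 * r" for j y s
 using that(3-)
 proof (induction j arbitrary: y s)
 case 0
 have s: "0 < s" using 0(2) r by (smt (verit) zero_less_mult_pos zero_less_power)
 have "dist y x0 <= 4 * r" using dist_triangle[of y x0 y0] y0 0(1) \<rho>2[of 0] r by linarith
 then have "t <= q ^ (p + 1 + 7) * hext om h (y, s)" unfolding t_def by (intro hl[OF e h r]) (use 0(2,3) r in \<open>auto simp: mult.commute\<close>)
 then show ?case using tf[of "(y, s)"] s by (simp add: Q_def half_space_snd add.commute)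
 next
 case (Suc j)
 define a where "a = r / 2 ^ (p + j)"
 have a: "0 < a" using r by (simp add: a_def)
 have s1: "a / 4 <= s" "s <= a / 2" using Suc.prems(2,3) by (simp_all add: a_def field_simps)
 have s: "0 < s" "s < a" using s1 a by auto
 have d4: "dist y' x0 <= 4 * r" if "dist y' y0 <= \<rho> i" for y' i using that dist_triangle[of y' x0 y0] y0 \<rho>2[of i] r by linarith
 have "4 * a * real (m * (j + 1)) = (4 * real m / 2 ^ p) * (r * (real j + 1) / 2 ^ j)" by (simp add: a_def power_add field_simps)
 also have "... <= 1 / 8 * (r * (real j + 1) / 2 ^ j)" using r by (intro mult_right_mono p) auto
 also have "... = \<rho> j - \<rho> (Suc j)" using \<rho>1[of j] by simp
 finally have dd: "dist y y0 + 4 * a * real (m * (j + 1)) <= \<rho> j" using Suc.prems(1) by linarith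
 have "0 < r * (real j + 1) / 2 ^ j / 8" using r by simp
 then have dy: "dist y y0 < \<rho> j" using Suc.prems(1) \<rho>1[of j] by linarith
 define D where "D = ball y0 (\<rho> j) \<times> {0<..<a}"
 define W where "W x = (if x \<in> D then max 0 (0 + hext om (k j) x) else 0)" for x
 have DH: "D \<subseteq> half_space" by (auto simp: D_def half_space_snd)
 have clD: "snd x <= a" if "x \<in> closure D" for x
 proof -
 have "closure D \<subseteq> snd -` {..a}" by (rule closure_minimal) (auto simp: D_def intro: closed_vimage_snd)
 then show ?thesis using that by auto
 qed
 have sub: "subsol lam Lam (ball y0 (\<rho> j) \<times> UNIV) W"
 unfolding W_def
 proof (rule hext_subsol[OF e k _ DH])
 show "open D" "open (ball y0 (\<rho> j) \<times> UNIV)" unfolding D_def by (intro open_Times open_ball open_greaterThanLessThan open_UNIV)+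
 fix x :: "'m pnt" assume xB: "x \<in> ball y0 (\<rho> j) \<times> UNIV"
 then have xy: "dist (fst x) y0 < \<rho> j" by (auto simp: dist_commute)
 { assume x: "x \<in> half_space" "x \<in> closure D" "x ~: D"
 then have sx: "snd x = a" using clD[OF x(2)] xB by (auto simp: D_def half_space_snd mem_Times_iff)
 have "t * hext om f (fst x, snd x) <= Q * (2 - 1 / 2 ^ j) * hext om h (fst x, snd x)"
 by (rule Suc.IH) (use xy r in \<open>auto simp: sx a_def\<close>)
 then show "0 + hext om (k j) x <= 0" using hk[OF x(1)] by simp }
 assume "snd x = 0"
 have "2 * r <= dist (fst x) x0" using dist_triangle[of y0 x0 "fst x"] xy \<rho>2[of j] y0 by (simp add: dist_commute)
 then have "f (fst x) = 0" by (rule f(4))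
 then show "0 + k j (fst x) <= 0" using cj[of j] h(2) by (simp add: k_def)
 qed
 have "W (y, s) <= (1 - c) ^ (m * (j + 1)) * t"
 proof (rule sd[OF a sub t _ _ dd])
 show "\<forall>x. W x <= t"
 proof
 fix x show "W x <= t"
 proof (cases "x \<in> D")
 case True
 then have xH: "x \<in> half_space" using DH by blast
 have "0 <= Q * (2 - 1 / 2 ^ j) * hext om h x" by (rule mult_nonneg_nonneg[OF cj v0])
 then show ?thesis using True t tf[OF xH] hk[OF xH, of j] by (simp add: W_def)
 qed (simp add: W_def t)
 qed
 show "\<forall>x. snd x <= 0 \<or> a <= snd x --> W x = 0" by (auto simp: W_def D_def)
 qed
 moreover have "t * hext om f (y, s) - Q * (2 - 1 / 2 ^ j) * hext om h (y, s) <= W (y, s)"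
 proof -
 have "(y, s) \<in> D" using dy s by (simp add: D_def dist_commute)
 then show ?thesis using hk[of "(y, s)" j] DH by (auto simp: W_def)
 qed
 moreover have "(1 - c) ^ (m * (j + 1)) * t <= Q / 2 ^ Suc j * hext om h (y, s)"
 proof -
 have "t <= q ^ (p + 1 + Suc j + 7) * hext om h (y, s)"
 unfolding t_def by (rule hl[OF e h r d4[OF Suc.prems(1)] Suc.prems(2)]) (use Suc.prems(3) r in linarith)
 then have "(1 - c) ^ (m * (j + 1)) * t <= (1 - c) ^ (m * (j + 1)) * (q ^ (p + 1 + Suc j + 7) * hext om h (y, s))"
 using c by (intro mult_left_mono) auto
 also have "... = ((1 - c) ^ m * q) ^ Suc j * (Q * hext om h (y, s))"
 proof -
 have "q ^ (p + 1 + Suc j + 7) = q ^ Suc j * Q" unfolding Q_def power_add[symmetric] by (rule arg_cong[of _ _ "%n. q ^ n"]) simp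
 moreover have "(1 - c) ^ (m * (j + 1)) = ((1 - c) ^ m) ^ Suc j" by (simp only: power_mult Suc_eq_plus1)
 ultimately show ?thesis by (simp only: power_mult_distrib mult_ac)
 qed
 also have "... <= (1 / 2) ^ Suc j * (Q * hext om h (y, s))"
 using m c q Q v0 by (intro mult_right_mono power_mono) auto
 finally show ?thesis by (simp add: power_divide)
 qed
 ultimately have "t * hext om f (y, s) <= Q * (2 - 1 / 2 ^ j) * hext om h (y, s) + Q / 2 ^ Suc j * hext om h (y, s)" by linarith
 also have "... = Q * (2 - 1 / 2 ^ Suc j) * hext om h (y, s)" by (simp add: field_simps)
 finally show ?case .
 qed
 have H: "(y0, s0) \<in> half_space" using s0 by (simp add: half_space_snd)
 have pyth: "(dist y0 x0)^2 + s0^2 = (3 * r)^2" unfolding dZ[symmetric] by (simp add: dist_Pair_Pair dist_real_def)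
 have "s0^2 <= (3 * r)^2" "(dist y0 x0)^2 <= (3 * r)^2" using pyth by (metis zero_le_power2 le_add_same_cancel1 le_add_same_cancel2)+
 then have s3: "s0 <= 3 * r" and y3: "dist y0 x0 <= 3 * r" using r by (auto intro: power2_le_imp_le)
 obtain n0 where "r / s0 < 2 ^ n0" using real_arch_pow[of 2 "r / s0"] by auto
 then have n0: "r <= 2 ^ n0 * s0" using s0 by (simp add: field_simps)
 \<comment> \<open>The dyadic height of the point. For \<open>i \<le> p + 1\<close> a plain Harnack
   chain is enough. Otherwise \<open>s0 \<le> r / 2\<close>, and since the point lies on the sphere
   of radius \<open>3 r\<close>, its horizontal distance is at least \<open>5/2 r\<close>, as the
   induction requires.\<close>
 define i where "i = (LEAST i. r <= 2 ^ i * s0)"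
 have i: "r <= 2 ^ i * s0" unfolding i_def by (rule LeastI[of "%i. r <= 2 ^ i * s0", OF n0])
 have i2: "2 ^ i * s0 <= 2 * r" if nz: "i ~= 0"
 proof -
 obtain i' where i': "i = Suc i'" using nz by (cases i) auto
 then have "\<not> r <= 2 ^ i' * s0" using not_less_Least[of i' "%i. r <= 2 ^ i * s0"] by (simp add: i_def)
 then show ?thesis by (simp add: i')
 qed
 have "t * hext om f (y0, s0) <= 2 * Q * hext om h (y0, s0)"
 proof (cases "i <= p + 1")
 case True
 have "2 ^ i * s0 <= 4 * r" using i2 s3 r by (cases "i = 0") auto
 then have "t <= q ^ (i + 7) * hext om h (y0, s0)" unfolding t_def by (intro hl[OF e h r _ i]) (use y3 r in auto)
 also have "... <= (2 * Q) * hext om h (y0, s0)"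
 proof (rule mult_right_mono[OF _ v0])
 have "q ^ (i + 7) <= Q" unfolding Q_def using q True by (intro power_increasing) auto
 then show "q ^ (i + 7) <= 2 * Q" using Q by linarith
 qed
 finally show ?thesis using tf[OF H] by linarith
 next
 case False
 define j where "j = i - (p + 1)"
 have ij: "i = p + 1 + j" using False by (simp add: j_def)
 have "2 * (2 ^ 1 * s0) <= 2 * r"
 proof -
 have "2 * 2 ^ 1 <= (2 :: real) ^ i" using False power_increasing[of 2 i "2 :: real"] by simp
 then have "2 * 2 ^ 1 * s0 <= 2 ^ i * s0" using s0 by (intro mult_right_mono) auto
 then show ?thesis using i2 False by simp
 qed
 then have "s0 <= r / 2" by simp
 then have "s0^2 <= (r / 2)^2" using s0 by (intro power_mono) auto
 moreover have "(5 / 2 * r)^2 = 25 / 4 * r^2" "(3 * r)^2 = 9 * r^2" "(r / 2)^2 = r^2 / 4" by (simp_all add: power2_eq_square)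
 ultimately have "(5 / 2 * r)^2 <= (dist y0 x0)^2" using pyth zero_le_power2[of r] by linarith
 then have d5: "5 / 2 * r <= dist y0 x0" by (rule power2_le_imp_le) simp
 have "t * hext om f (y0, s0) <= Q * (2 - 1 / 2 ^ j) * hext om h (y0, s0)"
 by (rule main[OF d5 y3]) (use \<rho>0[of j] i i2 False in \<open>auto simp: ij\<close>)
 also have "... <= 2 * Q * hext om h (y0, s0)" using Q by (intro mult_right_mono v0) (simp add: field_simps)
 finally show ?thesis .
 qed
 then show "hext om h (x0, r) * hext om (tent x0 r) (y0, s0) <= 2 * Q * hext om h (y0, s0)" by (simp add: t_def f_def)
 qed
 qed
 qed
qed

text \<open>On the sphere of radius \<open>3 r\<close> the box estimate applies, and on the flat
  boundary outside it the tent vanishes. So the positive part of \<open>t f - C v\<close> outside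
  the sphere, extended by zero, is a global \<open>subsol\<close> bounded by \<open>t\<close>. Every
  point at height \<open>x_n\<close> has near it a ball of size comparable to \<open>x_n\<close> in
  the lower half space, so the bound improves by \<open>1 - c\<close> everywhere at once, again and
  again, and must be 0.\<close>

lemma outer_comparison:
 assumes lam: "0 < lam" "0 < Lam"
 shows "\<exists>C\<ge>1. \<forall>om h (x0 :: real^'m::finite) r Z. emeas lam Lam om --> Cc h --> (\<forall>x. 0 <= h x) --> 0 < r --> Z \<in> half_space -->
 3 * r <= dist Z (x0, 0) --> hext om h (x0, r) * hext om (tent x0 r) Z <= C * hext om h Z"
proof -
 show ?thesis
 proof (rule exE[OF box_estimate[OF lam, where 'm = 'm]], elim conjE, goal_cases)
 case (1 C)
 note C = 1(1) and be0 = 1(2)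
 note be = be0[THEN spec4, THEN spec, THEN spec, THEN mp4, THEN mp, THEN mp]
 show ?thesis
 proof (rule exE[OF decay_ball[OF lam, where 'a = "'m pnt"]], elim conjE, goal_cases)
 case (1 c)
 note c = 1(1-2) and dl0 = 1(3)
 note dl = dl0[THEN spec4, THEN spec, THEN mp4, THEN mp, THEN mp, THEN bspec]
 show ?thesis
 proof (intro exI[of _ C] conjI C allI impI, goal_cases)
 case (1 om h x0 r Z)
 note e = 1(1) and h = 1(2,3) and r = 1(4) and ZH = 1(5) and Z = 1(6)
 define t where "t = hext om h (x0, r)"
 define f where "f = tent x0 r"
 have f: "Cc f" "!!x. 0 <= f x" "!!x. f x <= 1" "!!x. 2 * r <= dist x x0 ==> f x = 0"
 unfolding f_def using tent[OF r] by blast+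
 have t: "0 <= t" using h(2) by (simp add: t_def hext_nonneg)
 have v0: "0 <= hext om h X" for X using h(2) by (simp add: hext_nonneg)
 have f1: "hext om f X <= 1" if "X \<in> half_space" for X by (rule hext_le_1[OF e that f(1,3)])
 have tf: "t * hext om f X <= t" if "X \<in> half_space" for X using mult_left_mono[OF f1[OF that] t] by simp
 define k where "k x = t * f x + (- C) * h x" for x
 have k: "Cc k" unfolding k_def by (rule Cc_lincomb[OF f(1) h(1)])
 have hk: "hext om k X = t * hext om f X - C * hext om h X" if "X \<in> half_space" for X
 unfolding k_def hext_lincomb[OF e that f(1) h(1)] by simp
 have eq: "t * hext om f X <= C * hext om h X" if "X \<in> half_space" "dist X (x0, 0) = 3 * r" for X
 using be[OF e h r, of "snd X" "fst X"] that by (simp add: half_space_snd t_def f_def)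
 show "hext om h (x0, r) * hext om (tent x0 r) Z <= C * hext om h Z"
 proof (cases "dist Z (x0, 0) = 3 * r")
 case True
 then show ?thesis using eq[OF ZH] by (simp add: t_def f_def)
 next
 case False
 define D where "D = half_space \<inter> - cball (x0, 0 :: real) (3 * r)"
 define W where "W x = (if x \<in> D then max 0 (0 + hext om k x) else 0)" for x
 have DH: "D \<subseteq> half_space" by (simp add: D_def)
 have clD: "3 * r <= dist x (x0, 0)" if "x \<in> closure D" for x
 proof -
 have "closure D \<subseteq> - ball (x0, 0) (3 * r)" by (rule closure_minimal) (auto simp: D_def)
 then show ?thesis using that by (auto simp: dist_commute)
 qed
 have sub: "subsol lam Lam UNIV W"
 unfolding W_def
 proof (rule hext_subsol[OF e k _ DH open_UNIV])
 show "open D" unfolding D_def by (intro open_Int open_half_space open_Compl closed_cball)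
 fix x :: "'m pnt"
 { assume x: "x \<in> half_space" "x \<in> closure D" "x ~: D"
 then have "dist x (x0, 0) = 3 * r" using clD[OF x(2)] by (auto simp: D_def dist_commute)
 then show "0 + hext om k x <= 0" using hk[OF x(1)] eq[OF x(1)] by simp }
 assume x: "snd x = 0" "x \<in> closure D"
 have "dist x (x0, 0) = dist (fst x) x0" using x(1) by (cases x) (simp add: dist_Pair_Pair)
 then have "f (fst x) = 0" using clD[OF x(2)] r by (intro f(4)) auto
 then show "0 + k (fst x) <= 0" using C h(2) by (simp add: k_def)
 qed
 have Wle: "W x <= (1 - c) ^ N * t" for N x
 proof (induction N arbitrary: x)
 case 0
 show ?case
 proof (cases "x \<in> D")
 case True
 then have xH: "x \<in> half_space" using DH by blast
 have "0 <= C * hext om h x" using C v0 by simp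
 then show ?thesis using True t tf[OF xH] hk[OF xH] by (simp add: W_def)
 qed (simp add: W_def t)
 next
 case (Suc N)
 show ?case
 proof (cases "x \<in> D")
 case False
 then show ?thesis using c t by (simp add: W_def)
 next
 case True
 then have s: "0 < snd x" using DH by (auto simp: half_space_snd)
 define z where "z = (fst x, - snd x / 2)"
 have d: "dist x z = 3 / 2 * snd x" using s by (cases x) (simp add: z_def dist_Pair_Pair dist_real_def)
 have "W x <= (1 - c) * ((1 - c) ^ N * t)"
 proof (rule dl)
 show "0 < 2 * snd x" using s by simp
 show "subsol lam Lam (ball x (2 * (2 * snd x))) W" by (rule subsol_subset[OF sub open_ball subset_UNIV])
 show "0 <= (1 - c) ^ N * t" using c t by simp
 show "ball z (2 * snd x / 4) \<subseteq> ball x (2 * snd x)"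
 proof
 fix y assume "y \<in> ball z (2 * snd x / 4)"
 then show "y \<in> ball x (2 * snd x)" using dist_triangle[of x y z] d by simp
 qed
 show "\<forall>y\<in>ball z (2 * snd x / 4). W y = 0"
 proof
 fix y assume "y \<in> ball z (2 * snd x / 4)"
 then have "snd y <= 0" using dist_snd_le[of z y] by (simp add: dist_real_def z_def)
 then show "W y = 0" using DH by (auto simp: W_def half_space_snd)
 qed
 show "x \<in> ball x (2 * snd x / 2)" using s by simp
 qed (use Suc.IH in blast)
 then show ?thesis by simp
 qed
 qed
 have "(%N. (1 - c) ^ N * t) ~~> 0 * t" using c by (intro tendsto_mult tendsto_const LIMSEQ_realpow_zero) auto
 then have "W Z <= 0 * t" by (rule LIMSEQ_le_const) (use Wle in blast)
 moreover have "Z \<in> D" using False Z ZH by (auto simp: D_def dist_commute)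
 ultimately show ?thesis using hk[OF ZH] by (simp add: W_def t_def f_def)
 qed
 qed
 qed
 qed
qed

text \<open>The indicator of \<open>S\<close> lies below a tent. If \<open>Z\<close> is far from
  \<open>S\<close>, the outer comparison applies and Harnack moves the other pole from height
  \<open>N l\<close> to \<open>l\<close>. If \<open>Z\<close> is near, its height is at least a
  multiple of \<open>l\<close>, so a Harnack chain joins the two poles and
  \<open>measure (om Z) S \<le> 1\<close> does the rest.\<close>

lemma pole_change:
 assumes lam: "0 < lam" "0 < Lam" and et: "0 < et" and N: "1 <= N"
 shows "\<exists>C\<ge>1. \<forall>om (x :: real^'m::finite) l Z S F. emeas lam Lam om --> 0 < l --> et * l <= snd Z --> S \<in> sets borel --> F \<in> sets borel -->
 S \<subseteq> ball x (N * l) --> measure (om Z) S * measure (om (x, l)) F <= C * measure (om Z) F"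
proof -
 show ?thesis
 proof (rule exE[OF outer_comparison[OF lam, where 'm = 'm]], elim conjE, goal_cases)
 case (1 C)
 note C = 1(1) and oc0 = 1(2)
 note oc = oc0[THEN spec4, THEN spec, THEN mp4, THEN mp, THEN mp]
 show ?thesis
 proof (rule exE[OF measure_harnack[OF lam, where 'm = 'm]], elim conjE, goal_cases)
 case (1 Ch)
 note Ch = 1(1) and mh0 = 1(2)
 note mh = mh0[THEN spec4, THEN spec, THEN spec, THEN mp4, THEN mp, THEN mp]
 define b where "b = min 1 et"
 have b: "0 < b" "b <= 1" "b <= et" using et by (auto simp: b_def)
 obtain k :: nat where k: "36 * (3 * N + 1) / b < real k" using reals_Archimedean2 by blast
 have k1: "3 * N + 1 <= real k * b / 36" using k b by (simp add: field_simps)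
 have Ck: "1 <= Ch ^ k" using Ch by simp
 show ?thesis
 proof (intro exI[of _ "C * Ch ^ k"] conjI allI impI, goal_cases)
 case 1
 show ?case using mult_mono[OF C Ck] C by simp
 next
 case (2 om x l Z S F)
 note e = 2(1) and l = 2(2) and Z = 2(3) and S = 2(4) and F = 2(5) and Sb = 2(6)
 have bl: "0 < b * l" "b * l <= l" "b * l <= snd Z"
 proof -
 have "b * l <= et * l" "b * l <= 1 * l" using b l by (intro mult_right_mono; simp)+
 moreover have "0 < b * l" using b l by simp
 ultimately show "0 < b * l" "b * l <= l" "b * l <= snd Z" using Z by linarith+
 qed
 have ZH: "Z \<in> half_space" using bl by (simp add: half_space_snd)
 interpret Z: prob_space "om Z" by (rule emeas_D[OF e ZH])
 have kl: "(3 * N + 1) * l <= real k * (b * l) / 36" using mult_right_mono[OF k1, of l] l by simp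
 have C0: "measure (om Z) S * y <= y" if "0 <= y" for y using mult_right_mono[OF Z.prob_le_1 that] by simp
 show "measure (om Z) S * measure (om (x, l)) F <= C * Ch ^ k * measure (om Z) F"
 proof (cases "3 * (N * l) <= dist Z (x, 0)")
 case True
 define r where "r = N * l"
 have r: "0 < r" "l <= r" using l N by (auto simp: r_def)
 have XH: "(x, r) \<in> half_space" using r by (simp add: half_space_snd)
 have tn: "measure (om Z) S <= hext om (tent x r) Z"
 proof (rule measure_le_hext[OF e ZH tent(1)[OF r(1)] S tent(2)[OF r(1)]])
 fix z assume "z \<in> S"
 then have "dist z x <= r" using Sb by (auto simp: r_def dist_commute subset_iff less_imp_le)
 then have "tent x r z = 1" by (rule tent(4)[OF r(1)])
 then show "1 <= tent x r z" by simp
 qed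
 have "measure (om Z) S * measure (om (x, r)) F <= C * measure (om Z) F"
 proof (rule measure_le_of_Cc[OF emeas_D(1,2)[OF e XH] emeas_D(1,2)[OF e ZH] _ _ _ F])
 fix g :: "real^'m => real" assume g: "Cc g" "!!x. 0 <= g x"
 have "measure (om Z) S * hext om g (x, r) <= hext om (tent x r) Z * hext om g (x, r)"
 by (intro mult_right_mono tn hext_nonneg g)
 also have "... <= C * hext om g Z" using oc[OF e g(1) _ r(1) ZH] g(2) True by (simp add: mult.commute r_def)
 finally show "measure (om Z) S * (LINT x|om (x, r). g x) <= C * (LINT x|om Z. g x)" by (simp add: hext_def)
 qed (use C in auto)
 moreover have "measure (om (x, l)) F <= Ch ^ k * measure (om (x, r)) F"
 proof (rule mh[OF e F bl(1)])
 have "r - l <= (3 * N + 1) * l" using N l by (simp add: r_def algebra_simps)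
 then have "r - l <= real k * (b * l) / 36" using kl by linarith
 then show "dist (x, l) (x, r) <= real k * (b * l) / 36" using r by (simp add: dist_Pair_Pair dist_real_def)
 qed (use bl r in auto)
 ultimately have "measure (om Z) S * measure (om (x, l)) F <= Ch ^ k * (measure (om Z) S * measure (om (x, r)) F)"
 using mult_left_mono[of "measure (om (x, l)) F" "Ch ^ k * measure (om (x, r)) F" "measure (om Z) S"] by (simp add: mult_ac)
 also have "... <= Ch ^ k * (C * measure (om Z) F)" using Ck by (intro mult_left_mono) (use \<open>_ <= C * measure (om Z) F\<close> in auto)
 finally show ?thesis by (simp add: mult_ac)
 next
 case False
 have "measure (om Z) S * measure (om (x, l)) F <= measure (om (x, l)) F" by (rule C0) simp
 also have "... <= Ch ^ k * measure (om Z) F"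
 proof (rule mh[OF e F bl(1)])
 have "dist (x, l) Z <= dist (x, l) (x, 0) + dist Z (x, 0)" by (metis dist_commute dist_triangle)
 also have "dist (x, l) (x, 0) = l" using l by (simp add: dist_Pair_Pair dist_real_def)
 finally show "dist (x, l) Z <= real k * (b * l) / 36" using False kl by (simp add: algebra_simps)
 qed (use bl in auto)
 also have "... <= C * Ch ^ k * measure (om Z) F" using C Ck by (intro mult_right_mono) auto
 finally show ?thesis .
 qed
 qed
 qed
 qed
qed

subsection \<open>Weak gradients of solutions with indicator data\<close>

lemma nn_integral_le_of_measure:
 fixes M N :: "'a::euclidean_space measure"
 assumes M: "prob_space M" "sets M = sets borel" and N: "prob_space N" "sets N = sets borel" and C: "0 <= a" "0 <= C"
 and le: "!!F. F \<in> sets borel ==> a * measure M F <= C * measure N F" and f: "f \<in> bm"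
 shows "ennreal a * (\<integral>\<^sup>+x. f x \<partial>M) <= ennreal C * (\<integral>\<^sup>+x. f x \<partial>N)"
proof -
 interpret M: prob_space M by (rule M)
 interpret N: prob_space N by (rule N)
 have fM: "f \<in> borel_measurable M" "f \<in> borel_measurable N" using f M N by (auto cong: measurable_cong_sets)
 have "(\<integral>\<^sup>+x. f x \<partial>scale_measure (ennreal a) M) <= (\<integral>\<^sup>+x. f x \<partial>scale_measure (ennreal C) N)"
 proof (rule nn_integral_mono_measure)
 show s: "sets (scale_measure (ennreal a) M) = sets (scale_measure (ennreal C) N)" using M N by simp
 have "emeasure (scale_measure (ennreal a) M) F <= emeasure (scale_measure (ennreal C) N) F" if "F \<in> sets borel" for F
 using le[OF that] C that by (simp add: M.emeasure_eq_measure N.emeasure_eq_measure ennreal_leI flip: ennreal_mult)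
 then show "scale_measure (ennreal a) M <= scale_measure (ennreal C) N" using s M by (subst le_measure) auto
 qed
 then show ?thesis by (simp add: nn_integral_scale_measure fM)
qed

lemma Cc_dense:
 fixes M :: "'a::euclidean_space measure"
 assumes M: "prob_space M" "sets M = sets borel" and H: "H \<in> sets borel" and e: "0 < e"
 shows "\<exists>g. Cc g & (\<forall>x. 0 <= g x & g x <= 1) & (LINT x|M. \<bar>g x - indicator H x\<bar>) <= e"
proof -
 interpret M: prob_space M by (rule M)
 have "\<exists>K. K \<subseteq> H & compact K & measure M H - e / 2 < measure M K"
 proof (cases "measure M H - e / 2 < 0")
 case True
 then show ?thesis by (intro exI[of _ "{}"]) auto
 next
 case False
 have "emeasure M H = (SUP K\<in>{K. K \<subseteq> H & compact K}. emeasure M K)"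
 by (rule inner_regular[OF M(2) _ H]) (simp add: M.emeasure_space_1)
 moreover have "ennreal (measure M H - e / 2) < emeasure M H"
 using e False by (simp add: M.emeasure_eq_measure ennreal_less_iff)
 ultimately have "ennreal (measure M H - e / 2) < (SUP K\<in>{K. K \<subseteq> H & compact K}. emeasure M K)" by simp
 then show ?thesis using False by (auto simp: less_SUP_iff M.emeasure_eq_measure ennreal_less_iff)
 qed
 then obtain K where K: "K \<subseteq> H" "compact K" and mK: "measure M H - e / 2 < measure M K" by blast
 have KM: "K \<in> sets M" "H \<in> sets M" using K H M(2) by (auto simp: borel_compact)
 obtain g where g: "\<forall>n::nat. Cc (g n) & (\<forall>x. 0 <= g n x & g n x <= 1) & (\<forall>x\<in>K. g n x = 1)"
 and conv: "\<forall>P. prob_space P --> sets P = sets borel --> (%n. LINT x|P. g n x) ~~> measure P K"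
 using compact_Cc_approx[OF K(2)] by (elim exE conjE) (rule that)
 have "(%n. LINT x|M. g n x) ~~> measure M K" using conv M by blast
 then have "eventually (%n. (LINT x|M. g n x) < measure M K + e / 2) sequentially" using e by (intro order_tendstoD) auto
 then obtain n where n: "(LINT x|M. g n x) < measure M K + e / 2" by (auto simp: eventually_sequentially)
 have Cg: "Cc (g n)" using g by blast
 have gi: "integrable M (g n)" by (rule Cc_integrable[OF Cg M])
 have ii: "integrable M (indicator K :: 'a => real)" "integrable M (indicator H :: 'a => real)"
 using KM by (simp_all add: M.emeasure_eq_measure)
 have "(LINT x|M. \<bar>g n x - indicator H x\<bar>) <= (LINT x|M. (g n x - indicator K x) + (indicator H x - indicator K x))"
 proof (rule integral_mono)
 fix x
 have "0 <= g n x" "g n x <= 1" "x \<in> K ==> g n x = 1" using g by blast+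
 then show "\<bar>g n x - indicator H x\<bar> <= (g n x - indicator K x) + (indicator H x - indicator K x)"
 using K(1) by (auto split: split_indicator)
 qed (use gi ii in auto)
 also have "... = ((LINT x|M. g n x) - measure M K) + (measure M H - measure M K)" using gi ii KM by simp
 also have "... <= e" using n mK by simp
 finally show ?thesis using g by blast
qed

text \<open>\<open>w / a + 2\<close> takes values in \<open>[1, 3]\<close> on \<open>L\<close>, so
  truncation at level 1/2 changes nothing there, and the energy inequality for positive parts yields
  the estimate for solutions of either sign.\<close>

lemma caccioppoli:
 assumes lam: "0 < lam" "0 < Lam" and K: "compact K" "K \<subseteq> Om" and Om: "open (Om :: 'a::euclidean_space set)"
 shows "\<exists>L C. compact L & L \<subseteq> Om & 0 <= C & (\<forall>w G F a. ellflux lam Lam Om w G F --> 0 < a --> (\<forall>x\<in>L. \<bar>w x\<bar> <= a) --> L2sq K G <= ennreal (C * a^2))"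
proof -
 obtain ch E L where ch: "C1 ch E" "!!x. 0 <= ch x" "!!x. ch x <= 1" "!!x. x \<in> K ==> ch x = 1" "!!x. x \<in> K ==> E x = 0"
 "compact L" "L \<subseteq> Om" "!!x. x ~: L ==> ch x = 0" "!!x. x ~: L ==> E x = 0"
 using cutoff_exists[OF K(1) Om K(2)] by metis
 have Lb[measurable]: "L \<in> sets borel" "K \<in> sets borel" using ch(6) K by (auto simp: borel_compact)
 have KL: "K \<subseteq> L" using ch(4,8) by (metis subsetI zero_neq_one)
 have "compact (E ` L)" by (rule compact_continuous_image[OF continuous_on_subset[OF C1_cont_D[OF ch(1)] subset_UNIV] ch(6)])
 then have "\<exists>B. \<forall>x\<in>L. norm (E x) <= B" using compact_imp_bounded[of "E ` L"] by (simp add: bounded_iff)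
 then obtain B where B: "\<forall>x\<in>L. norm (E x) <= B" ..
 define V where "V = enn2real (emeasure lborel L)"
 have V: "emeasure lborel L = ennreal V" "0 <= V" using emeasure_compact_finite[OF ch(6)] by (auto simp: V_def)
 define C where "C = 4 / 3 * (4 * Lam^2 / lam^2 * (B^2 * 40 * V))"
 show ?thesis
 proof (intro exI[of _ L] exI[of _ C] conjI ch(6,7) allI impI)
 show "0 <= C" using V by (simp add: C_def)
 fix w :: "'a => real" and G F :: "'a => 'a" and a :: real
 assume e: "ellflux lam Lam Om w G F" and a: "0 < a" and wa: "\<forall>x\<in>L. \<bar>w x\<bar> <= a"
 have [measurable]: "G \<in> bm" using e by (simp add: ellflux_def sob_def)
 define W where "W x = (1 / a) * w x + 2" for x
 have e': "ellflux lam Lam Om W (%x. (1 / a) *. G x) (%x. (1 / a) *. F x)" unfolding W_def by (rule ellflux_affine[OF e])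
 have W13: "1 <= W x" "W x <= 3" if "x \<in> L" for x
 proof -
 have "\<bar>w x\<bar> <= a" using wa that by blast
 then show "1 <= W x" "W x <= 3" using a by (auto simp: W_def field_simps abs_le_iff)
 qed
 have d3: "DERIV (%t. (max 0 (t - 1 / 2)) ^ 3) t :> 3 * (max 0 (t - 1 / 2))^2" for t :: real
 using DERIV_pos_part_power[of 2 "1 / 2" t] by (simp add: numeral_3_eq_3 numeral_2_eq_2)
 have ei: "(NI x. ie L x ((ch x)^2 * (3 * (max 0 (W x - 1 / 2))^2) * (norm ((1 / a) *. G x))^2))
 <= ennreal (4 * Lam^2 * (1 / 3) / lam^2) * (NI x. ie L x ((norm (E x))^2 * ((max 0 (W x - 1 / 2))^2)^2))"
 proof (rule energy_inequality[OF e' lam Om _ _ ch(1,6,7) ch(8,9) _ d3, where W = W and T = UNIV and \<kappa> = "1 / 2"])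
 show "continuous_on Om W" using e' by (simp add: ellflux_def sob_def)
 show "L = {x \<in> L. 1 / 2 / 2 <= W x}" using W13 by force
 show "((max 0 (t - 1 / 2)) ^ 3)^2 <= 1 / 3 * (3 * (max 0 (t - 1 / 2))^2) * ((max 0 (t - 1 / 2))^2)^2" for t :: real
 by (simp add: power_mult[symmetric] power_add[symmetric])
 qed (auto intro!: continuous_intros)
 have "L2sq K G <= (NI x. ennreal (4 / 3 * a^2) * (ie L x ((ch x)^2 * (3 * (max 0 (W x - 1 / 2))^2) * (norm ((1 / a) *. G x))^2)))"
 unfolding L2sq_def
 proof (intro nn_integral_mono)
 fix x
 show "ie K x ((norm (G x))^2) <= ennreal (4 / 3 * a^2) * (ie L x ((ch x)^2 * (3 * (max 0 (W x - 1 / 2))^2) * (norm ((1 / a) *. G x))^2))"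
 proof (cases "x \<in> K")
 case True
 have "(1 / 2)^2 <= (max 0 (W x - 1 / 2))^2" using W13[of x] True KL by (intro power_mono) auto
 then have "(norm (G x))^2 * (1 / 4) <= (norm (G x))^2 * (max 0 (W x - 1 / 2))^2" by (intro mult_left_mono) (auto simp: power2_eq_square)
 then have "(norm (G x))^2 <= 4 / 3 * a^2 * ((ch x)^2 * (3 * (max 0 (W x - 1 / 2))^2) * (norm ((1 / a) *. G x))^2)"
 using a ch(4)[OF True] by (simp add: power_mult_distrib power_divide field_simps)
 then show ?thesis using True KL a by (auto simp: ennreal_leI simp flip: ennreal_mult)
 qed simp
 qed
 also have "... = ennreal (4 / 3 * a^2) * (NI x. ie L x ((ch x)^2 * (3 * (max 0 (W x - 1 / 2))^2) * (norm ((1 / a) *. G x))^2))"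
 proof (rule nn_integral_cmult)
 have "(%x. indicator L x *. W x) \<in> bm"
 using e' ch(7) by (intro borel_measurable_continuous_on_indicator) (auto simp: ellflux_def sob_def intro: continuous_on_subset)
 then have [measurable]: "(%x. indicator L x * (max 0 (indicator L x *. W x - 1 / 2))^2) \<in> bm" by measurable
 have [measurable]: "ch \<in> bm" using C1_measurable[OF ch(1)] by simp
 have "(%x. ennreal ((ch x)^2 * (3 * (indicator L x * (max 0 (indicator L x *. W x - 1 / 2))^2)) * (norm ((1 / a) *. G x))^2)) \<in> borel_measurable lborel" by measurable
 also have "(%x. ennreal ((ch x)^2 * (3 * (indicator L x * (max 0 (indicator L x *. W x - 1 / 2))^2)) * (norm ((1 / a) *. G x))^2))
 = (%x. ie L x ((ch x)^2 * (3 * (max 0 (W x - 1 / 2))^2) * (norm ((1 / a) *. G x))^2))"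
 by (auto split: split_indicator)
 finally show "(%x. ie L x ((ch x)^2 * (3 * (max 0 (W x - 1 / 2))^2) * (norm ((1 / a) *. G x))^2)) \<in> borel_measurable lborel" .
 qed
 also have "... <= ennreal (4 / 3 * a^2) * (ennreal (4 * Lam^2 * (1 / 3) / lam^2) * ennreal (B^2 * 40 * V))"
 proof (intro mult_left_mono order_trans[OF ei])
 have "(NI x. ie L x ((norm (E x))^2 * ((max 0 (W x - 1 / 2))^2)^2)) <= (NI x. ennreal (B^2 * 40) * indicator L x)"
 proof (intro nn_integral_mono)
 fix x
 show "ie L x ((norm (E x))^2 * ((max 0 (W x - 1 / 2))^2)^2) <= ennreal (B^2 * 40) * indicator L x"
 proof (cases "x \<in> L")
 case True
 have "norm (E x) <= B" using B True by blast
 moreover have "((max 0 (W x - 1 / 2))^2)^2 <= ((5 / 2)^2)^2" using W13[OF True] by (intro power_mono) auto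
 then have "((max 0 (W x - 1 / 2))^2)^2 <= 40" by (simp add: power2_eq_square)
 ultimately have "(norm (E x))^2 * ((max 0 (W x - 1 / 2))^2)^2 <= B^2 * 40" by (intro mult_mono power_mono) auto
 then show ?thesis using True by (simp add: ennreal_leI)
 qed simp
 qed
 also have "... = ennreal (B^2 * 40 * V)" using V by (simp add: nn_integral_cmult ennreal_mult)
 finally show "(NI x. ie L x ((norm (E x))^2 * ((max 0 (W x - 1 / 2))^2)^2)) <= ennreal (B^2 * 40 * V)" .
 qed auto
 also have "... = ennreal (4 / 3 * a^2 * (4 * Lam^2 * (1 / 3) / lam^2 * (B^2 * 40 * V)))"
 using V(2) by (simp add: ennreal_mult[symmetric])
 also have "... <= ennreal (C * a^2)"
 proof (rule ennreal_leI)
 have third: "0 <= y ==> 1 / 3 * y <= y" for y :: real by simp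
 have "1 / 3 * (4 * Lam^2 / lam^2 * (B^2 * 40 * V)) <= 4 * Lam^2 / lam^2 * (B^2 * 40 * V)" by (rule third) (use V in simp)
 then have "(4 / 3 * a^2) * (1 / 3 * (4 * Lam^2 / lam^2 * (B^2 * 40 * V))) <= (4 / 3 * a^2) * (4 * Lam^2 / lam^2 * (B^2 * 40 * V))"
 by (intro mult_left_mono) auto
 then show "4 / 3 * a^2 * (4 * Lam^2 * (1 / 3) / lam^2 * (B^2 * 40 * V)) <= C * a^2" by (simp add: C_def mult_ac)
 qed
 finally show "L2sq K G <= ennreal (C * a^2)" .
 qed
qed

lemma L2loc_integrable:
 fixes V :: "'a::euclidean_space => 'b::euclidean_space" and P :: "'a => 'c::euclidean_space"
 assumes Om: "Om \<in> sets lebesgue" and K: "compact K" "K \<subseteq> Om" and V: "integrable (lebesgue_on K) (%x. (norm (V x))^2)"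
 and P: "P \<in> borel_measurable (lebesgue_on Om)" "!!x. norm (P x) <= indicator K x * (B * norm (V x))" and B: "0 <= B"
 shows "integrable (lebesgue_on Om) P"
proof -
 have KL: "K \<in> sets lebesgue" using K by (simp add: sets_completionI_sets borel_compact)
 have i1: "integrable lebesgue (%x. indicator K x *. (norm (V x))^2)"
 using V KL by (subst (asm) integrable_restrict_space) auto
 have i2: "integrable lebesgue (indicator K :: 'a => real)"
 using KL emeasure_compact_finite[OF K(1)] by (subst integrable_indicator_iff) (auto simp: emeasure_completion borel_compact[OF K(1)])
 have i: "integrable lebesgue (%x. B * (indicator K x + indicator K x *. (norm (V x))^2))"
 by (rule integrable_mult_right[OF Bochner_Integration.integrable_add[OF i2 i1]])
 have "integrable lebesgue (%x. indicator Om x *. P x)"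
 proof (rule Bochner_Integration.integrable_bound[OF i])
 show "(%x. indicator Om x *. P x) \<in> borel_measurable lebesgue" using P(1) Om by (subst (asm) borel_measurable_restrict_space_iff) auto
 have "norm (indicator Om x *. P x) <= norm (B * (indicator K x + indicator K x *. (norm (V x))^2))" for x
 proof -
 have "0 <= (norm (V x) - 1 / 2)^2" by (rule zero_le_power2)
 also have "... = (norm (V x))^2 - norm (V x) + 1 / 4" by (simp add: power2_eq_square algebra_simps)
 finally have "norm (V x) <= 1 + (norm (V x))^2" by simp
 then have "B * norm (V x) <= B * (1 + (norm (V x))^2)" using B by (rule mult_left_mono)
 then show ?thesis using P(2)[of x] B K(2) by (auto split: split_indicator)
 qed
 then show "AE x in lebesgue. norm (indicator Om x *. P x) <= norm (B * (indicator K x + indicator K x *. (norm (V x))^2))" by simp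
 qed
 then show ?thesis using Om by (subst integrable_restrict_space) auto
qed

lemma weak_gradient_integrable:
 assumes hw: "has_weak_gradient Om u G" and t: "test_function Om f D" and Om: "open (Om :: 'a::euclidean_space set)"
 shows "integrable (lebesgue_on Om) (%X. u X *. D X)" "integrable (lebesgue_on Om) (%X. f X *. G X)"
proof -
 let ?K = "closure {X. f X ~= 0}"
 have OmL: "Om \<in> sets lebesgue" using Om by (simp add: sets_completionI_sets)
 have C1: "C1 f D" using t by (auto simp: test_function_def C1_def)
 have K: "compact ?K" "?K \<subseteq> Om" using t by (auto simp: test_function_def)
 have z: "x ~: ?K ==> D x = 0" "x ~: ?K ==> f x = 0" for x
 using C1_zero_outside_support[OF t] closure_subset[of "{X. f X ~= 0}"] by auto
 have "compact (f ` ?K)" "compact (D ` ?K)"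
 by (intro compact_continuous_image[OF _ K(1)] continuous_on_subset[OF C1_cont[OF C1] subset_UNIV] continuous_on_subset[OF C1_cont_D[OF C1] subset_UNIV])+
 then have "\<exists>B. \<forall>x\<in>?K. norm (f x) <= B" "\<exists>B. \<forall>x\<in>?K. norm (D x) <= B"
 using compact_imp_bounded[of "f ` ?K"] compact_imp_bounded[of "D ` ?K"] by (simp_all add: bounded_iff)
 then obtain Bf BD where B: "\<forall>x\<in>?K. norm (f x) <= Bf" "\<forall>x\<in>?K. norm (D x) <= BD" by blast
 have um: "u \<in> borel_measurable (lebesgue_on Om)" "G \<in> borel_measurable (lebesgue_on Om)" using hw by (auto simp: has_weak_gradient_def)
 have m: "f \<in> borel_measurable (lebesgue_on Om)" "D \<in> borel_measurable (lebesgue_on Om)"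
 using C1_measurable[OF C1] by (auto simp: measurable_completion measurable_restrict_space1)
 have i: "integrable (lebesgue_on ?K) (%x. (norm (u x))^2)" "integrable (lebesgue_on ?K) (%x. (norm (G x))^2)"
 using hw K by (auto simp: has_weak_gradient_def)
 show "integrable (lebesgue_on Om) (%X. u X *. D X)"
 proof (rule L2loc_integrable[OF OmL K i(1), where B = "\<bar>BD\<bar>"])
 fix x show "norm (u x *. D x) <= indicator ?K x * (\<bar>BD\<bar> * norm (u x))"
 proof (cases "x \<in> ?K")
 case True
 have "\<bar>u x\<bar> * norm (D x) <= \<bar>u x\<bar> * \<bar>BD\<bar>" by (rule mult_left_mono) (use bspec[OF B(2) True] in linarith, simp)
 then show ?thesis using True by (simp only: norm_scaleR real_norm_def indicator_simps mult_1 mult.commute[of "\<bar>BD\<bar>"])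
 qed (simp add: z(1))
 qed (simp_all add: borel_measurable_scaleR um m)
 show "integrable (lebesgue_on Om) (%X. f X *. G X)"
 proof (rule L2loc_integrable[OF OmL K i(2), where B = "\<bar>Bf\<bar>"])
 fix x show "norm (f x *. G x) <= indicator ?K x * (\<bar>Bf\<bar> * norm (G x))"
 proof (cases "x \<in> ?K")
 case True
 have "norm (f x) * norm (G x) <= \<bar>Bf\<bar> * norm (G x)" by (rule mult_right_mono) (use bspec[OF B(1) True] in linarith, simp)
 then show ?thesis using True by (simp only: norm_scaleR real_norm_def indicator_simps mult_1)
 qed (simp add: z(2)[of x])
 qed (simp_all add: borel_measurable_scaleR um m)
qed

text \<open>Cauchy-Schwarz with weights \<open>2^-(i+1)\<close>, whose sum is at most 1. It gives
  absolute convergence of a series wherever its weighted squares are summable.\<close>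

lemma sum_sq_weighted: "(\<Sum>i<n. a i)^2 <= (\<Sum>i<n. 2 ^ Suc i * (a i)^2)" for a :: "nat => real"
proof (induction n arbitrary: a)
 case (Suc n)
 have "(\<Sum>i<Suc n. a i)^2 = (a 0 + (\<Sum>i<n. a (Suc i)))^2" unfolding sum.lessThan_Suc_shift ..
 also have "... <= 2 * (a 0)^2 + 2 * (\<Sum>i<n. a (Suc i))^2" using norm_add_sq_le[of "a 0" "\<Sum>i<n. a (Suc i)"] by simp
 also have "... <= 2 * (a 0)^2 + 2 * (\<Sum>i<n. 2 ^ Suc i * (a (Suc i))^2)" using Suc.IH[of "%i. a (Suc i)"] by simp
 also have "... = (\<Sum>i<Suc n. 2 ^ Suc i * (a i)^2)" unfolding sum.lessThan_Suc_shift[of _ n] by (simp add: sum_distrib_left mult_ac)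
 finally show ?case .
qed simp

lemma L2sq_integrable:
 fixes V :: "'a::euclidean_space => 'b::euclidean_space"
 assumes "V \<in> bm" "K \<in> sets borel" "L2sq K V < \<infinity>"
 shows "integrable (lebesgue_on K) (%x. (norm (V x))^2)"
proof -
 have KL: "K \<in> sets lebesgue" using assms by (simp add: sets_completionI_sets)
 have "(\<integral>\<^sup>+x. ennreal ((norm (V x))^2) \<partial>lebesgue_on K) = L2sq K V"
 unfolding L2sq_def using KL assms by (simp add: nn_integral_restrict_space nn_integral_completion mult.commute)
 moreover have "V \<in> borel_measurable (lebesgue_on K)" using assms by (simp add: measurable_completion measurable_restrict_space1)
 ultimately show ?thesis using assms(3) by (simp add: integrable_iff_bounded)
qed

text \<open>The weighted sum \<open>S\<close> of squares is locally integrable because the square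
  integrals decay like \<open>4^-i\<close>. Where \<open>S\<close> is finite, the partial sums of
  the gradients converge and are dominated by its square root \<open>V\<close>, so both sides of the
  weak identity pass to the limit by dominated convergence.\<close>

lemma has_weak_gradient_series:
 fixes d :: "nat => 'a::euclidean_space => real"
 assumes Om: "open Om" and hw: "!!i. has_weak_gradient Om (d i) (D i)" and Db[measurable]: "!!i. D i \<in> bm"
 and L2: "!!K. compact K ==> K \<subseteq> Om ==> \<exists>c\<ge>0. \<forall>i. L2sq K (D i) <= ennreal (c / 4 ^ i)"
 and lim: "!!x. x \<in> Om ==> (%n. \<Sum>i<n. d i x) ~~> u x" and bd: "!!x n. x \<in> Om ==> \<bar>\<Sum>i<n. d i x\<bar> <= 1"
 shows "\<exists>G. has_weak_gradient Om u G"
proof -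
 have OmL: "Om \<in> sets lebesgue" and Omb[measurable]: "Om \<in> sets borel" using Om by (auto simp: sets_completionI_sets)
 define S where "S x = (\<Sum>i. ennreal (2 ^ Suc i * (norm (D i x))^2))" for x
 have Sm[measurable]: "S \<in> bm" unfolding S_def by measurable
 have Sint: "(NI x. indicator K x * S x) < \<infinity>" if K: "compact K" "K \<subseteq> Om" for K
 proof -
 have [measurable]: "K \<in> sets borel" using K by (simp add: borel_compact)
 obtain c where c: "0 <= c" "\<forall>i. L2sq K (D i) <= ennreal (c / 4 ^ i)" using L2[OF K] by blast
 have "(NI x. indicator K x * S x) = (NI x. (\<Sum>i. ie K x (2 ^ Suc i * (norm (D i x))^2)))"
 unfolding S_def by simp
 also have "... = (\<Sum>i. (NI x. ie K x (2 ^ Suc i * (norm (D i x))^2)))"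
 by (rule nn_integral_suminf) measurable
 also have "... = (\<Sum>i. ennreal (2 ^ Suc i) * L2sq K (D i))"
 proof (rule suminf_cong)
 fix i
 have "(NI x. ie K x (2 ^ Suc i * (norm (D i x))^2)) = (NI x. ennreal (2 ^ Suc i) * (ie K x ((norm (D i x))^2)))"
 by (intro nn_integral_cong) (simp add: ennreal_mult mult_ac)
 also have "... = ennreal (2 ^ Suc i) * L2sq K (D i)" unfolding L2sq_def by (rule nn_integral_cmult) measurable
 finally show "(NI x. ie K x (2 ^ Suc i * (norm (D i x))^2)) = ennreal (2 ^ Suc i) * L2sq K (D i)" .
 qed
 also have "... <= (\<Sum>i. ennreal (2 * c * (1 / 2) ^ i))"
 proof (rule suminf_le)
 fix i
 have "ennreal (2 ^ Suc i) * L2sq K (D i) <= ennreal (2 ^ Suc i) * ennreal (c / 4 ^ i)" using c by (intro mult_left_mono) auto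
 also have "... = ennreal (2 ^ Suc i * (c / 4 ^ i))" by (rule ennreal_mult[symmetric]) (use c in auto)
 also have "2 ^ Suc i * (c / 4 ^ i) = 2 * c * (1 / 2) ^ i"
 proof -
 have "(4 :: real) ^ i = 2 ^ i * 2 ^ i" by (simp flip: power_mult_distrib)
 then show ?thesis by (simp add: power_divide)
 qed
 finally show "ennreal (2 ^ Suc i) * L2sq K (D i) <= ennreal (2 * c * (1 / 2) ^ i)" .
 qed auto
 also have "... = ennreal (\<Sum>i. 2 * c * (1 / 2) ^ i)" using c by (intro suminf_ennreal2) (auto intro: summable_mult summable_geometric)
 also have "... < \<infinity>" by simp
 finally show ?thesis .
 qed
 define G where "G x = (\<Sum>i. D i x)" for x
 have Gm[measurable]: "G \<in> bm" unfolding G_def by measurable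
 define V where "V x = sqrt (enn2real (S x))" for x
 have Vm[measurable]: "V \<in> bm" unfolding V_def by measurable
 have pt: "(%n. \<Sum>i<n. D i x) ~~> G x" "norm (\<Sum>i<n. D i x) <= V x" "norm (G x) <= V x" if S: "S x < \<infinity>" for x n
 proof -
 have sV: "enn2real (S x) = (V x)^2" "0 <= V x" by (simp_all add: V_def)
 have V: "(\<Sum>i<n. norm (D i x)) <= V x" for n
 proof -
 have "ennreal (\<Sum>i<n. 2 ^ Suc i * (norm (D i x))^2) = (\<Sum>i<n. ennreal (2 ^ Suc i * (norm (D i x))^2))" by (subst sum_ennreal) auto
 also have "... <= S x" unfolding S_def by (rule sum_le_suminf) auto
 also have "... = ennreal ((V x)^2)" using S by (simp flip: sV(1))
 finally have "(\<Sum>i<n. 2 ^ Suc i * (norm (D i x))^2) <= (V x)^2" by (subst (asm) ennreal_le_iff) auto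
 then have "(\<Sum>i<n. norm (D i x))^2 <= (V x)^2" using sum_sq_weighted[of "%i. norm (D i x)" n] by simp
 then show ?thesis using sV(2) by (rule power2_le_imp_le)
 qed
 have "summable (%i. norm (D i x))" by (rule summableI_nonneg_bounded[of _ "V x"]) (use V in auto)
 then have "summable (%i. D i x)" by (rule summable_norm_cancel)
 then show l: "(%n. \<Sum>i<n. D i x) ~~> G x" unfolding G_def by (rule summable_LIMSEQ)
 have n: "norm (\<Sum>i<n. D i x) <= V x" for n using norm_sum[of "%i. D i x" "{..<n}"] V[of n] by linarith
 show "norm (\<Sum>i<n. D i x) <= V x" by (rule n)
 show "norm (G x) <= V x" by (rule LIMSEQ_le_const2[OF tendsto_norm[OF l]]) (use n in blast)
 qed
 have aeS: "AE x in lborel. x \<in> Om --> S x < \<infinity>"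
 proof -
 obtain C where C: "!!n::nat. compact (C n)" "!!n. C n \<subseteq> Om" "!!n. C n \<subseteq> interior (C (Suc n))" "\<Union>(range C) = Om"
 using open_Union_compact_subsets[OF Om] by metis
 have "AE x in lborel. x \<in> C n --> S x < \<infinity>" for n
 proof -
 have [measurable]: "C n \<in> sets borel" using C(1) by (simp add: borel_compact)
 have "AE x in lborel. indicator (C n) x * S x ~= \<infinity>" by (rule nn_integral_PInf_AE) (use Sint[OF C(1)[of n] C(2)[of n]] in auto)
 then show ?thesis by eventually_elim (auto simp: less_top)
 qed
 then have "AE x in lborel. \<forall>n. x \<in> C n --> S x < \<infinity>" by (subst AE_all_countable) (rule allI)
 then show ?thesis by eventually_elim (use C(4) in blast)
 qed
 have aeSL: "AE x in lebesgue_on Om. S x < \<infinity>" using AE_completion[OF aeS] OmL by (simp add: AE_restrict_space_iff)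
 have VK: "L2sq K V < \<infinity>" "L2sq K G < \<infinity>" if K: "compact K" "K \<subseteq> Om" for K
 proof -
 have "L2sq K V <= (NI x. indicator K x * S x)"
 unfolding L2sq_def
 proof (intro nn_integral_mono mult_left_mono)
 fix x show "ennreal ((norm (V x))^2) <= S x" by (cases "S x") (auto simp: V_def)
 qed simp
 then show V: "L2sq K V < \<infinity>" using Sint[OF K] by simp
 have "L2sq K G <= L2sq K V"
 unfolding L2sq_def
 proof (rule nn_integral_mono_AE)
 show "AE x in lborel. ie K x ((norm (G x))^2) <= ie K x ((norm (V x))^2)"
 using aeS
 proof eventually_elim
 case (elim x)
 have "x \<in> K ==> (norm (G x))^2 <= (norm (V x))^2" using elim K(2) pt(3)[of x] by (intro power_mono) auto
 then show ?case by (auto split: split_indicator intro: ennreal_leI)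
 qed
 qed
 then show "L2sq K G < \<infinity>" using V by simp
 qed
 have um: "u \<in> borel_measurable (lebesgue_on Om)"
 proof (rule borel_measurable_LIMSEQ_metric[where f = "%n x. \<Sum>i<n. d i x"])
 show "(%x. \<Sum>i<n. d i x) \<in> borel_measurable (lebesgue_on Om)" for n
 using hw by (intro borel_measurable_sum) (simp add: has_weak_gradient_def)
 qed (use lim in simp)
 have u1: "\<bar>u x\<bar> <= 1" if "x \<in> Om" for x
 by (rule LIMSEQ_le_const2[OF tendsto_rabs[OF lim[OF that]]]) (use bd[OF that] in blast)
 have "has_weak_gradient Om u G"
 unfolding has_weak_gradient_def
 proof (intro conjI allI impI um)
 show GmO: "G \<in> borel_measurable (lebesgue_on Om)" by (simp add: measurable_completion measurable_restrict_space1)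
 { fix K assume K': "compact K & K \<subseteq> Om"
 then have K: "compact K" "K \<subseteq> Om" "K \<in> sets borel" by (auto simp: borel_compact)
 then have KL: "K \<in> sets lebesgue" by (simp add: sets_completionI_sets)
 show "integrable (lebesgue_on K) (%x. (norm (G x))^2)" by (rule L2sq_integrable[OF Gm K(3) VK(2)[OF K(1,2)]])
 have "finite_measure (lebesgue_on K)"
 using emeasure_compact_finite[OF K(1)] KL K(3) by (intro finite_measureI) (simp add: emeasure_restrict_space emeasure_completion)
 then interpret finite_measure "lebesgue_on K" .
 have "u \<in> borel_measurable (lebesgue_on K)" by (rule measurable_restrict_mono[OF um K(2)])
 then show "integrable (lebesgue_on K) (%x. (u x)^2)"
 proof (intro integrable_const_bound[of _ 1] AE_I2)
 fix x assume "x \<in> space (lebesgue_on K)"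
 then have "\<bar>u x\<bar> <= 1" using K by (intro u1) auto
 then show "norm ((u x)^2) <= 1" by (simp add: abs_square_le_1)
 qed measurable }
 fix f Df assume t: "test_function Om f Df"
 let ?K = "closure {X. f X ~= 0}" and ?M = "lebesgue_on Om"
 have C1: "C1 f Df" using t by (auto simp: test_function_def C1_def)
 have K: "compact ?K" "?K \<subseteq> Om" "?K \<in> sets borel" using t by (auto simp: test_function_def)
 have z: "x ~: ?K ==> Df x = 0" "x ~: ?K ==> f x = 0" for x
 using C1_zero_outside_support[OF t] closure_subset[of "{X. f X ~= 0}"] by auto
 have m: "f \<in> borel_measurable ?M" "Df \<in> borel_measurable ?M" "V \<in> borel_measurable ?M" "!!i. D i \<in> borel_measurable ?M"
 using C1_measurable[OF C1] by (auto simp: measurable_completion measurable_restrict_space1)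
 have i: "integrable ?M (%X. d i X *. Df X)" "integrable ?M (%X. f X *. D i X)" for i
 using weak_gradient_integrable[OF hw t Om] by auto
 have id: "(LINT X|?M. (\<Sum>i<n. d i X) *. Df X) = - (LINT X|?M. f X *. (\<Sum>i<n. D i X))" for n
 proof -
 have "(LINT X|?M. (\<Sum>i<n. d i X) *. Df X) = (\<Sum>i<n. (LINT X|?M. d i X *. Df X))"
 unfolding scaleR_left.sum by (rule Bochner_Integration.integral_sum) (rule i)
 also have "... = (\<Sum>i<n. - (LINT X|?M. f X *. D i X))" using hw t by (intro sum.cong) (auto simp: has_weak_gradient_def)
 also have "... = - (LINT X|?M. f X *. (\<Sum>i<n. D i X))"
 unfolding scaleR_right.sum sum_negf by (subst Bochner_Integration.integral_sum) (auto intro: i)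
 finally show ?thesis .
 qed
 have "compact (f ` ?K)"
 by (rule compact_continuous_image[OF continuous_on_subset[OF C1_cont[OF C1] subset_UNIV] K(1)])
 then have "\<exists>B. \<forall>x\<in>?K. norm (f x) <= B" using compact_imp_bounded[of "f ` ?K"] by (simp add: bounded_iff)
 then obtain B where B: "\<forall>x\<in>?K. norm (f x) <= B" ..
 have "(%n. LINT X|?M. (\<Sum>i<n. d i X) *. Df X) ~~> (LINT X|?M. u X *. Df X)"
 proof (rule integral_dominated_convergence[where w = "%x. norm (Df x)"])
 show "integrable ?M (%x. norm (Df x))"
 proof (rule integrable_norm)
 have "integrable lborel Df"
 by (rule integrable_compact_support[OF C1_cont_D[OF C1] K(1)]) (use z in blast)
 then have "integrable lebesgue Df" using C1_measurable(2)[OF C1] by (simp add: integrable_completion)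
 then have "integrable lebesgue (%x. indicator Om x *. Df x)" using OmL by (intro integrable_mult_indicator)
 then show "integrable ?M Df" using OmL by (subst integrable_restrict_space) auto
 qed
 show "(%X. u X *. Df X) \<in> borel_measurable ?M" using um m by measurable
 show "(%X. (\<Sum>i<n. d i X) *. Df X) \<in> borel_measurable ?M" for n
 using hw m by (intro borel_measurable_scaleR borel_measurable_sum) (auto simp: has_weak_gradient_def)
 show "AE X in ?M. (%n. (\<Sum>i<n. d i X) *. Df X) ~~> u X *. Df X" using lim by (intro AE_I2 tendsto_scaleR tendsto_const) auto
 show "AE X in ?M. norm ((\<Sum>i<n. d i X) *. Df X) <= norm (Df X)" for n
 using bd mult_right_mono[of "\<bar>\<Sum>i<n. d i _\<bar>" 1 "norm (Df _)"] by (intro AE_I2) auto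
 qed
 moreover have "(%n. LINT X|?M. f X *. (\<Sum>i<n. D i X)) ~~> (LINT X|?M. f X *. G X)"
 proof (rule integral_dominated_convergence[where w = "%x. norm (f x *. V x)"])
 show "integrable ?M (%x. norm (f x *. V x))"
 proof (intro integrable_norm L2loc_integrable[OF OmL K(1,2) L2sq_integrable[OF Vm K(3) VK(1)[OF K(1,2)]], where B = "\<bar>B\<bar>"])
 fix x show "norm (f x *. V x) <= indicator ?K x * (\<bar>B\<bar> * norm (V x))"
 proof (cases "x \<in> ?K")
 case True
 have "norm (f x) * norm (V x) <= \<bar>B\<bar> * norm (V x)" by (rule mult_right_mono) (use bspec[OF B True] in linarith, simp)
 then show ?thesis using True by (simp add: abs_mult)
 qed (simp add: z(2)[of x])
 qed (use m in auto)
 show "(%X. f X *. G X) \<in> borel_measurable ?M" using GmO m by measurable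
 show "(%X. f X *. (\<Sum>i<n. D i X)) \<in> borel_measurable ?M" for n
 using m by (intro borel_measurable_scaleR borel_measurable_sum) auto
 show "AE X in ?M. (%n. f X *. (\<Sum>i<n. D i X)) ~~> f X *. G X"
 using aeSL by eventually_elim (intro tendsto_scaleR tendsto_const pt)
 show "AE X in ?M. norm (f X *. (\<Sum>i<n. D i X)) <= norm (f X *. V X)" for n
 using aeSL
 proof eventually_elim
 case (elim X)
 have "norm (\<Sum>i<n. D i X) <= \<bar>V X\<bar>" using pt(2)[OF elim, of n] by linarith
 then show ?case by (simp add: abs_mult mult_left_mono)
 qed
 qed
 ultimately show "(LINT X|?M. u X *. Df X) = - (LINT X|?M. f X *. G X)"
 using LIMSEQ_unique tendsto_minus unfolding id by blast
 qed
 then show ?thesis by blast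
qed

lemma harnack_compact:
 fixes om :: "'m::finite pnt => (real^'m) measure"
 assumes lam: "0 < lam" "0 < Lam" and e: "emeas lam Lam om" and L: "compact L" "L \<subseteq> half_space" and X0: "X0 \<in> half_space"
 shows "\<exists>C\<ge>1. \<forall>X\<in>L. \<forall>F\<in>sets borel. measure (om X) F <= C * measure (om X0) F"
proof (cases "L = {}")
 case False
 show ?thesis
 proof (rule exE[OF measure_harnack[OF lam, where 'm = 'm]], elim conjE, goal_cases)
 case (1 C)
 note C = 1(1) and mh0 = 1(2)
 note mh = mh0[THEN spec4, THEN spec, THEN spec, THEN mp4, THEN mp, THEN mp]
 obtain Y where Y: "Y \<in> L" "\<forall>X\<in>L. snd Y <= snd X"
 using continuous_attains_inf[OF L(1) False continuous_on_snd[OF continuous_on_id]] by blast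
 have "\<exists>B. \<forall>X\<in>L. dist X X0 <= B" using compact_imp_bounded[OF L(1)] bounded_any_center[of L X0] by (auto simp: dist_commute)
 then obtain B where B: "\<forall>X\<in>L. dist X X0 <= B" ..
 define h where "h = min (snd Y) (snd X0)"
 have h: "0 < h" using Y(1) L(2) X0 by (auto simp: h_def half_space_snd)
 obtain k :: nat where "36 * B / h < real k" using reals_Archimedean2 by blast
 then have k: "B <= real k * h / 36" using h by (simp add: field_simps)
 show ?thesis
 proof (intro exI[of _ "C ^ k"] conjI ballI)
 show "1 <= C ^ k" using C by simp
 fix X F assume X: "X \<in> L" and F: "F \<in> sets (borel :: (real^'m) measure)"
 show "measure (om X) F <= C ^ k * measure (om X0) F"
 proof (rule mh[OF e F h])
 show "h <= snd X" using Y(2) X by (auto simp: h_def)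
 show "dist X X0 <= real k * h / 36" using B X k by (meson order_trans)
 qed (simp add: h_def)
 qed
 qed
qed (auto intro: exI[of _ 1])

lemma integral_le_of_measure:
 fixes M N :: "'a::euclidean_space measure" and f :: "'a => real"
 assumes M: "prob_space M" "sets M = sets borel" and N: "prob_space N" "sets N = sets borel" and C: "0 <= C"
 and le: "!!F. F \<in> sets borel ==> measure M F <= C * measure N F" and f: "f \<in> bm" "!!x. 0 <= f x" "!!x. f x <= B"
 shows "(LINT x|M. f x) <= C * (LINT x|N. f x)"
proof -
 have i: "integrable P f" if "prob_space P" "sets P = sets borel" for P
 proof -
 interpret prob_space P by (rule that)
 show ?thesis by (rule integrable_const_bound[of _ B]) (use f that in \<open>auto cong: measurable_cong_sets\<close>)
 qed
 have "ennreal 1 * (\<integral>\<^sup>+x. ennreal (f x) \<partial>M) <= ennreal C * (\<integral>\<^sup>+x. ennreal (f x) \<partial>N)"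
 by (rule nn_integral_le_of_measure[OF M N]) (use C le f in auto)
 then have "ennreal (LINT x|M. f x) <= ennreal (C * (LINT x|N. f x))"
 using i[OF M] i[OF N] f(2) C by (simp add: nn_integral_eq_integral Bochner_Integration.integral_nonneg ennreal_mult)
 then show ?thesis using f(2) C by (simp add: ennreal_le_iff Bochner_Integration.integral_nonneg)
qed

text \<open>Elliptic measure is characterised by continuous data only, and
  \<open>weak_gradient\<close> is an arbitrary choice until some weak gradient is known to exist.
  The indicator is approximated in L1 for one pole with errors \<open>2^-j\<close>; Harnack turns
  this into uniform convergence on compact sets, and Caccioppoli gives the decay of the
  gradients.\<close>

lemma hext_indicator_weak_gradient:
 fixes om :: "'m::finite pnt => (real^'m) measure"
 assumes lam: "0 < lam" "0 < Lam" and e: "emeas lam Lam om" and H: "H \<in> sets borel"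
 shows "\<exists>G. has_weak_gradient half_space (hext om (indicator H)) G"
proof -
 define X0 :: "'m pnt" where "X0 = (0, 1)"
 have X0: "X0 \<in> half_space" by (simp add: X0_def half_space_snd)
 note N = emeas_D(1,2)[OF e X0]
 have "\<forall>j. \<exists>g. Cc g & (\<forall>x. 0 <= g x & g x <= 1) & (LINT x|om X0. \<bar>g x - indicator H x\<bar>) <= 1 / 2 ^ j"
 by (rule allI, rule Cc_dense[OF N H]) simp
 from choice[OF this] obtain g where g: "!!j. Cc (g j)" "!!j x. 0 <= g j x" "!!j x. g j x <= 1"
 and gH: "!!j. (LINT x|om X0. \<bar>g j x - indicator H x\<bar>) <= 1 / 2 ^ j" by blast
 have gm: "g j \<in> bm" for j by (rule Cc_measurable[OF g(1)])
 \<comment> \<open>Successive differences: the first \<open>Suc n\<close> of them sum to the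
   solution with data \<open>g n\<close>, which stays between 0 and 1.\<close>
 define k where "k i = (case i of 0 => g 0 | Suc j => (%x. 1 * g (Suc j) x + (- 1) * g j x))" for i
 have k: "Cc (k i)" for i unfolding k_def by (cases i) (simp_all only: nat.case Cc_lincomb g(1))
 have "\<forall>i. \<exists>D F. ellflux lam Lam half_space (hext om (k i)) D F & has_weak_gradient half_space (hext om (k i)) D"
 using e k unfolding emeas_def by blast
 from choice[OF this] obtain D where D: "\<forall>i. \<exists>F. ellflux lam Lam half_space (hext om (k i)) (D i) F & has_weak_gradient half_space (hext om (k i)) (D i)" ..
 have int: "integrable (om X) (g j)" "integrable (om X) (%x. \<bar>g j x - indicator H x\<bar>)" "integrable (om X) (indicator H :: _ => real)" if "X \<in> half_space" for X j
 proof -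
 interpret prob_space "om X" by (rule emeas_D[OF e that])
 show "integrable (om X) (g j)" by (rule Cc_integrable[OF g(1) emeas_D(1,2)[OF e that]])
 show "integrable (om X) (indicator H :: _ => real)" using H emeas_D(2)[OF e that] by (simp add: emeasure_eq_measure)
 then show "integrable (om X) (%x. \<bar>g j x - indicator H x\<bar>)" using \<open>integrable (om X) (g j)\<close> by simp
 qed
 have psum: "(\<Sum>i<Suc n. hext om (k i) X) = hext om (g n) X" if X: "X \<in> half_space" for n X
 proof (induction n)
 case (Suc n)
 have "hext om (k (Suc n)) X = 1 * hext om (g (Suc n)) X + (- 1) * hext om (g n) X"
 unfolding k_def by (simp only: nat.case) (rule hext_lincomb[OF e X g(1) g(1)])
 then show ?case using Suc by simp
 qed (simp add: k_def)
 have kX0: "(LINT x|om X0. \<bar>k i x\<bar>) <= 3 / 2 ^ i" for i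
 proof (cases i)
 case 0
 have "(LINT x|om X0. \<bar>g 0 x\<bar>) = hext om (g 0) X0" using g(2) by (simp add: hext_def)
 also have "... <= 1" by (rule hext_le_1[OF e X0 g(1,3)])
 finally show ?thesis by (simp add: 0 k_def)
 next
 case (Suc j)
 have "(LINT x|om X0. \<bar>k i x\<bar>) <= (LINT x|om X0. \<bar>g (Suc j) x - indicator H x\<bar> + \<bar>g j x - indicator H x\<bar>)"
 using int[OF X0] Cc_integrable[OF k N] by (intro integral_mono) (auto simp: Suc k_def)
 also have "... <= 1 / 2 ^ Suc j + 1 / 2 ^ j" using int[OF X0] gH[of "Suc j"] gH[of j] by simp
 also have "... = 3 / 2 ^ i" by (simp add: Suc)
 finally show ?thesis .
 qed
 have kL: "\<exists>C\<ge>1. \<forall>X\<in>L. \<forall>i. \<bar>hext om (k i) X\<bar> <= 3 * C / 2 ^ i" and gL: "\<exists>C\<ge>1. \<forall>X\<in>L. \<forall>j. \<bar>hext om (g j) X - hext om (indicator H) X\<bar> <= C / 2 ^ j"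
 if L: "compact L" "L \<subseteq> half_space" for L
 proof -
 obtain C where C: "1 <= C" "\<forall>X\<in>L. \<forall>F\<in>sets borel. measure (om X) F <= C * measure (om X0) F"
 using harnack_compact[OF lam e L X0] by blast
 have 1: "\<bar>hext om (k i) X\<bar> <= 3 * C / 2 ^ i" if X: "X \<in> L" for X i
 proof -
 have XH: "X \<in> half_space" using X L by blast
 obtain B where B: "\<forall>x. \<bar>k i x\<bar> <= B" using Cc_bounded[OF k] ..
 have "\<bar>hext om (k i) X\<bar> <= (LINT x|om X. \<bar>k i x\<bar>)" unfolding hext_def by (rule integral_abs_bound)
 also have "... <= C * (LINT x|om X0. \<bar>k i x\<bar>)"
 by (rule integral_le_of_measure[OF emeas_D(1,2)[OF e XH] N, where B = B]) (use C X B Cc_measurable[OF k] in auto)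
 also have "... <= C * (3 / 2 ^ i)" using C by (intro mult_left_mono kX0) auto
 finally show ?thesis by (simp add: mult.commute)
 qed
 have 2: "\<bar>hext om (g j) X - hext om (indicator H) X\<bar> <= C / 2 ^ j" if X: "X \<in> L" for X j
 proof -
 have XH: "X \<in> half_space" using X L by blast
 have "hext om (g j) X - hext om (indicator H) X = (LINT x|om X. g j x - indicator H x)" unfolding hext_def using int[OF XH] by simp
 also have "\<bar>...\<bar> <= (LINT x|om X. \<bar>g j x - indicator H x\<bar>)" by (rule integral_abs_bound)
 also have "... <= C * (LINT x|om X0. \<bar>g j x - indicator H x\<bar>)"
 proof (rule integral_le_of_measure[OF emeas_D(1,2)[OF e XH] N, where B = 1])
 show "\<bar>g j x - indicator H x\<bar> <= 1" for x using g(2,3)[of j x] by (auto split: split_indicator)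
 qed (use C X H gm in auto)
 also have "... <= C * (1 / 2 ^ j)" using C by (intro mult_left_mono gH) auto
 finally show ?thesis by simp
 qed
 show "\<exists>C\<ge>1. \<forall>X\<in>L. \<forall>i. \<bar>hext om (k i) X\<bar> <= 3 * C / 2 ^ i" "\<exists>C\<ge>1. \<forall>X\<in>L. \<forall>j. \<bar>hext om (g j) X - hext om (indicator H) X\<bar> <= C / 2 ^ j"
 using 1 2 C(1) by blast+
 qed
 show ?thesis
 proof (rule has_weak_gradient_series[OF open_half_space, where d = "%i. hext om (k i)" and D = D])
 show "has_weak_gradient half_space (hext om (k i)) (D i)" for i using D by blast
 show "D i \<in> bm" for i
 proof -
 obtain F where "ellflux lam Lam half_space (hext om (k i)) (D i) F" using D by blast
 then show ?thesis by (simp add: ellflux_def sob_def)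
 qed
 fix K :: "'m pnt set" assume K: "compact K" "K \<subseteq> half_space"
 obtain L C where L: "compact L" "L \<subseteq> half_space" "0 <= C"
 and ca0: "\<forall>w G F a. ellflux lam Lam half_space w G F --> 0 < a --> (\<forall>x\<in>L. \<bar>w x\<bar> <= a) --> L2sq K G <= ennreal (C * a^2)"
 using caccioppoli[OF lam K open_half_space] by (elim exE conjE) (rule that)
 note ca = ca0[THEN spec4, THEN mp, THEN mp, THEN mp]
 obtain C' where C': "1 <= C'" "\<forall>X\<in>L. \<forall>i. \<bar>hext om (k i) X\<bar> <= 3 * C' / 2 ^ i" using kL[OF L(1,2)] by blast
 show "\<exists>c\<ge>0. \<forall>i. L2sq K (D i) <= ennreal (c / 4 ^ i)"
 proof (intro exI[of _ "C * (3 * C')^2"] conjI allI)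
 fix i
 obtain F where F: "ellflux lam Lam half_space (hext om (k i)) (D i) F" using D by blast
 have "L2sq K (D i) <= ennreal (C * (3 * C' / 2 ^ i)^2)" by (rule ca[OF F]) (use C' in auto)
 also have "C * (3 * C' / 2 ^ i)^2 = C * (3 * C')^2 / 4 ^ i"
 proof -
 have "((2 :: real) ^ i)^2 = 4 ^ i" by (simp add: power2_eq_square flip: power_mult_distrib)
 then show ?thesis by (simp add: power_divide)
 qed
 finally show "L2sq K (D i) <= ennreal (C * (3 * C')^2 / 4 ^ i)" .
 qed (use L in simp)
 next
 fix X :: "'m pnt" assume X: "X \<in> half_space"
 obtain C where C: "1 <= C" "\<forall>j. \<bar>hext om (g j) X - hext om (indicator H) X\<bar> <= C / 2 ^ j" using gL[of "{X}"] X by auto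
 have "(%n. hext om (g n) X) ~~> hext om (indicator H) X"
 proof (rule LIM_zero_cancel, rule Lim_null_comparison)
 show "EV n. norm (hext om (g n) X - hext om (indicator H) X) <= C * (1 / 2) ^ n"
 using C by (auto simp: power_divide)
 have "(%n. C * (1 / 2) ^ n) ~~> C * 0" by (intro tendsto_mult tendsto_const LIMSEQ_realpow_zero) auto
 then show "(%n. C * (1 / 2) ^ n) ~~> 0" by simp
 qed
 then have "(%n. \<Sum>i<Suc n. hext om (k i) X) ~~> hext om (indicator H) X" unfolding psum[OF X] .
 then show "(%n. \<Sum>i<n. hext om (k i) X) ~~> hext om (indicator H) X" by (subst (asm) filterlim_sequentially_Suc)
 fix n
 show "\<bar>\<Sum>i<n. hext om (k i) X\<bar> <= 1"
 proof (cases n)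
 case (Suc j)
 have "0 <= hext om (g j) X" "hext om (g j) X <= 1" using hext_nonneg[of "g j"] g hext_le_1[OF e X g(1,3)] by auto
 then show ?thesis unfolding Suc psum[OF X] by simp
 qed simp
 qed
qed

subsection \<open>Oscillation forces energy\<close>

lemma C1_inner_const: "C1 (%x. x \<bullet> e) (%x. e)"
 unfolding C1_def gderiv_def by (auto intro!: derivative_eq_intros)

text \<open>\<open>\<tau>\<close> is the hat function of height \<open>1 / r\<close> on
  \<open>[-r, r]\<close> and \<open>\<sigma>\<close> its primitive, written as a second difference
  of squared positive parts so that it is C1.\<close>

lemma smooth_step:
 assumes r: "0 < (r :: real)"
 shows "\<exists>\<sigma> \<tau>. (\<forall>s. DERIV \<sigma> s :> \<tau> s) & continuous_on UNIV \<tau> & (\<forall>s. 0 <= \<sigma> s & \<sigma> s <= 1) & (\<forall>s. s <= - r --> \<sigma> s = 0) & (\<forall>s. r <= s --> \<sigma> s = 1) &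
 (\<forall>s. 0 <= \<tau> s) & (\<forall>s. r <= \<bar>s\<bar> --> \<tau> s = 0) & (\<forall>s. \<bar>s\<bar> <= r / 2 --> 1 / (2 * r) <= \<tau> s)"
proof -
 define \<sigma> where "\<sigma> s = ((max 0 (s - (- r)))^2 + (- 2) * (max 0 (s - 0))^2 + (max 0 (s - r))^2) / (2 * r^2)" for s
 define \<tau> where "\<tau> s = (2 * max 0 (s - (- r)) + (- 2) * (2 * max 0 (s - 0)) + 2 * max 0 (s - r)) / (2 * r^2)" for s
 have d: "DERIV (%s::real. (max 0 (s - k))^2) s :> 2 * max 0 (s - k)" for k s
 using DERIV_pos_part_power[of 1 k s] by (simp add: power2_eq_square)
 have D: "DERIV \<sigma> s :> \<tau> s" for s
 unfolding \<sigma>_def[abs_def] \<tau>_def by (intro DERIV_cdivide DERIV_add DERIV_cmult d)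
 have c: "continuous_on UNIV \<tau>" unfolding \<tau>_def[abs_def] by (intro continuous_intros) (use r in auto)
 have s0: "\<sigma> s = 0" if "s <= - r" for s using that r by (simp add: \<sigma>_def max_def)
 have s1: "\<sigma> s = 1" if "r <= s" for s
 proof -
 have "(s + r)^2 - 2 * s^2 + (s - r)^2 = 2 * r^2" by (simp add: power2_eq_square algebra_simps)
 then show ?thesis using that r by (simp add: \<sigma>_def max_def)
 qed
 have t0: "\<tau> s = 0" if "r <= \<bar>s\<bar>" for s
 using that r by (cases "0 <= s") (simp_all add: \<tau>_def max_def algebra_simps)
 have tv: "\<tau> s = (r - \<bar>s\<bar>) / r^2" if "\<bar>s\<bar> <= r" for s
 using that r by (cases "0 <= s") (auto simp: \<tau>_def max_def field_simps)
 have tn: "0 <= \<tau> s" for s using t0[of s] tv[of s] r by (cases "r <= \<bar>s\<bar>") auto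
 have tl: "1 / (2 * r) <= \<tau> s" if "\<bar>s\<bar> <= r / 2" for s
 proof -
 have "1 / (2 * r) = (r - r / 2) / r^2" using r by (simp add: field_simps power2_eq_square)
 also have "... <= (r - \<bar>s\<bar>) / r^2" using that by (intro divide_right_mono) auto
 finally show ?thesis using tv[of s] that r by simp
 qed
 have mono: "\<sigma> s <= \<sigma> t" if "s <= t" for s t by (rule DERIV_nonneg_imp_nondecreasing[OF that]) (use D tn in blast)
 have s01: "0 <= \<sigma> s & \<sigma> s <= 1" for s
 using mono[of "min s (- r)" s] mono[of s "max s r"] s0[of "min s (- r)"] s1[of "max s r"] by simp
 show ?thesis using D c s01 s0 s1 tn t0 tl by blast
qed

lemma slab_subset:
 fixes P e :: "'a::euclidean_space"
 assumes "0 < r" "0 <= h" and x: "- r <= (x - P) \<bullet> e" "(x - P) \<bullet> e <= h + r" "(x - P) \<bullet> (x - P) - ((x - P) \<bullet> e)^2 <= r^2"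
 shows "dist x P <= h + 2 * r"
proof -
 have "((x - P) \<bullet> e)^2 <= (h + r)^2" using assms by (intro power2_le_iff_abs_le[THEN iffD2]) auto
 then have "(norm (x - P))^2 <= (h + r)^2 + r^2" using x(3) by (simp add: dot_square_norm)
 moreover have "(h + 2 * r)^2 - ((h + r)^2 + r^2) = 2 * (h * r) + 2 * (r * r)" by (simp add: power2_eq_square algebra_simps)
 moreover have "0 <= h * r" "0 <= r * r" using assms by simp_all
 ultimately have "(norm (x - P))^2 <= (h + 2 * r)^2" by linarith
 then show ?thesis unfolding dist_norm by (rule power2_le_imp_le) (use assms in simp)
qed

text \<open>The test function has derivative \<open>\<phi>1 - \<phi>2\<close> in direction \<open>e\<close>, where \<open>\<phi>1\<close> and \<open>\<phi>2\<close> are translates of one bump at the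
two ends of the slab.\<close>

lemma energy_gap:
 fixes u :: "'a::euclidean_space => real"
 assumes hw: "has_weak_gradient Om u V" and Om: "open Om" and e: "norm e = 1" and r: "0 < r" and h: "0 <= h"
 and T: "T = {x. - r <= (x - P) \<bullet> e & (x - P) \<bullet> e <= h + r & (x - P) \<bullet> (x - P) - ((x - P) \<bullet> e)^2 <= r^2}" "T \<subseteq> Om"
 and hi: "!!x. x \<in> Om ==> dist x P <= 2 * r ==> 3 / 4 <= u x" and lo: "!!x. x \<in> Om ==> dist x (P + h *. e) <= 2 * r ==> u x <= 1 / 4"
 shows "ennreal ((9 / (64 * r))^2 * measure lborel (ball (0::'a) 1) * ((r / 2) ^ DIM('a))^2 / (h + 3 * r) ^ DIM('a)) <= (\<integral>\<^sup>+x. ie T x ((norm (V x))^2) \<partial>lebesgue)"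
proof -
 obtain \<sigma> \<tau> where st: "!!s. DERIV \<sigma> s :> \<tau> s" "continuous_on UNIV \<tau>" "!!s. 0 <= \<sigma> s" "!!s. \<sigma> s <= 1" "!!s. s <= - r ==> \<sigma> s = 0" "!!s. r <= s ==> \<sigma> s = 1"
 "!!s. 0 <= \<tau> s" "!!s. r <= \<bar>s\<bar> ==> \<tau> s = 0" "!!s. \<bar>s\<bar> <= r / 2 ==> 1 / (2 * r) <= \<tau> s"
 using smooth_step[OF r] by metis
 \<comment> \<open>This is \<open>1 - |y'|^2 / r^2\<close> with \<open>y'\<close> the part of
   \<open>y\<close> orthogonal to \<open>e\<close>. It is constant along \<open>e\<close>, so the
   transverse cutoff contributes nothing to the derivative in that direction.\<close>
 define q where "q y = 1 + (- 1 / r^2) * (y \<bullet> y) + (1 / r^2) * ((y \<bullet> e) * (y \<bullet> e))" for y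
 define Dq where "Dq y = 0 + (- 1 / r^2) *. (2 *. y) + (1 / r^2) *. ((y \<bullet> e) *. e + (y \<bullet> e) *. e)" for y
 define B where "B y = (max 0 (q y))^2" for y
 define \<Psi>0 where "\<Psi>0 y = (\<sigma> (y \<bullet> e) - \<sigma> (y \<bullet> e - h)) * B y" for y
 define D0 where "D0 y = (\<sigma> (y \<bullet> e) - \<sigma> (y \<bullet> e - h)) *. ((2 * max 0 (q y)) *. Dq y) + B y *. ((\<tau> (y \<bullet> e) - \<tau> (y \<bullet> e - h)) *. e)" for y
 have ee: "e \<bullet> e = 1" using e by (simp add: norm_eq_1)
 have Cq: "C1 q Dq" unfolding q_def Dq_def by (intro C1_add C1_const C1_scale C1_inner_self C1_mult C1_inner_const)
 have d2: "DERIV (%t::real. (max 0 t)^2) t :> 2 * max 0 t" for t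
 using DERIV_pos_part_power[of 1 0 t] by (simp add: power2_eq_square)
 have CB: "C1 B (%y. (2 * max 0 (q y)) *. Dq y)" unfolding B_def by (rule C1_compose[OF Cq d2]) (intro continuous_intros)
 have CA: "C1 (%y. \<sigma> (y \<bullet> e) - \<sigma> (y \<bullet> e - h)) (%y. (\<tau> (y \<bullet> e) - \<tau> (y \<bullet> e - h)) *. e)"
 proof (rule C1_compose[OF C1_inner_const, where p = "%s. \<sigma> s - \<sigma> (s - h)" and p' = "%s. \<tau> s - \<tau> (s - h)"])
 have "DERIV (%s. \<sigma> (s - h)) s :> \<tau> (s - h)" for s using DERIV_shift[of \<sigma> "\<tau> (s - h)" s "- h"] st(1)[of "s - h"] by simp
 then show "DERIV (%s. \<sigma> s - \<sigma> (s - h)) s :> \<tau> s - \<tau> (s - h)" for s by (intro DERIV_diff st(1))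
 show "continuous_on UNIV (%s. \<tau> s - \<tau> (s - h))"
 by (intro continuous_on_diff st(2) continuous_on_compose2[OF st(2)] continuous_intros) auto
 qed
 have C\<Psi>: "C1 (%x. \<Psi>0 (x - P)) (%x. D0 (x - P))" unfolding \<Psi>0_def D0_def by (intro C1_shift C1_mult CA CB)
 have D0e: "D0 y \<bullet> e = B y * (\<tau> (y \<bullet> e) - \<tau> (y \<bullet> e - h))" for y
 proof -
 have "Dq y \<bullet> e = 0" using ee by (simp add: Dq_def inner_add_left inner_diff_left algebra_simps)
 then show ?thesis using ee by (simp add: D0_def inner_add_left)
 qed
 have q1: "q y <= 1" for y
 proof -
 have "(y \<bullet> e) * (y \<bullet> e) <= y \<bullet> y" using Cauchy_Schwarz_ineq[of y e] ee by (simp add: power2_eq_square)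
 then have "(1 / r^2) * ((y \<bullet> e) * (y \<bullet> e)) <= (1 / r^2) * (y \<bullet> y)" by (intro mult_left_mono) auto
 then show ?thesis by (simp add: q_def)
 qed
 have q0: "y \<bullet> y - (y \<bullet> e)^2 <= r^2" if "B y ~= 0" for y
 proof -
 have "0 < q y" using that by (auto simp: B_def max_def split: if_splits)
 then have "0 < r^2 * q y" using r by simp
 also have "r^2 * q y = r^2 - (y \<bullet> y) + (y \<bullet> e)^2" using r by (simp add: q_def field_simps power2_eq_square)
 finally show ?thesis by simp
 qed
 have B01: "0 <= B y" "B y <= 1" for y
 using q1[of y] by (auto simp: B_def intro: power_le_one)
 have bigB: "9 / 16 <= B y" if "norm y <= r / 2" for y
 proof -
 have "y \<bullet> y <= (r / 2)^2" using that power_mono[of "norm y" "r / 2" 2] by (simp add: dot_square_norm)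
 then have "y \<bullet> y / r^2 <= 1 / 4" using r by (simp add: divide_le_eq power2_eq_square)
 moreover have "0 <= (1 / r^2) * ((y \<bullet> e) * (y \<bullet> e))" by simp
 moreover have "(- 1 / r^2) * (y \<bullet> y) = - (y \<bullet> y / r^2)" by simp
 ultimately have "3 / 4 <= q y" unfolding q_def by linarith
 then have "(3 / 4)^2 <= (max 0 (q y))^2" by (intro power_mono) auto
 then show ?thesis by (simp add: B_def power2_eq_square)
 qed
 have Bsh: "B (y - h *. e) = B y" for y
 proof -
 have "(y - h *. e) \<bullet> (y - h *. e) - ((y - h *. e) \<bullet> e) * ((y - h *. e) \<bullet> e) = y \<bullet> y - (y \<bullet> e) * (y \<bullet> e)"
 using ee by (simp add: inner_diff_left inner_diff_right inner_commute algebra_simps)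
 moreover have "q z = 1 - (1 / r^2) * (z \<bullet> z - (z \<bullet> e) * (z \<bullet> e))" for z by (simp add: q_def algebra_simps)
 ultimately show ?thesis by (simp add: B_def)
 qed
 define \<phi>1 where "\<phi>1 x = \<tau> ((x - P) \<bullet> e) * B (x - P)" for x
 define \<phi>2 where "\<phi>2 x = \<tau> ((x - P) \<bullet> e - h) * B (x - P)" for x
 have \<phi>0: "0 <= \<phi>1 x" "0 <= \<phi>2 x" for x using st(7) B01 by (auto simp: \<phi>1_def \<phi>2_def)
 have \<phi>sh: "\<phi>2 x = \<phi>1 (x + - (h *. e))" for x
 using Bsh[of "x - P"] ee by (simp add: \<phi>1_def \<phi>2_def inner_diff_left diff_diff_eq2 algebra_simps)
 have \<phi>T: "x \<in> T" "dist x P <= 2 * r" if "\<phi>1 x ~= 0" for x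
 proof -
 have a: "\<bar>(x - P) \<bullet> e\<bar> < r" using that st(8) by (force simp: \<phi>1_def)
 have b: "(x - P) \<bullet> (x - P) - ((x - P) \<bullet> e)^2 <= r^2" using that by (intro q0) (auto simp: \<phi>1_def)
 show "x \<in> T" using a b h unfolding T by auto
 have "((x - P) \<bullet> e)^2 <= r^2" using a r by (intro power2_le_iff_abs_le[THEN iffD2]) auto
 moreover have "(2 * r)^2 = 4 * r^2" by (simp add: power_mult_distrib)
 ultimately have "(norm (x - P))^2 <= (2 * r)^2" using b zero_le_power2[of r] unfolding dot_square_norm by linarith
 then show "dist x P <= 2 * r" unfolding dist_norm by (rule power2_le_imp_le) (use r in simp)
 qed
 have \<phi>T2: "x \<in> T" "dist x (P + h *. e) <= 2 * r" if "\<phi>2 x ~= 0" for x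
 proof -
 have a: "\<bar>(x - P) \<bullet> e - h\<bar> < r" using that st(8) by (force simp: \<phi>2_def)
 have b: "(x - P) \<bullet> (x - P) - ((x - P) \<bullet> e)^2 <= r^2" using that by (intro q0) (auto simp: \<phi>2_def)
 show "x \<in> T" using a b h unfolding T by auto
 show "dist x (P + h *. e) <= 2 * r" using \<phi>T(2)[of "x + - (h *. e)"] that by (simp add: \<phi>sh dist_norm algebra_simps)
 qed
 have \<Psi>T: "x \<in> T" if "\<Psi>0 (x - P) ~= 0" for x
 proof -
 have "\<not> (x - P) \<bullet> e <= - r" "\<not> h + r <= (x - P) \<bullet> e"
 using that st(5)[of "(x - P) \<bullet> e"] st(5)[of "(x - P) \<bullet> e - h"] st(6)[of "(x - P) \<bullet> e"] st(6)[of "(x - P) \<bullet> e - h"] h by (auto simp: \<Psi>0_def)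
 moreover have "(x - P) \<bullet> (x - P) - ((x - P) \<bullet> e)^2 <= r^2" using that by (intro q0) (auto simp: \<Psi>0_def)
 ultimately show ?thesis unfolding T by auto
 qed
 have \<Psi>1: "\<bar>\<Psi>0 y\<bar> <= 1" for y
 proof -
 have "\<bar>\<sigma> (y \<bullet> e) - \<sigma> (y \<bullet> e - h)\<bar> <= 1" using st(3,4)[of "y \<bullet> e"] st(3,4)[of "y \<bullet> e - h"] by linarith
 then have "\<bar>\<sigma> (y \<bullet> e) - \<sigma> (y \<bullet> e - h)\<bar> * \<bar>B y\<bar> <= 1 * 1" using B01[of y] by (intro mult_mono) auto
 then show ?thesis by (simp add: \<Psi>0_def abs_mult)
 qed
 have Tball: "T \<subseteq> ball P (h + 3 * r)"
 proof
 fix x assume "x \<in> T"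
 then have "dist x P <= h + 2 * r" unfolding T by (intro slab_subset[OF r h]) auto
 then show "x \<in> ball P (h + 3 * r)" using r by (simp add: dist_commute)
 qed
 have Tc: "closed T" unfolding T
 by (intro closed_Collect_conj closed_Collect_le continuous_intros)
 then have Tk: "compact T" using Tball by (meson bounded_ball bounded_subset compact_eq_bounded_closed)
 have Tb[measurable]: "T \<in> sets borel" and TL: "T \<in> sets lebesgue" using Tk by (auto simp: borel_compact sets_completionI_sets)
 have Omb: "Om \<in> sets borel" and OmL: "Om \<in> sets lebesgue" using Om by (auto simp: sets_completionI_sets)
 let ?M = "lebesgue_on Om"
 have test: "test_function Om (%x. \<Psi>0 (x - P)) (%x. D0 (x - P))"
 proof -
 have "closure {x. \<Psi>0 (x - P) ~= 0} \<subseteq> T" by (rule closure_minimal[OF _ Tc]) (use \<Psi>T in blast)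
 moreover then have "compact (closure {x. \<Psi>0 (x - P) ~= 0})" using Tk by (meson bounded_subset closed_closure compact_eq_bounded_closed)
 ultimately show ?thesis using C\<Psi> T(2) by (auto simp: test_function_def C1_def)
 qed
 have cB: "continuous_on UNIV B" by (rule C1_cont[OF CB])
 have onM: "integrable ?M \<phi>" "(LINT x|?M. \<phi> x) = (LINT x|lborel. \<phi> x)" "integrable lborel \<phi>" if c: "continuous_on UNIV \<phi>" and z: "!!x. x ~: T ==> \<phi> x = 0" for \<phi> :: "'a => real"
 proof -
 have m: "\<phi> \<in> bm" using c by (rule borel_measurable_continuous_onI)
 show i: "integrable lborel \<phi>" by (rule integrable_compact_support[OF c Tk z])
 then have "integrable lebesgue (%x. indicator Om x *. \<phi> x)" using m OmL by (intro integrable_mult_indicator) (auto simp: integrable_completion)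
 then show "integrable ?M \<phi>" using OmL by (subst integrable_restrict_space) auto
 have "indicator Om x *. \<phi> x = \<phi> x" for x using z[of x] T(2) by (auto split: split_indicator)
 then show "(LINT x|?M. \<phi> x) = (LINT x|lborel. \<phi> x)"
 using m by (intro set_lebesgue_on_lborel[OF Omb]) (auto simp: measurable_completion measurable_restrict_space1)
 qed
 have \<phi>c: "continuous_on UNIV \<phi>1" "continuous_on UNIV \<phi>2" unfolding \<phi>1_def \<phi>2_def
 by (intro continuous_on_mult continuous_on_compose2[OF st(2)] continuous_on_compose2[OF cB] continuous_intros; simp)+
 have \<phi>z: "x ~: T ==> \<phi>1 x = 0" "x ~: T ==> \<phi>2 x = 0" for x using \<phi>T(1) \<phi>T2(1) by blast+
 note o1 = onM[OF \<phi>c(1) \<phi>z(1)] and o2 = onM[OF \<phi>c(2) \<phi>z(2)]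
 define I where "I = (LINT x|lborel. \<phi>1 x)"
 have I2: "(LINT x|lborel. \<phi>2 x) = I"
 unfolding \<phi>sh I_def by (rule integral_shift) (rule borel_measurable_continuous_onI[OF \<phi>c(1)])
 let ?n = "DIM('a)" and ?v = "measure lborel (ball (0::'a) 1)"
 have v: "0 < ?v" by (rule content_unit_ball_pos)
 have I: "9 / (32 * r) * (?v * (r / 2) ^ ?n) <= I"
 proof -
 have "(LINT x|lborel. 9 / (32 * r) * indicator (ball P (r / 2)) x) <= I"
 unfolding I_def
 proof (rule integral_mono[OF _ o1(3)])
 show "integrable lborel (%x. 9 / (32 * r) * indicator (ball P (r / 2)) x)"
 using emeasure_lborel_ball_finite[of P "r / 2"] by (intro integrable_mult_right) simp
 fix x
 show "9 / (32 * r) * indicator (ball P (r / 2)) x <= \<phi>1 x"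
 proof (cases "x \<in> ball P (r / 2)")
 case True
 then have n: "norm (x - P) <= r / 2" by (simp add: dist_norm norm_minus_commute)
 then have "\<bar>(x - P) \<bullet> e\<bar> <= r / 2" using Cauchy_Schwarz_ineq2[of "x - P" e] e by simp
 then have "1 / (2 * r) * (9 / 16) <= \<phi>1 x" unfolding \<phi>1_def using bigB[OF n] r st(7) by (intro mult_mono st(9)) auto
 then show ?thesis using True by simp
 qed (simp add: \<phi>0)
 qed
 moreover have "measure lborel (ball P (r / 2)) = ?v * (r / 2) ^ ?n"
 using emeasure_ball_scale[of "r / 2" P] r by (simp add: measure_def mult.commute)
 ultimately show ?thesis by simp
 qed
 have i: "integrable ?M (%X. u X *. D0 (X - P))" "integrable ?M (%X. \<Psi>0 (X - P) *. V X)"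
 using weak_gradient_integrable[OF hw test Om] by auto
 \<comment> \<open>The two bumps have the same integral \<open>I\<close>, so the gap between 3/4 and
   1/4 leaves \<open>I / 2\<close>. The weak identity converts this into an integral of the gradient
   over the slab.\<close>
 have "I / 2 = (LINT x|?M. 3 / 4 * \<phi>1 x - 1 / 4 * \<phi>2 x)" using o1 o2 I2 by (simp add: I_def)
 also have "... <= (LINT x|?M. (u x *. D0 (x - P)) \<bullet> e)"
 proof (rule integral_mono)
 show "integrable ?M (%x. 3 / 4 * \<phi>1 x - 1 / 4 * \<phi>2 x)" using o1(1) o2(1) by simp
 show "integrable ?M (%x. (u x *. D0 (x - P)) \<bullet> e)" using i(1) by (rule integrable_inner_left)
 fix x assume "x \<in> space ?M"
 then have x: "x \<in> Om" by simp
 have "3 / 4 * \<phi>1 x <= u x * \<phi>1 x"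
 using hi[OF x] \<phi>T(2)[of x] \<phi>0(1)[of x] by (cases "\<phi>1 x = 0") (auto intro: mult_right_mono)
 moreover have "u x * \<phi>2 x <= 1 / 4 * \<phi>2 x"
 using lo[OF x] \<phi>T2(2)[of x] \<phi>0(2)[of x] by (cases "\<phi>2 x = 0") (auto intro: mult_right_mono)
 moreover have "(u x *. D0 (x - P)) \<bullet> e = u x * \<phi>1 x - u x * \<phi>2 x"
 by (simp add: D0e \<phi>1_def \<phi>2_def algebra_simps)
 ultimately show "3 / 4 * \<phi>1 x - 1 / 4 * \<phi>2 x <= (u x *. D0 (x - P)) \<bullet> e" by linarith
 qed
 also have "... = (LINT x|?M. u x *. D0 (x - P)) \<bullet> e" using i(1) by (rule integral_inner_left)
 also have "(LINT x|?M. u x *. D0 (x - P)) = - (LINT x|?M. \<Psi>0 (x - P) *. V x)"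
 using hw test by (simp add: has_weak_gradient_def)
 also have "- (LINT x|?M. \<Psi>0 (x - P) *. V x) \<bullet> e <= norm (LINT x|?M. \<Psi>0 (x - P) *. V x)"
 using Cauchy_Schwarz_ineq2[of "LINT x|?M. \<Psi>0 (x - P) *. V x" e] e by (simp add: abs_le_iff)
 also have "... <= (LINT x|?M. norm (\<Psi>0 (x - P) *. V x))" by (rule integral_norm_bound)
 finally have up: "I / 2 <= (LINT x|?M. norm (\<Psi>0 (x - P) *. V x))" .
 have Vm: "(%x. indicator Om x *. V x) \<in> borel_measurable lebesgue"
 using hw OmL by (subst borel_measurable_restrict_space_iff[symmetric]) (auto simp: has_weak_gradient_def)
 have Vn: "(%x. ie T x (norm (V x))) \<in> borel_measurable lebesgue"
 proof -
 have "(%x. ie T x (norm (indicator Om x *. V x))) \<in> borel_measurable lebesgue" using Vm TL by measurable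
 also have "(%x. ie T x (norm (indicator Om x *. V x))) = (%x. ie T x (norm (V x)))"
 using T(2) by (auto simp: fun_eq_iff split: split_indicator)
 finally show ?thesis .
 qed
 have "ennreal (I / 2) <= ennreal (LINT x|?M. norm (\<Psi>0 (x - P) *. V x))" using up by (rule ennreal_leI)
 also have "... = (\<integral>\<^sup>+x. ennreal (norm (\<Psi>0 (x - P) *. V x)) \<partial>?M)"
 by (rule nn_integral_eq_integral[OF integrable_norm[OF i(2)], symmetric]) simp
 also have "... = (\<integral>\<^sup>+x. ennreal (norm (\<Psi>0 (x - P) *. V x)) * indicator Om x \<partial>lebesgue)"
 using OmL by (intro nn_integral_restrict_space) simp
 also have "... <= (\<integral>\<^sup>+x. indicator T x * (ie T x (norm (V x))) \<partial>lebesgue)"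
 proof (rule nn_integral_mono)
 fix x
 show "ennreal (norm (\<Psi>0 (x - P) *. V x)) * indicator Om x <= indicator T x * (ie T x (norm (V x)))"
 proof (cases "x \<in> T")
 case True
 have "norm (\<Psi>0 (x - P) *. V x) <= norm (V x)" using mult_right_mono[OF \<Psi>1[of "x - P"] norm_ge_zero[of "V x"]] by simp
 then show ?thesis using True T(2) by (auto intro: ennreal_leI)
 next
 case False
 then have "\<Psi>0 (x - P) = 0" using \<Psi>T by blast
 then show ?thesis by simp
 qed
 qed
 finally have "ennreal (I / 2) <= (\<integral>\<^sup>+x. indicator T x * (ie T x (norm (V x))) \<partial>lebesgue)" .
 then have "(ennreal (I / 2))^2 <= (\<integral>\<^sup>+x. indicator T x * (ie T x (norm (V x))) \<partial>lebesgue)^2" by (rule power_mono) simp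
 also have "... <= (\<integral>\<^sup>+x. (indicator T x)^2 \<partial>lebesgue) * (\<integral>\<^sup>+x. (ie T x (norm (V x)))^2 \<partial>lebesgue)"
 by (rule Cauchy_Schwarz_nn_integral[OF borel_measurable_indicator[OF TL] Vn])
 also have "(\<integral>\<^sup>+x. (indicator T x)^2 \<partial>lebesgue) = emeasure lborel T"
 proof -
 have "(\<integral>\<^sup>+x. (indicator T x)^2 \<partial>lebesgue) = (\<integral>\<^sup>+x. indicator T x \<partial>lebesgue)" by (intro nn_integral_cong) (auto split: split_indicator)
 then show ?thesis using TL by (simp add: emeasure_completion)
 qed
 also have "(\<integral>\<^sup>+x. (ie T x (norm (V x)))^2 \<partial>lebesgue) = (\<integral>\<^sup>+x. ie T x ((norm (V x))^2) \<partial>lebesgue)"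
 by (intro nn_integral_cong) (auto split: split_indicator simp: ennreal_power)
 finally have main: "(ennreal (I / 2))^2 <= emeasure lborel T * (\<integral>\<^sup>+x. ie T x ((norm (V x))^2) \<partial>lebesgue)" (is "_ <= _ * ?J") .
 have Tm: "emeasure lborel T <= ennreal ((h + 3 * r) ^ ?n * ?v)"
 using emeasure_mono[OF Tball, of lborel] emeasure_ball_scale[of "h + 3 * r" P] h r by simp
 have hr: "0 < (h + 3 * r) ^ ?n * ?v" using h r v by simp
 have I0: "0 <= I" using \<phi>0 by (simp add: I_def Bochner_Integration.integral_nonneg)
 show ?thesis
 proof (cases "?J = \<infinity>")
 case False
 then obtain J where J: "?J = ennreal J" "0 <= J" by (cases ?J) auto
 have "ennreal ((I / 2)^2) <= ennreal ((h + 3 * r) ^ ?n * ?v) * ennreal J"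
 using main mult_right_mono[OF Tm, of ?J] I0 unfolding J(1) by (simp add: ennreal_power)
 then have "(I / 2)^2 <= (h + 3 * r) ^ ?n * ?v * J"
 using hr J(2) by (subst (asm) ennreal_mult[symmetric]) (auto simp: ennreal_le_iff)
 moreover have "(9 / (64 * r) * (?v * (r / 2) ^ ?n))^2 <= (I / 2)^2" using I r v by (intro power_mono) auto
 moreover have "(9 / (64 * r) * (?v * (r / 2) ^ ?n))^2 = (9 / (64 * r))^2 * ?v * ((r / 2) ^ ?n)^2 * ?v"
 unfolding power2_eq_square by (simp only: mult_ac)
 moreover have "(h + 3 * r) ^ ?n * ?v * J = J * (h + 3 * r) ^ ?n * ?v" by (simp only: mult_ac)
 ultimately have "(9 / (64 * r))^2 * ?v * ((r / 2) ^ ?n)^2 * ?v <= J * (h + 3 * r) ^ ?n * ?v" by linarith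
 then have "(9 / (64 * r))^2 * ?v * ((r / 2) ^ ?n)^2 <= J * (h + 3 * r) ^ ?n" by (rule mult_right_le_imp_le[OF _ v])
 then have "(9 / (64 * r))^2 * ?v * ((r / 2) ^ ?n)^2 / (h + 3 * r) ^ ?n <= J" using h r by (simp add: pos_divide_le_eq)
 then show ?thesis unfolding J(1) by (rule ennreal_leI)
 qed simp
qed

subsection \<open>Dyadic cells and stopping generations\<close>

text \<open>Integer coordinates of the cell of side \<open>l / 2^k\<close> containing
  \<open>y\<close>, for the grid with corner \<open>a\<close>. Half-open cells make each level a
  partition of the whole space, so lying in the same cell is an equation between index
  functions.\<close>

definition dyad :: "real^'m::finite => real => nat => real^'m => 'm => int" where
 "dyad a l k y i = \<lfloor>(y $ i - a $ i) / (l / 2 ^ k)\<rfloor>"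

definition dcell :: "real^'m::finite => real => nat => ('m => int) => (real^'m) set" where
 "dcell a l k n = {y. dyad a l k y = n}"

definition dcen :: "real^'m::finite => real => nat => ('m => int) => real^'m" where
 "dcen a l k n = (\<chi> i. a $ i + (real_of_int (n i) + 1 / 2) * (l / 2 ^ k))"

lemma floor_divide_eq_iff: "0 < s ==> \<lfloor>(y - a) / s\<rfloor> = n \<longleftrightarrow> a + of_int n * s <= y & y < a + (of_int n + 1) * s" for s :: real
 unfolding floor_eq_iff by (auto simp: field_simps)

lemma dyad_iff:
 assumes "0 < l"
 shows "dyad a l k y i = n \<longleftrightarrow> a $ i + of_int n * (l / 2 ^ k) <= y $ i & y $ i < a $ i + (of_int n + 1) * (l / 2 ^ k)"
 unfolding dyad_def by (rule floor_divide_eq_iff) (use assms in simp)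

lemma dcell_borel [measurable]: "dcell a l k n \<in> sets borel"
proof -
 have "dcell a l k n = (\<Inter>i. {y. dyad a l k y i = n i})" by (auto simp: dcell_def fun_eq_iff)
 moreover have "{y. dyad a l k y i = n i} \<in> sets borel" for i
 proof -
 have [measurable]: "(%y::real^'a. y $ i) \<in> bm" by (intro borel_measurable_continuous_onI continuous_intros)
 show ?thesis unfolding dyad_def by measurable
 qed
 ultimately show ?thesis by (auto intro!: sets.finite_INT)
qed

lemma dyad_parent:
 assumes l: "0 < l"
 shows "dyad a l k y i = dyad a l (Suc k) y i div 2"
proof -
 let ?m = "dyad a l (Suc k) y i" and ?s = "l / 2 ^ Suc k"
 have s: "l / 2 ^ k = 2 * ?s" "0 < ?s" using l by simp_all
 have 1: "a $ i + of_int ?m * ?s <= y $ i" "y $ i < a $ i + (of_int ?m + 1) * ?s" using dyad_iff[OF l, of a "Suc k" y i ?m] by auto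
 have 2: "?m = 2 * (?m div 2) + ?m mod 2" "0 <= ?m mod 2" "?m mod 2 <= 1" by simp_all
 have 3: "of_int ?m = (2 * of_int (?m div 2) + of_int (?m mod 2) :: real)" using 2(1) by (metis of_int_add of_int_mult of_int_numeral)
 have 4: "0 <= (of_int (?m mod 2) :: real)" "(of_int (?m mod 2) :: real) <= 1" using 2 by simp_all
 have 5: "0 <= of_int (?m mod 2) * ?s" "of_int (?m mod 2) * ?s <= 1 * ?s" using 4 s(2) by (intro mult_nonneg_nonneg mult_right_mono; simp)+
 show ?thesis
 unfolding dyad_iff[OF l] s(1) using 1 5 unfolding 3 by (simp add: algebra_simps)
qed

lemma dyad_mono:
 assumes l: "0 < l" and "k <= k'" "dyad a l k' x = dyad a l k' y"
 shows "dyad a l k x = dyad a l k y"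
 using assms(2,3)
proof (induction k' rule: dec_induct)
 case (step j)
 have "dyad a l j x = dyad a l j y" using step.prems by (auto simp: fun_eq_iff dyad_parent[OF l, of a j])
 then show ?case by (rule step.IH)
qed

lemma dcell_subset:
 assumes "0 < l" "k <= k'"
 shows "dcell a l k' (dyad a l k' x) \<subseteq> dcell a l k (dyad a l k x)"
 using dyad_mono[OF assms] by (auto simp: dcell_def)

lemma dcell_component:
 assumes "0 < l" "y \<in> dcell a l k n"
 shows "\<bar>y $ i - dcen a l k n $ i\<bar> <= l / 2 ^ k / 2"
proof -
 have "\<bar>z - (b + (m + 1 / 2) * s)\<bar> <= s / 2" if "b + m * s <= z" "z < b + (m + 1) * s" for z b m s :: real
 proof -
 have "(m + 1 / 2) * s = m * s + s / 2" "(m + 1) * s = m * s + s" by (simp_all add: algebra_simps)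
 then show ?thesis using that by linarith
 qed
 moreover have "dyad a l k y i = n i" using assms(2) by (auto simp: dcell_def)
 ultimately show ?thesis unfolding dcen_def vec_lambda_beta by (simp only: dyad_iff[OF assms(1)])
qed

lemma dcell_dist:
 fixes a :: "real^'m::finite"
 assumes "0 < l" "y \<in> dcell a l k n"
 shows "dist y (dcen a l k n) <= real CARD('m) * (l / 2 ^ k) / 2"
proof -
 have "dist y (dcen a l k n) <= (\<Sum>i\<in>UNIV. \<bar>(y - dcen a l k n) $ i\<bar>)" unfolding dist_norm by (rule norm_le_l1_cart)
 also have "... <= (\<Sum>i\<in>(UNIV :: 'm set). l / 2 ^ k / 2)" using dcell_component[OF assms] by (intro sum_mono) simp
 finally show ?thesis by simp
qed

lemma dcell_dyad: "x \<in> dcell a l k (dyad a l k x)"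
 by (simp add: dcell_def)

lemma half_interval_bounds:
 fixes z b m s t :: real
 shows "\<bar>z - (b + (m + 1 / 2) * s)\<bar> < s / 2 ==> b + m * s < z & z < b + (m + 1) * s"
 and "\<bar>z - (b + (m + 1 / 2) * s + t)\<bar> < s / 4 ==> t = - (s / 4) ==> b + 2 * m * (s / 2) <= z & z < b + (2 * m + 1) * (s / 2)"
 and "\<bar>z - (b + (m + 1 / 2) * s + t)\<bar> < s / 4 ==> t = s / 4 ==> b + (2 * m + 1) * (s / 2) <= z & z < b + ((2 * m + 1) + 1) * (s / 2)"
proof -
 have eq: "(m + 1 / 2) * s = m * s + s / 2" "(m + 1) * s = m * s + s" "(2 * m + 1) * (s / 2) = m * s + s / 2"
 "2 * m * (s / 2) = m * s" "((2 * m + 1) + 1) * (s / 2) = m * s + s" by (simp_all add: algebra_simps)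
 show "\<bar>z - (b + (m + 1 / 2) * s)\<bar> < s / 2 ==> b + m * s < z & z < b + (m + 1) * s"
 "\<bar>z - (b + (m + 1 / 2) * s + t)\<bar> < s / 4 ==> t = - (s / 4) ==> b + 2 * m * (s / 2) <= z & z < b + (2 * m + 1) * (s / 2)"
 "\<bar>z - (b + (m + 1 / 2) * s + t)\<bar> < s / 4 ==> t = s / 4 ==> b + (2 * m + 1) * (s / 2) <= z & z < b + ((2 * m + 1) + 1) * (s / 2)"
 unfolding eq by (auto simp: abs_less_iff field_simps)
qed

text \<open>The two halves of a cell in direction \<open>j\<close> are told apart by the parity of
  the next dyadic index. Each contains the ball of radius a quarter of the side about the centre
  shifted by a quarter of the side.\<close>

lemma half_cell_balls:
 fixes a :: "real^'m::finite"
 assumes l: "0 < l" and y: "dist y (dcen a l k n + \<theta> *. axis j 1) < l / 2 ^ k / 4" and \<theta>: "\<bar>\<theta>\<bar> = l / 2 ^ k / 4"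
 shows "y \<in> dcell a l k n" "!!i. a $ i + of_int (n i) * (l / 2 ^ k) < y $ i" "even (dyad a l (Suc k) y j) \<longleftrightarrow> \<theta> < 0"
proof -
 obtain s where s: "l / 2 ^ k = s" "0 < s" using l by simp
 note y = y[unfolded s(1)] and \<theta> = \<theta>[unfolded s(1)]
 have c: "\<bar>y $ i - (dcen a l k n $ i + \<theta> * axis j 1 $ i)\<bar> < s / 4" for i
 proof -
 have "\<bar>(y - (dcen a l k n + \<theta> *. axis j 1)) $ i\<bar> <= dist y (dcen a l k n + \<theta> *. axis j 1)" unfolding dist_norm by (rule component_le_norm_cart)
 then show ?thesis using y by simp
 qed
 have d: "\<bar>y $ i - (a $ i + (of_int (n i) + 1 / 2) * s)\<bar> < s / 2" for i
 using c[of i] \<theta> s(2) by (cases "i = j") (auto simp: dcen_def axis_def s(1))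
 have e: "a $ i + of_int (n i) * s < y $ i" "y $ i < a $ i + (of_int (n i) + 1) * s" for i using half_interval_bounds(1)[OF d] by blast+
 then show "!!i. a $ i + of_int (n i) * (l / 2 ^ k) < y $ i" unfolding s(1) by blast
 show "y \<in> dcell a l k n" using e by (auto simp: dcell_def fun_eq_iff dyad_iff[OF l] less_imp_le s(1))
 have cj: "\<bar>y $ j - (a $ j + (of_int (n j) + 1 / 2) * s + \<theta>)\<bar> < s / 4" using c[of j] by (simp add: dcen_def axis_def s(1))
 have s2: "l / 2 ^ Suc k = s / 2" using s(1) by simp
 show "even (dyad a l (Suc k) y j) \<longleftrightarrow> \<theta> < 0"
 proof (cases "\<theta> < 0")
 case True
 then have "\<theta> = - (s / 4)" using \<theta> by linarith
 then have "dyad a l (Suc k) y j = 2 * n j" unfolding dyad_iff[OF l] s2 using half_interval_bounds(2)[OF cj] by simp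
 then show ?thesis using True by simp
 next
 case False
 then have "\<theta> = s / 4" using \<theta> by linarith
 then have "dyad a l (Suc k) y j = 2 * n j + 1" unfolding dyad_iff[OF l] s2 using half_interval_bounds(3)[OF cj] by simp
 then show ?thesis using False by simp
 qed
qed

lemma cube_iff: "x \<in> cube c l \<longleftrightarrow> (\<forall>i. \<bar>x $ i - c $ i\<bar> < l / 2)"
proof -
 have "infnorm (x - c) < l / 2 \<longleftrightarrow> (\<forall>b\<in>Basis. \<bar>(x - c) \<bullet> b\<bar> < l / 2)" unfolding infnorm_Max by (subst Max_less_iff) auto
 then show ?thesis by (auto simp: cube_def Basis_vec_def inner_axis)
qed

lemma cube_dyad:
 fixes c :: "real^'m::finite"
 assumes l: "0 < l" and a: "a = (\<chi> i. c $ i - l / 2)" and x: "x \<in> cube c l"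
 shows "dcen a l 0 (dyad a l 0 x) = c" "!!k i. 0 <= dyad a l k x i" "!!k i. of_int (dyad a l k x i) + 1 <= (2 ^ k :: real)"
proof -
 have b: "a $ i < x $ i" "x $ i < a $ i + l" for i
 proof -
 have "\<bar>x $ i - c $ i\<bar> < l / 2" using x unfolding cube_iff by blast
 moreover have "a $ i = c $ i - l / 2" by (simp add: a)
 ultimately show "a $ i < x $ i" "x $ i < a $ i + l" by linarith+
 qed
 have "dyad a l 0 x i = 0" for i using b[of i] by (simp add: dyad_iff[OF l])
 then show "dcen a l 0 (dyad a l 0 x) = c" by (simp add: dcen_def a vec_eq_iff)
 fix k i
 have "0 <= (x $ i - a $ i) / (l / 2 ^ k)" using b[of i] l by (intro divide_nonneg_pos) auto
 then show "0 <= dyad a l k x i" by (simp add: dyad_def)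
 have "2 ^ k * (l / 2 ^ k) = l" by simp
 then have "(x $ i - a $ i) / (l / 2 ^ k) < 2 ^ k" using b[of i] l by (subst pos_divide_less_eq) simp_all
 then have "dyad a l k x i < 2 ^ k" by (simp add: dyad_def floor_less_iff)
 then have "dyad a l k x i + 1 <= 2 ^ k" by simp
 then have "(of_int (dyad a l k x i + 1) :: real) <= of_int (2 ^ k)" by (simp only: of_int_le_iff)
 then show "of_int (dyad a l k x i) + 1 <= (2 ^ k :: real)" by simp
qed

section \<open>Heavy cells and the oscillation they force\<close>

lemma nn_harnack:
 assumes lam: "0 < lam" "0 < Lam"
 shows "\<exists>C\<ge>1. \<forall>om (X :: 'm::finite pnt) Y h f. emeas lam Lam om --> f \<in> bm --> 0 < h --> h <= snd X --> h <= snd Y -->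
 dist X Y <= B * h --> (\<integral>\<^sup>+y. f y \<partial>om X) <= ennreal C * (\<integral>\<^sup>+y. f y \<partial>om Y)"
proof -
 show ?thesis
 proof (rule exE[OF measure_harnack[OF lam, where 'm = 'm]], elim conjE, goal_cases)
 case (1 C)
 note C = 1(1) and mh0 = 1(2)
 note mh = mh0[THEN spec4, THEN spec, THEN spec, THEN mp4, THEN mp, THEN mp]
 obtain k :: nat where k: "36 * B < real k" using reals_Archimedean2 by blast
 show ?thesis
 proof (intro exI[of _ "C ^ k"] conjI allI impI, goal_cases)
 case 1
 show ?case using C by simp
 next
 case (2 om X Y h f)
 note e = 2(1) and f = 2(2) and h = 2(3-5) and d = 2(6)
 have XY: "X \<in> half_space" "Y \<in> half_space" using h by (auto simp: half_space_snd)
 have "B * h <= real k * h / 36" using k h by (simp add: mult_right_mono)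
 then have d': "dist X Y <= real k * h / 36" using d by linarith
 have "ennreal 1 * (\<integral>\<^sup>+y. f y \<partial>om X) <= ennreal (C ^ k) * (\<integral>\<^sup>+y. f y \<partial>om Y)"
 by (rule nn_integral_le_of_measure[OF emeas_D(1,2)[OF e XY(1)] emeas_D(1,2)[OF e XY(2)]]) (use C f mh[OF e _ h d'] in auto)
 then show "(\<integral>\<^sup>+y. f y \<partial>om X) <= ennreal (C ^ k) * (\<integral>\<^sup>+y. f y \<partial>om Y)" by simp
 qed
 qed
qed

text \<open>From the small height \<open>b s\<close> at least half of the mass falls into the ball,
  by the boundary estimate; Harnack carries this up to height \<open>s\<close> at the price of
  \<open>1 / C\<close>.\<close>

lemma cell_mass:
 assumes lam: "0 < lam" "0 < Lam"
 shows "\<exists>c>0. \<forall>om (x :: real^'m::finite) s. emeas lam Lam om --> 0 < s --> ennreal c <= emeasure (om (x, s)) (ball x (s / 2))"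
proof -
 obtain K where K: "0 < K" and bm: "\<forall>om (y :: real^'m) s. emeas lam Lam om --> 0 < s --> 1 - 1 / 2 <= measure (om (y, s)) (ball y (K * s))"
 using boundary_mass[OF lam, where 'm = 'm, of "1 / 2"] by auto
 define b where "b = 1 / (2 * (K + 1))"
 have b: "0 < b" "b <= 1" "K * b <= 1 / 2" using K by (simp_all add: b_def field_simps)
 show ?thesis
 proof (rule exE[OF nn_harnack[OF lam, where 'm = 'm, of "1 / b"]], elim conjE, goal_cases)
 case (1 C)
 note C = 1(1) and nh0 = 1(2)
 note nh = nh0[THEN spec4, THEN spec, THEN mp4, THEN mp, THEN mp]
 show ?thesis
 proof (intro exI[of _ "1 / (2 * C)"] conjI allI impI)
 show "0 < 1 / (2 * C)" using C by simp
 fix om :: "'m pnt => (real^'m) measure" and x :: "real^'m" and s :: real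
 assume e: "emeas lam Lam om" and s: "0 < s"
 have bs: "0 < b * s" using b s by simp
 have XH: "(x, b * s) \<in> half_space" "(x, s) \<in> half_space" using bs s by (auto simp: half_space_snd)
 interpret X: prob_space "om (x, b * s)" by (rule emeas_D[OF e XH(1)])
 interpret Y: prob_space "om (x, s)" by (rule emeas_D[OF e XH(2)])
 have ss: "ball x (s / 2) \<in> sets (om (x, b * s))" "ball x (s / 2) \<in> sets (om (x, s))" using emeas_D(2)[OF e] XH by auto
 have Kbs: "K * (b * s) <= s / 2" using mult_right_mono[OF b(3), of s] s by simp
 have "1 / 2 <= measure (om (x, b * s)) (ball x (K * (b * s)))" using bm e bs by fastforce
 also have "... <= measure (om (x, b * s)) (ball x (s / 2))" by (intro X.finite_measure_mono subset_ball Kbs ss)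
 finally have "ennreal (1 / 2) <= emeasure (om (x, b * s)) (ball x (s / 2))" unfolding X.emeasure_eq_measure by (rule ennreal_leI)
 also have "... <= ennreal C * emeasure (om (x, s)) (ball x (s / 2))"
 proof -
 have "(\<integral>\<^sup>+y. indicator (ball x (s / 2)) y \<partial>om (x, b * s)) <= ennreal C * (\<integral>\<^sup>+y. indicator (ball x (s / 2)) y \<partial>om (x, s))"
 proof (rule nh[OF e _ bs])
 have "b * s <= 1 * s" using b s by (intro mult_right_mono) auto
 then show "b * s <= snd (x, s)" by simp
 have "dist (x, b * s) (x, s) = \<bar>b * s - s\<bar>" by (simp add: dist_Pair_Pair dist_real_def)
 then show "dist (x, b * s) (x, s) <= (1 / b) * (b * s)" using \<open>b * s <= 1 * s\<close> bs b by simp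
 qed (auto intro: borel_measurable_indicator)
 then show ?thesis using ss by simp
 qed
 finally have "1 / 2 <= C * measure (om (x, s)) (ball x (s / 2))"
 using C by (subst (asm) Y.emeasure_eq_measure) (simp add: ennreal_mult[symmetric] ennreal_le_iff del: ennreal_half)
 then show "ennreal (1 / (2 * C)) <= emeasure (om (x, s)) (ball x (s / 2))"
 unfolding Y.emeasure_eq_measure using C by (intro ennreal_leI) (simp add: field_simps)
 qed
 qed
qed

text \<open>The maximal cells satisfying \<open>Hv\<close> are disjoint, and the change of pole compares each of them with \<open>om Z\<close>.\<close>

lemma heavy_measure:
 assumes lam: "0 < lam" "0 < Lam" and et: "0 < et"
 shows "\<exists>C\<ge>1. \<forall>om \<Phi> a l t k0 n0 (Z :: 'm::finite pnt) Hv. emeas lam Lam om --> \<Phi> \<in> bm --> 0 < l --> 0 <= t -->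
 (\<forall>k n. Hv k n --> ennreal t <= (\<integral>\<^sup>+y. indicator (dcell a l k n) y * \<Phi> y \<partial>om (dcen a l k n, l / 2 ^ k))) -->
 (\<forall>y\<in>dcell a l k0 n0. \<forall>k<k0. \<not> Hv k (dyad a l k y)) --> et * (l / 2 ^ k0) <= snd Z -->
 emeasure (om Z) {y\<in>dcell a l k0 n0. \<exists>k. Hv k (dyad a l k y)} * ennreal t <= ennreal C * (\<integral>\<^sup>+y. indicator (dcell a l k0 n0) y * \<Phi> y \<partial>om Z)"
proof -
 define N where "N = real CARD('m)"
 have N: "1 <= N" unfolding N_def by (simp add: Suc_leI)
 show ?thesis
 proof (rule exE[OF pole_change[OF lam et N, where 'm = 'm]], elim conjE, goal_cases)
 case (1 C)
 note C = 1(1) and pc0 = 1(2)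
 note pc = pc0[THEN spec4, THEN spec, THEN spec, THEN mp4, THEN mp, THEN mp]
 show ?thesis
 proof (intro exI[of _ C] conjI C allI impI, goal_cases)
 case (1 om \<Phi> a l t k0 n0 Z Hv)
 note e = 1(1) and \<Phi>[measurable] = 1(2) and l = 1(3) and t = 1(4) and hv = 1(5) and anc = 1(6) and Z = 1(7)
 define U where "U = {y\<in>dcell a l k0 n0. \<exists>k. Hv k (dyad a l k y)}"
 \<comment> \<open>The first heavy level at \<open>y\<close>. It is constant along the corresponding
   cell, so the stopping cells partition \<open>U\<close>.\<close>
 define m where "m y = (LEAST k. Hv k (dyad a l k y))" for y
 define cl where "cl y = dcell a l (m y) (dyad a l (m y) y)" for y
 have m: "Hv (m y) (dyad a l (m y) y)" "k0 <= m y" if "y \<in> U" for y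
 proof -
 show h: "Hv (m y) (dyad a l (m y) y)" unfolding m_def by (rule LeastI_ex) (use that in \<open>simp add: U_def\<close>)
 have "y \<in> dcell a l k0 n0" using that unfolding U_def by blast
 then have "\<forall>k<k0. \<not> Hv k (dyad a l k y)" by (rule anc[THEN bspec])
 then show "k0 <= m y" using h not_le by blast
 qed
 have cl: "w \<in> U" "m w = m y" "cl w = cl y" if y: "y \<in> U" and w: "w \<in> cl y" for y w
 proof -
 have eq: "dyad a l (m y) w = dyad a l (m y) y" using w by (simp add: cl_def dcell_def)
 have eqk: "dyad a l k w = dyad a l k y" if "k <= m y" for k by (rule dyad_mono[OF l that eq])
 have "Hv (m y) (dyad a l (m y) w)" using m(1)[OF y] eq by simp
 moreover have "w \<in> dcell a l k0 n0" using y eqk[OF m(2)[OF y]] by (simp add: U_def dcell_def)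
 ultimately show "w \<in> U" by (auto simp: U_def)
 show mw: "m w = m y" unfolding m_def[of w]
 proof (rule Least_equality)
 fix k assume k: "Hv k (dyad a l k w)"
 show "m y <= k"
 proof (rule ccontr)
 assume "\<not> m y <= k"
 then have "k < m y" by simp
 then have "\<not> Hv k (dyad a l k y)" unfolding m_def by (rule not_less_Least)
 then show False using k eqk[of k] \<open>k < m y\<close> by simp
 qed
 qed fact
 show "cl w = cl y" by (simp add: cl_def mw eq)
 qed
 define \<S> where "\<S> = cl ` U"
 have US: "U = \<Union>\<S>"
 proof
 show "U \<subseteq> \<Union>\<S>"
 proof
 fix y assume "y \<in> U"
 then have "cl y \<in> \<S>" by (simp add: \<S>_def)
 moreover have "y \<in> cl y" unfolding cl_def by (rule dcell_dyad)
 ultimately show "y \<in> \<Union>\<S>" by blast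
 qed
 show "\<Union>\<S> \<subseteq> U" unfolding \<S>_def using cl(1) by blast
 qed
 have cS: "countable \<S>"
 proof (rule countable_subset)
 show "\<S> \<subseteq> range (%(k, n). dcell a l k n)" by (auto simp: \<S>_def cl_def)
 show "countable (range (%(k :: nat, n). dcell a l k n))" by (rule countable_image) (rule countableI_type)
 qed
 have dis: "disjoint_family_on (%S. S) \<S>"
 unfolding disjoint_family_on_def
 proof (intro ballI impI equals0I)
 fix S S' w assume S: "S \<in> \<S>" "S' \<in> \<S>" "S ~= S'" "w \<in> S \<inter> S'"
 obtain y y' where y: "y \<in> U" "S = cl y" "y' \<in> U" "S' = cl y'" using S(1,2) unfolding \<S>_def by blast
 have "cl w = cl y" by (rule cl(3)[OF y(1)]) (use S(4) y(2) in blast)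
 moreover have "cl w = cl y'" by (rule cl(3)[OF y(3)]) (use S(4) y(4) in blast)
 ultimately show False using S(3) y by simp
 qed
 have "0 < et * (l / 2 ^ k0)" using l et by simp
 then have ZH: "Z \<in> half_space" using Z unfolding half_space_snd by linarith
 interpret Z: prob_space "om Z" by (rule emeas_D[OF e ZH])
 have sZ: "sets (om Z) = sets borel" by (rule emeas_D[OF e ZH])
 have \<Phi>Z: "\<Phi> \<in> borel_measurable (om Z)" unfolding measurable_cong_sets[OF sZ refl] by (rule \<Phi>)
 have Sb: "S \<in> sets (om Z)" if SS: "S \<in> \<S>" for S
 proof -
 obtain y where "S = cl y" using SS unfolding \<S>_def by blast
 then show ?thesis unfolding sZ cl_def by (simp add: dcell_borel)
 qed
 define \<nu> where "\<nu> = density (om Z) \<Phi>"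
 have \<nu>: "emeasure \<nu> S = (\<integral>\<^sup>+y. indicator S y * \<Phi> y \<partial>om Z)" if "S \<in> sets borel" for S
 proof -
 have "S \<in> sets (om Z)" using that by (simp only: sZ)
 then show ?thesis unfolding \<nu>_def by (simp add: emeasure_density[OF \<Phi>Z] mult.commute)
 qed
 \<comment> \<open>The change of pole integrated against \<Phi>: on one side stands the integral
   from the pole above the cell, at least \<open>t\<close> by heaviness, on the other the integral
   from \<open>Z\<close>. Disjointness then allows summing over all cells.\<close>
 have each: "emeasure (om Z) S * ennreal t <= ennreal C * emeasure \<nu> S" if SS: "S \<in> \<S>" for S
 proof -
 obtain y where y: "y \<in> U" "S = cl y" using SS unfolding \<S>_def by blast
 define k n x s where "k = m y" and "n = dyad a l k y" and "x = dcen a l k n" and "s = l / 2 ^ k"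
 have S: "S = dcell a l k n" by (simp add: y cl_def k_def n_def)
 have s: "0 < s" using l by (simp add: s_def)
 have XH: "(x, s) \<in> half_space" using s by (simp add: half_space_snd)
 have "l / 2 ^ k <= l / 2 ^ k0" using m(2)[OF y(1)] l by (intro divide_left_mono power_increasing) (auto simp: k_def)
 then have "et * s <= et * (l / 2 ^ k0)" unfolding s_def using et by (intro mult_left_mono) auto
 then have sz: "et * s <= snd Z" using Z by linarith
 have Sx: "S \<subseteq> ball x (N * s)"
 proof
 fix w assume "w \<in> S"
 then have "dist w x <= N * s / 2" unfolding S x_def N_def s_def by (rule dcell_dist[OF l])
 moreover have "0 < N * s" using N s by simp
 ultimately show "w \<in> ball x (N * s)" by (simp add: dist_commute)
 qed
 have "emeasure (om Z) S * ennreal t <= ennreal (measure (om Z) S) * (\<integral>\<^sup>+w. indicator S w * \<Phi> w \<partial>om (x, s))"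
 unfolding Z.emeasure_eq_measure using hv m(1)[OF y(1)] by (intro mult_left_mono) (auto simp: S x_def s_def k_def n_def)
 also have "... <= ennreal C * (\<integral>\<^sup>+w. indicator S w * \<Phi> w \<partial>om Z)"
 proof (rule nn_integral_le_of_measure[OF emeas_D(1,2)[OF e XH] emeas_D(1,2)[OF e ZH]])
 show "measure (om Z) S * measure (om (x, s)) F <= C * measure (om Z) F" if "F \<in> sets borel" for F
 by (rule pc[OF e s sz _ that Sx]) (simp add: S)
 show "(%w. indicator S w * \<Phi> w) \<in> bm" unfolding S by measurable
 qed (use C in auto)
 also have "... = ennreal C * emeasure \<nu> S" by (subst \<nu>) (simp_all add: S)
 finally show ?thesis .
 qed
 have "emeasure (om Z) U * ennreal t = (\<integral>\<^sup>+S. emeasure (om Z) S \<partial>count_space \<S>) * ennreal t"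
 using emeasure_UN_countable[OF Sb cS dis] by (simp add: US)
 also have "... = (\<integral>\<^sup>+S. emeasure (om Z) S * ennreal t \<partial>count_space \<S>)" by (rule nn_integral_multc[symmetric]) simp
 also have "... <= (\<integral>\<^sup>+S. ennreal C * emeasure \<nu> S \<partial>count_space \<S>)" by (rule nn_integral_mono) (use each in simp)
 also have "... = ennreal C * (\<integral>\<^sup>+S. emeasure \<nu> S \<partial>count_space \<S>)" by (rule nn_integral_cmult) simp
 also have "(\<integral>\<^sup>+S. emeasure \<nu> S \<partial>count_space \<S>) = emeasure \<nu> U"
 using emeasure_UN_countable[OF _ cS dis, of \<nu>] Sb by (simp add: US \<nu>_def)
 finally have A: "emeasure (om Z) U * ennreal t <= ennreal C * emeasure \<nu> U" .
 have "emeasure \<nu> U <= emeasure \<nu> (dcell a l k0 n0)" by (rule emeasure_mono) (auto simp: U_def \<nu>_def sZ)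
 also have "... = (\<integral>\<^sup>+y. indicator (dcell a l k0 n0) y * \<Phi> y \<partial>om Z)" by (rule \<nu>) simp
 finally show ?case
 using order_trans[OF A mult_left_mono] by (simp add: U_def)
 qed
 qed
qed

definition cellint :: "('m::finite pnt => (real^'m) measure) => (real^'m => ennreal) => real^'m => real => nat => ('m => int) => ennreal" where
 "cellint om \<Phi> a l k n = (\<integral>\<^sup>+y. indicator (dcell a l k n) y * \<Phi> y \<partial>om (dcen a l k n, l / 2 ^ k))"

lemma dyad_pred_borel: "{y. P (dyad a l k y)} \<in> sets borel"
proof -
 have "{y. P (dyad a l k y)} = (\<Union>n\<in>{n. P n}. dcell a l k n)" by (auto simp: dcell_def)
 moreover have "countable {n :: 'a => int. P n}" by (rule countableI_type)
 ultimately show ?thesis by (auto intro!: sets.countable_UN'')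
qed

text \<open>The parent of a maximal cell is not heavy, and Harnack between the two poles bounds the
  integral over the cell by \<open>CB M^i < M^(i+1)\<close>; so a cell never serves two generations.
  Fed into the heavy measure estimate, the same bound gives generation \<open>i + 1\<close> measure
  at most \<open>CA CB / M = 1/8\<close> from the low poles. With 7/8 of the mass falling on one
  half, this leaves 3/4 above the left half and 1/4 above the right.\<close>

lemma generation_oscillation:
 assumes lam: "0 < lam" "0 < Lam"
 shows "\<exists>et>0. et <= 1 / 16 & (\<exists>M>1. \<forall>om \<Phi> (c :: real^'m::finite) l a j. emeas lam Lam om --> \<Phi> \<in> bm --> 0 < l -->
 a = (\<chi> i. c $ i - l / 2) --> (\<integral>\<^sup>+y. \<Phi> y \<partial>om (c, l)) <= 1 --> (\<exists>H\<in>sets borel. H \<subseteq> cube c l & (\<forall>x\<in>cube c l. \<forall>i\<ge>1. \<forall>k.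
 ennreal (M ^ i) <= cellint om \<Phi> a l k (dyad a l k x) --> (\<forall>k'<k. \<not> ennreal (M ^ i) <= cellint om \<Phi> a l k' (dyad a l k' x)) -->
 \<not> ennreal (M ^ Suc i) <= cellint om \<Phi> a l k (dyad a l k x) &
 (\<forall>Z. dist Z (dcen a l k (dyad a l k x) + (- (l / 2 ^ k / 4)) *. axis j 1, et * (l / 2 ^ k)) <= et * (l / 2 ^ k) / 4 --> 3 / 4 <= hext om (indicator H) Z) &
 (\<forall>Z. dist Z (dcen a l k (dyad a l k x) + (l / 2 ^ k / 4) *. axis j 1, et * (l / 2 ^ k)) <= et * (l / 2 ^ k) / 4 --> hext om (indicator H) Z <= 1 / 4))))"
proof -
 define N where "N = real CARD('m)"
 have N: "1 <= N" unfolding N_def by (simp add: Suc_leI)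
 have e8: "0 < (1 / 8 :: real)" by simp
 show ?thesis
 proof (rule exE[OF boundary_mass[OF lam e8, where 'm = 'm]], elim conjE, goal_cases)
 case (1 K)
 note K = 1(1) and bm0 = 1(2)
 note bm = bm0[THEN spec, THEN spec, THEN spec, THEN mp, THEN mp]
 \<comment> \<open>A pole has 7/8 of its mass within \<open>K\<close> times its height. At height
   about \<open>et * s\<close>, the choice \<open>(K + 1) * et = 1/16\<close> keeps that ball inside
   the ball of radius \<open>s / 4\<close> in a half cell.\<close>
 define et where "et = 1 / (16 * (K + 1))"
 have et: "0 < et" "et <= 1 / 16" "(K + 1) * et = 1 / 16" using K by (simp_all add: et_def field_simps)
 have et2: "0 < et / 2" using et by simp
 show ?thesis
 proof (rule exE[OF heavy_measure[OF lam et2, where 'm = 'm]], elim conjE, goal_cases)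
 case (1 CA)
 note CA = 1(1) and hm0 = 1(2)
 note hm = hm0[THEN spec4, THEN spec4, THEN spec, THEN mp4, THEN mp, THEN mp, THEN mp]
 define B where "B = (4 + 2 * N) / (et / 2)"
 show ?thesis
 proof (rule exE[OF nn_harnack[OF lam, where 'm = 'm, of B]], elim conjE, goal_cases)
 case (1 CB)
 note CB = 1(1) and nh0 = 1(2)
 note nh = nh0[THEN spec4, THEN spec, THEN mp4, THEN mp, THEN mp]
 define M where "M = 8 * CA * CB"
 have "1 * 1 <= CA * CB" using CA CB by (intro mult_mono) auto
 then have M1: "1 < M" by (simp add: M_def)
 have "1 * CB <= CA * CB" using CA CB by (intro mult_right_mono) auto
 then have MB: "CB < M" using CB by (simp add: M_def)
 show ?thesis
 proof (rule exI[of _ et], intro exI[of _ M] conjI et(1,2) M1 allI impI, goal_cases)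
 case (1 om \<Phi> c l a j)
 note e = 1(1) and \<Phi>[measurable] = 1(2) and l = 1(3) and a = 1(4) and \<Phi>1 = 1(5)
 define hv where "hv i k n \<longleftrightarrow> ennreal (M ^ i) <= cellint om \<Phi> a l k n" for i k n
 have hv_mono: "hv i k n" if "hv i' k n" "i <= i'" for i i' k n
 proof -
 have "ennreal (M ^ i) <= ennreal (M ^ i')" using that(2) M1 by (intro ennreal_leI power_increasing) auto
 then show ?thesis using that(1) unfolding hv_def by (rule order_trans)
 qed
 have [measurable]: "Measurable.pred borel (%y. hv i k (dyad a l k y))" "Measurable.pred borel (%y. even (dyad a l k y j))" for i k
 using dyad_pred_borel[of "hv i k" a l k] dyad_pred_borel[of "%n. even (n j)" a l k] by (simp_all add: pred_def)
 define H where "H = {y\<in>cube c l. \<exists>i k. 1 <= i & hv i k (dyad a l k y) & (\<forall>k'. k' < k --> \<not> hv i k' (dyad a l k' y)) &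
 (\<forall>k'. \<not> hv (Suc i) k' (dyad a l k' y)) & even (dyad a l (Suc k) y j)}"
 have cb[measurable]: "cube c l \<in> sets borel"
 proof -
 have "cube c l = (\<Inter>i. {y. \<bar>y $ i - c $ i\<bar> < l / 2})" by (auto simp: cube_iff)
 also have "... \<in> sets borel" by (intro borel_open open_INT finite open_Collect_less continuous_intros ballI)
 finally show ?thesis .
 qed
 have Hb: "H \<in> sets borel" unfolding H_def by measurable
 show ?case
 proof (intro bexI[of _ H] Hb conjI ballI allI impI)
 show "H \<subseteq> cube c l" by (auto simp: H_def)
 fix x i k assume x: "x \<in> cube c l" and i: "1 <= i" and h1: "ennreal (M ^ i) <= cellint om \<Phi> a l k (dyad a l k x)"
 and h2: "\<forall>k'<k. \<not> ennreal (M ^ i) <= cellint om \<Phi> a l k' (dyad a l k' x)"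
 have hk: "hv i k (dyad a l k x)" using h1 by (simp add: hv_def)
 have hk': "\<not> hv i k' (dyad a l k' x)" if "k' < k" for k' using h2 that by (simp add: hv_def)
 define n where "n = dyad a l k x"
 define s where "s = l / 2 ^ k"
 define S where "S = dcell a l k n"
 define z where "z = dcen a l k n"
 have s: "0 < s" using l by (simp add: s_def)
 have xS: "x \<in> S" unfolding S_def n_def by (rule dcell_dyad)
 have S[measurable]: "S \<in> sets borel" by (simp add: S_def)
 \<comment> \<open>The top cell is weighed from \<open>(c, l)\<close>, where \<Phi> has integral at
   most 1, so it is never heavy for \<open>i \<ge> 1\<close> and the stopping cell has a
   parent.\<close>
 have k1: "k ~= 0"
 proof
 assume k: "k = 0"
 have "cellint om \<Phi> a l 0 (dyad a l 0 x) <= (\<integral>\<^sup>+y. \<Phi> y \<partial>om (c, l))"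
 unfolding cellint_def cube_dyad(1)[OF l a x] by (simp, intro nn_integral_mono) (auto split: split_indicator)
 also have "... <= 1" by (rule \<Phi>1)
 finally have "cellint om \<Phi> a l 0 (dyad a l 0 x) <= 1" .
 from order_trans[OF h1[unfolded k] this] have "M ^ i <= 1" by simp
 moreover have "1 < M ^ i" using M1 i by (intro one_less_power) auto
 ultimately show False by simp
 qed
 define n' where "n' = dyad a l (k - 1) x"
 define z' where "z' = dcen a l (k - 1) n'"
 have s': "l / 2 ^ (k - 1) = 2 * s" using k1 by (cases k) (simp_all add: s_def)
 have SS': "S \<subseteq> dcell a l (k - 1) n'" unfolding S_def n_def n'_def by (rule dcell_subset[OF l]) simp
 have par: "cellint om \<Phi> a l (k - 1) n' < ennreal (M ^ i)" using hk'[of "k - 1"] k1 by (simp add: hv_def n'_def)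
 have dxz: "dist x z <= N * s / 2" using dcell_dist[OF l xS[unfolded S_def]] by (simp add: z_def N_def s_def)
 have dxz': "dist x z' <= N * s"
 using dcell_dist[OF l dcell_dyad[of x a l "k - 1"]] unfolding z'_def n'_def N_def s' by simp
 \<comment> \<open>Lightness of the parent, carried by Harnack to every pole near the cell of height
   at least \<open>et * s / 2\<close>; \<open>B\<close> is the ratio of distance to height that this
   requires.\<close>
 have comp: "(\<integral>\<^sup>+y. indicator S y * \<Phi> y \<partial>om Z) <= ennreal (CB * M ^ i)" if Z: "dist Z (z, s) <= 3 * s" "et / 2 * s <= snd Z" for Z
 proof -
 have "(\<integral>\<^sup>+y. indicator S y * \<Phi> y \<partial>om Z) <= ennreal CB * (\<integral>\<^sup>+y. indicator S y * \<Phi> y \<partial>om (z', 2 * s))"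
 proof (rule nh[OF e _ _ Z(2)])
 show "0 < et / 2 * s" using et s by simp
 have "et / 2 * s <= 1 * s" using et s by (intro mult_right_mono) auto
 then show "et / 2 * s <= snd (z', 2 * s)" using s by simp
 have "dist (z, s) (z', 2 * s) <= dist z z' + dist s (2 * s)" unfolding dist_Pair_Pair by (rule sqrt_sum_squares_le_sum) auto
 also have "dist z z' <= N * s / 2 + N * s" using dist_triangle[of z z' x] dxz dxz' by (simp add: dist_commute)
 finally have "dist (z, s) (z', 2 * s) <= N * s / 2 + N * s + s" using s by (simp add: dist_real_def)
 then have "dist Z (z', 2 * s) <= 3 * s + (N * s / 2 + N * s + s)" using dist_triangle[of Z "(z', 2 * s)" "(z, s)"] Z(1) by linarith
 also have "... <= (4 + 2 * N) * s" using N s by (simp add: algebra_simps)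
 also have "... = B * (et / 2 * s)" using et by (simp add: B_def)
 finally show "dist Z (z', 2 * s) <= B * (et / 2 * s)" .
 qed measurable
 also have "... <= ennreal CB * ennreal (M ^ i)"
 proof (rule mult_left_mono)
 have "(\<integral>\<^sup>+y. indicator S y * \<Phi> y \<partial>om (z', 2 * s)) <= cellint om \<Phi> a l (k - 1) n'"
 unfolding cellint_def s' z'_def[symmetric] using SS' by (intro nn_integral_mono) (auto split: split_indicator)
 then show "(\<integral>\<^sup>+y. indicator S y * \<Phi> y \<partial>om (z', 2 * s)) <= ennreal (M ^ i)" using par by simp
 qed simp
 also have "... = ennreal (CB * M ^ i)" by (rule ennreal_mult[symmetric]) (use CB M1 in auto)
 finally show ?thesis .
 qed
 show "\<not> ennreal (M ^ Suc i) <= cellint om \<Phi> a l k (dyad a l k x)"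
 proof
 assume "ennreal (M ^ Suc i) <= cellint om \<Phi> a l k (dyad a l k x)"
 also have "... = (\<integral>\<^sup>+y. indicator S y * \<Phi> y \<partial>om (z, s))" by (simp add: cellint_def S_def z_def s_def n_def)
 also have "... <= ennreal (CB * M ^ i)"
 proof (rule comp)
 have "et / 2 * s <= 1 * s" using et s by (intro mult_right_mono) auto
 then show "et / 2 * s <= snd (z, s)" by simp
 qed (use s in simp)
 finally have "M ^ Suc i <= CB * M ^ i" using CB M1 by (subst (asm) ennreal_le_iff) auto
 moreover have "CB * M ^ i < M * M ^ i" using MB M1 by (intro mult_strict_right_mono) auto
 ultimately show False by simp
 qed
 define U where "U = {y\<in>S. \<exists>k'. hv (Suc i) k' (dyad a l k' y)}"
 have Ub: "U \<in> sets borel" unfolding U_def by measurable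
 have lev: "dyad a l k' w = dyad a l k' x" if "w \<in> S" "k' <= k" for w k'
 by (rule dyad_mono[OF l that(2)]) (use that(1) in \<open>simp add: S_def dcell_def n_def\<close>)
 have near: "3 / 4 * (et * s) <= snd Z & dist Z (z, s) <= 3 * s & Z \<in> half_space & measure (om Z) U <= 1 / 8 & 7 / 8 <= measure (om Z) (ball (z + \<theta> *. axis j 1) (s / 4))"
 if Z: "dist Z (z + \<theta> *. axis j 1, et * s) <= et * s / 4" and \<theta>: "\<bar>\<theta>\<bar> = s / 4" for Z \<theta>
 proof -
 have es: "0 < et * s" "et * s <= s / 16" using et s mult_right_mono[OF et(2), of s] by auto
 have sz: "\<bar>snd Z - et * s\<bar> <= et * s / 4" using dist_snd_le[of Z "(z + \<theta> *. axis j 1, et * s)"] Z by (simp add: dist_real_def)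
 have fz: "dist (fst Z) (z + \<theta> *. axis j 1) <= et * s / 4" using dist_fst_le[of Z "(z + \<theta> *. axis j 1, et * s)"] Z by simp
 have s3: "3 / 4 * (et * s) <= snd Z" "snd Z <= 5 / 4 * (et * s)" using sz by linarith+
 have ZH: "Z \<in> half_space" using s3 es unfolding half_space_snd by linarith
 have "dist (z + \<theta> *. axis j 1, et * s) (z, s) <= dist (z + \<theta> *. axis j 1) z + dist (et * s) s" unfolding dist_Pair_Pair by (rule sqrt_sum_squares_le_sum) auto
 also have "... <= s / 4 + s" using \<theta> es by (intro add_mono) (auto simp: dist_norm)
 finally have dz: "dist Z (z, s) <= 3 * s" using dist_triangle[of Z "(z, s)" "(z + \<theta> *. axis j 1, et * s)"] Z es s by linarith
 interpret Z: prob_space "om Z" by (rule emeas_D[OF e ZH])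
 have sets: "sets (om Z) = sets borel" by (rule emeas_D[OF e ZH])
 have s2: "et / 2 * s <= snd Z" using s3 es by linarith
 have "7 / 8 <= measure (om (fst Z, snd Z)) (ball (fst Z) (K * snd Z))" using bm[OF e, of "snd Z" "fst Z"] ZH by (simp add: half_space_snd)
 also have "... <= measure (om Z) (ball (z + \<theta> *. axis j 1) (s / 4))"
 proof (simp, rule Z.finite_measure_mono)
 have "K * snd Z <= K * (5 / 4 * (et * s))" using s3 K by (intro mult_left_mono) auto
 moreover have "K * (5 / 4 * (et * s)) + 5 / 4 * (et * s) = 5 / 4 * ((K + 1) * et) * s" by (simp add: algebra_simps)
 ultimately have Ks: "K * snd Z + et * s / 4 < s / 4" using et(3) es s by simp
 show "ball (fst Z) (K * snd Z) \<subseteq> ball (z + \<theta> *. axis j 1) (s / 4)"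
 proof
 fix y assume "y \<in> ball (fst Z) (K * snd Z)"
 then show "y \<in> ball (z + \<theta> *. axis j 1) (s / 4)"
 using dist_triangle[of "z + \<theta> *. axis j 1" y "fst Z"] fz Ks by (simp add: dist_commute)
 qed
 qed (simp add: sets)
 finally have b: "7 / 8 <= measure (om Z) (ball (z + \<theta> *. axis j 1) (s / 4))" .
 have "emeasure (om Z) U * ennreal (M ^ Suc i) <= ennreal CA * (\<integral>\<^sup>+y. indicator S y * \<Phi> y \<partial>om Z)"
 unfolding U_def S_def
 proof (rule hm[OF e \<Phi> l])
 show "0 <= M ^ Suc i" using M1 by simp
 show "\<forall>k n. hv (Suc i) k n --> ennreal (M ^ Suc i) <= (\<integral>\<^sup>+y. indicator (dcell a l k n) y * \<Phi> y \<partial>om (dcen a l k n, l / 2 ^ k))"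
 unfolding hv_def cellint_def by blast
 show "\<forall>y\<in>dcell a l k n. \<forall>k'<k. \<not> hv (Suc i) k' (dyad a l k' y)"
 proof (intro ballI allI impI notI)
 fix y k' assume y: "y \<in> dcell a l k n" "k' < k" "hv (Suc i) k' (dyad a l k' y)"
 have "hv i k' (dyad a l k' y)" by (rule hv_mono[OF y(3)]) simp
 then show False using hk'[OF y(2)] lev[of y k'] y by (simp add: S_def)
 qed
 show "et / 2 * (l / 2 ^ k) <= snd Z" using s2 by (simp add: s_def)
 qed
 also have "... <= ennreal CA * ennreal (CB * M ^ i)" by (intro mult_left_mono comp[OF dz s2]) simp
 also have "... = ennreal (CA * (CB * M ^ i))" by (rule ennreal_mult[symmetric]) (use CA CB M1 in auto)
 finally have "measure (om Z) U * M ^ Suc i <= CA * (CB * M ^ i)"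
 unfolding Z.emeasure_eq_measure using CA CB M1 by (subst (asm) ennreal_mult[symmetric]) (auto simp: ennreal_le_iff)
 also have "CA * (CB * M ^ i) = 1 / 8 * M ^ Suc i" by (simp add: M_def)
 finally have "measure (om Z) U <= 1 / 8" by (rule mult_right_le_imp_le) (use M1 in simp)
 then show ?thesis using b s3(1) dz ZH by blast
 qed
 have ballS: "w \<in> S" "w \<in> cube c l" "even (dyad a l (Suc k) w j) \<longleftrightarrow> \<theta> < 0" if w: "w \<in> ball (z + \<theta> *. axis j 1) (s / 4)" and \<theta>: "\<bar>\<theta>\<bar> = s / 4" for w \<theta>
 proof -
 have d: "dist w (dcen a l k n + \<theta> *. axis j 1) < l / 2 ^ k / 4" using w by (simp add: z_def s_def dist_commute)
 note hb = half_cell_balls[OF l d \<theta>[unfolded s_def]]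
 show "w \<in> S" unfolding S_def by (rule hb(1))
 show "even (dyad a l (Suc k) w j) \<longleftrightarrow> \<theta> < 0" by (rule hb(3))
 show "w \<in> cube c l" unfolding cube_iff
 proof
 fix m
 have "w $ m < a $ m + (of_int (n m) + 1) * (l / 2 ^ k)" using hb(1) dyad_iff[OF l, of a k w m "n m"] by (auto simp: dcell_def)
 moreover have "(of_int (n m) + 1) * (l / 2 ^ k) <= 2 ^ k * (l / 2 ^ k)" using cube_dyad(3)[OF l a x, of k m] l by (intro mult_right_mono) (auto simp: n_def)
 moreover have "2 ^ k * (l / 2 ^ k) = l" by simp
 moreover have "a $ m < w $ m"
 proof -
 have "0 <= of_int (n m) * (l / 2 ^ k)" using cube_dyad(2)[OF l a x, of k m] l by (simp add: n_def)
 then show ?thesis using hb(2)[of m] by linarith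
 qed
 moreover have "a $ m = c $ m - l / 2" by (simp add: a)
 ultimately show "\<bar>w $ m - c $ m\<bar> < l / 2" by linarith
 qed
 qed
 have uH: "hext om (indicator H) Z = measure (om Z) H" if "Z \<in> half_space" for Z
 using Hb emeas_D(2)[OF e that] by (simp add: hext_def)
 { fix Z assume "dist Z (dcen a l k (dyad a l k x) + (- (l / 2 ^ k / 4)) *. axis j 1, et * (l / 2 ^ k)) <= et * (l / 2 ^ k) / 4"
 then have Z: "dist Z (z + (- (s / 4)) *. axis j 1, et * s) <= et * s / 4" by (simp add: z_def n_def s_def)
 have th: "\<bar>- (s / 4)\<bar> = s / 4" using s by simp
 note nr = near[OF Z th]
 then have ZH: "Z \<in> half_space" by blast
 interpret Z: prob_space "om Z" by (rule emeas_D[OF e ZH])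
 have sets: "sets (om Z) = sets borel" by (rule emeas_D[OF e ZH])
 have "ball (z + (- (s / 4)) *. axis j 1) (s / 4) \<subseteq> H \<union> U"
 proof
 fix w assume w: "w \<in> ball (z + (- (s / 4)) *. axis j 1) (s / 4)"
 note b = ballS[OF w th]
 show "w \<in> H \<union> U"
 proof (cases "w \<in> U")
 case False
 then have nU: "\<forall>k'. \<not> hv (Suc i) k' (dyad a l k' w)" using b(1) unfolding U_def by blast
 have "hv i k (dyad a l k w)" using hk lev[OF b(1), of k] by simp
 moreover have "\<forall>k'. k' < k --> \<not> hv i k' (dyad a l k' w)" using hk' lev[OF b(1)] by simp
 moreover have "even (dyad a l (Suc k) w j)" using b(3) s by simp
 ultimately show ?thesis using i nU b(2) unfolding H_def by blast
 qed simp
 qed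
 then have "measure (om Z) (ball (z + (- (s / 4)) *. axis j 1) (s / 4)) <= measure (om Z) (H \<union> U)"
 using Hb Ub by (intro Z.finite_measure_mono) (auto simp: sets)
 also have "... <= measure (om Z) H + measure (om Z) U" using Hb Ub by (intro measure_Un_le) (auto simp: sets)
 finally show "3 / 4 <= hext om (indicator H) Z" using nr uH[OF ZH] by linarith }
 { fix Z assume "dist Z (dcen a l k (dyad a l k x) + (l / 2 ^ k / 4) *. axis j 1, et * (l / 2 ^ k)) <= et * (l / 2 ^ k) / 4"
 then have Z: "dist Z (z + (s / 4) *. axis j 1, et * s) <= et * s / 4" by (simp add: z_def n_def s_def)
 have th: "\<bar>s / 4\<bar> = s / 4" using s by simp
 note nr = near[OF Z th]
 then have ZH: "Z \<in> half_space" by blast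
 interpret Z: prob_space "om Z" by (rule emeas_D[OF e ZH])
 have sets: "sets (om Z) = sets borel" by (rule emeas_D[OF e ZH])
 have sp: "space (om Z) = UNIV" by (rule emeas_D[OF e ZH])
 let ?B = "ball (z + (s / 4) *. axis j 1) (s / 4)"
 have "H \<subseteq> U \<union> (space (om Z) - ?B)"
 proof
 fix w assume wH: "w \<in> H"
 show "w \<in> U \<union> (space (om Z) - ?B)"
 proof (cases "w \<in> ?B")
 case True
 note b = ballS[OF True th]
 obtain i' k' where h: "1 <= i'" "hv i' k' (dyad a l k' w)" "\<forall>k2. k2 < k' --> \<not> hv i' k2 (dyad a l k2 w)"
 "\<forall>k2. \<not> hv (Suc i') k2 (dyad a l k2 w)" "even (dyad a l (Suc k') w j)" using wH unfolding H_def by blast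
 have wk: "hv i k (dyad a l k w)" using hk lev[OF b(1), of k] by simp
 have wk': "\<not> hv i k2 (dyad a l k2 w)" if "k2 < k" for k2 using hk'[OF that] lev[OF b(1), of k2] that by simp
 \<comment> \<open>Here \<open>w\<close> belongs to \<open>H\<close> through generation
   \<open>i'\<close>. If \<open>i'\<close> is smaller, generation \<open>i\<close> would be a later
   one meeting \<open>w\<close>, which \<open>H\<close> forbids; if \<open>i' = i\<close>, the
   maximal cell is the same and parity fails in the right half; if \<open>i'\<close> is larger,
   \<open>w\<close> lies in \<open>U\<close>.\<close>
 consider "i' < i" | "i' = i" | "Suc i <= i'" by linarith
 then have "w \<in> U"
 proof cases
 case 1
 then have "hv (Suc i') k (dyad a l k w)" by (intro hv_mono[OF wk]) simp
 then show ?thesis using h(4) by blast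
 next
 case 2
 have "k' = k"
 proof (rule linorder_cases[of k' k])
 show "k' < k ==> k' = k" using wk' h(2) 2 by blast
 show "k < k' ==> k' = k" using wk h(3) 2 by blast
 qed
 then show ?thesis using h(5) b(3) s by simp
 next
 case 3
 then have "hv (Suc i) k' (dyad a l k' w)" by (rule hv_mono[OF h(2)])
 then show ?thesis using b(1) unfolding U_def by blast
 qed
 then show ?thesis by blast
 qed (simp add: sp)
 qed
 then have "measure (om Z) H <= measure (om Z) (U \<union> (space (om Z) - ?B))"
 using Ub by (intro Z.finite_measure_mono) (auto simp: sets sp)
 also have "... <= measure (om Z) U + measure (om Z) (space (om Z) - ?B)" using Ub by (intro measure_Un_le) (auto simp: sets sp)
 also have "measure (om Z) (space (om Z) - ?B) = 1 - measure (om Z) ?B" by (rule Z.prob_compl) (simp add: sets)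
 finally show "hext om (indicator H) Z <= 1 / 4" using nr uH[OF ZH] by linarith }
 qed
 qed
 qed
 qed
 qed
qed

subsection \<open>The square function\<close>

text \<open>Scale invariance: over a slab of size \<open>s\<close> in dimension \<open>n\<close> the
  energy is at least a multiple of \<open>s^(n-2)\<close> and the weight at least a multiple of
  \<open>s^(2-n)\<close>. The slab is a thin tube at height about \<open>et * s\<close>, parallel to
  the boundary, running from above the left half to above the right half.\<close>

lemma slab_energy:
 fixes u :: "'m::finite pnt => real"
 assumes et: "0 < et" "et <= 1 / 16" and N: "1 <= N"
 shows "\<exists>c>0. \<forall>(u :: 'm pnt => real) V s z j x. has_weak_gradient half_space u V --> 0 < s --> dist x z <= N * s -->
 (\<forall>Z. dist Z (z + (- (s / 4)) *. axis j 1, et * s) <= et * s / 4 --> 3 / 4 <= u Z) -->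
 (\<forall>Z. dist Z (z + (s / 4) *. axis j 1, et * s) <= et * s / 4 --> u Z <= 1 / 4) -->
 (\<exists>T. (\<forall>X\<in>T. 7 / 8 * (et * s) <= snd X & snd X <= 9 / 8 * (et * s) & norm (fst X - x) <= (N + 2) * s) &
 (%X. ie T X ((norm (V X))^2 * norm (X - (x, 0)) powr (2 - real DIM('m pnt)))) \<in> borel_measurable lebesgue &
 ennreal c <= (\<integral>\<^sup>+X. ie T X ((norm (V X))^2 * norm (X - (x, 0)) powr (2 - real DIM('m pnt))) \<partial>lebesgue))"
proof -
 let ?d = "DIM('m pnt)" and ?v = "measure lborel (ball (0 :: 'm pnt) 1)"
 have v: "0 < ?v" by (rule content_unit_ball_pos)
 have d2: "2 <= ?d" by (simp add: Suc_leI)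
 define ce where "ce = (9 / (8 * et))^2 * ?v * ((et / 16) ^ ?d)^2 / (1 / 2 + 3 * et / 8) ^ ?d"
 have ce: "0 < ce" using et v by (simp add: ce_def)
 define c where "c = ce * (N + 4) powr (2 - real ?d)"
 show ?thesis
 proof (intro exI[of _ c] conjI allI impI, goal_cases)
 case 1
 show ?case using ce N by (simp add: c_def)
 next
 case (2 u V s z j x)
 note hw = 2(1) and s = 2(2) and xz = 2(3) and hi = 2(4) and lo = 2(5)
 define e :: "'m pnt" where "e = (axis j 1, 0)"
 define P :: "'m pnt" where "P = (z + (- (s / 4)) *. axis j 1, et * s)"
 define r where "r = et * s / 8"
 define h where "h = s / 2"
 define T where "T = {X. - r <= (X - P) \<bullet> e & (X - P) \<bullet> e <= h + r & (X - P) \<bullet> (X - P) - ((X - P) \<bullet> e)^2 <= r^2}"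
 have es: "0 < et * s" "et * s <= s / 16" using et s mult_right_mono[OF et(2), of s] by auto
 have r: "0 < r" "r <= s / 128" and h: "0 <= h" using es s by (simp_all add: r_def h_def)
 have e1: "norm e = 1" by (simp add: e_def norm_Pair)
 have Phe: "P + h *. e = (z + (s / 4) *. axis j 1, et * s)"
 proof -
 have "(- (s / 4)) *. w + (s / 2) *. w = (s / 4) *. w" for w :: "real^'m" by (subst scaleR_left_distrib[symmetric]) simp
 then show ?thesis unfolding P_def e_def h_def scaleR_Pair add_Pair by (simp add: add.assoc)
 qed
 have Tsnd: "7 / 8 * (et * s) <= snd X & snd X <= 9 / 8 * (et * s)" if "X \<in> T" for X
 proof -
 have "(fst (X - P) \<bullet> axis j 1)^2 <= (fst (X - P) \<bullet> fst (X - P)) * (axis j 1 \<bullet> (axis j 1 :: real^'m))" by (rule Cauchy_Schwarz_ineq)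
 then have "(fst (X - P) \<bullet> axis j 1)^2 <= fst (X - P) \<bullet> fst (X - P)" by (simp add: inner_axis)
 moreover have "(X - P) \<bullet> e = fst (X - P) \<bullet> axis j 1" by (simp add: e_def inner_prod_def)
 moreover have "(X - P) \<bullet> (X - P) = fst (X - P) \<bullet> fst (X - P) + (snd (X - P))^2" by (simp add: inner_prod_def power2_eq_square)
 ultimately have "(snd (X - P))^2 <= r^2" using that unfolding T_def by simp
 then have "\<bar>snd (X - P)\<bar> <= r" using r by (intro power2_le_iff_abs_le[THEN iffD1]) auto
 then have "\<bar>snd X - et * s\<bar> <= et * s / 8" by (simp add: P_def r_def)
 then show ?thesis by linarith
 qed
 have TH: "T \<subseteq> half_space"
 proof
 fix X assume "X \<in> T"
 then show "X \<in> half_space" using Tsnd[of X] es unfolding half_space_snd by linarith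
 qed
 have Tfst: "norm (fst X - x) <= (N + 2) * s" if "X \<in> T" for X
 proof -
 have "dist (fst X) (fst P) <= dist X P" by (rule dist_fst_le)
 also have "... <= h + 2 * r" using that r h by (intro slab_subset) (auto simp: T_def)
 finally have 1: "dist (fst X) (fst P) <= s" using r s by (simp add: h_def)
 have "dist (fst P) z = s / 4" using s by (simp add: P_def dist_norm)
 then have "dist (fst X) x <= s + s / 4 + N * s"
 using dist_triangle[of "fst X" x "fst P"] dist_triangle[of "fst P" x z] xz 1 by (simp add: dist_commute)
 then show ?thesis using s by (simp add: dist_norm algebra_simps)
 qed
 have eg: "ennreal ((9 / (64 * r))^2 * ?v * ((r / 2) ^ ?d)^2 / (h + 3 * r) ^ ?d) <= (\<integral>\<^sup>+X. ie T X ((norm (V X))^2) \<partial>lebesgue)"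
 proof (rule energy_gap[OF hw open_half_space e1 r(1) h T_def TH])
 have r4: "2 * r = et * s / 4" by (simp add: r_def)
 show "3 / 4 <= u Z" if "dist Z P <= 2 * r" for Z using hi that unfolding P_def r4 by blast
 show "u Z <= 1 / 4" if "dist Z (P + h *. e) <= 2 * r" for Z using lo that unfolding Phe r4 by blast
 qed
 have Tc: "closed T" unfolding T_def by (intro closed_Collect_conj closed_Collect_le continuous_intros)
 have TL: "T \<in> sets lebesgue" using Tc by (simp add: sets_completionI_sets)
 have HL: "half_space \<in> sets (lebesgue :: 'm pnt measure)" by (simp add: sets_completionI_sets)
 have Vm: "(%X. indicator half_space X *. V X) \<in> borel_measurable lebesgue"
 using hw HL by (subst borel_measurable_restrict_space_iff[symmetric]) (auto simp: has_weak_gradient_def)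
 have w[measurable]: "(%X :: 'm pnt. norm (X - (x, 0)) powr (2 - real ?d)) \<in> borel_measurable lebesgue"
 by (intro measurable_completion) simp
 let ?f = "%X. ie T X ((norm (V X))^2 * norm (X - (x, 0)) powr (2 - real ?d))"
 have V2: "(%X. ie T X ((norm (V X))^2)) \<in> borel_measurable lebesgue"
 proof -
 have "(%X. ie T X ((norm (indicator half_space X *. V X))^2)) \<in> borel_measurable lebesgue" using Vm TL by measurable
 also have "(%X. ie T X ((norm (indicator half_space X *. V X))^2)) = (%X. ie T X ((norm (V X))^2))"
 using TH by (auto simp: fun_eq_iff split: split_indicator)
 finally show ?thesis .
 qed
 have fm: "?f \<in> borel_measurable lebesgue"
 proof -
 have "(%X. (ie T X ((norm (V X))^2)) * ennreal (norm (X - (x, 0)) powr (2 - real ?d))) \<in> borel_measurable lebesgue"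
 using V2 by measurable
 also have "(%X. (ie T X ((norm (V X))^2)) * ennreal (norm (X - (x, 0)) powr (2 - real ?d))) = ?f"
 by (auto simp: fun_eq_iff ennreal_mult split: split_indicator)
 finally show ?thesis .
 qed
 define w0 where "w0 = ((N + 4) * s) powr (2 - real ?d)"
 have wt: "w0 <= norm (X - (x, 0)) powr (2 - real ?d)" if X: "X \<in> T" for X
 proof -
 have "norm (X - (x, 0)) = norm (fst X - x, snd X)" by (cases X) simp
 also have "... <= norm (fst X - x) + norm (snd X)" by (rule norm_Pair_le)
 also have "... <= (N + 2) * s + 9 / 8 * (et * s)" using Tfst[OF X] Tsnd[OF X] es by (intro add_mono) auto
 also have "... <= (N + 4) * s" using es s by (simp add: algebra_simps)
 finally have "norm (X - (x, 0)) <= (N + 4) * s" .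
 moreover have "0 < snd X" using Tsnd[OF X] es by linarith
 then have "X ~= (x, 0)" by auto
 then have "0 < norm (X - (x, 0))" by simp
 ultimately show ?thesis unfolding w0_def using d2 by (intro powr_mono2') auto
 qed
 have w00: "0 <= w0" by (simp add: w0_def)
 show ?case
 proof (intro exI[of _ T] conjI ballI fm)
 fix X assume "X \<in> T"
 then show "7 / 8 * (et * s) <= snd X" "snd X <= 9 / 8 * (et * s)" "norm (fst X - x) <= (N + 2) * s" using Tsnd Tfst by blast+
 next
 have "c = w0 * ((9 / (64 * r))^2 * ?v * ((r / 2) ^ ?d)^2 / (h + 3 * r) ^ ?d)"
 proof -
 have "(9 / (64 * r))^2 = (9 / (8 * et))^2 / s^2" by (simp add: r_def power_divide power_mult_distrib)
 moreover have "((r / 2) ^ ?d)^2 = ((et / 16) ^ ?d)^2 * (s ^ ?d)^2" by (simp add: r_def power_divide power_mult_distrib)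
 moreover have "(h + 3 * r) ^ ?d = (1 / 2 + 3 * et / 8) ^ ?d * s ^ ?d"
 proof -
 have "h + 3 * r = (1 / 2 + 3 * et / 8) * s" by (simp add: h_def r_def algebra_simps)
 then show ?thesis by (simp only: power_mult_distrib)
 qed
 ultimately have "(9 / (64 * r))^2 * ?v * ((r / 2) ^ ?d)^2 / (h + 3 * r) ^ ?d = ce * (s ^ ?d / s^2)"
 using s by (simp only: ce_def) (simp add: power2_eq_square)
 moreover have "w0 = (N + 4) powr (2 - real ?d) * (s^2 / s ^ ?d)"
 proof -
 have "s powr (2 - real ?d) = s^2 / s ^ ?d" unfolding powr_diff using s by (simp only: powr_realpow powr_numeral)
 then show ?thesis using N s unfolding w0_def by (subst powr_mult) auto
 qed
 ultimately show ?thesis using s by (simp add: c_def)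
 qed
 then have "ennreal c = ennreal w0 * ennreal ((9 / (64 * r))^2 * ?v * ((r / 2) ^ ?d)^2 / (h + 3 * r) ^ ?d)"
 using w00 r h v by (simp only:) (rule ennreal_mult, auto)
 also have "... <= ennreal w0 * (\<integral>\<^sup>+X. ie T X ((norm (V X))^2) \<partial>lebesgue)" by (intro mult_left_mono eg) simp
 also have "... = (\<integral>\<^sup>+X. ennreal w0 * (ie T X ((norm (V X))^2)) \<partial>lebesgue)" by (rule nn_integral_cmult[symmetric, OF V2])
 also have "... <= (\<integral>\<^sup>+X. ?f X \<partial>lebesgue)"
 proof (rule nn_integral_mono)
 fix X
 show "ennreal w0 * (ie T X ((norm (V X))^2)) <= ?f X"
 proof (cases "X \<in> T")
 case True
 have "w0 * (norm (V X))^2 <= (norm (V X))^2 * norm (X - (x, 0)) powr (2 - real ?d)"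
 using mult_left_mono[OF wt[OF True], of "(norm (V X))^2"] by (simp add: mult.commute)
 then show ?thesis using True w00 by (simp add: ennreal_leI flip: ennreal_mult)
 qed simp
 qed
 finally show "ennreal c <= (\<integral>\<^sup>+X. ?f X \<partial>lebesgue)" .
 qed
 qed
qed

text \<open>If \<Phi> is at least \<open>M^n / c1\<close> near \<open>x\<close>, a tiny cell around
  \<open>x\<close> is heavy of generation \<open>n\<close>, because its pole gives it mass at least
  \<open>c1\<close>. Such a cell is heavy for all lower generations too, so \<open>x\<close> has
  stopping levels \<open>lv 1 < ... < lv n\<close>, each contributing \<open>c2\<close> from its own
  slab.\<close>

lemma square_function_lower:
 assumes lam: "0 < lam" "0 < Lam"
 shows "\<exists>\<gamma>>0. \<exists>M>1. \<exists>c1>0. c1 <= 1 & (\<exists>c2>0. \<forall>om \<Phi> (c :: real^'m::finite) l. emeas lam Lam om --> \<Phi> \<in> bm --> 0 < l -->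
 (\<integral>\<^sup>+y. \<Phi> y \<partial>om (c, l)) <= 1 --> (\<exists>H\<in>sets borel. H \<subseteq> cube c l & (\<forall>x\<in>cube c l. \<forall>n. (\<exists>\<delta>>0. \<forall>y. dist y x < \<delta> --> ennreal (M ^ n / c1) <= \<Phi> y) -->
 (\<forall>V. has_weak_gradient half_space (hext om (indicator H)) V --> ennreal (real n * c2) <=
 (\<integral>\<^sup>+Y\<in>approach_cone \<gamma> (\<gamma> * l) x. ennreal ((norm (V Y))^2 * norm (Y - (x, 0)) powr (2 - real DIM('m pnt))) \<partial>lebesgue)))))"
proof -
 define N where "N = real CARD('m)"
 have N: "1 <= N" unfolding N_def by (simp add: Suc_leI)
 show ?thesis
 proof (rule exE[OF generation_oscillation[OF lam, where 'm = 'm]], elim conjE exE, goal_cases)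
 case (1 et M)
 note et = 1(1-2) and M = 1(3) and go0 = 1(4)
 note go = go0[THEN spec4, THEN spec, THEN spec, THEN mp4, THEN mp]
 show ?thesis
 proof (rule exE[OF cell_mass[OF lam, where 'm = 'm]], elim conjE, goal_cases)
 case (1 c0)
 note c0 = 1(1) and cm0 = 1(2)
 note cm = cm0[THEN spec, THEN spec, THEN spec, THEN mp, THEN mp]
 show ?thesis
 proof (rule exE[OF slab_energy[OF et N, where 'm = 'm]], elim conjE, goal_cases)
 case (1 c2)
 note c2 = 1(1) and se0 = 1(2)
 note se = se0[THEN spec4, THEN spec, THEN spec, THEN mp4, THEN mp]
 define c1 where "c1 = min c0 1"
 have c1: "0 < c1" "c1 <= 1" "c1 <= c0" using c0 by (auto simp: c1_def)
 \<comment> \<open>A slab at scale \<open>s\<close> has height at least \<open>7/8 * et * s\<close>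
   and lies within \<open>(N + 2) * s\<close> of \<open>x\<close> horizontally; this aperture puts
   it in the cone with room to spare.\<close>
 define \<gamma> where "\<gamma> = 2 * (N + 2) / et"
 have get: "\<gamma> * et = 2 * (N + 2)" using et by (simp add: \<gamma>_def)
 have \<gamma>: "2 <= \<gamma>" using et N by (simp add: \<gamma>_def le_divide_eq)
 show ?thesis
 proof (rule exI[of _ \<gamma>], rule conjI, use \<gamma> in linarith, rule exI[of _ M], rule conjI[OF M], rule exI[of _ c1], intro conjI c1(1,2), rule exI[of _ c2], intro conjI c2 allI impI, goal_cases)
 case (1 om \<Phi> c l)
 note e = 1(1) and \<Phi>[measurable] = 1(2) and l = 1(3) and \<Phi>1 = 1(4)
 obtain j :: 'm where True by blast
 define a where "a = (\<chi> i. c $ i - l / 2)"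
 define hv where "hv i k n \<longleftrightarrow> ennreal (M ^ i) <= cellint om \<Phi> a l k n" for i k n
 show ?case
 proof (rule bexE[OF go[OF e \<Phi> l a_def \<Phi>1, of j]], elim conjE, goal_cases)
 case (1 H)
 note H = 1(1,2) and osc0 = 1(3)
 note osc = osc0[folded hv_def, THEN bspec, THEN spec, THEN mp, THEN spec, THEN mp, THEN mp]
 show ?case
 proof (intro bexI[of _ H] H conjI ballI allI impI)
 fix x n V assume x: "x \<in> cube c l" and "\<exists>\<delta>>0. \<forall>y. dist y x < \<delta> --> ennreal (M ^ n / c1) <= \<Phi> y"
 and hw: "has_weak_gradient half_space (hext om (indicator H)) V"
 then obtain \<delta> where \<delta>: "0 < \<delta>" "\<forall>y. dist y x < \<delta> --> ennreal (M ^ n / c1) <= \<Phi> y" by blast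
 obtain k0 where "N * l / \<delta> < 2 ^ k0" using real_arch_pow[of 2 "N * l / \<delta>"] by auto
 then have k0: "N * (l / 2 ^ k0) < \<delta>" using \<delta>(1) by (simp add: field_simps)
 have heavy_n: "hv n k0 (dyad a l k0 x)"
 proof -
 define z s where "z = dcen a l k0 (dyad a l k0 x)" and "s = l / 2 ^ k0"
 have s: "0 < s" using l by (simp add: s_def)
 have XH: "(z, s) \<in> half_space" using s by (simp add: half_space_snd)
 have sets: "sets (om (z, s)) = sets borel" by (rule emeas_D[OF e XH])
 let ?S = "dcell a l k0 (dyad a l k0 x)"
 have near: "ennreal (M ^ n / c1) <= \<Phi> y" if "y \<in> ?S" for y
 proof -
 have "dist y z <= N * s / 2" "dist x z <= N * s / 2"
 using dcell_dist[OF l that] dcell_dist[OF l dcell_dyad[of x a l k0]] by (simp_all add: N_def s_def z_def)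
 then have "dist y x < \<delta>" using k0 dist_triangle[of y x z] by (simp add: dist_commute s_def)
 then show ?thesis using \<delta>(2) by blast
 qed
 have "ball z (s / 2) \<subseteq> ?S"
 proof
 fix y assume y: "y \<in> ball z (s / 2)"
 have "\<bar>y $ i - (a $ i + (of_int (dyad a l k0 x i) + 1 / 2) * (l / 2 ^ k0))\<bar> < (l / 2 ^ k0) / 2" for i
 proof -
 have "\<bar>(y - z) $ i\<bar> <= dist y z" unfolding dist_norm by (rule component_le_norm_cart)
 then show ?thesis using y by (simp add: z_def s_def dcen_def dist_commute)
 qed
 then have "a $ i + of_int (dyad a l k0 x i) * (l / 2 ^ k0) < y $ i & y $ i < a $ i + (of_int (dyad a l k0 x i) + 1) * (l / 2 ^ k0)" for i
 by (rule half_interval_bounds(1))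
 then show "y \<in> ?S" by (auto simp: dcell_def fun_eq_iff dyad_iff[OF l] intro: less_imp_le)
 qed
 then have "emeasure (om (z, s)) (ball z (s / 2)) <= emeasure (om (z, s)) ?S" by (intro emeasure_mono) (auto simp: sets)
 then have "ennreal c0 <= emeasure (om (z, s)) ?S" using cm[OF e s, of z] by (rule order_trans[rotated])
 then have c1S: "ennreal c1 <= emeasure (om (z, s)) ?S" using ennreal_leI[OF c1(3)] by (rule order_trans[rotated])
 have "ennreal (M ^ n) = ennreal (M ^ n / c1) * ennreal c1" using c1 M by (subst ennreal_mult[symmetric]) auto
 also have "... <= ennreal (M ^ n / c1) * emeasure (om (z, s)) ?S" by (intro mult_left_mono c1S) simp
 also have "... = (\<integral>\<^sup>+y. ennreal (M ^ n / c1) * indicator ?S y \<partial>om (z, s))" by (rule nn_integral_cmult_indicator[symmetric]) (simp add: sets)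
 also have "... <= (\<integral>\<^sup>+y. indicator ?S y * \<Phi> y \<partial>om (z, s))" using near by (intro nn_integral_mono) (auto split: split_indicator)
 finally show ?thesis by (simp add: hv_def cellint_def z_def s_def)
 qed
 have hv_mono: "hv i k m" if "hv i' k m" "i <= i'" for i i' k m
 proof -
 have "ennreal (M ^ i) <= ennreal (M ^ i')" using that(2) M by (intro ennreal_leI power_increasing) auto
 then show ?thesis using that(1) unfolding hv_def by (rule order_trans)
 qed
 define lv where "lv i = (LEAST k. hv i k (dyad a l k x))" for i
 have lv: "hv i (lv i) (dyad a l (lv i) x)" "\<forall>k'<lv i. \<not> hv i k' (dyad a l k' x)" if "i <= n" for i
 proof -
 have "hv i k0 (dyad a l k0 x)" by (rule hv_mono[OF heavy_n that])
 then show "hv i (lv i) (dyad a l (lv i) x)" unfolding lv_def by (rule LeastI)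
 show "\<forall>k'<lv i. \<not> hv i k' (dyad a l k' x)" unfolding lv_def using not_less_Least by blast
 qed
 have gap: "lv i < lv (Suc i)" if "1 <= i" "Suc i <= n" for i
 proof -
 have i: "i <= n" using that by simp
 have "\<not> hv (Suc i) (lv i) (dyad a l (lv i) x)" using osc[OF x that(1) lv[OF i]] by blast
 then have "lv (Suc i) ~= lv i" using lv(1)[OF that(2)] by metis
 moreover have "lv i <= lv (Suc i)" unfolding lv_def[of i] by (rule Least_le, rule hv_mono[OF lv(1)[OF that(2)]]) simp
 ultimately show ?thesis by simp
 qed
 have lvm: "lv i < lv i'" if "1 <= i" "i < i'" "i' <= n" for i i'
 using that(2,3)
 proof (induction i' rule: less_induct)
 case (less i')
 obtain i0 where i0: "i' = Suc i0" using less.prems by (cases i') auto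
 show ?case
 proof (cases "i = i0")
 case True
 then show ?thesis using gap[of i] that less.prems i0 by simp
 next
 case False
 then have "lv i < lv i0" using less i0 by simp
 also have "lv i0 < lv i'" using gap[of i0] that less.prems i0 by simp
 finally show ?thesis .
 qed
 qed
 define f where "f X = ennreal ((norm (V X))^2 * norm (X - (x, 0)) powr (2 - real DIM('m pnt)))" for X
 have "\<forall>i. \<exists>T. 1 <= i & i <= n --> (\<forall>X\<in>T. 7 / 8 * (et * (l / 2 ^ lv i)) <= snd X & snd X <= 9 / 8 * (et * (l / 2 ^ lv i)) & norm (fst X - x) <= (N + 2) * (l / 2 ^ lv i)) &
 (%X. indicator T X * f X) \<in> borel_measurable lebesgue & ennreal c2 <= (\<integral>\<^sup>+X. indicator T X * f X \<partial>lebesgue)"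
 proof
 fix i
 show "\<exists>T. 1 <= i & i <= n --> (\<forall>X\<in>T. 7 / 8 * (et * (l / 2 ^ lv i)) <= snd X & snd X <= 9 / 8 * (et * (l / 2 ^ lv i)) & norm (fst X - x) <= (N + 2) * (l / 2 ^ lv i)) &
 (%X. indicator T X * f X) \<in> borel_measurable lebesgue & ennreal c2 <= (\<integral>\<^sup>+X. indicator T X * f X \<partial>lebesgue)"
 proof (cases "1 <= i & i <= n")
 case True
 then have i: "1 <= i" "i <= n" by auto
 note o = osc[OF x i(1) lv[OF i(2)]]
 have "dist x (dcen a l (lv i) (dyad a l (lv i) x)) <= N * (l / 2 ^ lv i) / 2" unfolding N_def by (rule dcell_dist[OF l dcell_dyad])
 moreover have "0 <= N * (l / 2 ^ lv i)" using N l by simp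
 moreover have "y <= X" if "y <= X / 2" "0 <= X" for X y :: real using that by simp
 ultimately have d: "dist x (dcen a l (lv i) (dyad a l (lv i) x)) <= N * (l / 2 ^ lv i)" by blast
 have s: "0 < l / 2 ^ lv i" using l by simp
 show ?thesis using se[OF hw s d, of j] o unfolding f_def by blast
 qed blast
 qed
 from choice[OF this] obtain T where T: "\<forall>i. 1 <= i & i <= n --> (\<forall>X\<in>T i. 7 / 8 * (et * (l / 2 ^ lv i)) <= snd X & snd X <= 9 / 8 * (et * (l / 2 ^ lv i)) & norm (fst X - x) <= (N + 2) * (l / 2 ^ lv i)) &
 (%X. indicator (T i) X * f X) \<in> borel_measurable lebesgue & ennreal c2 <= (\<integral>\<^sup>+X. indicator (T i) X * f X \<partial>lebesgue)" ..
 have Tb: "7 / 8 * (et * (l / 2 ^ lv i)) <= snd X" "snd X <= 9 / 8 * (et * (l / 2 ^ lv i))" "norm (fst X - x) <= (N + 2) * (l / 2 ^ lv i)"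
 if "i \<in> {1..n}" "X \<in> T i" for i X using T that by auto
 have Tcone: "X \<in> approach_cone \<gamma> (\<gamma> * l) x" if iX: "i \<in> {1..n}" "X \<in> T i" for i X
 proof -
 define s where "s = l / 2 ^ lv i"
 have s: "0 < s" "s <= l" using l by (auto simp: s_def divide_le_eq mult_ge1_I)
 note t = Tb[OF iX, folded s_def]
 have es: "0 < et * s" "et * s <= s / 16" using et s mult_right_mono[OF et(2), of s] by auto
 have "\<gamma> * (7 / 8 * (et * s)) <= \<gamma> * snd X" using \<gamma> t(1) by (intro mult_left_mono) auto
 moreover have "\<gamma> * (7 / 8 * (et * s)) = 7 / 4 * ((N + 2) * s)" using get by (simp add: mult.assoc[symmetric])
 moreover have "0 <= (N + 2) * s" using N s by simp
 ultimately have 1: "norm (fst X - x) <= \<gamma> * snd X" using t(3) by linarith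
 have "2 * l <= \<gamma> * l" using \<gamma> l by (intro mult_right_mono) auto
 then have 2: "snd X <= \<gamma> * l" using t(2) es s by linarith
 have 3: "0 < snd X" using t(1) es by linarith
 show ?thesis using 1 2 3 by (cases X) (simp add: approach_cone_def half_space_def)
 qed
 \<comment> \<open>Slab heights stay within a factor between 7/8 and 9/8 of
   \<open>et * l / 2^lv i\<close>. Distinct levels differ by a factor of at least 2, and
   \<open>9/8 * 1/2 < 7/8\<close>.\<close>
 have dis: "disjoint_family_on T {1..n}"
 proof -
 have aux: "X ~: T i'" if i: "i \<in> {1..n}" "i' \<in> {1..n}" "i < i'" and X: "X \<in> T i" for i i' X
 proof
 assume X': "X \<in> T i'"
 have "lv i < lv i'" using lvm[of i i'] i by simp
 then have "(2 :: real) * 2 ^ lv i <= 2 ^ lv i'" using power_increasing[of "Suc (lv i)" "lv i'" "2 :: real"] by simp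
 then have "l / 2 ^ lv i' <= l / (2 * 2 ^ lv i)" using l by (intro divide_left_mono) auto
 then have "et * (l / 2 ^ lv i') <= et * (l / 2 ^ lv i / 2)" using et by (intro mult_left_mono) (auto simp: mult.commute)
 then have A: "et * (l / 2 ^ lv i') <= et * (l / 2 ^ lv i) / 2" by simp
 have B: "0 < et * (l / 2 ^ lv i)" using et l by simp
 have "False" if "y <= 9 / 8 * B'" "7 / 8 * B <= y" "B' <= B / 2" "0 < B" for y B B' :: real using that by linarith
 then show False using Tb(2)[OF i(2) X'] Tb(1)[OF i(1) X] A B by blast
 qed
 show ?thesis unfolding disjoint_family_on_def
 proof (intro ballI impI equals0I)
 fix i i' X assume "i \<in> {1..n}" "i' \<in> {1..n}" "i ~= i'" "X \<in> T i \<inter> T i'"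
 then show False using aux[of i i' X] aux[of i' i X] by (cases "i < i'") auto
 qed
 qed
 have "ennreal (real n * c2) = (\<Sum>i\<in>{1..n}. ennreal c2)" using c2 by (simp add: ennreal_mult ennreal_of_nat_eq_real_of_nat)
 also have "... <= (\<Sum>i\<in>{1..n}. (\<integral>\<^sup>+X. indicator (T i) X * f X \<partial>lebesgue))" using T by (intro sum_mono) auto
 also have "... = (\<integral>\<^sup>+X. (\<Sum>i\<in>{1..n}. indicator (T i) X * f X) \<partial>lebesgue)" by (rule nn_integral_sum[symmetric]) (use T in auto)
 also have "... <= (\<integral>\<^sup>+X. f X * indicator (approach_cone \<gamma> (\<gamma> * l) x) X \<partial>lebesgue)"
 proof (rule nn_integral_mono)
 fix X
 show "(\<Sum>i\<in>{1..n}. indicator (T i) X * f X) <= f X * indicator (approach_cone \<gamma> (\<gamma> * l) x) X"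
 proof (cases "\<exists>i\<in>{1..n}. X \<in> T i")
 case True
 then obtain i where i: "i \<in> {1..n}" "X \<in> T i" by blast
 have "(\<Sum>i\<in>{1..n}. f X * indicator (T i) X) = f X" by (rule sum_indicator_disjoint_family[OF dis i(2) _ i(1)]) simp
 then show ?thesis using Tcone[OF i] by (simp add: mult.commute)
 next
 case False
 then have "(\<Sum>i\<in>{1..n}. indicator (T i) X * f X) = 0" by (intro sum.neutral) auto
 then show ?thesis by (simp only: zero_le)
 qed
 qed
 finally show "ennreal (real n * c2) <= (\<integral>\<^sup>+Y\<in>approach_cone \<gamma> (\<gamma> * l) x. ennreal ((norm (V Y))^2 * norm (Y - (x, 0)) powr (2 - real DIM('m pnt))) \<partial>lebesgue)"
 unfolding f_def .
 qed
 qed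
 qed
 qed
 qed
 qed
qed

section \<open>Choice of the weight and of the final constants\<close>

lemma sqrt_ennreal_ge: "ennreal y <= a ==> 0 <= y ==> ennreal (sqrt y) <= sqrt_ennreal a"
proof (cases a)
 case (real r)
 assume "ennreal y <= a" "0 <= y"
 then have "y <= r" using real by (simp add: ennreal_le_iff)
 then show ?thesis using real by (simp add: sqrt_ennreal_def ennreal_leI)
qed (simp add: sqrt_ennreal_def)

lemma pow_between:
 assumes "1 < (M :: real)" "1 <= t"
 shows "\<exists>n. M ^ n <= t & t < M ^ Suc n"
proof -
 obtain N where N: "t < M ^ N" using real_arch_pow[OF assms(1)] by blast
 define n where "n = (LEAST n. t < M ^ n)"
 have n: "t < M ^ n" unfolding n_def using N by (rule LeastI)
 then have "n ~= 0" using assms by (intro notI) simp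
 then obtain k where k: "n = Suc k" by (cases n) auto
 then have "\<not> t < M ^ k" unfolding n_def by (intro not_less_Least) simp
 then show ?thesis using n k by (intro exI[of _ k]) simp
qed

lemma outer_open:
 fixes M :: "'a::euclidean_space measure"
 assumes "prob_space M" "sets M = sets borel" "E \<in> sets borel" "measure M E < b"
 shows "\<exists>Op. open Op & E \<subseteq> Op & measure M Op <= b"
proof -
 interpret prob_space M by (rule assms)
 have "emeasure M E = (INF U\<in>{U. E \<subseteq> U & open U}. emeasure M U)"
 by (rule outer_regular[OF assms(2) _ assms(3)]) (simp add: emeasure_space_1)
 moreover have "emeasure M E < ennreal b" using assms(4) by (simp add: emeasure_eq_measure ennreal_less_iff)
 ultimately have "(INF U\<in>{U. E \<subseteq> U & open U}. emeasure M U) < ennreal b" by simp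
 then obtain U where U: "E \<subseteq> U" "open U" "emeasure M U < ennreal b" by (auto simp: INF_less_iff)
 then have "measure M U <= b" by (simp add: emeasure_eq_measure ennreal_less_iff)
 then show ?thesis using U by blast
qed

text \<open>What remains is to choose \<Phi>. For \<open>p > 0\<close> the largest \<open>n\<close>
  with \<open>M^n / c1 \<le> 1 / (2 p)\<close> is available, which is
  \<open>ln (1 / p) / ln M\<close> up to an additive loss; the square in
  \<open>\<delta>0 = (c1 / (2 M))^2\<close> makes that loss at most half of the main term, whence
  the 2 in \<open>C1\<close>. For \<open>p = 0\<close> every \<open>n\<close> is available and the
  square function is infinite on \<open>E\<close>.\<close>

theorem proposition3p1:
 fixes lam \<Lambda> :: real
 assumes "0 < lam"
 shows "\<exists>\<delta>\<^sub>0>0. \<exists>\<gamma>>0. \<exists>C\<^sub>1>0.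
 \<forall>(A :: 'm::finite pnt \<Rightarrow> 'm pnt \<Rightarrow>\<^sub>L 'm pnt) \<omega>.
 elliptic_coefficients lam \<Lambda> A \<and> is_elliptic_measure A \<omega> \<longrightarrow>
 (\<forall>(c :: real^'m) (l :: real). 0 < l \<longrightarrow>
 (\<forall>E\<in>sets borel. E \<subseteq> cube c l \<longrightarrow>
 (\<exists>H\<in>sets borel. H \<subseteq> cube c l \<and>
 (\<forall>u. measure (\<omega> (c, l)) E < \<delta>\<^sub>0 \<and> u = solution_with_data \<omega> (indicator H) \<longrightarrow>
 (\<forall>x\<in>E. ennreal C\<^sub>1 * sqrt_ennreal (log_recip (measure (\<omega> (c, l)) E))
 \<le> square_function \<gamma> (\<gamma> * l) u x)))))"
proof -
 define Lam where "Lam = real DIM('m pnt) ^ 2 * \<bar>\<Lambda>\<bar> + 1"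
 have Lam: "0 < Lam" unfolding Lam_def by (intro add_nonneg_pos) auto
 show ?thesis
 proof (rule exE[OF square_function_lower[OF assms Lam, where 'm = 'm]], elim conjE exE, goal_cases)
 case (1 \<gamma> M c1 c2)
 note \<gamma> = 1(1) and M = 1(2) and c1 = 1(3-4) and c2 = 1(5) and sf0 = 1(6)
 note sf = sf0[THEN spec4, THEN mp4]
 define \<delta>0 where "\<delta>0 = (c1 / (2 * M))^2"
 have \<delta>0: "0 < \<delta>0" using c1 M by (simp add: \<delta>0_def)
 have lnM: "0 < ln M" using M by simp
 define C1 where "C1 = sqrt (c2 / (2 * ln M))"
 have C1: "0 < C1" using c2 lnM by (simp add: C1_def)
 have C1sq: "C1^2 = c2 / (2 * ln M)" using c2 lnM by (simp add: C1_def)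
 show ?thesis
 proof (rule exI[of _ \<delta>0], rule conjI[OF \<delta>0], rule exI[of _ \<gamma>], rule conjI[OF \<gamma>], rule exI[of _ C1], rule conjI[OF C1], intro allI impI ballI, goal_cases)
 case (1 A om c l E)
 note el = 1(1) and l = 1(2) and E = 1(3,4)
 have e: "emeas lam Lam om" unfolding Lam_def using el by (intro emeas_of_elliptic) auto
 have XH: "(c, l) \<in> half_space" using l by (simp add: half_space_snd)
 note P = emeas_D[OF e XH]
 interpret X: prob_space "om (c, l)" by (rule P)
 define p where "p = measure (om (c, l)) E"
 have p0: "0 <= p" by (simp add: p_def)
 let ?G = "\<exists>H\<in>sets borel. H \<subseteq> cube c l & (\<forall>u. p < \<delta>0 & u = solution_with_data om (indicator H) -->
 (\<forall>x\<in>E. ennreal C1 * sqrt_ennreal (log_recip p) <= square_function \<gamma> (\<gamma> * l) u x))"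
 \<comment> \<open>Common conclusion for both kinds of weight: each admissible \<open>b\<close> must
   be reached by some number of generations. When \<open>p = 0\<close> the upper bound on
   \<open>b\<close> is vacuous, so all \<open>b \<ge> 0\<close> are admissible, which encodes the
   infinite logarithm.\<close>
 have concl: ?G
 if \<Phi>: "\<Phi> \<in> bm" "(\<integral>\<^sup>+y. \<Phi> y \<partial>om (c, l)) <= 1"
 and n: "!!b. 0 <= b ==> (0 < p ==> b <= C1^2 * ln (1 / p)) ==> \<exists>n. b <= real n * c2 & (\<forall>x\<in>E. \<exists>\<delta>>0. \<forall>y. dist y x < \<delta> --> ennreal (M ^ n / c1) <= \<Phi> y)"
 and pd: "p < \<delta>0" for \<Phi>
 proof -
 show ?thesis
 proof (rule bexE[OF sf[OF e \<Phi>(1) l \<Phi>(2)]], elim conjE, goal_cases)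
 case (1 H)
 note H = 1(1,2) and HS = 1(3)
 have ueq: "solution_with_data om (indicator H) = hext om (indicator H)" by (simp add: fun_eq_iff solution_with_data_def hext_def)
 obtain G where G: "has_weak_gradient half_space (hext om (indicator H)) G" using hext_indicator_weak_gradient[OF assms Lam e H(1)] ..
 have wg: "has_weak_gradient half_space (hext om (indicator H)) (weak_gradient half_space (hext om (indicator H)))"
 using someI[of "has_weak_gradient half_space (hext om (indicator H))", OF G] by (simp add: weak_gradient_def)
 let ?I = "%x. \<integral>\<^sup>+Y\<in>approach_cone \<gamma> (\<gamma> * l) x. ennreal ((norm (weak_gradient half_space (hext om (indicator H)) Y))^2 * norm (Y - (x, 0)) powr (2 - real DIM('m pnt))) \<partial>lebesgue"
 have low: "ennreal b <= ?I x" if x: "x \<in> E" and b: "0 <= b" "0 < p ==> b <= C1^2 * ln (1 / p)" for x b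
 proof -
 obtain m where m: "b <= real m * c2" "\<forall>x\<in>E. \<exists>\<delta>>0. \<forall>y. dist y x < \<delta> --> ennreal (M ^ m / c1) <= \<Phi> y" using n[OF b] by blast
 have xc: "x \<in> cube c l" using x E by blast
 have "ennreal (real m * c2) <= ?I x"
 by (rule HS[THEN bspec, OF xc, THEN spec, THEN mp, OF m(2)[THEN bspec, OF x], THEN spec, THEN mp, OF wg])
 then show ?thesis using ennreal_leI[OF m(1)] by (rule order_trans[rotated])
 qed
 show ?thesis
 proof (intro bexI[of _ H] H conjI allI impI ballI)
 fix u x assume u: "p < \<delta>0 & u = solution_with_data om (indicator H)" and x: "x \<in> E"
 have sq: "square_function \<gamma> (\<gamma> * l) u x = sqrt_ennreal (?I x)" using u unfolding ueq square_function_def by simp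
 show "ennreal C1 * sqrt_ennreal (log_recip p) <= square_function \<gamma> (\<gamma> * l) u x"
 proof (cases "p = 0")
 case True
 have "?I x = \<infinity>"
 proof (rule ccontr)
 assume "?I x ~= \<infinity>"
 then obtain r where r: "?I x = ennreal r" "0 <= r" by (cases "?I x") auto
 have "ennreal (r + 1) <= ?I x" by (rule low[OF x]) (use r True in auto)
 then show False using r by (simp add: ennreal_le_iff)
 qed
 then show ?thesis unfolding sq by (simp add: sqrt_ennreal_def)
 next
 case False
 then have p: "0 < p" using p0 by simp
 have "p <= 1" by (simp add: p_def)
 then have lp: "0 <= ln (1 / p)" using p by (intro ln_ge_zero) simp
 have "ennreal C1 * sqrt_ennreal (log_recip p) = ennreal (C1 * sqrt (ln (1 / p)))"
 using False lp C1 by (simp add: log_recip_def sqrt_ennreal_def ennreal_mult)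
 also have "C1 * sqrt (ln (1 / p)) = sqrt (C1^2 * ln (1 / p))" using C1 by (simp add: real_sqrt_mult)
 also have "ennreal (sqrt (C1^2 * ln (1 / p))) <= sqrt_ennreal (?I x)"
 by (intro sqrt_ennreal_ge low[OF x]) (use lp in auto)
 finally show ?thesis unfolding sq .
 qed
 qed
 qed
 qed
 have ?G
 proof -
 consider "\<not> p < \<delta>0" | "p = 0" "p < \<delta>0" | "0 < p" "p < \<delta>0" using p0 by linarith
 then show ?thesis
 proof cases
 case 1
 then show ?thesis by (intro bexI[of _ "{}"]) auto
 next
 case 2
 \<comment> \<open>Open neighbourhoods with measures summing to at most 1. Near a point of
   \<open>E\<close> any finite number of them overlap on a common ball, so \<Phi> exceeds every
   bound there.\<close>
 have "\<forall>j. \<exists>Op. open Op & E \<subseteq> Op & measure (om (c, l)) Op <= (1 / 2) ^ Suc j"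
 by (rule allI, rule outer_open[OF P(1,2) E(1)]) (use 2(1) in \<open>simp add: p_def\<close>)
 from choice[OF this] obtain Op where Op: "!!j. open (Op j)" "!!j. E \<subseteq> Op j" "!!j. measure (om (c, l)) (Op j) <= (1 / 2) ^ Suc j" by blast
 have Ob: "Op j \<in> sets borel" for j using Op(1) by simp
 define \<Phi> :: "real^'m => ennreal" where "\<Phi> y = (\<Sum>j. indicator (Op j) y)" for y
 show ?thesis
 proof (rule concl[of \<Phi>])
 show m: "\<Phi> \<in> bm" unfolding \<Phi>_def using Ob by measurable
 have "(\<integral>\<^sup>+y. \<Phi> y \<partial>om (c, l)) = (\<Sum>j. \<integral>\<^sup>+y. indicator (Op j) y \<partial>om (c, l))"
 unfolding \<Phi>_def by (rule nn_integral_suminf) (use Ob P(2) in auto)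
 also have "... <= (\<Sum>j. ennreal ((1 / 2) ^ Suc j))"
 by (rule suminf_le) (use Op(3) Ob P(2) in \<open>auto simp: X.emeasure_eq_measure intro!: ennreal_leI simp del: power_Suc\<close>)
 also have "... = ennreal (\<Sum>j. (1 / 2) ^ Suc j)" by (rule suminf_ennreal2) (use power_half_series in \<open>auto simp: sums_iff\<close>)
 also have "(\<Sum>j. (1 / 2 :: real) ^ Suc j) = 1" using power_half_series by (simp add: sums_iff)
 finally show "(\<integral>\<^sup>+y. \<Phi> y \<partial>om (c, l)) <= 1" by simp
 fix b :: real
 obtain n where n: "b / c2 < real n" using reals_Archimedean2 by blast
 obtain J :: nat where J: "M ^ n / c1 < real J" using reals_Archimedean2 by blast
 show "\<exists>n. b <= real n * c2 & (\<forall>x\<in>E. \<exists>\<delta>>0. \<forall>y. dist y x < \<delta> --> ennreal (M ^ n / c1) <= \<Phi> y)"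
 proof (intro exI[of _ n] conjI ballI)
 show "b <= real n * c2" using n c2 by (simp add: divide_less_eq)
 fix x assume x: "x \<in> E"
 have "open (\<Inter>j\<in>{..<J}. Op j)" "x \<in> (\<Inter>j\<in>{..<J}. Op j)" using Op x by (auto intro!: open_INT)
 then obtain \<delta> where \<delta>: "0 < \<delta>" "ball x \<delta> \<subseteq> (\<Inter>j\<in>{..<J}. Op j)" using open_contains_ball by blast
 have "ennreal (M ^ n / c1) <= \<Phi> y" if "dist y x < \<delta>" for y
 proof -
 have "y \<in> ball x \<delta>" using that by (simp add: dist_commute)
 then have yO: "y \<in> Op j" if "j < J" for j using \<delta>(2) that by blast
 have "ennreal (M ^ n / c1) <= ennreal (real J)" using J by (intro ennreal_leI) simp
 also have "... = (\<Sum>j<J. indicator (Op j) y)" using yO by (simp add: ennreal_of_nat_eq_real_of_nat)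
 also have "... <= \<Phi> y" unfolding \<Phi>_def by (rule sum_le_suminf) auto
 finally show ?thesis .
 qed
 then show "\<exists>\<delta>>0. \<forall>y. dist y x < \<delta> --> ennreal (M ^ n / c1) <= \<Phi> y" using \<delta>(1) by blast
 qed
 qed (rule 2(2))
 next
 case 3
 have "measure (om (c, l)) E < 2 * p" using 3 by (simp add: p_def)
 then obtain Op where Op: "open Op" "E \<subseteq> Op" "measure (om (c, l)) Op <= 2 * p" using outer_open[OF P(1,2) E(1)] by blast
 have Ob: "Op \<in> sets borel" using Op(1) by simp
 define \<Phi> :: "real^'m => ennreal" where "\<Phi> y = ennreal (1 / (2 * p)) * indicator Op y" for y
 show ?thesis
 proof (rule concl[of \<Phi>])
 show "\<Phi> \<in> bm" unfolding \<Phi>_def using Ob by measurable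
 have "(\<integral>\<^sup>+y. \<Phi> y \<partial>om (c, l)) = ennreal (1 / (2 * p)) * emeasure (om (c, l)) Op"
 unfolding \<Phi>_def by (rule nn_integral_cmult_indicator) (use Ob P(2) in simp)
 also have "... <= ennreal (1 / (2 * p)) * ennreal (2 * p)" unfolding X.emeasure_eq_measure by (intro mult_left_mono ennreal_leI Op(3)) simp
 also have "... = ennreal (1 / (2 * p) * (2 * p))" by (rule ennreal_mult[symmetric]) (use 3 in auto)
 also have "1 / (2 * p) * (2 * p) = 1" using 3 by simp
 finally show "(\<integral>\<^sup>+y. \<Phi> y \<partial>om (c, l)) <= 1" by simp
 fix b :: real assume b: "0 < p ==> b <= C1^2 * ln (1 / p)"
 have q: "c1 / (2 * M) <= c1 / 2" "0 < c1 / (2 * M)" "c1 / (2 * M) <= 1" using c1 M by (auto simp: field_simps)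
 have "\<delta>0 <= c1 / (2 * M)" unfolding \<delta>0_def power2_eq_square using q mult_left_le[of "c1 / (2 * M)" "c1 / (2 * M)"] by simp
 then have "2 * p <= c1" using 3(2) q(1) by linarith
 then have t1: "1 <= c1 / (2 * p)" using 3 by simp
 obtain n where n: "M ^ n <= c1 / (2 * p)" "c1 / (2 * p) < M ^ Suc n" using pow_between[OF M t1] by blast
 show "\<exists>n. b <= real n * c2 & (\<forall>x\<in>E. \<exists>\<delta>>0. \<forall>y. dist y x < \<delta> --> ennreal (M ^ n / c1) <= \<Phi> y)"
 proof (intro exI[of _ n] conjI ballI)
 have "c1 / (2 * p) * (1 / M) < M ^ Suc n * (1 / M)" using n(2) M by (intro mult_strict_right_mono) auto
 also have "M ^ Suc n * (1 / M) = M ^ n" using M by simp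
 finally have "c1 / (2 * p) * (1 / M) < M ^ n" .
 then have "ln (c1 / (2 * p) * (1 / M)) < ln (M ^ n)" using c1 3 M by (subst ln_less_cancel_iff) auto
 moreover have "ln (c1 / (2 * p) * (1 / M)) = ln (1 / p) + ln (c1 / (2 * M))"
 proof -
 have "c1 / (2 * p) * (1 / M) = (1 / p) * (c1 / (2 * M))" by simp
 moreover have "ln ((1 / p) * (c1 / (2 * M))) = ln (1 / p) + ln (c1 / (2 * M))" using 3 q(2) by (intro ln_mult_pos) auto
 ultimately show ?thesis by (simp only:)
 qed
 ultimately have l1: "ln (1 / p) + ln (c1 / (2 * M)) < real n * ln M" using M by (simp add: ln_realpow)
 have "ln p < ln \<delta>0" using 3 \<delta>0 by simp
 also have "ln \<delta>0 = 2 * ln (c1 / (2 * M))" unfolding \<delta>0_def by (subst ln_realpow) simp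
 finally have "ln p < 2 * ln (c1 / (2 * M))" .
 moreover have "ln (1 / p) = - ln p" using 3 by (simp add: ln_div)
 ultimately have "ln (1 / p) / 2 <= real n * ln M" using l1 by linarith
 then have "ln (1 / p) <= real n * (2 * ln M)" by simp
 then have "c2 / (2 * ln M) * ln (1 / p) <= c2 / (2 * ln M) * (real n * (2 * ln M))" using c2 lnM by (intro mult_left_mono) auto
 also have "... = real n * c2" using lnM by simp
 finally show "b <= real n * c2" using b[OF 3(1)] C1sq by simp
 fix x assume x: "x \<in> E"
 obtain \<delta> where \<delta>: "0 < \<delta>" "ball x \<delta> \<subseteq> Op" using Op x open_contains_ball by blast
 have "ennreal (M ^ n / c1) <= \<Phi> y" if "dist y x < \<delta>" for y
 proof -
 have "y \<in> Op" using that \<delta>(2) by (auto simp: dist_commute)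
 moreover have "M ^ n / c1 <= 1 / (2 * p)" using n(1) c1 by (simp add: pos_divide_le_eq)
 ultimately show ?thesis unfolding \<Phi>_def by (simp add: ennreal_leI)
 qed
 then show "\<exists>\<delta>>0. \<forall>y. dist y x < \<delta> --> ennreal (M ^ n / c1) <= \<Phi> y" using \<delta>(1) by blast
 qed
 qed (rule 3(2))
 qed
 qed
 then show ?case unfolding p_def .
 qed
 qed
qed

end
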